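(* There exists an $O(n^3)$-time algorithm which receives as input a claw-free graph $G$ with $n$ vertices and a vertex $v\in V(G)$, and decides whether $v$ is shedding.
   Context: Graphs are finite, simple, undirected. A graph is claw-free if it has no induced subgraph isomorphic to $K_{1,3}$. $N(v)$ is the neighbourhood of $v$, $N[v]=N(v)\cup\{v\}$. A set is independent if its vertices are pairwise nonadjacent. A vertex $v$ is shedding if for every independent set $S\subseteq V(G)\setminus N[v]$ there exists $u\in N(v)$ such that $S\cup\{u\}$ is independent. *)

theory Defs
  imports Complex_Main "HOL-Library.Landau_Symbols" "Graph_Theory.Graph_Theory"
begin

section \<open>Graphs\<close>

text \<open>
  As in the library, a finite simple undirected graph is a finite, symmetric, loop-free digraph
  without parallel arcs (locales \<^locale>\<open>graph\<close> and \<^locale>\<open>pair_graph\<close>). The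
  predicate \<^const>\<open>complete_bipartite_digraph\<close> is closed under isomorphism, so that
  no isomorphism has to be mentioned in the definition of claw-freeness.
\<close>

definition claw_free :: "('a, 'b) pre_digraph \<Rightarrow> bool" where
  "claw_free G \<longleftrightarrow> \<not> (\<exists>H. induced_subgraph H G \<and> complete_bipartite_digraph 1 3 H)"

definition nbhd :: "('a, 'b) pre_digraph \<Rightarrow> 'a \<Rightarrow> 'a set" where
  "nbhd G v = {u \<in> verts G. v \<rightarrow>\<^bsub>G\<^esub> u}"

definition closed_nbhd :: "('a, 'b) pre_digraph \<Rightarrow> 'a \<Rightarrow> 'a set" where
  "closed_nbhd G v = nbhd G v \<union> {v}"

definition independent_set :: "('a, 'b) pre_digraph \<Rightarrow> 'a set \<Rightarrow> bool" where
  "independent_set G S \<longleftrightarrow> S \<subseteq> verts G \<and> (\<forall>x\<in>S. \<forall>y\<in>S. x \<noteq> y \<longrightarrow> \<not> x \<rightarrow>\<^bsub>G\<^esub> y)"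

definition shedding :: "('a, 'b) pre_digraph \<Rightarrow> 'a \<Rightarrow> bool" where
  "shedding G v \<longleftrightarrow>
    (\<forall>S. S \<subseteq> verts G - closed_nbhd G v \<longrightarrow> independent_set G S \<longrightarrow>
      (\<exists>u\<in>nbhd G v. independent_set G (insert u S)))"


section \<open>Word RAM\<close>

text \<open>
  The model of computation is a deterministic random access machine with finitely many registers
  per program and an addressable memory, both holding natural numbers. Programs are structured;
  every operator, constant, register read, memory access, register assignment and branch costs one
  time unit. Unit cost is justified by a word size \<open>w\<close>: each value occurring in the
  evaluation of an expression, in particular each address and each stored value, must be less than
  \<open>2 ^ w\<close>; otherwise the machine is stuck (no execution is derivable). The word size acts
  only as this restriction and cannot be read by a program. Algorithms on inputs of size
  \<open>n\<close> are to be run with a word size in \<open>O(ln n)\<close>.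
\<close>

datatype aexp =
    Num nat
  | Reg nat
  | Mem aexp
  | Plus aexp aexp
  | Minus aexp aexp
  | Times aexp aexp

datatype bexp =
    Less aexp aexp
  | Equal aexp aexp
  | Neg bexp
  | Conj bexp bexp

datatype com =
    Skip
  | Assign nat aexp
  | Store aexp aexp
  | Seq com com
  | Cond bexp com com
  | While bexp com

record state =
  reg :: "nat \<Rightarrow> nat"
  mem :: "nat \<Rightarrow> nat"

text \<open>Subtraction is truncated at zero.\<close>

fun aval :: "aexp \<Rightarrow> state \<Rightarrow> nat" where
  "aval (Num k) s = k"
| "aval (Reg r) s = reg s r"
| "aval (Mem a) s = mem s (aval a s)"
| "aval (Plus a b) s = aval a s + aval b s"
| "aval (Minus a b) s = aval a s - aval b s"
| "aval (Times a b) s = aval a s * aval b s"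

fun bval :: "bexp \<Rightarrow> state \<Rightarrow> bool" where
  "bval (Less a b) s \<longleftrightarrow> aval a s < aval b s"
| "bval (Equal a b) s \<longleftrightarrow> aval a s = aval b s"
| "bval (Neg b) s \<longleftrightarrow> \<not> bval b s"
| "bval (Conj b c) s \<longleftrightarrow> bval b s \<and> bval c s"

fun afits :: "nat \<Rightarrow> aexp \<Rightarrow> state \<Rightarrow> bool" where
  "afits w (Num k) s \<longleftrightarrow> k < 2 ^ w"
| "afits w (Reg r) s \<longleftrightarrow> reg s r < 2 ^ w"
| "afits w (Mem a) s \<longleftrightarrow> afits w a s \<and> mem s (aval a s) < 2 ^ w"
| "afits w (Plus a b) s \<longleftrightarrow> afits w a s \<and> afits w b s \<and> aval a s + aval b s < 2 ^ w"
| "afits w (Minus a b) s \<longleftrightarrow> afits w a s \<and> afits w b s"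
| "afits w (Times a b) s \<longleftrightarrow> afits w a s \<and> afits w b s \<and> aval a s * aval b s < 2 ^ w"

fun bfits :: "nat \<Rightarrow> bexp \<Rightarrow> state \<Rightarrow> bool" where
  "bfits w (Less a b) s \<longleftrightarrow> afits w a s \<and> afits w b s"
| "bfits w (Equal a b) s \<longleftrightarrow> afits w a s \<and> afits w b s"
| "bfits w (Neg b) s \<longleftrightarrow> bfits w b s"
| "bfits w (Conj b c) s \<longleftrightarrow> bfits w b s \<and> bfits w c s"

fun acost :: "aexp \<Rightarrow> nat" where
  "acost (Num k) = 1"
| "acost (Reg r) = 1"
| "acost (Mem a) = acost a + 1"
| "acost (Plus a b) = acost a + acost b + 1"
| "acost (Minus a b) = acost a + acost b + 1"
| "acost (Times a b) = acost a + acost b + 1"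

fun bcost :: "bexp \<Rightarrow> nat" where
  "bcost (Less a b) = acost a + acost b + 1"
| "bcost (Equal a b) = acost a + acost b + 1"
| "bcost (Neg b) = bcost b + 1"
| "bcost (Conj b c) = bcost b + bcost c + 1"

text \<open>
  \<open>exec w c s t s'\<close>: with word size \<open>w\<close>, the program \<open>c\<close> started in
  \<open>s\<close> halts in \<open>s'\<close> after exactly \<open>t\<close> time units.
\<close>

inductive exec :: "nat \<Rightarrow> com \<Rightarrow> state \<Rightarrow> nat \<Rightarrow> state \<Rightarrow> bool" for w where
  Skip: "exec w Skip s 1 s"
| Assign: "afits w a s \<Longrightarrow>
    exec w (Assign r a) s (acost a + 1) (s\<lparr>reg := (reg s)(r := aval a s)\<rparr>)"
| Store: "afits w p s \<Longrightarrow> afits w a s \<Longrightarrow>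
    exec w (Store p a) s (acost p + acost a + 1) (s\<lparr>mem := (mem s)(aval p s := aval a s)\<rparr>)"
| Seq: "exec w c s t s' \<Longrightarrow> exec w d s' t' s'' \<Longrightarrow> exec w (Seq c d) s (t + t') s''"
| CondTrue: "bfits w b s \<Longrightarrow> bval b s \<Longrightarrow> exec w c s t s' \<Longrightarrow>
    exec w (Cond b c d) s (bcost b + t + 1) s'"
| CondFalse: "bfits w b s \<Longrightarrow> \<not> bval b s \<Longrightarrow> exec w d s t s' \<Longrightarrow>
    exec w (Cond b c d) s (bcost b + t + 1) s'"
| WhileTrue: "bfits w b s \<Longrightarrow> bval b s \<Longrightarrow> exec w c s t s' \<Longrightarrow> exec w (While b c) s' t' s'' \<Longrightarrow>
    exec w (While b c) s (bcost b + t + t' + 1) s''"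
| WhileFalse: "bfits w b s \<Longrightarrow> \<not> bval b s \<Longrightarrow> exec w (While b c) s (bcost b + 1) s"

inductive_cases exec_SkipE: "exec w Skip s t s'"
inductive_cases exec_AssignE: "exec w (Assign r a) s t s'"
inductive_cases exec_StoreE: "exec w (Store p a) s t s'"
inductive_cases exec_SeqE: "exec w (Seq c d) s t s'"
inductive_cases exec_CondE: "exec w (Cond b c d) s t s'"
inductive_cases exec_WhileE: "exec w (While b c) s t s'"

lemma exec_deterministic:
  "exec w c s t s' \<Longrightarrow> exec w c s u s'' \<Longrightarrow> t = u \<and> s' = s''"
proof (induction arbitrary: u s'' rule: exec.induct)
  case (Skip s)
  then show ?case by (rule exec_SkipE) simp
next
  case (Assign a s r)
  from Assign.prems show ?case by (rule exec_AssignE) simp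
next
  case (Store p s a)
  from Store.prems show ?case by (rule exec_StoreE) simp
next
  case (Seq c s t s' d t' s2)
  from Seq.prems show ?case by (rule exec_SeqE) (auto dest!: Seq.IH)
next
  case (CondTrue b s c t s' d)
  from CondTrue.prems show ?case by (rule exec_CondE) (use CondTrue.hyps(2) in \<open>auto dest!: CondTrue.IH\<close>)
next
  case (CondFalse b s d t s' c)
  from CondFalse.prems show ?case by (rule exec_CondE) (use CondFalse.hyps(2) in \<open>auto dest!: CondFalse.IH\<close>)
next
  case (WhileTrue b s c t s' t' s2)
  from WhileTrue.prems show ?case
    by (rule exec_WhileE) (use WhileTrue.hyps(2) in \<open>auto dest!: WhileTrue.IH\<close>)
next
  case (WhileFalse b s c)
  from WhileFalse.prems show ?case
    by (rule exec_WhileE) (use WhileFalse.hyps(2) in simp_all)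
qed

text \<open>
  Input convention for a graph on the vertices \<open>{..<n}\<close> and a vertex \<open>v\<close>:
  \<open>n\<close> and \<open>v\<close> in registers 0 and 1, the adjacency matrix row by row in memory,
  and zero everywhere else.
\<close>

definition graph_vertex_input :: "(nat, 'b) pre_digraph \<Rightarrow> nat \<Rightarrow> nat \<Rightarrow> state" where
  "graph_vertex_input G n v =
    \<lparr>reg = (\<lambda>r. if r = 0 then n else if r = 1 then v else 0),
     mem = (\<lambda>p. if p < n * n \<and> (p div n) \<rightarrow>\<^bsub>G\<^esub> (p mod n) then 1 else 0)\<rparr>"

text \<open>The answer of a decision procedure is left in register 0.\<close>

definition answers :: "nat \<Rightarrow> com \<Rightarrow> state \<Rightarrow> nat \<Rightarrow> bool \<Rightarrow> bool" where
  "answers w c s t b \<longleftrightarrow> (\<exists>t' s'. exec w c s t' s' \<and> t' \<le> t \<and> reg s' 0 = of_bool b)"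

end

theory Submission
  imports Defs
begin

text \<open>A vertex \<open>v\<close> is not shedding iff some independent set of vertices at distance at least two covers its
  neighbourhood. Such a cover is grown by one neighbour \<open>u\<close> of \<open>v\<close> at a time. In a claw-free graph every
  vertex outside the closed neighbourhood has at most two neighbours in the present partial cover \<open>S\<close>, so
  the symmetric difference of \<open>S\<close> and a complete cover consists of paths, and only the path that starts
  at \<open>u\<close> matters. The vertices with two neighbours in \<open>S\<close> become the edges of a graph in which
  each \<open>s\<close> in \<open>S\<close> is split into two matched nodes, one for each of two classes of
  these edges at \<open>s\<close>, arranged so that consecutive edges of an alternating path are nonadjacent vertices.
  The required paths are the augmenting paths of this graph, and Edmonds' algorithm finds one. Each search runs in time
  quadratic in the number of vertices because only the set of vertices of each path is
  stored, and each node becomes even at most once.\<close>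

section \<open>Partial covers in claw-free graphs\<close>

text \<open>Alternation must be strong: the two new vertices that meet a removed \<open>s\<close>
  have to be nonadjacent and have to take over what \<open>s\<close> covered. The second follows
  from the first, since two nonadjacent neighbours of \<open>s\<close> outside the closed
  neighbourhood of \<open>v\<close> share out the neighbours of \<open>v\<close> seen by
  \<open>s\<close> (\<open>nonadj_trace\<close>). The obstacle is that nonadjacency of the wings at
  \<open>s\<close> is only nearly bipartite, whereas splitting \<open>s\<close> into two nodes, as
  in Minty's treatment of claw-free graphs, needs two definite classes. They are pinned down by one
  distinguished class at each \<open>s\<close>: the wings after which a path may stop, else those
  with which it may begin, else those adjacent to one fixed neighbour of \<open>v\<close>. The first
  two choices agree where both exist once the improvements by a single start vertex are exhausted,
  hence \<open>stuck_cover\<close>. The end of a path may leave a gap that one further vertex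
  closes; it is looked for after switching. Covered neighbours of \<open>v\<close> stay covered, so
  there is at most one search for each of them, and a failed search settles the answer because it
  excludes every complete cover, not only extensions of \<open>S\<close>.\<close>

locale clawfree =
  fixes V :: "'a set" and adj :: "'a \<Rightarrow> 'a \<Rightarrow> bool" and v :: 'a
  assumes finite_V: "finite V"
    and adj_V: "adj x y \<Longrightarrow> x \<in> V"
    and adj_sym: "adj x y \<Longrightarrow> adj y x"
    and adj_irrefl: "\<not> adj x x"
    and claw: "adj c x \<Longrightarrow> adj c y \<Longrightarrow> adj c z \<Longrightarrow> x \<noteq> y \<Longrightarrow> x \<noteq> z \<Longrightarrow> y \<noteq> z \<Longrightarrow>
      adj x y \<or> adj x z \<or> adj y z"
begin

definition D :: "'a set" where
  "D = {t \<in> V. t \<noteq> v \<and> \<not> adj v t}"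

definition indep :: "'a set \<Rightarrow> bool" where
  "indep T \<longleftrightarrow> (\<forall>x\<in>T. \<forall>y\<in>T. \<not> adj x y)"

definition covers :: "'a set \<Rightarrow> 'a \<Rightarrow> bool" where
  "covers T x \<longleftrightarrow> (\<exists>t\<in>T. adj x t)"

text \<open>The claw centred at \<open>x\<close> with leaf \<open>v\<close>.\<close>

lemma common_nbr_adj:
  assumes "adj v x" "t \<in> D" "t' \<in> D" "adj x t" "adj x t'" "t \<noteq> t'"
  shows "adj t t'"
  using claw[of x v t t'] assms by (auto simp: D_def dest: adj_sym)

end

locale partial_cover = clawfree +
  fixes S :: "'a set" and u :: 'a
  assumes S_D: "S \<subseteq> D" and S_indep: "indep S"
    and u_nbr: "adj v u" and u_free: "s \<in> S \<Longrightarrow> \<not> adj u s"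
begin

definition NS :: "'a \<Rightarrow> 'a set" where
  "NS t = {s \<in> S. adj s t}"

text \<open>Roles on a path from \<open>u\<close>: a \<open>start\<close> vertex covers
  \<open>u\<close> and displaces its only neighbour in \<open>S\<close>, a \<open>two\<close> vertex
  leads from one displaced vertex to the next, a \<open>one\<close> vertex can fill the gap at the
  end.\<close>

definition two :: "'a \<Rightarrow> bool" where
  "two t \<longleftrightarrow> t \<in> D \<and> \<not> adj u t \<and> card (NS t) = 2"

definition one :: "'a \<Rightarrow> bool" where
  "one t \<longleftrightarrow> t \<in> D \<and> \<not> adj u t \<and> card (NS t) = 1"

definition start :: "'a \<Rightarrow> bool" where
  "start t \<longleftrightarrow> t \<in> D \<and> adj u t \<and> card (NS t) = 1"

definition wing :: "'a \<Rightarrow> 'a \<Rightarrow> 'a \<Rightarrow> bool" where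
  "wing t a b \<longleftrightarrow> two t \<and> NS t = {a, b} \<and> a \<noteq> b"

text \<open>A path that has brought in \<open>t\<close> may stop after removing \<open>s\<close>:
  either \<open>t\<close> alone replaces \<open>s\<close>, or \<open>z\<close>, which disturbs no
  other member of \<open>S\<close>, covers what \<open>t\<close> misses.\<close>

definition terminal :: "'a \<Rightarrow> 'a \<Rightarrow> bool" where
  "terminal t s \<longleftrightarrow> (\<forall>x. adj v x \<and> adj s x \<longrightarrow> adj t x) \<or> (\<exists>z. one z \<and> NS z = {s} \<and> \<not> adj z t)"

text \<open>A path may begin with \<open>u\<close>, \<open>q\<close>, \<open>s\<close>,
  \<open>t\<close>; since \<open>q\<close> and \<open>t\<close> both enter the new set, they must be
  nonadjacent.\<close>

definition initial :: "'a \<Rightarrow> 'a \<Rightarrow> bool" where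
  "initial t s \<longleftrightarrow> (\<exists>q. start q \<and> NS q = {s} \<and> \<not> adj q t)"

definition has_terminal :: "'a \<Rightarrow> bool" where
  "has_terminal s \<longleftrightarrow> (\<exists>t a. wing t s a \<and> terminal t s)"

definition has_initial :: "'a \<Rightarrow> bool" where
  "has_initial s \<longleftrightarrow> (\<exists>t a. wing t s a \<and> initial t s)"

lemma finite_S: "finite S"
  using S_D finite_V by (auto simp: D_def intro: finite_subset)

lemma finite_NS: "finite (NS t)"
  using finite_S by (simp add: NS_def)

lemma wing_sym: "wing t a b \<Longrightarrow> wing t b a"
  by (auto simp: wing_def)

lemma two_wing: "two t \<Longrightarrow> \<exists>a b. wing t a b"
  unfolding wing_def two_def card_2_iff by auto

lemma wingD:
  assumes "wing t a b"
  shows "t \<in> D" "\<not> adj u t" "\<not> adj t u" "a \<in> S" "b \<in> S" "a \<noteq> b" "adj t a" "adj t b" "adj a t" "adj b t"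
    "t \<notin> S" "NS t = {a, b}"
proof -
  have "a \<in> NS t" "b \<in> NS t" using assms by (auto simp: wing_def)
  then show "a \<in> S" "b \<in> S" "adj t a" "adj t b" "adj a t" "adj b t"
    by (auto simp: NS_def dest: adj_sym)
  then show "t \<notin> S" using S_indep by (auto simp: indep_def)
qed (use assms in \<open>auto simp: wing_def two_def dest: adj_sym\<close>)

lemma startE:
  assumes "start q"
  obtains s where "NS q = {s}"
  using assms by (auto simp: start_def card_1_singleton_iff)

lemma NS_singleD:
  assumes "NS q = {s}"
  shows "s \<in> S" "adj q s" "adj s q" "q \<notin> S" "\<And>a. a \<in> S \<Longrightarrow> a \<noteq> s \<Longrightarrow> \<not> adj q a"
proof -
  have "s \<in> NS q" using assms by auto
  then show "s \<in> S" "adj q s" "adj s q" by (auto simp: NS_def dest: adj_sym)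
  then show "q \<notin> S" using S_indep by (auto simp: indep_def)
  show "\<not> adj q a" if "a \<in> S" "a \<noteq> s" for a
    using assms that by (auto simp: NS_def dest: adj_sym)
qed

lemma wing_other: "wing t a b \<Longrightarrow> c \<in> S \<Longrightarrow> adj t c \<Longrightarrow> c = a \<or> c = b"
  using wingD(12)[of t a b] by (auto simp: NS_def dest: adj_sym)

lemma wing_unique: "wing t a b \<Longrightarrow> wing t a c \<Longrightarrow> b = c"
  by (auto simp: wing_def)

lemma S_not_adj: "a \<in> S \<Longrightarrow> b \<in> S \<Longrightarrow> \<not> adj a b"
  using S_indep by (auto simp: indep_def)

text \<open>Two members of \<open>S\<close> that cover the same neighbour of \<open>v\<close> would
  be adjacent by \<open>common_nbr_adj\<close>.\<close>

lemma S_disjoint: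
  assumes "a \<in> S" "b \<in> S" "adj v x" "adj a x" "adj b x"
  shows "a = b"
  using assms common_nbr_adj[of x a b] S_D S_not_adj by (blast dest: adj_sym)

lemma S_uD: "s \<in> S \<Longrightarrow> \<not> adj u s" "s \<in> S \<Longrightarrow> \<not> adj s u"
  using u_free by (auto dest: adj_sym)

text \<open>Three members of \<open>S\<close> adjacent to \<open>t\<close> would be the leaves of a
  claw centred at \<open>t\<close>.\<close>

lemma card_NS_le2:
  assumes "t \<in> D" shows "card (NS t) \<le> 2"
proof (rule ccontr)
  assume "\<not> card (NS t) \<le> 2"
  then have "3 \<le> card (NS t)" by simp
  then obtain X where X: "X \<subseteq> NS t" "card X = 3" by (meson obtain_subset_with_card_n)
  then obtain a b c where "X = {a,b,c}" "a \<noteq> b" "a \<noteq> c" "b \<noteq> c" by (auto simp: card_3_iff)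
  then have "a \<in> S" "b \<in> S" "c \<in> S" "adj t a" "adj t b" "adj t c"
    using X by (auto simp: NS_def dest: adj_sym)
  then show False using claw[of t a b c] S_not_adj \<open>a \<noteq> b\<close> \<open>a \<noteq> c\<close> \<open>b \<noteq> c\<close> by auto
qed

text \<open>Here \<open>u\<close>, which is nonadjacent to all of \<open>S\<close>, serves as the
  third leaf of the claw at \<open>t\<close>.\<close>

lemma card_NS_u:
  assumes "t \<in> D" "adj u t" shows "card (NS t) \<le> 1"
proof (rule ccontr)
  assume "\<not> card (NS t) \<le> 1"
  then have "2 \<le> card (NS t)" by simp
  then obtain X where X: "X \<subseteq> NS t" "card X = 2" by (meson obtain_subset_with_card_n)
  then obtain a b where ab: "X = {a,b}" "a \<noteq> b" by (auto simp: card_2_iff)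
  then have *: "a \<in> S" "b \<in> S" "adj t a" "adj t b"
    using X by (auto simp: NS_def dest: adj_sym)
  then have "a \<noteq> u" "b \<noteq> u" using S_D u_nbr by (auto simp: D_def)
  then show False using claw[of t u a b] * ab S_not_adj S_uD assms adj_sym by blast
qed

text \<open>Otherwise \<open>t\<close> is the centre of a claw with leaves \<open>x\<close>,
  \<open>a\<close> and \<open>q\<close>; \<open>x\<close> and \<open>a\<close> are nonadjacent
  because \<open>s\<close> is already the only neighbour of \<open>x\<close> in
  \<open>S\<close>.\<close>

lemma wing_nonadj:
  assumes "wing t s a" "adj v x" "adj s x" "adj t x" "adj s q" "\<not> adj q x" "\<not> adj q a" "q \<in> D"
  shows "\<not> adj t q"
proof
  assume "adj t q"
  note w = wingD[OF assms(1)]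
  have "\<not> adj a x" using S_disjoint[of a s x] w assms by auto
  moreover have "x \<noteq> a" using w S_D assms(2) by (auto simp: D_def)
  moreover have "x \<noteq> q" using assms by (auto simp: D_def)
  moreover have "q \<noteq> a" using S_not_adj w assms by auto
  ultimately show False
    using claw[of t x a q] w assms \<open>adj t q\<close> adj_sym by blast
qed

text \<open>Not both of \<open>t\<close> and \<open>q\<close> see \<open>x\<close>, by the claw at
  \<open>x\<close> with leaf \<open>v\<close>; not neither, by the claw at \<open>s\<close> with
  leaves \<open>t\<close>, \<open>q\<close>, \<open>x\<close>. This is the fact that lets
  nonadjacency take care of covering.\<close>

lemma nonadj_trace:
  assumes "s \<in> S" "adj s t" "adj s q" "t \<in> D" "q \<in> D" "t \<noteq> q" "\<not> adj t q" "adj v x" "adj s x"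
  shows "adj t x \<longleftrightarrow> \<not> adj q x"
proof
  assume "adj t x" then show "\<not> adj q x"
    using common_nbr_adj[of x t q] assms adj_sym by blast
next
  assume "\<not> adj q x"
  have "x \<noteq> t" "x \<noteq> q" using assms by (auto simp: D_def)
  then show "adj t x" using claw[of s t q x] assms \<open>\<not> adj q x\<close> adj_sym by blast
qed

text \<open>Without this edge, \<open>a\<close>, \<open>q\<close> and \<open>z\<close> would be the
  leaves of a claw at \<open>t\<close>.\<close>

lemma wing_link:
  assumes "wing t s a" "adj t q" "adj t z" "\<not> adj q a" "\<not> adj z a" "q \<noteq> z" "q \<noteq> a" "z \<noteq> a"
  shows "adj q z"
  using claw[of t a q z] wingD[OF assms(1)] assms adj_sym by blast

lemma no_triple:
  assumes "s \<in> S" "adj s a" "adj s b" "adj s c" "a \<noteq> b" "a \<noteq> c" "b \<noteq> c"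
    "\<not> adj a b" "\<not> adj a c" "\<not> adj b c"
  shows False
  using claw[of s a b c] assms by blast

end

section \<open>Wings at a cover vertex when single start vertices no longer help\<close>

locale stuck_cover = partial_cover +
  assumes start_nonempty: "t \<in> D \<Longrightarrow> adj u t \<Longrightarrow> NS t \<noteq> {}"
    and start_not_terminal: "start q \<Longrightarrow> NS q = {s} \<Longrightarrow> \<not> terminal q s"
begin

text \<open>The last two facts are the two halves of the negation of
  \<open>terminal q s\<close>.\<close>

lemma startD:
  assumes "start q" "NS q = {s}"
  shows "q \<in> D" "adj u q" "adj q u" "s \<in> S" "adj q s" "adj s q" "q \<notin> S"
    "\<And>a. a \<in> S \<Longrightarrow> a \<noteq> s \<Longrightarrow> \<not> adj q a" "\<And>z. one z \<Longrightarrow> NS z = {s} \<Longrightarrow> adj q z"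
    "\<exists>x. adj v x \<and> adj s x \<and> \<not> adj q x"
  using assms start_not_terminal[OF assms] NS_singleD[OF assms(2)]
  by (auto simp: start_def terminal_def dest: adj_sym)

lemma oneD:
  assumes "one z" "NS z = {s}"
  shows "z \<in> D" "\<not> adj u z" "\<not> adj z u" "s \<in> S" "adj z s" "adj s z" "z \<notin> S"
    "\<And>a. a \<in> S \<Longrightarrow> a \<noteq> s \<Longrightarrow> \<not> adj z a"
  using assms NS_singleD[OF assms(2)] by (auto simp: one_def dest: adj_sym)

lemma kinds_distinct:
  "wing t a b \<Longrightarrow> \<not> one t" "wing t a b \<Longrightarrow> \<not> start t" "one t \<Longrightarrow> \<not> start t"
  by (auto simp: wing_def one_def start_def two_def)

text \<open>If \<open>t\<close> and \<open>e\<close> were adjacent, a neighbour of \<open>v\<close>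
  that \<open>t\<close> misses and \<open>e\<close> sees would give a claw at \<open>e\<close>; and
  a closing vertex \<open>z\<close> for \<open>e\<close> would be adjacent to \<open>t\<close> and
  give a claw at \<open>t\<close> with leaves \<open>a\<close>, \<open>e\<close>,
  \<open>z\<close>.\<close>

lemma terminal_nonadj:
  assumes t: "wing t s a" and e: "wing e s b" and "a \<noteq> b" and ne: "\<not> terminal t s" and ce: "terminal e s"
  shows "\<not> adj t e"
proof
  assume te: "adj t e"
  note wt = wingD[OF t] and we = wingD[OF e]
  have ea: "\<not> adj e a" using wing_other[OF e, of a] wt \<open>a \<noteq> b\<close> by auto
  have tb: "\<not> adj t b" using wing_other[OF t, of b] we \<open>a \<noteq> b\<close> by auto
  have "e \<noteq> a" using we wt by auto
  from ce show False unfolding terminal_def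
  proof
    assume fl: "\<forall>x. adj v x \<and> adj s x \<longrightarrow> adj e x"
    from ne obtain x where "adj v x" "adj s x" "\<not> adj t x" by (auto simp: terminal_def)
    then show False using wing_nonadj[OF e, of x t] fl wt tb te by (blast dest: adj_sym)
  next
    assume "\<exists>z. one z \<and> NS z = {s} \<and> \<not> adj z e"
    then obtain z where z: "one z" "NS z = {s}" "\<not> adj z e" by auto
    note oz = oneD[OF z(1,2)]
    have "adj t z" using ne z by (auto simp: terminal_def dest: adj_sym)
    then have "adj e z"
      using wing_link[OF t te, of z] ea \<open>e \<noteq> a\<close> oz wt kinds_distinct(1)[OF e] z by auto
    then show False using z adj_sym by blast
  qed
qed

text \<open>Compare both wings with some terminal wing \<open>e\<close> at \<open>s\<close>. If the
  other end of \<open>e\<close> differs from \<open>a\<close> and \<open>b\<close>, then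
  \<open>s\<close> has three pairwise nonadjacent neighbours. If it is one of them, \<open>e\<close>
  sees the same neighbours of \<open>v\<close> at \<open>s\<close> as the wing with that end, since
  both are complementary to the remaining wing.\<close>

lemma terminal_complement:
  assumes t: "wing t s a" and t': "wing t' s b" and "a \<noteq> b" and na: "\<not> adj t t'"
    and ne: "\<not> terminal t s" and hc: "has_terminal s"
  shows "terminal t' s"
proof (rule ccontr)
  assume ne': "\<not> terminal t' s"
  from hc obtain e c where e: "wing e s c" "terminal e s" by (auto simp: has_terminal_def)
  note wt = wingD[OF t] and we = wingD[OF e(1)] and wt' = wingD[OF t']
  have tt': "t \<noteq> t'" using wing_unique t t' \<open>a \<noteq> b\<close> by blast
  have et: "e \<noteq> t" "e \<noteq> t'" using ne ne' e by auto
  have tr: "adj t x \<longleftrightarrow> \<not> adj t' x" if "adj v x" "adj s x" for x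
    using nonadj_trace[of s t t' x] wt wt' tt' na that by auto
  consider "c \<noteq> a" "c \<noteq> b" | "c = b" | "c = a" by auto
  then show False
  proof cases
    case 1
    have "\<not> adj t e" "\<not> adj t' e" using terminal_nonadj t t' e ne ne' 1 by blast+
    then show False using no_triple[of s t t' e] wt wt' we et tt' na by auto
  next
    case 2
    have nte: "\<not> adj t e" using terminal_nonadj[OF t e(1)] 2 \<open>a \<noteq> b\<close> ne e by blast
    have tre: "adj t x \<longleftrightarrow> \<not> adj e x" if "adj v x" "adj s x" for x
      using nonadj_trace[of s t e x] wt we et nte that by auto
    from e(2) show False unfolding terminal_def
    proof
      assume "\<forall>x. adj v x \<and> adj s x \<longrightarrow> adj e x"
      then show False using ne' tr tre by (auto simp: terminal_def)
    next
      assume "\<exists>z. one z \<and> NS z = {s} \<and> \<not> adj z e"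
      then obtain z where z: "one z" "NS z = {s}" "\<not> adj z e" by auto
      note oz = oneD[OF z(1,2)]
      have trz: "adj z x \<longleftrightarrow> \<not> adj e x" if "adj v x" "adj s x" for x
        using nonadj_trace[of s z e x] oz we kinds_distinct(1)[OF e(1)] z that by auto
      \<comment> \<open>Among the neighbours of \<open>v\<close> at \<open>s\<close>,
        \<open>z\<close> sees the same ones as \<open>t\<close>, the complement of what
        \<open>t'\<close> sees. As \<open>t'\<close> is adjacent to \<open>z\<close>, a claw at
        \<open>t'\<close> forbids it every such \<open>x\<close>; then \<open>t\<close> sees all of
        them and is terminal after all.\<close>
      have t'z: "adj z t'" using ne' z by (auto simp: terminal_def)
      have "\<not> adj t' x" if "adj v x" "adj s x" for x
        using wing_nonadj[OF t', of x z] that tr tre trz oz t'z wt' \<open>a \<noteq> b\<close> by (blast dest: adj_sym)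
      then show False using ne tr by (auto simp: terminal_def)
    qed
  next
    case 3
    have nte: "\<not> adj t' e" using terminal_nonadj[OF t' e(1)] 3 \<open>a \<noteq> b\<close> ne' e by blast
    have tre: "adj t' x \<longleftrightarrow> \<not> adj e x" if "adj v x" "adj s x" for x
      using nonadj_trace[of s t' e x] wt' we et nte that by auto
    from e(2) show False unfolding terminal_def
    proof
      assume "\<forall>x. adj v x \<and> adj s x \<longrightarrow> adj e x"
      then show False using ne tr tre by (auto simp: terminal_def)
    next
      assume "\<exists>z. one z \<and> NS z = {s} \<and> \<not> adj z e"
      then obtain z where z: "one z" "NS z = {s}" "\<not> adj z e" by auto
      note oz = oneD[OF z(1,2)]
      have trz: "adj z x \<longleftrightarrow> \<not> adj e x" if "adj v x" "adj s x" for x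
        using nonadj_trace[of s z e x] oz we kinds_distinct(1)[OF e(1)] z that by auto
      have tz: "adj z t" using ne z by (auto simp: terminal_def)
      have "\<not> adj t x" if "adj v x" "adj s x" for x
        using wing_nonadj[OF t, of x z] that tr tre trz oz tz wt \<open>a \<noteq> b\<close> by (blast dest: adj_sym)
      then show False using ne' tr by (auto simp: terminal_def)
    qed
  qed
qed

text \<open>The start vertex \<open>q\<close> that makes \<open>e\<close> initial is adjacent to
  \<open>t\<close>, since \<open>t\<close> is not initial; if \<open>t\<close> and \<open>e\<close>
  were adjacent too, \<open>a\<close>, \<open>e\<close> and \<open>q\<close> would be the leaves of
  a claw at \<open>t\<close>.\<close>

lemma initial_nonadj:
  assumes t: "wing t s a" and e: "wing e s b" and "a \<noteq> b" and ne: "\<not> initial t s" and ce: "initial e s"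
  shows "\<not> adj t e"
proof
  assume te: "adj t e"
  note wt = wingD[OF t] and we = wingD[OF e]
  from ce obtain q where q: "start q" "NS q = {s}" "\<not> adj q e" by (auto simp: initial_def)
  note sq = startD[OF q(1,2)]
  have "adj t q" using ne q by (auto simp: initial_def dest: adj_sym)
  moreover have "\<not> adj e a" using wing_other[OF e, of a] wt \<open>a \<noteq> b\<close> by auto
  ultimately show False
    using wing_link[OF t te, of q] wt we sq q kinds_distinct(2)[OF e] adj_sym by metis
qed

text \<open>The argument of \<open>terminal_complement\<close> with a start vertex \<open>q\<close>
  in the place of the closing vertex; the absence of terminal wings refutes the case in which one of
  the two wings sees every neighbour of \<open>v\<close> at \<open>s\<close>.\<close>

lemma initial_complement:
  assumes t: "wing t s a" and t': "wing t' s b" and "a \<noteq> b" and na: "\<not> adj t t'"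
    and ne': "\<not> initial t' s" and hc: "has_initial s" and nc: "\<not> has_terminal s"
  shows "initial t s"
proof (rule ccontr)
  assume ne: "\<not> initial t s"
  from hc obtain e c where e: "wing e s c" "initial e s" by (auto simp: has_initial_def)
  then obtain q where q: "start q" "NS q = {s}" "\<not> adj q e" by (auto simp: initial_def)
  note sq = startD[OF q(1,2)]
  note wt = wingD[OF t] and we = wingD[OF e(1)] and wt' = wingD[OF t']
  have tt': "t \<noteq> t'" using wing_unique t t' \<open>a \<noteq> b\<close> by blast
  have et: "e \<noteq> t" "e \<noteq> t'" using ne ne' e by auto
  have tr: "adj t x \<longleftrightarrow> \<not> adj t' x" if "adj v x" "adj s x" for x
    using nonadj_trace[of s t t' x] wt wt' tt' na that by auto
  have trq: "adj q x \<longleftrightarrow> \<not> adj e x" if "adj v x" "adj s x" for x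
    using nonadj_trace[of s q e x] sq we kinds_distinct(2)[OF e(1)] q that by auto
  have qt: "adj t q" "adj t' q" using ne ne' q by (auto simp: initial_def dest: adj_sym)
  have nclo: "\<not> terminal t s" "\<not> terminal t' s" using nc t t' by (auto simp: has_terminal_def)
  consider "c \<noteq> a" "c \<noteq> b" | "c = b" | "c = a" by auto
  then show False
  proof cases
    case 1
    have "\<not> adj t e" "\<not> adj t' e" using initial_nonadj t t' e ne ne' 1 by blast+
    then show False using no_triple[of s t t' e] wt wt' we et tt' na by auto
  next
    case 2
    have nte: "\<not> adj t e" using initial_nonadj[OF t e(1)] 2 \<open>a \<noteq> b\<close> ne e by blast
    have tre: "adj t x \<longleftrightarrow> \<not> adj e x" if "adj v x" "adj s x" for x
      using nonadj_trace[of s t e x] wt we et nte that by auto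
    have "\<not> adj t' x" if "adj v x" "adj s x" for x
      using wing_nonadj[OF t', of x q] that tr tre trq sq qt wt' \<open>a \<noteq> b\<close> by (blast dest: adj_sym)
    then show False using nclo tr by (auto simp: terminal_def)
  next
    case 3
    have nte: "\<not> adj t' e" using initial_nonadj[OF t' e(1)] 3 \<open>a \<noteq> b\<close> ne' e by blast
    have tre: "adj t' x \<longleftrightarrow> \<not> adj e x" if "adj v x" "adj s x" for x
      using nonadj_trace[of s t' e x] wt' we et nte that by auto
    have "\<not> adj t x" if "adj v x" "adj s x" for x
      using wing_nonadj[OF t, of x q] that tr tre trq sq qt wt \<open>a \<noteq> b\<close> by (blast dest: adj_sym)
    then show False using nclo tr by (auto simp: terminal_def)
  qed
qed

text \<open>If \<open>q\<close> and \<open>e\<close> were adjacent, then in the first case of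
  \<open>terminal\<close> a neighbour of \<open>v\<close> missed by \<open>q\<close> gives a claw at
  \<open>e\<close>; in the second, \<open>q\<close> is adjacent to the closing vertex
  \<open>z\<close>, and \<open>u\<close>, \<open>e\<close>, \<open>z\<close> are the leaves of a
  claw at \<open>q\<close>.\<close>

lemma terminal_start_nonadj:
  assumes e: "wing e s b" "terminal e s" and q: "start q" "NS q = {s}"
  shows "\<not> adj q e"
proof
  assume qe: "adj q e"
  note we = wingD[OF e(1)] and sq = startD[OF q]
  have "b \<noteq> s" using we by auto
  from e(2) show False unfolding terminal_def
  proof
    assume fl: "\<forall>x. adj v x \<and> adj s x \<longrightarrow> adj e x"
    from sq(10) obtain x where "adj v x" "adj s x" "\<not> adj q x" by blast
    then show False using wing_nonadj[OF e(1), of x q] fl sq we \<open>b \<noteq> s\<close> qe by (blast dest: adj_sym)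
  next
    assume "\<exists>z. one z \<and> NS z = {s} \<and> \<not> adj z e"
    then obtain z where z: "one z" "NS z = {s}" "\<not> adj z e" by auto
    note oz = oneD[OF z(1,2)]
    have "u \<noteq> e" "u \<noteq> z" using we oz u_nbr by (auto simp: D_def)
    moreover have "e \<noteq> z" using kinds_distinct(1)[OF e(1)] z by auto
    ultimately show False using claw[of q u e z] sq(9)[OF z(1,2)] sq qe we oz z adj_sym by blast
  qed
qed

text \<open>Needed because a cover vertex can admit both a beginning and an end of a path while it
  is split only once.\<close>

lemma terminal_iff_initial:
  assumes hc: "has_terminal s" and q: "start q" "NS q = {s}" and t: "wing t s a"
  shows "terminal t s \<longleftrightarrow> initial t s"
proof
  assume "terminal t s"
  then show "initial t s" using terminal_start_nonadj[OF t _ q] q by (auto simp: initial_def)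
next
  assume "initial t s"
  then obtain q where q: "start q" "NS q = {s}" "\<not> adj q t" by (auto simp: initial_def)
  from hc obtain e b where e: "wing e s b" "terminal e s" by (auto simp: has_terminal_def)
  have qe: "\<not> adj q e" using terminal_start_nonadj[OF e q(1,2)] .
  note we = wingD[OF e(1)] and sq = startD[OF q(1,2)] and wt = wingD[OF t]
  show "terminal t s"
  proof (rule ccontr)
    assume nt: "\<not> terminal t s"
    have "e \<noteq> t" using nt e by auto
    have trq: "adj q x \<longleftrightarrow> \<not> adj e x" if "adj v x" "adj s x" for x
      using nonadj_trace[of s q e x] sq we kinds_distinct(2)[OF e(1)] q qe that by auto
    have trt: "adj q x \<longleftrightarrow> \<not> adj t x" if "adj v x" "adj s x" for x
      using nonadj_trace[of s q t x] sq wt kinds_distinct(2)[OF t] q that by auto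
    show False
    proof (cases "a = b")
      case False
      then have "\<not> adj t e" using terminal_nonadj[OF t e(1) _ nt e(2)] by blast
      then show False using no_triple[of s t e q] wt we sq q qe \<open>e \<noteq> t\<close> kinds_distinct(2)[OF t]
          kinds_distinct(2)[OF e(1)] adj_sym by metis
    next
      case True
      from e(2) show False unfolding terminal_def
      proof
        assume "\<forall>x. adj v x \<and> adj s x \<longrightarrow> adj e x"
        then show False using nt trq trt by (auto simp: terminal_def)
      next
        assume "\<exists>z. one z \<and> NS z = {s} \<and> \<not> adj z e"
        then obtain z where z: "one z" "NS z = {s}" "\<not> adj z e" by auto
        note oz = oneD[OF z(1,2)]
        have trz: "adj z x \<longleftrightarrow> \<not> adj e x" if "adj v x" "adj s x" for x
          using nonadj_trace[of s z e x] oz we kinds_distinct(1)[OF e(1)] z that by auto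
        have tz: "adj z t" using nt z by (auto simp: terminal_def)
        have "\<not> adj t x" if "adj v x" "adj s x" for x
          using wing_nonadj[OF t, of x z] that trq trt trz oz tz wt by (blast dest: adj_sym)
        then show False using sq(10) trt by auto
      qed
    qed
  qed
qed

end

section \<open>Alternating paths and blossoms\<close>

text \<open>The exposed root lies outside \<open>Nd\<close> and \<open>rt\<close> marks its
  neighbours. The involution laws are asked of the whole type, so that they can serve as rewrite
  rules without membership conditions. A label stands for one edge, so simple paths do not repeat
  labels.\<close>

locale matched_graph =
  fixes Nd :: "'a set" and mt :: "'a \<Rightarrow> 'a" and ed :: "'t \<Rightarrow> 'a \<Rightarrow> 'a \<Rightarrow> bool" and rt :: "'a \<Rightarrow> bool"
  assumes finite_Nd: "finite Nd"
    and mt_Nd: "x \<in> Nd \<Longrightarrow> mt x \<in> Nd"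
    and mt_mt [simp]: "mt (mt x) = x"
    and mt_neq [simp]: "mt x \<noteq> x"
    and ed_sym: "ed t x y \<Longrightarrow> ed t y x"
    and ed_Nd: "ed t x y \<Longrightarrow> x \<in> Nd"
    and ed_unique: "ed t x y \<Longrightarrow> ed t x' y' \<Longrightarrow> {x, y} = {x', y'}"
    and rt_Nd: "rt x \<Longrightarrow> x \<in> Nd"
begin

text \<open>An even alternating path from the exposed root is recorded as the list of its even
  vertices \<open>y\<close>, each reached through \<open>mt y\<close> by the labelled edge before it; the root
  edges have no label, and the first label is meaningless.\<close>

definition nds :: "('t \<times> 'a) list \<Rightarrow> 'a set" where
  "nds L = snd ` set L"

definition sup2 :: "('t \<times> 'a) list \<Rightarrow> 'a set" where
  "sup2 L = nds L \<union> mt ` nds L"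

definition labs :: "('t \<times> 'a) list \<Rightarrow> 't set" where
  "labs L = fst ` set (tl L)"

text \<open>As \<open>sup2 L\<close> is closed under \<open>mt\<close>, the single test on
  \<open>y\<close> keeps the odd vertex \<open>mt y\<close> new as well.\<close>

inductive apath :: "('t \<times> 'a) list \<Rightarrow> bool" where
  apath_single: "rt (mt y) \<Longrightarrow> apath [(t, y)]"
| apath_snoc: "apath L \<Longrightarrow> ed t (snd (last L)) (mt y) \<Longrightarrow> y \<notin> sup2 L \<Longrightarrow> apath (L @ [(t, y)])"

lemma mt_inj [simp]: "mt x = mt y \<longleftrightarrow> x = y"
  by (metis mt_mt)

lemma mt_swap: "mt x = y \<longleftrightarrow> x = mt y"
  by (metis mt_mt)

lemma nds_simps [simp]: "nds [] = {}" "nds (p # L) = insert (snd p) (nds L)" "nds (L @ L') = nds L \<union> nds L'"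
  by (auto simp: nds_def)

lemma last_single: "last [x] = x"
  by simp

lemma nds_rev [simp]: "nds (rev L) = nds L"
  by (simp add: nds_def)

lemma sup2_simps [simp]: "sup2 [] = {}" "sup2 (p # L) = {snd p, mt (snd p)} \<union> sup2 L"
  "sup2 (L @ L') = sup2 L \<union> sup2 L'"
  by (auto simp: sup2_def)

lemma mt_sup2 [simp]: "mt x \<in> sup2 L \<longleftrightarrow> x \<in> sup2 L"
  by (auto simp: sup2_def) (metis imageI mt_mt)+

lemma nds_sup2: "x \<in> nds L \<Longrightarrow> x \<in> sup2 L"
  by (simp add: sup2_def)

lemma sup2_disjointI:
  assumes "\<And>x. x \<in> nds L \<Longrightarrow> x \<notin> sup2 L'"
  shows "sup2 L' \<inter> sup2 L = {}"
proof -
  have "x \<notin> sup2 L'" if "x \<in> sup2 L" for x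
    using that assms mt_sup2[of _ L'] by (auto simp: sup2_def[of L])
  then show ?thesis by auto
qed

lemma apath_nonempty: "apath L \<Longrightarrow> L \<noteq> []"
  by (erule apath.cases) auto

lemma last_nds: "L \<noteq> [] \<Longrightarrow> snd (last L) \<in> nds L"
  by (simp add: nds_def)

lemma labs_append [simp]: "L \<noteq> [] \<Longrightarrow> labs (L @ L') = labs L \<union> fst ` set L'"
  by (auto simp: labs_def)

lemma apath_Nd: "apath L \<Longrightarrow> nds L \<subseteq> Nd"
proof (induction rule: apath.induct)
  case (apath_single y t)
  then show ?case using rt_Nd mt_Nd[of "mt y"] by auto
next
  case (apath_snoc L t y)
  then show ?case using ed_Nd[OF ed_sym, of t _ "mt y"] mt_Nd[of "mt y"] by auto
qed

lemma apath_labs: "apath L \<Longrightarrow> t \<in> labs L \<Longrightarrow> ed t x y \<Longrightarrow> x \<in> sup2 L"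
proof (induction rule: apath.induct)
  case (apath_single y t)
  then show ?case by (simp add: labs_def)
next
  case (apath_snoc L t' y')
  have "snd (last L) \<in> sup2 L" using last_nds apath_nonempty apath_snoc(1) nds_sup2 by blast
  then show ?case using apath_snoc apath_nonempty[OF apath_snoc(1)] ed_unique[of t x y "snd (last L)" "mt y'"]
    by (auto simp: doubleton_eq_iff)
qed

lemma apath_prefix: "apath (L @ R) \<Longrightarrow> L \<noteq> [] \<Longrightarrow> apath L"
proof (induction R rule: rev_induct)
  case (snoc r R)
  have "apath (L @ R)" using snoc.prems(1)
    by (cases rule: apath.cases) (use snoc.prems(2) in \<open>auto simp flip: append_assoc\<close>)
  then show ?case using snoc by auto
qed auto

lemma apath_snocD:
  assumes "apath (L @ [(t, y)])" "L \<noteq> []"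
  shows "apath L" "ed t (snd (last L)) (mt y)" "y \<notin> sup2 L"
  using assms(1) by (cases rule: apath.cases, use assms(2) in auto)+

lemma apath_disjoint: "apath (L @ R) \<Longrightarrow> L \<noteq> [] \<Longrightarrow> sup2 L \<inter> sup2 R = {}"
proof (induction R rule: rev_induct)
  case (snoc r R)
  obtain t y where r: "r = (t, y)" by force
  have "apath ((L @ R) @ [(t, y)])" using snoc r by simp
  from apath_snocD[OF this] have "apath (L @ R)" "y \<notin> sup2 (L @ R)" using snoc.prems(2) by auto
  then show ?case using snoc r by auto
qed auto

text \<open>A repeated label would stand for the same edge, whose end \<open>mt y\<close> would then
  already lie on the earlier part of the path.\<close>

lemma apath_labs_disjoint: "apath (L @ R) \<Longrightarrow> L \<noteq> [] \<Longrightarrow> labs L \<inter> fst ` set R = {}"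
proof (induction R rule: rev_induct)
  case (snoc r R)
  obtain t y where r: "r = (t, y)" by force
  have *: "apath ((L @ R) @ [(t, y)])" using snoc r by simp
  have "t \<notin> labs L"
  proof
    assume "t \<in> labs L"
    then have "mt y \<in> sup2 L"
      using apath_labs[of L t "mt y"] apath_snocD(2)[OF *] ed_sym apath_prefix[of L "R @ [r]"] snoc.prems by auto
    then show False using apath_snocD(3)[OF *] snoc.prems by auto
  qed
  moreover have "apath (L @ R)" using apath_snocD(1)[OF *] snoc.prems by auto
  ultimately show ?case using snoc r by auto
qed auto

text \<open>Traversing a stretch of path backwards makes its odd vertices even. The labels move by
  one place because each label belongs to the edge before its vertex.\<close>

fun turn :: "'t \<Rightarrow> ('t \<times> 'a) list \<Rightarrow> ('t \<times> 'a) list" where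
  "turn t [] = []"
| "turn t ((t', y) # L) = (t, mt y) # turn t' L"

lemma turn_nds: "nds (turn t L) = mt ` nds L"
  by (induction t L rule: turn.induct) auto

lemma turn_last: "L \<noteq> [] \<Longrightarrow> snd (last (turn t L)) = mt (snd (last L))"
  by (induction t L rule: turn.induct) (auto elim: turn.elims)

lemma turn_labs: "fst ` set (turn t (L @ [(t', y)])) = insert t (fst ` set L)"
  by (induction t L rule: turn.induct) auto

text \<open>The path \<open>L @ R\<close> vouches for the edges inside \<open>R\<close>. The
  induction consumes \<open>R\<close> from its end, which is where the edge \<open>t\<close> enters
  it.\<close>

lemma apath_turn:
  assumes "apath P" "ed t (snd (last P)) (snd (last R))" "apath (L @ R)" "R \<noteq> []" "sup2 P \<inter> sup2 R = {}"
  shows "apath (P @ turn t (rev R))"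
  using assms
proof (induction R arbitrary: P t rule: rev_induct)
  case (snoc r R)
  obtain t' y where r: "r = (t', y)" by force
  have s: "apath (P @ [(t, mt y)])"
    using snoc.prems r by (intro apath.intros) auto
  show ?case
  proof (cases "R = []")
    case True
    then show ?thesis using s r by simp
  next
    case False
    have *: "apath ((L @ R) @ [(t', y)])" using snoc.prems r by simp
    have e: "ed t' (mt y) (snd (last R))" using apath_snocD(2)[OF *] False ed_sym by auto
    have "y \<notin> sup2 R" using apath_snocD(3)[OF *] False by auto
    then have "apath ((P @ [(t, mt y)]) @ turn t' (rev R))"
      using s e snoc.prems False r apath_snocD(1)[OF *] by (intro snoc.IH) auto
    then show ?thesis using r by simp
  qed
qed auto

end

section \<open>Even paths as matchings that miss one vertex\<close>

lemma even_card_involution: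
  assumes "finite A" "\<And>x. x \<in> A \<Longrightarrow> f x \<in> A" "\<And>x. x \<in> A \<Longrightarrow> f (f x) = x" "\<And>x. x \<in> A \<Longrightarrow> f x \<noteq> x"
  shows "even (card A)"
  using assms
proof (induction "card A" arbitrary: A rule: less_induct)
  case less
  show ?case
  proof (cases "A = {}")
    case False
    then obtain a where a: "a \<in> A" by blast
    let ?A = "A - {a, f a}"
    have sub: "{a, f a} \<subseteq> A" "card {a, f a} = 2" using a less.prems(2,4)[OF a] by auto
    have c: "card ?A = card A - 2" using sub less.prems(1) by (subst card_Diff_subset) auto
    have "2 \<le> card A" using sub card_mono[OF less.prems(1) sub(1)] by simp
    moreover have "even (card ?A)"
    proof (rule less.hyps)
      show "card ?A < card A" using c \<open>2 \<le> card A\<close> by simp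
      fix x assume x: "x \<in> ?A"
      then have "f x \<noteq> a" "f x \<noteq> f a" using less.prems(3)[of x] less.prems(3)[OF a] by auto
      then show "f x \<in> ?A" using x less.prems(2) by auto
    qed (use less.prems in auto)
    ultimately show ?thesis using c by simp
  qed simp
qed

context matched_graph begin

text \<open>What switching along an even path to \<open>y\<close> produces: a perfect matching,
  given as an involution, of the root \<open>None\<close> together with all vertices except
  \<open>y\<close>.\<close>

definition perfect_except :: "'a \<Rightarrow> ('a option \<Rightarrow> 'a option) \<Rightarrow> bool" where
  "perfect_except y f \<longleftrightarrow> (\<forall>x\<in>insert None (Some ` (Nd - {y})). f x \<in> insert None (Some ` (Nd - {y})) \<and> f (f x) = x \<and> f x \<noteq> x) \<and>
    (\<forall>a\<in>Nd - {y}. \<forall>b. f (Some a) = Some b \<longrightarrow> b = mt a \<or> (\<exists>t. ed t a b)) \<and> (\<forall>b. f None = Some b \<longrightarrow> rt b)"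

lemma perfect_exceptD:
  assumes "perfect_except y f"
  shows "x \<in> insert None (Some ` (Nd - {y})) \<Longrightarrow> f x \<in> insert None (Some ` (Nd - {y}))"
    "x \<in> insert None (Some ` (Nd - {y})) \<Longrightarrow> f (f x) = x"
    "x \<in> insert None (Some ` (Nd - {y})) \<Longrightarrow> f x \<noteq> x"
    "a \<in> Nd - {y} \<Longrightarrow> f (Some a) = Some b \<Longrightarrow> b = mt a \<or> (\<exists>t. ed t a b)"
    "f None = Some b \<Longrightarrow> rt b"
  using assms unfolding perfect_except_def by metis+

text \<open>The new edge matches \<open>mt y\<close> with the old end, which was the exposed vertex,
  and exposes \<open>y\<close> instead. The second conjunct carries through the induction that
  \<open>y\<close> and \<open>mt y\<close> are still matched to each other until then.\<close>

lemma apath_perfect: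
  "apath L \<Longrightarrow> \<exists>f. perfect_except (snd (last L)) f \<and> (\<forall>a\<in>Nd - sup2 L. f (Some a) = Some (mt a))"
proof (induction rule: apath.induct)
  case (apath_single y t)
  let ?f = "(map_option mt)(None := Some (mt y), Some (mt y) := None)"
  have "mt y \<in> Nd" using rt_Nd apath_single by auto
  then have "perfect_except y ?f" using mt_Nd apath_single by (auto simp: perfect_except_def mt_swap)
  moreover have "\<forall>a\<in>Nd - sup2 [(t, y)]. ?f (Some a) = Some (mt a)" by auto
  ultimately show ?case by (subst last_single, subst snd_conv) blast
next
  case (apath_snoc L t y)
  let ?p = "snd (last L)"
  from apath_snoc.IH obtain f where f: "perfect_except ?p f" "\<forall>a\<in>Nd - sup2 L. f (Some a) = Some (mt a)" by blast
  let ?f = "f(Some ?p := Some (mt y), Some (mt y) := Some ?p)"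
  have p: "?p \<in> nds L" using last_nds apath_nonempty apath_snoc(1) by blast
  have yN: "mt y \<in> Nd" "y \<in> Nd" "?p \<in> Nd"
    using ed_Nd[OF ed_sym[OF apath_snoc(2)]] mt_Nd[of "mt y"] ed_Nd[OF apath_snoc(2)] by auto
  have "mt y \<notin> sup2 L" using apath_snoc(3) by simp
  then have "mt y \<noteq> ?p" using nds_sup2[OF p] by metis
  moreover have "y \<noteq> ?p" using apath_snoc(3) nds_sup2[OF p] by metis
  ultimately have ne: "y \<noteq> ?p" "mt y \<noteq> ?p" by simp_all
  have fy: "f (Some (mt y)) = Some y" "f (Some y) = Some (mt y)" using f(2) apath_snoc(3) yN by auto
  have F: "f x \<in> insert None (Some ` (Nd - {?p}))" "f (f x) = x" "f x \<noteq> x"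
    if "x \<in> insert None (Some ` (Nd - {?p}))" for x using perfect_exceptD(1-3)[OF f(1) that] .
  have "perfect_except y ?f"
    unfolding perfect_except_def
  proof (intro conjI ballI allI impI)
    fix x assume x: "x \<in> insert None (Some ` (Nd - {y}))"
    have "?f x \<in> insert None (Some ` (Nd - {y})) \<and> ?f (?f x) = x \<and> ?f x \<noteq> x"
    proof (cases "x = Some ?p \<or> x = Some (mt y)")
      case True
      then show ?thesis using yN ne by auto
    next
      case False
      then have x': "x \<in> insert None (Some ` (Nd - {?p}))" "x \<noteq> Some y" using x by auto
      have "f x \<noteq> Some y" "f x \<noteq> Some (mt y)" using F(2)[OF x'(1)] fy x'(2) False by auto
      then show ?thesis using F[OF x'(1)] False by auto
    qed
    then show "?f x \<in> insert None (Some ` (Nd - {y}))" "?f (?f x) = x" "?f x \<noteq> x" by blast+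
  next
    fix a b assume a: "a \<in> Nd - {y}" "?f (Some a) = Some b"
    show "b = mt a \<or> (\<exists>t. ed t a b)"
    proof (cases "a = ?p \<or> a = mt y")
      case True
      then show ?thesis using a apath_snoc(2) ed_sym[OF apath_snoc(2)] ne by (auto split: if_splits)
    next
      case False
      then have "a \<in> Nd - {?p}" "f (Some a) = Some b" using a by simp_all
      then show ?thesis by (rule perfect_exceptD(4)[OF f(1)])
    qed
  next
    fix b assume "?f None = Some b"
    then show "rt b" using perfect_exceptD(5)[OF f(1)] by simp
  qed
  moreover have "\<forall>a\<in>Nd - sup2 (L @ [(t, y)]). ?f (Some a) = Some (mt a)"
  proof
    fix a assume "a \<in> Nd - sup2 (L @ [(t, y)])"
    then have "a \<in> Nd - sup2 L" "a \<noteq> mt y" "a \<noteq> ?p" using nds_sup2[OF p] by auto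
    then show "?f (Some a) = Some (mt a)" using f(2) by simp
  qed
  ultimately show ?case by (intro exI[of _ ?f] conjI) (simp_all only: last_snoc snd_conv)
qed

end

text \<open>The search forest: \<open>Ou\<close> holds the even vertices, \<open>P\<close> an even path to each
  of them, and \<open>B\<close> the base of the blossom it lies in, \<open>None\<close> standing for the blossom
  of the exposed root.\<close>

locale search_state = matched_graph +
  fixes Ou :: "'a set" and P :: "'a \<Rightarrow> ('b \<times> 'a) list" and B :: "'a \<Rightarrow> 'a option"
  assumes P_path: "p \<in> Ou \<Longrightarrow> apath (P p)"
    and P_last: "p \<in> Ou \<Longrightarrow> snd (last (P p)) = p"
    and P_Ou: "p \<in> Ou \<Longrightarrow> nds (P p) \<subseteq> Ou"
    and root_mt: "p \<in> Ou \<Longrightarrow> B p = None \<Longrightarrow> mt p \<in> Ou \<and> B (mt p) = None"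
    and root_P: "p \<in> Ou \<Longrightarrow> B p = None \<Longrightarrow> y \<in> nds (P p) \<Longrightarrow> B y = None"
    and base_Ou: "p \<in> Ou \<Longrightarrow> B p = Some b \<Longrightarrow> b \<in> Ou \<and> B b = Some b \<and> mt b \<notin> Ou"
    and base_mt: "p \<in> Ou \<Longrightarrow> B p = Some b \<Longrightarrow> p \<noteq> b \<Longrightarrow> mt p \<in> Ou \<and> B (mt p) = Some b"
    and base_P: "p \<in> Ou \<Longrightarrow> B p = Some b \<Longrightarrow> \<exists>R. P p = P b @ R \<and> (\<forall>y\<in>nds R. B y = Some b)"
    and parent: "b \<in> Ou \<Longrightarrow> B b = Some b \<Longrightarrow> (\<exists>t. P b = [(t, b)]) \<or> (\<exists>a\<in>Ou. \<exists>t. P b = P a @ [(t, b)])"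
    and rt_state: "rt y \<Longrightarrow> y \<in> Ou \<and> B y = None \<or> y \<notin> Ou \<and> mt y \<in> Ou \<and> (\<exists>t. P (mt y) = [(t, mt y)])"
begin

lemma P_nonempty: "p \<in> Ou \<Longrightarrow> P p \<noteq> []"
  using apath_nonempty P_path by blast

lemma P_self: assumes "p \<in> Ou" shows "p \<in> nds (P p)"
  using last_nds[OF P_nonempty[OF assms]] P_last[OF assms] by simp

lemma Ou_Nd: "Ou \<subseteq> Nd"
proof
  fix p assume p: "p \<in> Ou"
  then show "p \<in> Nd" using apath_Nd[OF P_path[OF p]] P_self[OF p] by blast
qed

definition base :: "'a \<Rightarrow> bool" where
  "base b \<longleftrightarrow> b \<in> Ou \<and> B b = Some b"

lemma baseD: "base b \<Longrightarrow> b \<in> Ou" "base b \<Longrightarrow> B b = Some b" "base b \<Longrightarrow> mt b \<notin> Ou"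
  using base_Ou[of b b] by (simp_all add: base_def)

text \<open>This characterisation allows the program to recognise bases from the even marks alone,
  without storing blossoms.\<close>

lemma base_iff: "base b \<longleftrightarrow> b \<in> Ou \<and> mt b \<notin> Ou"
proof
  assume b: "b \<in> Ou \<and> mt b \<notin> Ou"
  show "base b"
  proof (cases "B b")
    case None
    then show ?thesis using b root_mt by blast
  next
    case (Some b')
    then have "b = b'" using b base_mt by blast
    then show ?thesis using b Some by (simp add: base_def)
  qed
qed (blast dest: baseD)

text \<open>The path is cut at the base of the blossom containing \<open>p\<close>; the decrease of
  length in the last case drives the inductions up the contracted forest.\<close>

lemma path_cases:
  assumes "p \<in> Ou"
  obtains (root) "B p = None" "\<forall>y\<in>nds (P p). B y = None"
    | (top) b R t where "B p = Some b" "base b" "P p = P b @ R" "\<forall>y\<in>nds R. B y = Some b" "P b = [(t, b)]"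
    | (child) b R t a where "B p = Some b" "base b" "P p = P b @ R" "\<forall>y\<in>nds R. B y = Some b"
        "P b = P a @ [(t, b)]" "a \<in> Ou" "length (P a) < length (P p)"
proof (cases "B p")
  case None
  then show ?thesis using root_P assms root by blast
next
  case (Some b)
  then have b: "base b" using base_Ou[OF assms] by (simp add: base_def)
  obtain R where R: "P p = P b @ R" "\<forall>y\<in>nds R. B y = Some b" using base_P[OF assms Some] by blast
  have "b \<in> Ou" "B b = Some b" using b by (simp_all add: base_def)
  from parent[OF this] consider t where "P b = [(t, b)]" | a t where "a \<in> Ou" "P b = P a @ [(t, b)]"
    by blast
  then show ?thesis
  proof cases
    case 1
    then show ?thesis by (rule top[OF Some b R])
  next
    case (2 a t)
    have "length (P a) < length (P p)" using R 2 by simp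
    then show ?thesis using 2 by (intro child[OF Some b R])
  qed
qed

text \<open>The bases met by \<open>P p\<close> are the ancestors of \<open>p\<close> in the contracted forest.\<close>

lemma base_prefix: "p \<in> Ou \<Longrightarrow> base b \<Longrightarrow> b \<in> nds (P p) \<Longrightarrow> \<exists>R. P p = P b @ R"
proof (induction "length (P p)" arbitrary: p rule: less_induct)
  case less
  from \<open>p \<in> Ou\<close> show ?case
  proof (cases rule: path_cases)
    case root
    then show ?thesis using less.prems by (auto simp: base_def)
  next
    case (top b0 R t)
    then show ?thesis using less.prems by (auto simp: base_def)
  next
    case (child b0 R t a)
    then consider "b = b0" | "b \<in> nds (P a)" using less.prems by (auto simp: base_def)
    then show ?thesis
    proof cases
      case 2
      then show ?thesis using less.hyps[OF child(7) child(6)] less.prems child by auto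
    qed (use child in auto)
  qed
qed

lemma nds_base: "p \<in> Ou \<Longrightarrow> y \<in> nds (P p) \<Longrightarrow> B y = Some b \<Longrightarrow> b \<in> nds (P p)"
proof (induction "length (P p)" arbitrary: p rule: less_induct)
  case less
  from \<open>p \<in> Ou\<close> show ?case
  proof (cases rule: path_cases)
    case root
    then show ?thesis using less.prems by auto
  next
    case (top b0 R t)
    then show ?thesis using less.prems by (auto simp: base_def)
  next
    case (child b0 R t a)
    then show ?thesis using less.prems less.hyps[OF child(7) child(6)] by (auto simp: base_def)
  qed
qed

text \<open>If \<open>b\<close> came strictly after \<open>b0\<close>, it would lie in the blossom
  of \<open>b0\<close>, but a base lies in its own blossom.\<close>

lemma suffix_base_same:
  assumes "base b" "base b0" "P b = P b0 @ us" "\<forall>y\<in>nds (us @ R). B y = Some b0"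
  shows "b = b0"
proof (rule ccontr)
  assume "b \<noteq> b0"
  have l: "snd (last (P b)) = b" "snd (last (P b0)) = b0" using assms(1,2) P_last baseD by blast+
  have "us \<noteq> []"
  proof
    assume "us = []"
    then show False using l \<open>b \<noteq> b0\<close> assms(3) by simp
  qed
  then have "b \<in> nds us" using l(1) assms(3) last_nds[of us] by simp
  then have "B b = Some b0" using assms(4) by simp
  then show False using baseD(2)[OF assms(1)] \<open>b \<noteq> b0\<close> by simp
qed

text \<open>In the contracted forest, the blossoms that a path enters after \<open>b\<close> are
  descendants of \<open>b\<close>.\<close>

lemma suffix_base:
  "p \<in> Ou \<Longrightarrow> base b \<Longrightarrow> P p = P b @ R \<Longrightarrow> y \<in> nds R \<Longrightarrow> \<exists>b' R'. B y = Some b' \<and> P b' = P b @ R'"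
proof (induction "length (P p)" arbitrary: p R rule: less_induct)
  case less
  note bD = baseD[OF less.prems(2)]
  have pb: "P b \<noteq> []" "b \<in> nds (P b)" using bD P_nonempty P_self by blast+
  from \<open>p \<in> Ou\<close> show ?case
  proof (cases rule: path_cases)
    case root
    have "b \<in> nds (P p)" using less.prems(3) pb by simp
    then show ?thesis using root bD by simp
  next
    case (top b0 R0 t)
    then obtain us where us: "P b = P b0 @ us" "R0 = us @ R"
      using less.prems(3) pb by (cases "P b") auto
    have "b = b0" using suffix_base_same[OF less.prems(2) top(2) us(1), of R] top(4) us(2) by simp
    then show ?thesis using top(4) us less.prems(4) by simp
  next
    case (child b0 R0 t a)
    from less.prems(3) child(3) have "P b @ R = P b0 @ R0" by simp
    then consider us where "P b = P b0 @ us" "us @ R = R0"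
      | us where "P b @ us = P b0" "R = us @ R0"
      unfolding append_eq_append_conv2 by blast
    then show ?thesis
    proof cases
      case c1: (1 us)
      then have 1: "P b = P b0 @ us" "R0 = us @ R" by auto
      have "b = b0" using suffix_base_same[OF less.prems(2) child(2) 1(1), of R] child(4) 1(2) by simp
      then show ?thesis using child(4) 1 less.prems(4) by simp
    next
      case c2: (2 us)
      then have 2: "P b0 = P b @ us" "R = us @ R0" by auto
      then consider "y \<in> nds R0" | "y \<in> nds us" using less.prems(4) by auto
      then show ?thesis
      proof cases
        case 1
        then show ?thesis using child(4) 2(1) by blast
      next
        case y: 2
        then have "us \<noteq> []" by auto
        then have e: "butlast us @ [last us] = us" by simp
        have "P a @ [(t, b0)] = (P b @ butlast us) @ [last us]" using 2(1) child(5) e by simp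
        then have us: "last us = (t, b0)" "P a = P b @ butlast us" by (simp_all only: append1_eq_conv)
        have "y \<in> nds (butlast us @ [(t, b0)])" using y e us(1) by simp
        then consider "y = b0" | "y \<in> nds (butlast us)" by auto
        then show ?thesis
        proof cases
          case 1
          then show ?thesis using baseD(2)[OF child(2)] 2(1) by blast
        next
          case 2
          then show ?thesis using less.hyps[OF child(7) child(6) less.prems(2) us(2)] by blast
        qed
      qed
    qed
  qed
qed

lemma base_sup2: "p \<in> Ou \<Longrightarrow> base b \<Longrightarrow> b \<in> sup2 (P p) \<longleftrightarrow> b \<in> nds (P p)"
  using P_Ou baseD(3) by (fastforce simp: sup2_def)

text \<open>A node common to both would lie in a blossom descending from \<open>b\<close>. The path
  to \<open>q\<close> then passes through the base of that blossom (\<open>nds_base\<close>), hence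
  contains its whole path (\<open>base_prefix\<close>) and with it \<open>b\<close>.\<close>

lemma suffix_disjoint:
  assumes "p \<in> Ou" "q \<in> Ou" "base b" "P p = P b @ R" "b \<notin> nds (P q)" "y \<in> insert b (nds R)"
  shows "y \<notin> sup2 (P q)"
proof
  assume "y \<in> sup2 (P q)"
  then have "\<exists>y'. (y' = y \<or> y' = mt y) \<and> y' \<in> nds (P q)" by (auto simp: sup2_def)
  then obtain y' where y': "y' = y \<or> y' = mt y" "y' \<in> nds (P q)" by blast
  obtain b' R' where b': "B y = Some b'" "P b' = P b @ R'"
  proof (cases "y = b")
    case True
    then show ?thesis using that[of b "[]"] baseD(2)[OF assms(3)] by simp
  qed (use suffix_base[OF assms(1,3,4)] assms(6) that in blast)
  have "nds R \<subseteq> Ou" using P_Ou[OF assms(1)] assms(4) by auto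
  then have yO: "y \<in> Ou" using assms baseD by auto
  have y'O: "y' \<in> Ou" using P_Ou[OF assms(2)] y' by auto
  \<comment> \<open>The mate of a non-base node lies in the same blossom, and the mate of a base is
    not even, so passing to the mate does not change the blossom.\<close>
  have "B y' = Some b'"
  proof (cases "y' = y")
    case False
    then have "y' = mt y" using y' by auto
    then have "y \<noteq> b'" using y'O base_Ou[OF yO b'(1)] by auto
    then show ?thesis using base_mt[OF yO b'(1)] \<open>y' = mt y\<close> by blast
  qed (use b' in simp)
  then have "b' \<in> nds (P q)" using nds_base assms y' by blast
  moreover have "base b'" using base_Ou[OF yO b'(1)] by (auto simp: base_def)
  ultimately obtain R'' where "P q = P b' @ R''" using base_prefix assms by blast
  then have "P b \<noteq> [] \<Longrightarrow> b \<in> nds (P q)" using b' P_self[of b] baseD(1)[OF assms(3)] by auto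
  then show False using assms baseD P_nonempty by auto
qed

section \<open>Growing the forest and shrinking blossoms\<close>

lemma grow:
  assumes p: "p \<in> Ou" and e: "ed t p w" and w: "w \<notin> Ou" "mt w \<notin> Ou"
  shows "search_state Nd mt ed rt (insert (mt w) Ou) (P(mt w := P p @ [(t, mt w)])) (B(mt w := Some (mt w)))"
    (is "search_state _ _ _ _ ?O ?P ?B")
proof -
  have new: "mt w \<notin> nds (P x)" "w \<notin> nds (P x)" if "x \<in> Ou" for x
    using P_Ou[OF that] w by auto
  have "mt w \<notin> sup2 (P p)" using new[OF p] by (auto simp: sup2_def)
  then have path: "apath (P p @ [(t, mt w)])" using P_path[OF p] P_last[OF p] e by (intro apath_snoc) auto
  show ?thesis
  proof unfold_locales
    fix x assume "x \<in> ?O"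
    then show "apath (?P x)" "snd (last (?P x)) = x" "nds (?P x) \<subseteq> ?O"
      using path P_path P_last P_Ou[of x] P_Ou[OF p] by auto
  next
    fix x assume x: "x \<in> ?O" "?B x = None"
    then have x': "x \<in> Ou" "B x = None" "x \<noteq> mt w" by (auto split: if_splits)
    then show "mt x \<in> ?O \<and> ?B (mt x) = None" using root_mt[of x] w by auto
    fix y assume "y \<in> nds (?P x)"
    then show "?B y = None" using x' root_P[of x y] new[of x] by auto
  next
    fix x b assume x: "x \<in> ?O" "?B x = Some b"
    show "b \<in> ?O \<and> ?B b = Some b \<and> mt b \<notin> ?O"
      using x w base_Ou[of x b] by (auto split: if_splits)
    show "mt x \<in> ?O \<and> ?B (mt x) = Some b" if "x \<noteq> b"
      using x w that base_mt[of x b] by (auto split: if_splits)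
    show "\<exists>R. ?P x = ?P b @ R \<and> (\<forall>y\<in>nds R. ?B y = Some b)"
    proof (cases "x = mt w")
      case False
      then have x': "x \<in> Ou" "B x = Some b" using x by auto
      then obtain R where R: "P x = P b @ R" "\<forall>y\<in>nds R. B y = Some b" using base_P by blast
      then have "mt w \<notin> nds R" using new[OF x'(1)] by auto
      moreover have "b \<noteq> mt w" using base_Ou[OF x'] w by auto
      ultimately show ?thesis using R False by auto
    qed (use x in auto)
  next
    fix b assume b: "b \<in> ?O" "?B b = Some b"
    show "(\<exists>t. ?P b = [(t, b)]) \<or> (\<exists>a\<in>?O. \<exists>t. ?P b = ?P a @ [(t, b)])"
    proof (cases "b = mt w")
      case True
      then show ?thesis using p w by auto
    next
      case False
      then have "b \<in> Ou" "B b = Some b" using b by auto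
      from parent[OF this] show ?thesis
      proof
        assume "\<exists>a\<in>Ou. \<exists>t. P b = P a @ [(t, b)]"
        then obtain a t' where "a \<in> Ou" "P b = P a @ [(t', b)]" by blast
        moreover have "a \<noteq> mt w" using \<open>a \<in> Ou\<close> w by auto
        ultimately show ?thesis using False by auto
      qed (use False in auto)
    qed
  next
    fix y assume "rt y"
    from rt_state[OF this] show
      "y \<in> ?O \<and> ?B y = None \<or> y \<notin> ?O \<and> mt y \<in> ?O \<and> (\<exists>t. ?P (mt y) = [(t, mt y)])"
      using w by auto
  qed
qed

text \<open>The walk follows \<open>P q\<close>, crosses \<open>t\<close> to \<open>p\<close> and
  returns along \<open>P p\<close> down to \<open>b\<close>, where it arrives at
  \<open>mt b\<close>. The list \<open>last (P b) # R\<close> is the stretch of \<open>P p\<close>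
  from \<open>b\<close> on, with \<open>b\<close> included.\<close>

lemma turn_path:
  assumes p: "p \<in> Ou" and q: "q \<in> Ou" and e: "ed t p q" and b: "base b" "b \<notin> nds (P q)" and R: "P p = P b @ R"
  defines "W \<equiv> P q @ turn t (rev (last (P b) # R))"
  shows "apath W" "snd (last W) = mt b" "nds W = nds (P q) \<union> mt ` insert b (nds R)"
    "labs W = labs (P q) \<union> {t} \<union> fst ` set R"
proof -
  have bO: "b \<in> Ou" and lb: "snd (last (P b)) = b" using baseD(1)[OF b(1)] P_last by auto
  have "P b = butlast (P b) @ [last (P b)]" using P_nonempty[OF bO] by simp
  then have sp: "P p = butlast (P b) @ (last (P b) # R)" using R by (metis append.assoc append_Cons append_Nil)
  have "x \<notin> sup2 (P q)" if "x \<in> insert b (nds R)" for x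
    using suffix_disjoint[OF p q b(1) R b(2) that] .
  then have dj: "sup2 (P q) \<inter> sup2 (last (P b) # R) = {}"
    using lb by (intro sup2_disjointI) auto
  have "last (P p) = last (last (P b) # R)" by (subst sp) simp
  then have l: "snd (last (last (P b) # R)) = p" using P_last[OF p] by simp
  have path: "apath (butlast (P b) @ (last (P b) # R))" using P_path[OF p] sp by simp
  have e': "ed t (snd (last (P q))) (snd (last (last (P b) # R)))" using P_last[OF q] l e ed_sym by simp
  show "apath W"
    unfolding W_def by (rule apath_turn[OF P_path[OF q] e' path _ dj]) simp
  have "turn t (rev (last (P b) # R)) \<noteq> []" by (cases "rev R"; cases "last (P b)") auto
  moreover have "snd (last (turn t (rev (last (P b) # R)))) = mt b"
    using turn_last[of "rev (last (P b) # R)" t] lb by simp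
  ultimately show "snd (last W) = mt b" unfolding W_def by (simp only: last_append if_False)
  show "nds W = nds (P q) \<union> mt ` insert b (nds R)"
    using lb by (auto simp: W_def turn_nds)
  obtain l0 where "last (P b) = (l0, b)" using lb by (cases "last (P b)") simp
  then show "labs W = labs (P q) \<union> {t} \<union> fst ` set R"
    using P_nonempty[OF q] turn_labs[of t "rev R"] by (simp add: W_def)
qed

text \<open>Beyond \<open>b\<close> all blossoms descend from \<open>b\<close>; if one of their
  bases lay on \<open>P q\<close>, its whole path would, and so would \<open>b\<close>.\<close>

lemma merge_one_side:
  assumes p: "p \<in> Ou" and q: "q \<in> Ou" and b: "base b" "b \<in> nds (P p)" "b \<notin> nds (P q)" and R: "P p = P b @ R"
    and z: "z \<in> nds R"
  shows "\<exists>b'. base b' \<and> b' \<in> nds (P p) \<and> b' \<notin> nds (P q) \<and> B z = Some b' \<and> z \<in> Ou"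
proof -
  obtain b' R' where b': "B z = Some b'" "P b' = P b @ R'" using suffix_base[OF p b(1) R z] by blast
  have zp: "z \<in> nds (P p)" using z R by simp
  have zO: "z \<in> Ou" using P_Ou[OF p] zp by auto
  have bb: "base b'" using base_Ou[OF zO b'(1)] by (simp add: base_def)
  have "b' \<notin> nds (P q)"
  proof
    assume "b' \<in> nds (P q)"
    then obtain R'' where "P q = P b' @ R''" using base_prefix q bb by blast
    then show False using b' b(3) P_self[OF baseD(1)[OF b(1)]] by simp
  qed
  then show ?thesis using bb nds_base[OF p zp b'(1)] b'(1) zO by blast
qed

text \<open>In the contracted forest, these are the bases strictly below the nearest common ancestor
  of \<open>p\<close> and \<open>q\<close>, on either branch.\<close>

definition branch :: "'a \<Rightarrow> 'a \<Rightarrow> 'a set" where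
  "branch p q = {b. base b \<and> (b \<in> nds (P p)) \<noteq> (b \<in> nds (P q))}"

text \<open>\<open>L\<close> is the nearest common ancestor, found as the common base with the
  longest path. If there is no common base, the cycle passes through the root and the new blossom
  becomes part of the root blossom, hence \<open>None\<close>.\<close>

lemma common_base:
  assumes p: "p \<in> Ou" and q: "q \<in> Ou"
  obtains L where "L \<notin> Some ` branch p q" "\<And>l. L = Some l \<Longrightarrow> base l \<and> l \<in> nds (P p) \<and> l \<in> nds (P q)"
    "\<And>x. x \<in> {p, q} \<Longrightarrow> \<exists>R. P x = (case L of None \<Rightarrow> [] | Some l \<Rightarrow> P l) @ R \<and>
      (\<forall>y\<in>nds R. B y = L \<or> B y \<in> Some ` branch p q)"
proof (cases "\<exists>l. base l \<and> l \<in> nds (P p) \<and> l \<in> nds (P q)")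
  case False
  have "B y = None \<or> B y \<in> Some ` branch p q" if "x \<in> {p, q}" "y \<in> nds (P x)" for x y
  proof (cases "B y")
    case (Some b)
    have x: "x \<in> Ou" using that p q by auto
    have "y \<in> Ou" using P_Ou[OF x] that by auto
    then have "base b" using base_Ou[OF _ Some] by (simp add: base_def)
    moreover have "b \<in> nds (P x)" using nds_base[OF x that(2) Some] .
    ultimately have "b \<in> branch p q" using False that by (auto simp: branch_def)
    then show ?thesis using Some by simp
  qed simp
  then show ?thesis by (intro that[of None]) auto
next
  case True
  define C where "C = {l. base l \<and> l \<in> nds (P p) \<and> l \<in> nds (P q)}"
  have "finite C" unfolding C_def using finite_subset[of _ "nds (P p)"] by (auto simp: nds_def)
  moreover have "C \<noteq> {}" using True by (auto simp: C_def)
  ultimately have fin: "finite ((\<lambda>l. length (P l)) ` C)" "(\<lambda>l. length (P l)) ` C \<noteq> {}" by simp_all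
  obtain l where l: "l \<in> C" "Max ((\<lambda>l. length (P l)) ` C) = length (P l)" using Max_in[OF fin] by auto
  have le: "length (P l') \<le> length (P l)" if "l' \<in> C" for l' using Max_ge[OF fin(1)] l(2) that by auto
  have bl: "base l" "l \<in> nds (P p)" "l \<in> nds (P q)" using l(1) by (auto simp: C_def)
  have "\<exists>R. P x = P l @ R \<and> (\<forall>y\<in>nds R. B y = Some l \<or> B y \<in> Some ` branch p q)" if "x \<in> {p, q}" for x
  proof -
    have x: "x \<in> Ou" "l \<in> nds (P x)" using that p q bl by auto
    obtain R where R: "P x = P l @ R" using base_prefix[OF x(1) bl(1) x(2)] by blast
    have "B y = Some l \<or> B y \<in> Some ` branch p q" if y: "y \<in> nds R" for y
    proof -
      obtain b R' where b: "B y = Some b" "P b = P l @ R'" using suffix_base[OF x(1) bl(1) R y] by blast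
      have yx: "y \<in> nds (P x)" using y R by simp
      have "y \<in> Ou" using P_Ou[OF x(1)] yx by auto
      then have bb: "base b" using base_Ou[OF _ b(1)] by (simp add: base_def)
      have bx: "b \<in> nds (P x)" using nds_base[OF x(1) yx b(1)] .
      show ?thesis
      proof (cases "b \<in> C")
        case True
        \<comment> \<open>By maximality no common base extends \<open>P l\<close>.\<close>
        then have "R' = []" using le[OF True] b(2) by simp
        then have "snd (last (P b)) = snd (last (P l))" using b(2) by simp
        then have "b = l" using P_last baseD(1) bb bl(1) by metis
        then show ?thesis using b by simp
      next
        case False
        then have "b \<in> branch p q" using bb bx \<open>x \<in> {p, q}\<close> by (auto simp: C_def branch_def)
        then show ?thesis using b by simp
      qed
    qed
    then show ?thesis using R by blast
  qed
  moreover have "l \<notin> branch p q" using bl by (simp add: branch_def)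
  ultimately show ?thesis using bl by (intro that[of "Some l"]) auto
qed

text \<open>Shrinking the odd cycle closed by the edge \<open>t\<close> makes the odd vertices on it even; each of
  them is reached through \<open>t\<close> by going round the cycle in the other direction.\<close>

lemma merge:
  assumes p: "p \<in> Ou" and q: "q \<in> Ou" and e: "ed t p q"
  obtains P' B' where
    "search_state Nd mt ed rt (Ou \<union> mt ` branch p q) P' B'"
    "\<And>x. x \<in> Ou \<Longrightarrow> P' x = P x"
    "\<And>x y. x \<in> Ou \<Longrightarrow> y \<in> Ou \<Longrightarrow> B x = B y \<Longrightarrow> B' x = B' y"
    "B' p = B' q"
    "\<And>b. b \<in> branch p q \<Longrightarrow> b \<in> nds (P p) \<Longrightarrow>
      \<exists>R R'. P p = P b @ R \<and> P' (mt b) = P q @ R' \<and> nds (P' (mt b)) = nds (P q) \<union> mt ` insert b (nds R) \<and>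
        labs (P' (mt b)) = labs (P q) \<union> {t} \<union> fst ` set R"
    "\<And>b. b \<in> branch p q \<Longrightarrow> b \<notin> nds (P p) \<Longrightarrow>
      \<exists>R R'. P q = P b @ R \<and> P' (mt b) = P p @ R' \<and> nds (P' (mt b)) = nds (P p) \<union> mt ` insert b (nds R) \<and>
        labs (P' (mt b)) = labs (P p) \<union> {t} \<union> fst ` set R"
proof -
  define X where "X = branch p q"
  \<comment> \<open>\<open>Q\<close> treats both branches at once: \<open>x\<close> is the end of
    the edge whose path carries \<open>b\<close>, and \<open>y\<close> the other end, along whose
    path the walk starts.\<close>
  define Q where "Q b b0 W \<longleftrightarrow> (\<exists>x y R R'. {x, y} = {p, q} \<and> (x = p \<longleftrightarrow> b \<in> nds (P p)) \<and> P x = P b @ R \<and> apath W \<and> snd (last W) = b0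
    \<and> W = P y @ R' \<and> b \<in> nds (P x) \<and> b \<notin> nds (P y) \<and> nds W = nds (P y) \<union> mt ` insert b (nds R) \<and> labs W = labs (P y) \<union> {t} \<union> fst ` set R)" for b b0 W
  have "\<exists>W. Q b (mt b) W" if b: "b \<in> X" for b
  proof -
    have bb: "base b" using b by (simp add: X_def branch_def)
    obtain x y where xy: "{x, y} = {p, q}" "b \<in> nds (P x)" "b \<notin> nds (P y)" "x = p \<longleftrightarrow> b \<in> nds (P p)"
    proof (cases "b \<in> nds (P p)")
      case True
      then show ?thesis using that[of p q] b by (simp add: X_def branch_def)
    next
      case False
      then show ?thesis using that[of q p] b by (auto simp add: X_def branch_def)
    qed
    have xO: "x \<in> Ou" "y \<in> Ou" "ed t x y" using xy(1) p q e ed_sym by (auto simp: doubleton_eq_iff)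
    obtain R where R: "P x = P b @ R" using base_prefix[OF xO(1) bb xy(2)] by blast
    show ?thesis unfolding Q_def
      using turn_path[OF xO bb xy(3) R] xy R by blast
  qed
  then obtain W where W: "\<And>b. b \<in> X \<Longrightarrow> Q b (mt b) (W b)" by metis
  obtain L where L: "L \<notin> Some ` X" "\<And>l. L = Some l \<Longrightarrow> base l \<and> l \<in> nds (P p) \<and> l \<in> nds (P q)"
    "\<And>x. x \<in> {p, q} \<Longrightarrow> \<exists>R. P x = (case L of None \<Rightarrow> [] | Some l \<Rightarrow> P l) @ R \<and>
      (\<forall>y\<in>nds R. B y = L \<or> B y \<in> Some ` X)"
    using common_base[OF p q] unfolding X_def by metis
  \<comment> \<open>The path to the base of the new blossom, which is empty for the root
    blossom.\<close>
  define pre where "pre = (case L of None \<Rightarrow> [] | Some l \<Rightarrow> P l)"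
  define P' where "P' x = (if x \<in> mt ` X then W (mt x) else P x)" for x
  \<comment> \<open>The blossoms on both branches and the newly even vertices receive the base
    \<open>L\<close>; nodes that already had base \<open>L\<close> keep it.\<close>
  define B' where "B' x = (if x \<in> mt ` X \<or> B x \<in> Some ` X then L else B x)" for x
  let ?O = "Ou \<union> mt ` X"
  have Xbase: "base b" if "b \<in> X" for b using that by (simp add: X_def branch_def)
  have XO: "b \<in> Ou" "B b = Some b" "mt b \<notin> Ou" if "b \<in> X" for b
    using baseD[OF Xbase[OF that]] by auto
  have new: "x \<notin> mt ` X" if "x \<in> Ou" for x using XO(3) that by auto
  have P'O: "P' x = P x" if "x \<in> Ou" for x using new[OF that] by (simp add: P'_def)
  have B'same: "B' x = B x" if "x \<in> Ou" "B x \<notin> Some ` X" for x using new[OF that(1)] that(2) by (simp add: B'_def)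
  have B'L: "B' x = L" if "B x = L \<or> B x \<in> Some ` X" for x using that by (auto simp: B'_def)
  have B'new: "B' (mt b) = L" if "b \<in> X" for b using that by (simp add: B'_def)
  have Lbase: "l \<in> Ou" "B l = Some l" "mt l \<notin> Ou" "l \<notin> X" "mt l \<notin> mt ` X" "B' l = Some l" if "L = Some l" for l
  proof -
    show *: "l \<in> Ou" "B l = Some l" "mt l \<notin> Ou" using baseD L(2)[OF that] by blast+
    show "l \<notin> X" using L(1) that by auto
    then show "mt l \<notin> mt ` X" by auto
    show "B' l = Some l" using B'L[of l] * that by simp
  qed
  have preL: "\<exists>R. P x = pre @ R \<and> (\<forall>y\<in>nds R. B' y = L)" if "x \<in> {p, q}" for x
    using L(3)[OF that] B'L unfolding pre_def by blast
  have preX: "\<exists>R. P b = pre @ R \<and> (\<forall>y\<in>nds R. B' y = L)" if b: "b \<in> X" for b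
  proof -
    obtain x where x: "x \<in> {p, q}" "b \<in> nds (P x)" using b by (auto simp: X_def branch_def)
    have xO: "x \<in> Ou" using x p q by auto
    obtain R where R: "P x = P b @ R" using base_prefix[OF xO Xbase[OF b] x(2)] by blast
    obtain R' where R': "P x = pre @ R'" "\<forall>y\<in>nds R'. B' y = L" using preL[OF x(1)] by blast
    have bself: "b \<in> nds (P b)" using P_self XO(1)[OF b] by blast
    have "P b @ R = pre @ R'" using R R' by simp
    then consider us where "P b = pre @ us" "us @ R = R'" | us where "P b @ us = pre"
      unfolding append_eq_append_conv2 by blast
    then show ?thesis
    proof cases
      case 1
      then show ?thesis using R' by auto
    next
      case 2
      \<comment> \<open>Then \<open>b\<close> would lie on the common beginning of
        \<open>P p\<close> and \<open>P q\<close>, while a branch base lies on only one of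
        them.\<close>
      then have "b \<in> nds pre" using bself by auto
      then obtain l where l: "L = Some l" "b \<in> nds (P l)" by (cases L) (auto simp: pre_def)
      have "P l \<noteq> [] \<and> (\<forall>x\<in>{p,q}. \<exists>R. P x = P l @ R)" using preL l P_nonempty[OF Lbase(1)[OF l(1)]] by (fastforce simp: pre_def)
      then have "b \<in> nds (P p)" "b \<in> nds (P q)" using l by fastforce+
      then show ?thesis using b by (simp add: X_def branch_def)
    qed
  qed
  have Ocases: "x \<in> ?O \<Longrightarrow> (x \<in> Ou \<and> B x \<notin> Some ` X \<Longrightarrow> G) \<Longrightarrow>
      (\<And>b. x \<in> Ou \<Longrightarrow> B x = Some b \<Longrightarrow> b \<in> X \<Longrightarrow> G) \<Longrightarrow> (\<And>b. x = mt b \<Longrightarrow> b \<in> X \<Longrightarrow> G) \<Longrightarrow> G" for x G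
    by auto
  have merged: "mt x \<in> ?O \<and> B' (mt x) = L" if "x \<in> Ou" "B x = Some b" "b \<in> X" for x b
  proof (cases "x = b")
    case True
    then show ?thesis using that B'new by auto
  next
    case False
    from base_mt[OF that(1,2) False] show ?thesis using B'L[of "mt x"] that by auto
  qed
  have mergedP: "\<exists>R. P' x = pre @ R \<and> (\<forall>y\<in>nds R. B' y = L)" if "x \<in> ?O" "x \<in> Ou \<Longrightarrow> B x \<in> Some ` X" for x
    using that(1)
  proof (rule Ocases)
    fix b assume x: "x \<in> Ou" "B x = Some b" and b: "b \<in> X"
    obtain R where R: "P x = P b @ R" "\<forall>y\<in>nds R. B y = Some b" using base_P[OF x] by blast
    obtain R' where R': "P b = pre @ R'" "\<forall>y\<in>nds R'. B' y = L" using preX[OF b] by blast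
    have "\<forall>y\<in>nds R. B' y = L" using R(2) b B'L by auto
    then have "\<forall>y\<in>nds (R' @ R). B' y = L" using R' by auto
    moreover have "P' x = pre @ (R' @ R)" using P'O[OF x(1)] R R' by simp
    ultimately show ?thesis by blast
  next
    fix b assume x: "x = mt b" and b: "b \<in> X"
    from W[OF b] obtain x' y' R R1 where W': "{x', y'} = {p, q}" "P x' = P b @ R" "W b = P y' @ R1"
      "b \<in> nds (P x')" "b \<notin> nds (P y')" "nds (W b) = nds (P y') \<union> mt ` insert b (nds R)" "apath (W b)"
      unfolding Q_def by metis
    have xO: "x' \<in> Ou" "y' \<in> Ou" using W'(1) p q by (auto simp: doubleton_eq_iff)
    have X': "b' \<in> X" if "base b'" "b' \<in> nds (P x')" "b' \<notin> nds (P y')" for b'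
      using that W'(1) by (auto simp: X_def branch_def doubleton_eq_iff)
    have R1: "y \<in> nds R1 \<Longrightarrow> y \<in> mt ` insert b (nds R)" for y
    proof -
      assume y: "y \<in> nds R1"
      have "apath (P y' @ R1)" using W'(3,7) by simp
      from apath_disjoint[OF this P_nonempty[OF xO(2)]] have "y \<notin> nds (P y')" using y nds_sup2 by blast
      then show ?thesis using W'(3,6) y by auto
    qed
    have "B' (mt z) = L" if z: "z \<in> insert b (nds R)" for z
    proof (cases "z = b")
      case False
      then obtain b' where b': "base b'" "b' \<in> nds (P x')" "b' \<notin> nds (P y')" "B z = Some b'" "z \<in> Ou"
        using merge_one_side[OF xO Xbase[OF b] W'(4,5,2)] z by blast
      show ?thesis using merged[OF b'(5,4) X'[OF b'(1,2,3)]] by blast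
    qed (use B'new b in simp)
    then have "\<forall>y\<in>nds R1. B' y = L" using R1 by blast
    moreover obtain R2 where "P y' = pre @ R2" "\<forall>y\<in>nds R2. B' y = L" using preL[of y'] W'(1) by blast
    ultimately have "W b = pre @ (R2 @ R1)" "\<forall>y\<in>nds (R2 @ R1). B' y = L" using W'(3) by auto
    moreover have "P' x = W b" using x b by (auto simp: P'_def)
    ultimately show ?thesis by metis
  qed (use that in auto)
  have mergedB: "B' x = L \<and> mt x \<in> ?O \<and> B' (mt x) = L" if "x \<in> ?O" "x \<in> Ou \<Longrightarrow> B x \<in> Some ` X" for x
    using that(1)
  proof (rule Ocases)
    fix b assume x: "x \<in> Ou" "B x = Some b" and b: "b \<in> X"
    then show ?thesis using merged[OF x b] B'L[of x] by auto
  next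
    fix b assume x: "x = mt b" and b: "b \<in> X"
    then show ?thesis using B'new[OF b] XO[OF b] B'L[of b] by auto
  qed (use that in auto)
  have old: "x \<in> Ou \<and> B x \<notin> Some ` X \<and> B' x = B x" if "\<not> (x \<in> Ou \<longrightarrow> B x \<in> Some ` X)" for x
    using that B'same by auto
  have st: "search_state Nd mt ed rt ?O P' B'"
  proof unfold_locales
    fix x assume x: "x \<in> ?O"
    have "apath (P' x) \<and> snd (last (P' x)) = x \<and> nds (P' x) \<subseteq> ?O"
    proof (cases "x \<in> Ou")
      case True
      then show ?thesis using P'O[OF True] P_path[OF True] P_last[OF True] P_Ou[OF True] by auto
    next
      case False
      then obtain b where b: "x = mt b" "b \<in> X" using x by auto
      have P'x: "P' x = W b" using b by (auto simp: P'_def)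
      from W[OF b(2)] obtain x' y' R where W': "{x', y'} = {p, q}" "P x' = P b @ R" "apath (W b)" "snd (last (W b)) = mt b"
        "b \<in> nds (P x')" "b \<notin> nds (P y')" "nds (W b) = nds (P y') \<union> mt ` insert b (nds R)"
        unfolding Q_def by metis
      have xO: "x' \<in> Ou" "y' \<in> Ou" using W'(1) p q by (auto simp: doubleton_eq_iff)
      have X': "b' \<in> X" if "base b'" "b' \<in> nds (P x')" "b' \<notin> nds (P y')" for b'
        using that W'(1) by (auto simp: X_def branch_def doubleton_eq_iff)
      have "mt z \<in> ?O" if z: "z \<in> insert b (nds R)" for z
      proof (cases "z = b")
        case False
        then obtain b' where b': "base b'" "b' \<in> nds (P x')" "b' \<notin> nds (P y')" "B z = Some b'" "z \<in> Ou"
          using merge_one_side[OF xO Xbase[OF b(2)] W'(5,6,2)] z by blast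
        show ?thesis using merged[OF b'(5,4) X'[OF b'(1,2,3)]] by blast
      qed (use b in simp)
      then show ?thesis using P'x W' b P_Ou[OF xO(2)] by auto
    qed
    then show "apath (P' x)" "snd (last (P' x)) = x" "nds (P' x) \<subseteq> ?O" by auto
  next
    fix x assume x: "x \<in> ?O" "B' x = None"
    show "mt x \<in> ?O \<and> B' (mt x) = None"
    proof (cases "x \<in> Ou \<longrightarrow> B x \<in> Some ` X")
      case True
      then show ?thesis using mergedB[OF x(1)] x(2) by auto
    next
      case False
      note o = old[OF False]
      then have "x \<in> Ou" "B x = None" using x(2) by simp_all
      from root_mt[OF this] have "mt x \<in> Ou" "B (mt x) = None" by simp_all
      then show ?thesis using B'same[of "mt x"] by auto
    qed
    fix y assume y: "y \<in> nds (P' x)"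
    show "B' y = None"
    proof (cases "x \<in> Ou \<longrightarrow> B x \<in> Some ` X")
      case True
      then show ?thesis using mergedB[OF x(1)] mergedP[OF x(1)] x(2) y by (auto simp: pre_def)
    next
      case False
      note o = old[OF False]
      then have "y \<in> nds (P x)" using y P'O by auto
      then have "B y = None" "y \<in> Ou" using root_P[of x y] o x(2) P_Ou[of x] by auto
      then show ?thesis using B'same[of y] by auto
    qed
  next
    fix x b assume x: "x \<in> ?O" "B' x = Some b"
    have "(b \<in> ?O \<and> B' b = Some b \<and> mt b \<notin> ?O) \<and> (x \<noteq> b \<longrightarrow> mt x \<in> ?O \<and> B' (mt x) = Some b) \<and>
      (\<exists>R. P' x = P' b @ R \<and> (\<forall>y\<in>nds R. B' y = Some b))"
    proof (cases "x \<in> Ou \<longrightarrow> B x \<in> Some ` X")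
      case True
      then have m: "B' x = L" "mt x \<in> ?O" "B' (mt x) = L" using mergedB[OF x(1)] by auto
      then have Lb: "L = Some b" using x by simp
      obtain R where "P' x = pre @ R" "\<forall>y\<in>nds R. B' y = L" using mergedP[OF x(1)] True by blast
      then show ?thesis using m Lb Lbase[OF Lb] P'O[of b] by (auto simp: pre_def)
    next
      case False
      note o = old[OF False]
      then have xB: "x \<in> Ou" "B x = Some b" using x by simp_all
      moreover have "b \<notin> X" using o xB(2) by blast
      ultimately have xb: "x \<in> Ou" "B x = Some b" "b \<notin> X" by simp_all
      have bO: "b \<in> Ou" "B b = Some b" "mt b \<notin> Ou" using base_Ou[OF xb(1,2)] by auto
      obtain R where R: "P x = P b @ R" "\<forall>y\<in>nds R. B y = Some b" using base_P[OF xb(1,2)] by blast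
      have "\<forall>y\<in>nds R. B' y = Some b"
      proof
        fix y assume y: "y \<in> nds R"
        then have "y \<in> Ou" "B y = Some b" using R P_Ou[OF xb(1)] by auto
        then show "B' y = Some b" using B'same[of y] xb(3) by auto
      qed
      moreover have "mt x \<in> ?O \<and> B' (mt x) = Some b" if "x \<noteq> b"
        using base_mt[OF xb(1,2) that] B'same[of "mt x"] xb(3) by auto
      ultimately show ?thesis using bO xb(3) B'same[of b] P'O[of b] P'O[of x] xb(1) R by auto
    qed
    then show "b \<in> ?O \<and> B' b = Some b \<and> mt b \<notin> ?O" "x \<noteq> b \<Longrightarrow> mt x \<in> ?O \<and> B' (mt x) = Some b"
      "\<exists>R. P' x = P' b @ R \<and> (\<forall>y\<in>nds R. B' y = Some b)" by auto
  next
    fix b assume b: "b \<in> ?O" "B' b = Some b"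
    have bO: "b \<in> Ou \<and> B b = Some b"
    proof (cases "b \<in> Ou \<longrightarrow> B b \<in> Some ` X")
      case True
      then have "L = Some b" using mergedB[OF b(1)] b by auto
      then show ?thesis using Lbase by auto
    next
      case False
      then show ?thesis using old[OF False] b by auto
    qed
    have "(\<exists>t. P b = [(t, b)]) \<or> (\<exists>a\<in>Ou. \<exists>t. P b = P a @ [(t, b)])" using parent bO by blast
    then show "(\<exists>t. P' b = [(t, b)]) \<or> (\<exists>a\<in>?O. \<exists>t. P' b = P' a @ [(t, b)])"
    proof
      assume "\<exists>a\<in>Ou. \<exists>t. P b = P a @ [(t, b)]"
      then obtain a t where "a \<in> Ou" "P b = P a @ [(t, b)]" by blast
      then have "P' b = P' a @ [(t, b)]" "a \<in> ?O" using P'O[of b] P'O[of a] bO by auto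
      then show ?thesis by blast
    next
      assume "\<exists>t. P b = [(t, b)]"
      then show ?thesis using P'O[of b] bO by auto
    qed
  next
    fix y assume "rt y"
    from rt_state[OF this] show "y \<in> ?O \<and> B' y = None \<or> y \<notin> ?O \<and> mt y \<in> ?O \<and> (\<exists>t. P' (mt y) = [(t, mt y)])"
    proof
      assume "y \<in> Ou \<and> B y = None"
      then show ?thesis using B'same[of y] by auto
    next
      assume y: "y \<notin> Ou \<and> mt y \<in> Ou \<and> (\<exists>t. P (mt y) = [(t, mt y)])"
      show ?thesis
      proof (cases "mt y \<in> X")
        case True
        then have "y \<in> mt ` X" by (metis image_eqI mt_mt)
        \<comment> \<open>A path with a single entry has no other nonempty prefix, so a base
          \<open>L = Some l\<close> would be \<open>mt y\<close> itself, which lies strictly below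
          \<open>L\<close>.\<close>
        moreover have "L = None"
        proof (cases L)
          case (Some l)
          obtain R where R: "P (mt y) = P l @ R" using preX[OF True] Some by (auto simp: pre_def)
          obtain t where t: "P (mt y) = [(t, mt y)]" using y by blast
          have "P l = [(t, mt y)]" using R t P_nonempty[OF Lbase(1)[OF Some]] by (cases "P l") auto
          then have "l = mt y" using P_last[OF Lbase(1)[OF Some]] by simp
          then show ?thesis using Lbase(4)[OF Some] True by simp
        qed
        ultimately show ?thesis using B'new[OF True] by simp
      next
        case False
        then have "y \<notin> mt ` X" by auto
        then show ?thesis using y P'O[of "mt y"] by auto
      qed
    qed
  qed
  have B'pq: "B' x = L" if x: "x \<in> {p, q}" for x
  proof -
    have xO: "x \<in> Ou" using x p q by auto
    obtain R where R: "P x = pre @ R" "\<forall>y\<in>nds R. B' y = L" using preL[OF x] by blast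
    show ?thesis
    proof (cases "R = []")
      case False
      then have "last (P x) = last R" using R(1) by simp
      then have "x \<in> nds R" using P_last[OF xO] last_nds[OF False] by simp
      then show ?thesis using R(2) by blast
    next
      case True
      then have px: "P x = pre" using R(1) by simp
      then have "pre \<noteq> []" using P_nonempty[OF xO] by simp
      then obtain l where l: "L = Some l" by (cases L) (simp_all add: pre_def)
      then have "P x = P l" using px by (simp add: pre_def)
      then have "x = l" using P_last[OF xO] P_last[OF Lbase(1)[OF l]] by metis
      then show ?thesis using Lbase(6)[OF l] l by simp
    qed
  qed
  show ?thesis
  proof (rule that[of P' B'])
    show "search_state Nd mt ed rt (Ou \<union> mt ` branch p q) P' B'" using st by (simp add: X_def)
    show "P' x = P x" if "x \<in> Ou" for x using P'O[OF that] .
    show "B' x = B' y" if "x \<in> Ou" "y \<in> Ou" "B x = B y" for x y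
      using new[OF that(1)] new[OF that(2)] that(3) by (simp only: B'_def)
    show "B' p = B' q" using B'pq[of p] B'pq[of q] by simp
    fix b assume b: "b \<in> branch p q"
    then have bX: "b \<in> X" by (simp add: X_def)
    have P'b: "P' (mt b) = W b" using bX by (auto simp: P'_def)
    from W[OF bX] obtain x' y' R R1 where W': "{x', y'} = {p, q}" "x' = p \<longleftrightarrow> b \<in> nds (P p)" "P x' = P b @ R" "W b = P y' @ R1"
      "nds (W b) = nds (P y') \<union> mt ` insert b (nds R)" "labs (W b) = labs (P y') \<union> {t} \<union> fst ` set R"
      unfolding Q_def by metis
    show "\<exists>R R'. P p = P b @ R \<and> P' (mt b) = P q @ R' \<and> nds (P' (mt b)) = nds (P q) \<union> mt ` insert b (nds R) \<and>
        labs (P' (mt b)) = labs (P q) \<union> {t} \<union> fst ` set R" if "b \<in> nds (P p)"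
    proof -
      have "x' = p" "y' = q" using that W'(1,2) by (auto simp: doubleton_eq_iff)
      then show ?thesis using W'(3-6) unfolding P'b by blast
    qed
    show "\<exists>R R'. P q = P b @ R \<and> P' (mt b) = P p @ R' \<and> nds (P' (mt b)) = nds (P p) \<union> mt ` insert b (nds R) \<and>
        labs (P' (mt b)) = labs (P p) \<union> {t} \<union> fst ` set R" if "b \<notin> nds (P p)"
    proof -
      have "x' = q" "y' = p" using that W'(1,2) by (auto simp: doubleton_eq_iff)
      then show ?thesis using W'(3-6) unfolding P'b by blast
    qed
  qed
qed

end

section \<open>Completeness of a search that is stuck\<close>

context search_state begin

text \<open>A counting argument: if an even path ended outside \<open>Ou\<close>, switching along it would give a
  matching that covers the odd component of every blossom, hence matches the blossoms injectively
  to odd vertices, of which there is one less.\<close>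

lemma stuck_search:
  assumes closed: "\<And>t p q. p \<in> Ou \<Longrightarrow> ed t p q \<Longrightarrow> q \<in> Ou \<and> B q = B p \<or> q \<notin> Ou \<and> mt q \<in> Ou"
    and L: "apath L"
  shows "snd (last L) \<in> Ou"
proof (rule ccontr)
  define y where "y = snd (last L)"
  assume "snd (last L) \<notin> Ou"
  then have y: "y \<notin> Ou" by (simp add: y_def)
  obtain f where f: "perfect_except y f" using apath_perfect[OF L] y_def by blast
  define Bs where "Bs = {b. base b}"
  define I where "I = {w. w \<notin> Ou \<and> mt w \<in> Ou}"
  define Bx where "Bx x = (case x of None \<Rightarrow> None | Some p \<Rightarrow> B p)" for x
  \<comment> \<open>The nodes of the blossom with base \<open>c\<close>; the exposed root
    \<open>None\<close> belongs to the root blossom.\<close>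
  define comp where "comp c = {x \<in> insert None (Some ` Ou). Bx x = c}" for c
  have finO: "finite Ou" using finite_subset[OF Ou_Nd finite_Nd] .
  have sub: "comp c \<subseteq> insert None (Some ` (Nd - {y}))" for c
  proof -
    have "Ou \<subseteq> Nd - {y}" using Ou_Nd y by blast
    then show ?thesis unfolding comp_def by blast
  qed
  have F: "f x \<in> insert None (Some ` (Nd - {y}))" "f (f x) = x" "f x \<noteq> x" if "x \<in> comp c" for x c
  proof -
    have "x \<in> insert None (Some ` (Nd - {y}))" using subsetD[OF sub that] .
    then show "f x \<in> insert None (Some ` (Nd - {y}))" "f (f x) = x" "f x \<noteq> x"
      by (rule perfect_exceptD[OF f])+
  qed
  \<comment> \<open>Without \<open>c\<close> the set is paired off by \<open>mt\<close>, so
    \<open>comp c\<close> is odd and the fixed-point-free involution \<open>f\<close> cannot map it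
    to itself.\<close>
  have ex: "\<exists>x\<in>comp c. f x \<notin> comp c" if c: "c \<in> insert None (Some ` Bs)" for c
  proof (rule ccontr)
    assume "\<not> (\<exists>x\<in>comp c. f x \<notin> comp c)"
    then have "even (card (comp c))" using finO F[of _ c] by (intro even_card_involution[of _ f]) (auto simp: comp_def)
    moreover have "even (card (comp c - {c}))"
    proof (rule even_card_involution[of _ "map_option mt"])
      fix x assume x: "x \<in> comp c - {c}"
      show "map_option mt x \<in> comp c - {c}"
      proof (cases x)
        case None
        then show ?thesis using x by (auto simp: comp_def Bx_def)
      next
        case (Some p)
        then have p: "p \<in> Ou" "B p = c" "Some p \<noteq> c" using x by (auto simp: comp_def Bx_def)
        have "mt p \<in> Ou \<and> B (mt p) = c \<and> Some (mt p) \<noteq> c"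
        proof (cases c)
          case None
          then show ?thesis using root_mt[OF p(1)] p by auto
        next
          case (Some b)
          then show ?thesis using base_mt[OF p(1), of b] base_Ou[OF p(1), of b] p by auto
        qed
        then show ?thesis using Some by (auto simp: comp_def Bx_def)
      qed
      show "map_option mt x \<noteq> x" "map_option mt (map_option mt x) = x"
        using x by (cases x; auto simp: comp_def Bx_def)+
    qed (use finO in \<open>auto simp: comp_def\<close>)
    moreover have "c \<in> comp c" using c baseD by (auto simp: comp_def Bx_def Bs_def)
    ultimately show False using finO by (auto simp: comp_def)
  qed
  define g where "g c = (SOME x. x \<in> comp c \<and> f x \<notin> comp c)" for c
  have g: "g c \<in> comp c" "f (g c) \<notin> comp c" if "c \<in> insert None (Some ` Bs)" for c
    using someI_ex[of "\<lambda>x. x \<in> comp c \<and> f x \<notin> comp c"] ex[OF that] unfolding g_def by blast+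
  \<comment> \<open>A partner outside the component is not even: the mate of a base is odd, edges to
    even nodes stay in the blossom by \<open>closed\<close>, and \<open>rt_state\<close> handles the
    edges at the root.\<close>
  have gI: "f (g c) \<in> Some ` I" if c: "c \<in> insert None (Some ` Bs)" for c
  proof (cases "g c")
    case None
    then obtain w where w: "f None = Some w" using F(3)[OF g(1)[OF c]] by auto
    then have "rt w" by (rule perfect_exceptD(5)[OF f])
    moreover have "c = None" using g(1)[OF c] None by (auto simp: comp_def Bx_def)
    ultimately show ?thesis using rt_state[of w] g(2)[OF c] None w by (auto simp: I_def comp_def Bx_def)
  next
    case (Some p)
    then have p: "p \<in> Ou" "B p = c" using g(1)[OF c] by (auto simp: comp_def Bx_def)
    show ?thesis
    proof (cases "f (Some p)")
      case None
      then have "f None = Some p" using F(2)[OF g(1)[OF c]] Some by simp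
      then have "rt p" by (rule perfect_exceptD(5)[OF f])
      then have "B p = None" using rt_state[of p] p by auto
      then show ?thesis using g(2)[OF c] Some None p by (auto simp: comp_def Bx_def)
    next
      case q: (Some q)
      have pN: "p \<in> Nd - {y}" using p y Ou_Nd by auto
      have "q = mt p \<or> (\<exists>t. ed t p q)" using perfect_exceptD(4)[OF f pN q] .
      then consider "q = mt p" | t where "ed t p q" by blast
      then have "q \<in> Ou \<and> B q = B p \<or> q \<notin> Ou \<and> mt q \<in> Ou"
      proof cases
        case 1
        show ?thesis
        proof (cases "B p")
          case None
          then show ?thesis using root_mt[OF p(1)] 1 by auto
        next
          case (Some b)
          show ?thesis using base_mt[OF p(1) Some] base_Ou[OF p(1) Some] 1 p Some by (cases "p = b") auto
        qed
      next
        case 2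
        then show ?thesis by (rule closed[OF p(1)])
      qed
      then show ?thesis using g(2)[OF c] Some q p by (auto simp: comp_def Bx_def I_def)
    qed
  qed
  have inj: "inj_on (\<lambda>c. f (g c)) (insert None (Some ` Bs))"
  proof (rule inj_onI)
    fix c c' assume c: "c \<in> insert None (Some ` Bs)" "c' \<in> insert None (Some ` Bs)" "f (g c) = f (g c')"
    then have "g c = g c'" using F(2)[OF g(1)] by metis
    then show "c = c'" using g(1)[OF c(1)] g(1)[OF c(2)] by (auto simp: comp_def)
  qed
  have finB: "finite Bs" using finite_subset[of Bs Ou] finO baseD by (auto simp: Bs_def)
  have IB: "I = mt ` Bs"
  proof -
    have "w \<in> mt ` Bs" if "w \<in> I" for w
    proof (rule image_eqI[of _ _ "mt w"])
      show "mt w \<in> Bs" using that unfolding I_def Bs_def mem_Collect_eq base_iff mt_mt by blast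
    qed simp
    moreover have "mt b \<in> I" if "b \<in> Bs" for b
      using that unfolding I_def Bs_def mem_Collect_eq base_iff mt_mt by blast
    ultimately show ?thesis by blast
  qed
  then have finI: "finite (Some ` I)" "card (Some ` I) \<le> card Bs" using finB by (simp_all add: card_image card_image_le)
  have "card (insert None (Some ` Bs)) \<le> card (Some ` I)"
    using gI by (intro card_inj_on_le[OF inj _ finI(1)]) blast
  moreover have "card (insert None (Some ` Bs)) = Suc (card Bs)" using finB by (simp add: card_image)
  ultimately show False using finI by simp
qed

end

section \<open>Augmenting a partial cover\<close>

context partial_cover begin

text \<open>Neighbours of \<open>v\<close> that were covered must stay covered; this makes one phase
  for each neighbour enough.\<close>

definition improves :: "'a set \<Rightarrow> bool" where
  "improves T \<longleftrightarrow> T \<subseteq> D \<and> indep T \<and> (\<forall>x. adj v x \<longrightarrow> covers S x \<or> x = u \<longrightarrow> covers T x)"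

text \<open>The closing vertex of the second alternative of \<open>terminal\<close>. It must avoid
  the switched set \<open>T\<close>, while \<open>one\<close> and \<open>NS\<close> still refer to
  the old set \<open>S\<close>.\<close>

definition filler :: "'a \<Rightarrow> 'a set \<Rightarrow> 'a \<Rightarrow> bool" where
  "filler s T z \<longleftrightarrow> one z \<and> NS z = {s} \<and> (\<forall>y\<in>T. \<not> adj y z)"

lemma indep_insert: "indep (insert x T) \<longleftrightarrow> indep T \<and> (\<forall>y\<in>T. \<not> adj y x)"
  using adj_sym adj_irrefl by (auto simp: indep_def)

lemma improve_free:
  assumes "t \<in> D" "adj u t" "NS t = {}"
  shows "improves (insert t S)"
proof -
  have "\<not> adj s t" if "s \<in> S" for s using assms that by (auto simp: NS_def)
  then show ?thesis using assms S_D S_indep by (auto simp: improves_def indep_insert covers_def)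
qed

text \<open>The shortest augmentation, in which \<open>q\<close> replaces \<open>s\<close>. A filler
  is taken whenever one exists, without asking which alternative of \<open>terminal\<close> holds;
  if none exists, it must be the first alternative.\<close>

lemma improve_exchange:
  assumes q: "start q" "NS q = {s}" and te: "terminal q s"
  shows "filler s (insert q (S - {s})) z \<Longrightarrow> improves (insert z (insert q (S - {s})))"
    "\<nexists>z. filler s (insert q (S - {s})) z \<Longrightarrow> improves (insert q (S - {s}))"
proof -
  note qD = NS_singleD[OF q(2)]
  have q': "q \<in> D" "adj u q" using q by (auto simp: start_def)
  have S': "indep (insert q (S - {s}))" "insert q (S - {s}) \<subseteq> D"
  proof -
    have "\<not> adj y q" if "y \<in> S - {s}" for y using qD(5)[of y] that adj_sym by blast
    then show "indep (insert q (S - {s}))" using S_indep unfolding indep_insert by (auto simp: indep_def)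
  qed (use q' S_D in auto)
  have cov: "covers (insert q (S - {s})) x"
    if "adj v x" "covers S x \<or> x = u" "adj s x \<Longrightarrow> adj q x" for x
    using that q' adj_sym unfolding covers_def by blast
  show "improves (insert z (insert q (S - {s})))" if z: "filler s (insert q (S - {s})) z"
  proof -
    have zD: "z \<in> D" "\<not> adj q z" "adj s z" "z \<noteq> q" and zS: "\<forall>y\<in>insert q (S - {s}). \<not> adj y z"
      using z NS_singleD[of z s] q' by (auto simp: filler_def one_def)
    have "covers (insert z (insert q (S - {s}))) x" if x: "adj v x" "covers S x \<or> x = u" for x
    proof (cases "adj s x \<and> \<not> adj q x")
      case True
      then have "adj z x" using nonadj_trace[of s z q x] qD zD q' x adj_sym by blast
      then show ?thesis using adj_sym by (auto simp: covers_def)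
    next
      case False
      then show ?thesis using cov[OF x] by (auto simp: covers_def)
    qed
    then show ?thesis using S' zD zS by (auto simp: improves_def indep_insert)
  qed
  show "improves (insert q (S - {s}))" if "\<nexists>z. filler s (insert q (S - {s})) z"
  proof -
    have "\<not> (one z \<and> NS z = {s} \<and> \<not> adj z q)" for z
      using that NS_singleD[of z s] adj_sym unfolding filler_def by blast
    then have "adj q x" if "adj v x" "adj s x" for x using te that by (auto simp: terminal_def)
    then show ?thesis using S' cov by (auto simp: improves_def)
  qed
qed

end

section \<open>Splitting the cover vertices into two sides\<close>

locale cover_phase = stuck_cover +
  fixes rep :: "'a \<Rightarrow> 'a"
  assumes rep: "s \<in> S \<Longrightarrow> adj v x \<Longrightarrow> adj s x \<Longrightarrow> adj v (rep s) \<and> adj s (rep s)"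
begin

text \<open>The two sides of \<open>s\<close>: an augmenting path enters \<open>s\<close> on one and leaves it on the other.\<close>

definition side :: "'a \<Rightarrow> 'a \<Rightarrow> bool" where
  "side t s \<longleftrightarrow> (if has_terminal s then terminal t s else if has_initial s then initial t s else adj t (rep s))"

text \<open>A wing that is not terminal misses some neighbour of \<open>v\<close> at
  \<open>s\<close>, so a candidate for the representative exists.\<close>

lemma not_terminal_rep:
  assumes "s \<in> S" "\<not> terminal t s" shows "adj v (rep s)" "adj s (rep s)"
  using assms rep by (auto simp: terminal_def)

text \<open>Soundness of the split: wings on opposite sides may follow each other in a path. When
  the representative decides, an edge between the wings would make \<open>t'\<close> the centre of a
  claw with leaves \<open>rep s\<close>, \<open>b\<close> and \<open>t\<close>.\<close>

lemma side_nonadj: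
  assumes t: "wing t s a" and t': "wing t' s b" and "a \<noteq> b" "side t' s" "\<not> side t s"
  shows "\<not> adj t t'"
proof -
  consider "has_terminal s" | "\<not> has_terminal s" "has_initial s" | "\<not> has_terminal s" "\<not> has_initial s" by blast
  then show ?thesis
  proof cases
    case 1
    then show ?thesis using terminal_nonadj[OF t t'] assms by (simp add: side_def)
  next
    case 2
    then show ?thesis using initial_nonadj[OF t t'] assms by (simp add: side_def)
  next
    case 3
    note w = wingD[OF t] and w' = wingD[OF t']
    have "\<not> terminal t s" using 3 t by (auto simp: has_terminal_def)
    then have "adj v (rep s)" "adj s (rep s)" using not_terminal_rep w by auto
    then have "\<not> adj t' t"
      using wing_nonadj[OF t', of "rep s" t] assms 3 w w' wing_other[OF t] by (auto simp: side_def)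
    then show ?thesis using adj_sym by blast
  qed
qed

text \<open>Completeness of the split, up to two exceptions: a terminal \<open>t\<close> lets the
  path stop at \<open>s\<close>, and an initial \<open>t'\<close> lets it start afresh at
  \<open>s\<close>.\<close>

lemma side_flip:
  assumes t: "wing t s a" and t': "wing t' s b" and ab: "a \<noteq> b" and na: "\<not> adj t t'"
    and nt: "\<not> terminal t s" and ni: "\<not> initial t' s"
  shows "side t' s \<longleftrightarrow> \<not> side t s"
proof -
  consider "has_terminal s" | "\<not> has_terminal s" "has_initial s" | "\<not> has_terminal s" "\<not> has_initial s" by blast
  then show ?thesis
  proof cases
    case 1
    then show ?thesis using terminal_complement[OF t t' ab na nt] nt by (simp add: side_def)
  next
    case 2
    then show ?thesis using initial_complement[OF t t' ab na ni] ni by (simp add: side_def)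
  next
    case 3
    note w = wingD[OF t] and w' = wingD[OF t']
    have "t \<noteq> t'" using wing_unique t t' ab by blast
    then show ?thesis
      using nonadj_trace[of s t t' "rep s"] not_terminal_rep[OF _ nt] w w' na 3 by (simp add: side_def)
  qed
qed

lemma side_initial:
  assumes t: "wing t s a" and "has_initial s"
  shows "side t s \<longleftrightarrow> initial t s"
proof (cases "has_terminal s")
  case True
  obtain q where "start q" "NS q = {s}" using assms(2) by (auto simp: has_initial_def initial_def)
  then show ?thesis using terminal_iff_initial[OF True _ _ t] True by (simp add: side_def)
qed (use assms in \<open>simp add: side_def\<close>)

definition nodes :: "('a \<times> bool) set" where
  "nodes = S \<times> UNIV"

definition flip :: "'a \<times> bool \<Rightarrow> 'a \<times> bool" where
  "flip y = (fst y, \<not> snd y)"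

text \<open>The wing touches the node of its own side at each end. Hence an even node
  \<open>(s, c)\<close> is left by wings on side \<open>c\<close> of \<open>s\<close>, after having
  been reached through the other node by a wing on the opposite side.\<close>

definition edge :: "'a \<Rightarrow> 'a \<times> bool \<Rightarrow> 'a \<times> bool \<Rightarrow> bool" where
  "edge t y y' \<longleftrightarrow> wing t (fst y) (fst y') \<and> snd y = side t (fst y) \<and> snd y' = side t (fst y')"

text \<open>The root leads to the \<open>False\<close> node, so the first even node is
  \<open>(s, True)\<close> and the first wing is initial by \<open>side_initial\<close>.\<close>

definition entry :: "'a \<times> bool \<Rightarrow> bool" where
  "entry y \<longleftrightarrow> has_initial (fst y) \<and> \<not> snd y"

sublocale matched_graph nodes flip edge entry
proof
  show "finite nodes" using finite_S by (simp add: nodes_def)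
  show "edge t x y \<Longrightarrow> edge t y x" for t x y using wing_sym by (auto simp: edge_def)
  show "edge t x y \<Longrightarrow> x \<in> nodes" for t x y using wingD(4) by (cases x) (auto simp: edge_def nodes_def)
  show "edge t x y \<Longrightarrow> edge t x' y' \<Longrightarrow> {x, y} = {x', y'}" for t x y x' y'
    by (cases x; cases y; cases x'; cases y') (auto simp: edge_def wing_def doubleton_eq_iff)
  show "entry x \<Longrightarrow> x \<in> nodes" for x
    using wingD(4) by (cases x) (auto simp: entry_def nodes_def has_initial_def)
qed (auto simp: flip_def nodes_def prod_eq_iff)

lemma fst_flip [simp]: "fst (flip y) = fst y"
  by (simp add: flip_def)

lemma sup2_fst: "y \<in> sup2 L \<longleftrightarrow> fst y \<in> fst ` nds L"
proof
  assume "fst y \<in> fst ` nds L"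
  then obtain y' where y': "y' \<in> nds L" "fst y' = fst y" by force
  then have "y = y' \<or> y = flip y'" by (cases y; cases y') (auto simp: flip_def)
  then show "y \<in> sup2 L" using y' by (auto simp: sup2_def)
next
  assume "y \<in> sup2 L"
  then have "\<exists>y'\<in>nds L. y = y' \<or> y = flip y'" by (auto simp: sup2_def)
  then obtain y' where "y' \<in> nds L" "fst y = fst y'" by auto
  then show "fst y \<in> fst ` nds L" by simp
qed

section \<open>Complete covers yield alternating paths\<close>

lemma next_vertex:
  assumes T: "T \<subseteq> D" "indep T" "\<And>x. adj v x \<Longrightarrow> covers T x"
    and t: "t \<in> T" "adj t s" "s \<in> S" "\<not> terminal t s"
    and q: "q \<in> T" "adj u q" "q = t \<or> \<not> adj q s"
  obtains t' b where "t' \<in> T" "wing t' s b" "\<not> adj t t'" "t' \<noteq> t"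
proof -
  from t(4) obtain x where x: "adj v x" "adj s x" "\<not> adj t x" by (auto simp: terminal_def)
  obtain t' where t': "t' \<in> T" "adj x t'" using T(3)[OF x(1)] by (auto simp: covers_def)
  have ne: "t' \<noteq> t" using x t' adj_sym by blast
  have na: "\<not> adj t t'" using T(2) t t' by (auto simp: indep_def)
  have sT: "s \<notin> T" using T(2) t by (auto simp: indep_def)
  \<comment> \<open>Both \<open>s\<close> and \<open>t'\<close> see \<open>x\<close>, so they are
    adjacent.\<close>
  then have st': "adj s t'" using common_nbr_adj[of x s t'] x t' T(1) S_D t adj_sym by blast
  have nu: "\<not> adj u t'"
  proof
    assume ut': "adj u t'"
    \<comment> \<open>By independence, \<open>q\<close> is the only neighbour of \<open>u\<close> in
      \<open>T\<close>.\<close>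
    have "t' = q"
    proof (rule ccontr)
      assume "t' \<noteq> q"
      then have "adj t' q" using common_nbr_adj[of u t' q] u_nbr T(1) t' q ut' by blast
      then show False using T(2) t' q by (auto simp: indep_def)
    qed
    then show False using q st' ne adj_sym by blast
  qed
  have sN: "s \<in> NS t'" using st' t by (simp add: NS_def)
  have t'D: "t' \<in> D" using t' T by auto
  have "card (NS t') \<noteq> 0" using sN finite_NS by auto
  \<comment> \<open>With \<open>s\<close> as its only neighbour in \<open>S\<close>,
    \<open>t'\<close> would be a closing vertex and \<open>t\<close> terminal.\<close>
  moreover have "card (NS t') \<noteq> 1"
  proof
    assume c: "card (NS t') = 1"
    then have "NS t' = {s}" using sN by (auto simp: card_1_singleton_iff)
    moreover have "one t'" using c t'D nu by (simp add: one_def)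
    moreover have "\<not> adj t' t" using na adj_sym by blast
    ultimately show False using t(4) by (auto simp: terminal_def)
  qed
  ultimately have "card (NS t') = 2" using card_NS_le2[OF t'D] by linarith
  then have two: "two t'" using t'D nu by (simp add: two_def)
  then obtain a b where "wing t' a b" using two_wing by blast
  then have "wing t' s a \<or> wing t' s b" using sN by (auto simp: wing_def)
  then show ?thesis using that t' na ne by blast
qed

text \<open>The walk along the component at \<open>u\<close> of the symmetric difference of
  \<open>S\<close> and \<open>T\<close>: \<open>Us\<close> and \<open>Vs\<close> are the new and old
  vertices passed, \<open>t\<close> is the latest new vertex and \<open>s\<close> the old one it
  displaces. The path \<open>L\<close> may be only a final part of the walk, since it starts afresh
  at every initial wing.\<close>

lemma apath_of_cover_aux:
  assumes T: "T \<subseteq> D" "indep T" "\<And>x. adj v x \<Longrightarrow> covers T x"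
    and q: "q \<in> T" "adj u q" "start q" "q \<in> Us"
    and t: "t \<in> Us" "Us \<subseteq> T" "s \<in> Vs" "Vs \<subseteq> S" "adj t s"
    and Us: "\<And>x. x \<in> Us \<Longrightarrow> x \<noteq> t \<Longrightarrow> \<not> adj x s" "\<And>x. x \<in> Us \<Longrightarrow> NS x \<subseteq> Vs"
    and Vs: "\<And>b. b \<in> Vs \<Longrightarrow> b \<noteq> s \<Longrightarrow> \<exists>x\<in>Us. \<exists>y\<in>Us. x \<noteq> y \<and> adj x b \<and> adj y b"
    and st: "t = q \<and> NS q = {s} \<or> (\<exists>a L. wing t s a \<and> apath L \<and> snd (last L) = (s, \<not> side t s) \<and> fst ` nds L \<subseteq> Vs)"
  shows "\<exists>L s'. apath L \<and> snd (last L) = (s', False) \<and> has_terminal s'"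
  using q(4) t Us Vs st
proof (induction "card (S - Vs)" arbitrary: t s Us Vs rule: less_induct)
  case less
  note q4 = less.prems(1) and t = less.prems(2-6) and U1 = less.prems(7) and U2 = less.prems(8) and Vs = less.prems(9) and st = less.prems(10)
  have sS: "s \<in> S" and tT: "t \<in> T" using t by auto
  show ?case
  proof (cases "terminal t s")
    case True
    then have "t \<noteq> q \<or> NS q \<noteq> {s}" using start_not_terminal q by blast
    then obtain a L where L: "wing t s a" "apath L" "snd (last L) = (s, \<not> side t s)" using st by blast
    then have "has_terminal s" using True by (auto simp: has_terminal_def)
    then show ?thesis using L True by (auto simp: side_def)
  next
    case False
    have "q = t \<or> \<not> adj q s" using U1 q4 by blast
    with next_vertex[OF T tT t(5) sS False q(1,2)] obtain t' b where
      t': "t' \<in> T" "wing t' s b" "\<not> adj t t'" "t' \<noteq> t" by blast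
    note w' = wingD[OF t'(2)]
    have t'U: "t' \<notin> Us" using U1 t'(4) w' by blast
    \<comment> \<open>A return to an old vertex would give it a third neighbour in the independent
      set \<open>T\<close>, that is, a claw.\<close>
    have bV: "b \<notin> Vs"
    proof
      assume "b \<in> Vs"
      then obtain x y where xy: "x \<in> Us" "y \<in> Us" "x \<noteq> y" "adj x b" "adj y b" using Vs w' by blast
      have "\<not> adj x y" "\<not> adj x t'" "\<not> adj y t'" using xy T(2) t(2) t'(1) by (auto simp: indep_def)
      moreover have "x \<noteq> t'" "y \<noteq> t'" using xy t'U by auto
      ultimately show False using no_triple[of b x y t'] xy w' adj_sym by blast
    qed
    \<comment> \<open>An initial wing may be the first one after the root, so what was walked before
      is dropped. This also avoids the exception of \<open>side_flip\<close>.\<close>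
    obtain L0 where L0: "apath L0" "snd (last L0) = (s, side t' s)" "fst ` nds L0 \<subseteq> Vs"
    proof (cases "initial t' s")
      case True
      then have hi: "has_initial s" using t'(2) by (auto simp: has_initial_def)
      then have "apath [(t', (s, True))]" by (intro apath_single) (simp add: entry_def flip_def)
      moreover have "side t' s" using side_initial[OF t'(2) hi] True by simp
      ultimately show ?thesis using that[of "[(t', (s, True))]"] t by simp
    next
      case ni: False
      have "\<not> (t = q \<and> NS q = {s})"
        using ni t'(3) q(3) by (auto simp: initial_def)
      then obtain a L where L: "wing t s a" "apath L" "snd (last L) = (s, \<not> side t s)" "fst ` nds L \<subseteq> Vs"
        using st by blast
      have "a \<noteq> b" using L(1) U2[OF t(1)] bV by (auto simp: wing_def)
      from side_flip[OF L(1) t'(2) this t'(3) False ni] show ?thesis using that L by simp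
    qed
    have "(b, \<not> side t' b) \<notin> sup2 L0" using sup2_fst L0(3) bV by auto
    then have L': "apath (L0 @ [(t', (b, \<not> side t' b))])"
      using L0 t'(2) by (intro apath_snoc) (auto simp: edge_def flip_def)
    show ?thesis
    proof (rule less.hyps[where Vs = "insert b Vs" and Us = "insert t' Us" and t = t' and s = b])
      show "card (S - insert b Vs) < card (S - Vs)"
        using bV w' finite_S by (intro psubset_card_mono) auto
      show "q \<in> insert t' Us" "t' \<in> insert t' Us" "insert t' Us \<subseteq> T" "b \<in> insert b Vs" "insert b Vs \<subseteq> S" "adj t' b"
        using q4 t t' w' by auto
      show "\<not> adj x b" if "x \<in> insert t' Us" "x \<noteq> t'" for x
      proof
        assume "adj x b"
        then have "b \<in> NS x" using w' adj_sym by (auto simp: NS_def)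
        then show False using U2[of x] that bV by auto
      qed
      show "NS x \<subseteq> insert b Vs" if "x \<in> insert t' Us" for x
        using that U2 t'(2) t by (auto simp: wing_def)
      show "\<exists>x\<in>insert t' Us. \<exists>y\<in>insert t' Us. x \<noteq> y \<and> adj x b' \<and> adj y b'" if "b' \<in> insert b Vs" "b' \<noteq> b" for b'
      proof (cases "b' = s")
        case True
        then show ?thesis using t'(4) w' t by blast
      next
        case False
        then show ?thesis using Vs[of b'] that by blast
      qed
      show "t' = q \<and> NS q = {b} \<or> (\<exists>a L. wing t' b a \<and> apath L \<and> snd (last L) = (b, \<not> side t' b) \<and> fst ` nds L \<subseteq> insert b Vs)"
        using L' L0(3) wing_sym[OF t'(2)] by (intro disjI2 exI[of _ s] exI[of _ "L0 @ [(t', (b, \<not> side t' b))]"]) auto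
    qed
  qed
qed

theorem apath_of_cover:
  assumes T: "T \<subseteq> D" "indep T" "\<And>x. adj v x \<Longrightarrow> covers T x"
  shows "\<exists>L s. apath L \<and> snd (last L) = (s, False) \<and> has_terminal s"
proof -
  obtain q where q: "q \<in> T" "adj u q" using T(3)[OF u_nbr] by (auto simp: covers_def)
  have qD: "q \<in> D" using q T by auto
  have "NS q \<noteq> {}" using start_nonempty[OF qD q(2)] .
  then have "card (NS q) = 1" using card_NS_u[OF qD q(2)] finite_NS by (metis card_0_eq le_neq_implies_less less_one)
  then have sq: "start q" using qD q by (simp add: start_def)
  then obtain s where s: "NS q = {s}" by (rule startE)
  note sD = NS_singleD[OF s]
  show ?thesis
    by (rule apath_of_cover_aux[OF T q sq, of "{q}" q s "{s}"]) (use q s sD in auto)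
qed

section \<open>Alternating paths yield improvements\<close>

lemma nonadj_off:
  assumes t: "wing t a b" and z: "\<not> adj z a" "\<not> adj z b" "z \<noteq> a" "z \<noteq> b"
  shows "\<not> adj t z"
  \<comment> \<open>The ends of a wing and \<open>z\<close> would be the leaves of a claw at
    \<open>t\<close>; hence two wings can be adjacent only if they share an end.\<close>
  using claw[of t a b z] wingD[OF t] S_not_adj[of a b] z adj_sym by blast

text \<open>The effect of switching along an even path that has not reached its end: only the first
  and the last vertex removed from \<open>S\<close> may leave uncovered vertices behind.\<close>

lemma apath_switch:
  assumes "apath L"
  defines "Rm \<equiv> fst ` nds L" and "Ad \<equiv> labs L" and "s1 \<equiv> fst (snd (hd L))" and "s \<equiv> fst (snd (last L))" and "c \<equiv> snd (snd (last L))"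
  shows "snd (snd (hd L)) \<and> has_initial s1 \<and> s1 \<in> Rm \<and> s \<in> Rm \<and> Rm \<subseteq> S
    \<and> (\<forall>t\<in>Ad. \<exists>a\<in>Rm. \<exists>b\<in>Rm. wing t a b)
    \<and> (\<forall>t\<in>Ad. \<forall>t'\<in>Ad. \<not> adj t t')
    \<and> (\<forall>r\<in>Rm - {s1, s}. \<forall>x. adj v x \<and> adj r x \<longrightarrow> covers Ad x)
    \<and> (length L = 1 \<longrightarrow> Ad = {} \<and> s = s1)
    \<and> (length L \<noteq> 1 \<longrightarrow> s \<noteq> s1 \<and> (\<exists>t1\<in>Ad. \<exists>tk\<in>Ad. adj t1 s1 \<and> side t1 s1 \<and> (\<forall>t\<in>Ad. adj t s1 \<longrightarrow> t = t1)
        \<and> adj tk s \<and> side tk s \<noteq> c \<and> (\<forall>t\<in>Ad. adj t s \<longrightarrow> t = tk)))"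
  using assms(1) unfolding Rm_def Ad_def s1_def s_def c_def
proof (induction rule: apath.induct)
  case (apath_single y t)
  then show ?case using wingD(4) by (auto simp: entry_def flip_def labs_def has_initial_def)
next
  case (apath_snoc L t y)
  let ?s1 = "fst (snd (hd L))" and ?s = "fst (snd (last L))" and ?c = "snd (snd (last L))"
  let ?R = "fst ` nds L" and ?A = "labs L"
  note IH = apath_snoc.IH
  obtain b d where y: "y = (b, d)" by force
  have Ln: "L \<noteq> []" using apath_nonempty apath_snoc(1) .
  have w: "wing t ?s b" "?c = side t ?s" "d = (\<not> side t b)"
    using apath_snoc(2) y by (auto simp: edge_def flip_def)
  note wD = wingD[OF w(1)]
  have bR: "b \<notin> ?R" using apath_snoc(3) y sup2_fst[of y L] by simp
  have bs: "b \<noteq> ?s" "b \<noteq> ?s1" using IH bR by auto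
  have tb: "\<not> adj t' b" if t': "t' \<in> ?A" for t'
  proof
    assume "adj t' b"
    then have "b \<in> NS t'" using wD adj_sym by (auto simp: NS_def)
    moreover obtain a a' where "a \<in> ?R" "a' \<in> ?R" "wing t' a a'" using IH t' by blast
    ultimately show False using bR by (auto simp: wing_def)
  qed
  have tA: "t \<notin> ?A" using tb wD by blast
  \<comment> \<open>Only a wing that shares \<open>?s\<close> could be adjacent to \<open>t\<close>,
    and the one on the path lies on the other side of \<open>?s\<close>.\<close>
  have nt: "\<not> adj t t'" if t': "t' \<in> ?A" for t'
  proof (cases "adj t' ?s")
    case True
    have "length L \<noteq> 1" using IH t' by auto
    then obtain tk where tk: "side tk ?s \<noteq> ?c" "\<forall>t\<in>?A. adj t ?s \<longrightarrow> t = tk" using IH by blast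
    then have sd: "side t' ?s \<noteq> side t ?s" using t' True w by auto
    obtain a1 a2 where a12: "a1 \<in> ?R" "a2 \<in> ?R" "wing t' a1 a2" using IH t' by blast
    have "?s = a1 \<or> ?s = a2" using wing_other[OF a12(3) wD(4) True] .
    then obtain a where a: "wing t' ?s a" "a \<in> ?R" using a12 wing_sym by metis
    have ab: "a \<noteq> b" using a bR by auto
    show ?thesis
    proof (cases "side t ?s")
      case True
      then have "\<not> adj t' t" using side_nonadj[OF a(1) w(1) ab] sd by auto
      then show ?thesis using adj_sym by blast
    next
      case False
      then show ?thesis using side_nonadj[OF w(1) a(1) ab[symmetric]] sd by auto
    qed
  next
    case False
    have "t' \<notin> S" using IH t' wingD(11) by blast
    then show ?thesis using nonadj_off[OF w(1), of t'] False tb[OF t'] wD by auto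
  qed
  have lab: "labs (L @ [(t, y)]) = insert t ?A" using Ln by simp
  have nds: "fst ` nds (L @ [(t, y)]) = insert b ?R" using y by auto
  have hd: "hd (L @ [(t, y)]) = hd L" using Ln by simp
  have last: "fst (snd (last (L @ [(t, y)]))) = b" "snd (snd (last (L @ [(t, y)]))) = d" using y by simp_all
  have len: "length (L @ [(t, y)]) \<noteq> 1" using Ln by simp
  have c1: "\<forall>t1\<in>insert t ?A. \<exists>a\<in>insert b ?R. \<exists>b\<in>insert b ?R. wing t1 a b" using IH w(1) by blast
  have c2: "\<forall>t1\<in>insert t ?A. \<forall>t2\<in>insert t ?A. \<not> adj t1 t2" using IH nt adj_sym adj_irrefl by blast
  have c3: "\<forall>r\<in>insert b ?R - {?s1, b}. \<forall>x. adj v x \<and> adj r x \<longrightarrow> covers (insert t ?A) x"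
  proof (intro ballI allI impI)
    fix r x assume r: "r \<in> insert b ?R - {?s1, b}" and x: "adj v x \<and> adj r x"
    show "covers (insert t ?A) x"
    \<comment> \<open>The old last vertex becomes an inner one: the wings before and after it are
      nonadjacent and share out what it covered.\<close>
    proof (cases "r = ?s")
      case True
      then have "length L \<noteq> 1" using r IH by auto
      then obtain tk where tk: "tk \<in> ?A" "adj tk ?s" using IH by blast
      have "tk \<in> D" using IH tk(1) wingD(1) by blast
      then have "adj t x \<longleftrightarrow> \<not> adj tk x"
        using nonadj_trace[of ?s t tk x] wD tk nt[OF tk(1)] x True tA adj_sym by blast
      then show ?thesis using tk adj_sym by (auto simp: covers_def)
    next
      case False
      then have "covers ?A x" using IH r x by blast
      then show ?thesis by (auto simp: covers_def)
    qed
  qed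
  have c4: "\<exists>t1\<in>insert t ?A. adj t1 ?s1 \<and> side t1 ?s1 \<and> (\<forall>t'\<in>insert t ?A. adj t' ?s1 \<longrightarrow> t' = t1)"
  proof (cases "length L = 1")
    case True
    then have "?A = {}" "?s = ?s1" "?c" using IH by (auto simp: length_Suc_conv)
    then show ?thesis using wD w(2) by auto
  next
    case False
    then obtain t1 where t1: "t1 \<in> ?A" "adj t1 ?s1" "side t1 ?s1" "\<forall>t'\<in>?A. adj t' ?s1 \<longrightarrow> t' = t1" "?s \<noteq> ?s1" using IH by blast
    have "?s1 \<in> S" using IH by blast
    then have "\<not> adj t ?s1" using wing_other[OF w(1)] t1(5) bs by metis
    then show ?thesis using t1 by blast
  qed
  have c5: "adj t b \<and> side t b \<noteq> d \<and> (\<forall>t'\<in>insert t ?A. adj t' b \<longrightarrow> t' = t)" using wD w tb by blast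
  note I1 = IH[THEN conjunct2] note I2 = I1[THEN conjunct2] note I3 = I2[THEN conjunct2] note I4 = I3[THEN conjunct2]
  note I = IH[THEN conjunct1] I1[THEN conjunct1] I2[THEN conjunct1] I4[THEN conjunct1]
  show ?case
    unfolding lab nds hd last
  proof (intro conjI)
    show "length (L @ [(t, y)]) \<noteq> 1 \<longrightarrow> b \<noteq> ?s1 \<and> (\<exists>t1\<in>insert t ?A. \<exists>tk\<in>insert t ?A. adj t1 ?s1 \<and> side t1 ?s1 \<and>
        (\<forall>t'\<in>insert t ?A. adj t' ?s1 \<longrightarrow> t' = t1) \<and> adj tk b \<and> side tk b \<noteq> d \<and> (\<forall>t'\<in>insert t ?A. adj t' b \<longrightarrow> t' = tk))"
    proof -
      from c4 obtain t1 where t1: "t1 \<in> insert t ?A" "adj t1 ?s1" "side t1 ?s1" "\<forall>t'\<in>insert t ?A. adj t' ?s1 \<longrightarrow> t' = t1"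
        by (elim bexE conjE)
      note * = conjI[OF t1(2) conjI[OF t1(3) conjI[OF t1(4) c5]]]
      have "\<exists>tk\<in>insert t ?A. adj t1 ?s1 \<and> side t1 ?s1 \<and> (\<forall>t'\<in>insert t ?A. adj t' ?s1 \<longrightarrow> t' = t1) \<and>
          adj tk b \<and> side tk b \<noteq> d \<and> (\<forall>t'\<in>insert t ?A. adj t' b \<longrightarrow> t' = tk)"
        by (rule bexI[where x = t], rule *, rule insertI1)
      then have "\<exists>t1\<in>insert t ?A. \<exists>tk\<in>insert t ?A. adj t1 ?s1 \<and> side t1 ?s1 \<and> (\<forall>t'\<in>insert t ?A. adj t' ?s1 \<longrightarrow> t' = t1) \<and>
          adj tk b \<and> side tk b \<noteq> d \<and> (\<forall>t'\<in>insert t ?A. adj t' b \<longrightarrow> t' = tk)"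
        by (rule bexI[where x = t1, OF _ t1(1)])
      from conjI[OF bs(2) this] show ?thesis by (rule impI)
    qed
    show "snd (snd (hd L))" "has_initial ?s1" "?s1 \<in> insert b ?R" "insert b ?R \<subseteq> S" using I wD(5) by simp_all
    show "b \<in> insert b ?R" by simp
    show "length (L @ [(t, y)]) = 1 \<longrightarrow> insert t ?A = {} \<and> b = ?s1" using len by blast
  qed (fact c1 c2 c3)+
qed

text \<open>The start vertex and the filler are not recorded by the search and are chosen after
  switching, so every admissible choice has to work. At \<open>s1\<close> the gap is closed by
  \<open>q\<close> together with the first wing, at \<open>s\<close> by the last wing with or
  without a filler.\<close>

theorem improve_switch:
  assumes L: "apath L" "snd (last L) = (s, False)" and te: "has_terminal s"
  defines "S' \<equiv> (S - fst ` nds L) \<union> labs L" and "s1 \<equiv> fst (snd (hd L))"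
  shows "\<exists>q. start q \<and> NS q = {s1} \<and> (\<forall>y\<in>S'. \<not> adj y q)"
    "start q \<Longrightarrow> NS q = {s1} \<Longrightarrow> \<forall>y\<in>S'. \<not> adj y q \<Longrightarrow> filler s (insert q S') z \<Longrightarrow> improves (insert z (insert q S'))"
    "start q \<Longrightarrow> NS q = {s1} \<Longrightarrow> \<forall>y\<in>S'. \<not> adj y q \<Longrightarrow> \<nexists>z. filler s (insert q S') z \<Longrightarrow> improves (insert q S')"
proof -
  let ?R = "fst ` nds L" and ?A = "labs L"
  note W0 = apath_switch[OF L(1), folded s1_def, unfolded L(2) fst_conv snd_conv]
  note W1 = W0[THEN conjunct2] note W2 = W1[THEN conjunct2] note W3 = W2[THEN conjunct2]
  note W4 = W3[THEN conjunct2] note W5 = W4[THEN conjunct2] note W6 = W5[THEN conjunct2]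
  note W7 = W6[THEN conjunct2] note W8 = W7[THEN conjunct2] note W9 = W8[THEN conjunct2]
  have "length L \<noteq> 1"
  proof
    assume "length L = 1"
    then have "last L = hd L" by (auto simp: length_Suc_conv)
    then show False using W0[THEN conjunct1] L(2) by simp
  qed
  from mp[OF W9 this] obtain t1 tk where t1: "t1 \<in> ?A" "adj t1 s1" "side t1 s1" "\<forall>t\<in>?A. adj t s1 \<longrightarrow> t = t1"
    and tk: "tk \<in> ?A" "adj tk s" "side tk s \<noteq> False" "\<forall>t\<in>?A. adj t s \<longrightarrow> t = tk" and ne: "s \<noteq> s1"
    by (elim conjE bexE)
  have R: "s1 \<in> ?R" "s \<in> ?R" "?R \<subseteq> S" by (fact W2[THEN conjunct1], fact W3[THEN conjunct1], fact W4[THEN conjunct1])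
  have A: "\<exists>a\<in>?R. \<exists>b\<in>?R. wing t a b" if "t \<in> ?A" for t using W5[THEN conjunct1] that by (rule bspec)
  have AA: "\<not> adj t t'" if "t \<in> ?A" "t' \<in> ?A" for t t' using W6[THEN conjunct1] that by blast
  have mid: "covers ?A x" if "r \<in> ?R" "r \<noteq> s1" "r \<noteq> s" "adj v x" "adj r x" for r x
    using W7[THEN conjunct1] that by blast
  have AD: "t \<in> D" "t \<notin> S" if "t \<in> ?A" for t using A[OF that] wingD(1,11) by blast+
  have off: "\<not> adj t r" if "t \<in> ?A" "r \<in> S" "r \<notin> ?R" for t r
    using A[OF that(1)] wing_other that by blast
  have S'D: "S' \<subseteq> D" using S_D AD by (auto simp: S'_def)
  have S'i: "indep S'" unfolding indep_def S'_def using AA off S_not_adj adj_sym by blast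
  have offq: "\<not> adj t q" if "t \<in> ?A" "NS q = {r}" "\<not> adj t r" "r \<in> S" for t q r
  proof -
    from A[OF that(1)] obtain a b where ab: "wing t a b" by blast
    note w = wingD[OF ab] and qD = NS_singleD[OF that(2)]
    have "a \<noteq> r" "b \<noteq> r" using w that by auto
    then show ?thesis using nonadj_off[OF ab] qD(5)[of a] qD(5)[of b] w qD(4) by auto
  qed
  have offS: "\<not> adj y q" if "NS q = {r}" "r \<in> ?R" "y \<in> S - ?R" for y q r
    using NS_singleD(5)[OF that(1), of y] that adj_sym by auto
  obtain a where a: "wing t1 s1 a"
    using A[OF t1(1)] wing_other[OF _ _ t1(2)] R wing_sym by (metis subsetD)
  obtain ak where ak: "wing tk s ak"
    using A[OF tk(1)] wing_other[OF _ _ tk(2)] R wing_sym by (metis subsetD)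
  have "has_initial s1" by (fact W1[THEN conjunct1])
  then have "initial t1 s1" using side_initial[OF a] t1 by blast
  then obtain q0 where q0: "start q0" "NS q0 = {s1}" "\<not> adj q0 t1" by (auto simp: initial_def)
  have "\<not> adj y q0" if "y \<in> S'" for y
  proof (cases "y \<in> ?A")
    case True
    show ?thesis
    proof (cases "adj y s1")
      case True
      then show ?thesis using t1 \<open>y \<in> ?A\<close> q0 adj_sym by blast
    next
      case False
      then show ?thesis using offq[OF True q0(2)] R by auto
    qed
  next
    case False
    then show ?thesis using offS[OF q0(2) R(1)] that by (auto simp: S'_def)
  qed
  then show "\<exists>q. start q \<and> NS q = {s1} \<and> (\<forall>y\<in>S'. \<not> adj y q)" using q0 by blast
  \<comment> \<open>The last even node is \<open>(s, False)\<close>, so the last wing is on the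
    \<open>True\<close> side of \<open>s\<close>, which is the terminal side because
    \<open>has_terminal s\<close>.\<close>
  have tet: "terminal tk s" using tk(3) te by (simp add: side_def)
  assume q: "start q" "NS q = {s1}" "\<forall>y\<in>S'. \<not> adj y q"
  note qD = startD[OF q(1,2)]
  have T: "insert q S' \<subseteq> D" "indep (insert q S')" using S'D S'i q qD unfolding indep_insert by auto
  have cov: "covers (insert q S') x" if x: "adj v x" "covers S x \<or> x = u" "adj s x \<Longrightarrow> covers (insert q S') x" for x
  proof (cases "x = u")
    case True
    then show ?thesis using qD by (auto simp: covers_def)
  next
    case False
    then obtain r where r: "r \<in> S" "adj r x" using x adj_sym by (auto simp: covers_def)
    consider "r \<notin> ?R" | "r = s1" | "r = s" | "r \<in> ?R" "r \<noteq> s1" "r \<noteq> s" by blast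
    then show ?thesis
    proof cases
      case 1
      then show ?thesis using r adj_sym by (auto simp: covers_def S'_def)
    next
      case 2
      have "q \<noteq> t1" using q(1) a kinds_distinct(2) by blast
      moreover have "\<not> adj q t1" using q(3) t1(1) adj_sym by (auto simp: S'_def)
      ultimately have "adj q x \<longleftrightarrow> \<not> adj t1 x"
        using nonadj_trace[of s1 q t1 x] qD wingD[OF a] r 2 x by blast
      then show ?thesis using t1(1) adj_sym by (auto simp: covers_def S'_def)
    next
      case 3
      then show ?thesis using x r by blast
    next
      case 4
      then show ?thesis using mid[of r x] r x by (auto simp: covers_def S'_def)
    qed
  qed
  show "improves (insert z (insert q S'))" if z: "filler s (insert q S') z"
  proof -
    have z': "one z" "NS z = {s}" "\<forall>y\<in>insert q S'. \<not> adj y z" using z by (auto simp: filler_def)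
    note zD = oneD[OF z'(1,2)]
    have "z \<noteq> tk" using z'(1) ak kinds_distinct(1) by blast
    have nz: "\<not> adj tk z" using z'(3) tk(1) by (auto simp: S'_def)
    have "covers (insert z (insert q S')) x" if x: "adj v x" "covers S x \<or> x = u" for x
    proof (cases "adj s x")
      case True
      have "adj tk x \<longleftrightarrow> \<not> adj z x"
        using nonadj_trace[of s tk z x] wingD[OF ak] zD nz \<open>z \<noteq> tk\<close> x True by auto
      then show ?thesis using tk(1) adj_sym by (auto simp: covers_def S'_def)
    next
      case False
      then show ?thesis using cov[OF x] by (auto simp: covers_def)
    qed
    then show ?thesis using T z' zD unfolding improves_def indep_insert[of z] by auto
  qed
  show "improves (insert q S')" if nz: "\<nexists>z. filler s (insert q S') z"
  proof -
    \<comment> \<open>A closing vertex for \<open>tk\<close> would avoid the whole switched set and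
      thus be a filler; so \<open>tk\<close> is terminal by the first alternative.\<close>
    have "\<not> (one z \<and> NS z = {s} \<and> \<not> adj z tk)" for z
    proof
      assume "one z \<and> NS z = {s} \<and> \<not> adj z tk"
      then have z: "one z" "NS z = {s}" "\<not> adj z tk" by auto
      note zD = oneD[OF z(1,2)]
      have "\<not> adj y z" if yS: "y \<in> insert q S'" for y
      proof -
        consider "y = q" | "y \<in> ?A" | "y \<in> S - ?R" using yS unfolding S'_def by blast
        then show ?thesis
        proof cases
          case 1
          have nu: "\<not> adj u s1" "u \<noteq> s1" "u \<noteq> z"
            using qD(4) S_uD(1) zD(1) u_nbr S_D by (auto simp: D_def)
          have "\<not> adj s1 z" "z \<noteq> s1" using zD(7) zD(8)[OF qD(4)] ne qD(4) adj_sym by auto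
          \<comment> \<open>Otherwise \<open>u\<close>, \<open>s1\<close> and \<open>z\<close> are
            the leaves of a claw at \<open>q\<close>.\<close>
          then show ?thesis using 1 claw[OF qD(3,5), of z] nu zD(2) by blast
        next
          case 2
          show ?thesis
          proof (cases "adj y s")
            case True
            then show ?thesis using tk(4) 2 z(3) adj_sym by blast
          next
            case False
            show ?thesis using offq[OF 2 z(2) False zD(4)] .
          qed
        next
          case 3
          show ?thesis using offS[OF z(2) R(2) 3] .
        qed
      qed
      then show False using nz z by (auto simp: filler_def)
    qed
    then have "adj tk x" if "adj v x" "adj s x" for x using tet that by (auto simp: terminal_def)
    then have "covers (insert q S') x" if "adj v x" "adj s x" for x
      using that tk(1) adj_sym by (auto simp: covers_def S'_def)
    then show ?thesis using T cov unfolding improves_def by blast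
  qed
qed

end

section \<open>Programs with arrays\<close>

text \<open>Programs over array variables, compiled to the machine: array \<open>j\<close> at index \<open>i\<close> is the
  memory cell \<open>n * n + 16 * i + j\<close> beyond the adjacency matrix, variable \<open>r\<close> is register
  \<open>r + 2\<close>. A loop runs its counter from 0 to a bound of the form \<open>a * n + b\<close>.\<close>

datatype ex = Cst nat | Var nat | Size | Source | Arr nat ex | Adj ex ex | Add ex ex | Sub ex ex | Mul ex ex

datatype bx = Lt ex ex | Eq ex ex | Not bx | And bx bx

datatype pr = Nop | Set nat ex | Put nat ex ex | Then pr pr (infixr ";;" 60) | If bx pr pr | For nat nat nat pr

text \<open>Interleaving the arrays leaves each of them unbounded, so no lengths have to be
  fixed.\<close>

definition cell :: "nat \<Rightarrow> aexp \<Rightarrow> aexp" where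
  "cell j a = Plus (Plus (Times (Reg 0) (Reg 0)) (Times (Num 16) a)) (Num j)"

primrec cx :: "ex \<Rightarrow> aexp" where
  "cx (Cst k) = Num k"
| "cx (Var r) = Reg (r + 2)"
| "cx Size = Reg 0"
| "cx Source = Reg 1"
| "cx (Arr j e) = Mem (cell j (cx e))"
| "cx (Adj a b) = Mem (Plus (Times (cx a) (Reg 0)) (cx b))"
| "cx (Add a b) = Plus (cx a) (cx b)"
| "cx (Sub a b) = Minus (cx a) (cx b)"
| "cx (Mul a b) = Times (cx a) (cx b)"

primrec cb :: "bx \<Rightarrow> bexp" where
  "cb (Lt a b) = Less (cx a) (cx b)"
| "cb (Eq a b) = Equal (cx a) (cx b)"
| "cb (Not b) = Neg (cb b)"
| "cb (And a b) = Conj (cb a) (cb b)"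

primrec cp :: "pr \<Rightarrow> com" where
  "cp Nop = Skip"
| "cp (Set r e) = Assign (r + 2) (cx e)"
| "cp (Put j i e) = Store (cell j (cx i)) (cx e)"
| "cp (p ;; q) = Seq (cp p) (cp q)"
| "cp (If b p q) = Cond (cb b) (cp p) (cp q)"
| "cp (For r a b p) = Seq (Assign (r + 2) (Num 0))
    (While (Less (Reg (r + 2)) (Plus (Times (Num a) (Reg 0)) (Num b)))
      (Seq (cp p) (Assign (r + 2) (Plus (Reg (r + 2)) (Num 1)))))"

primrec writes :: "pr \<Rightarrow> nat set" where
  "writes Nop = {}"
| "writes (Set r e) = {r}"
| "writes (Put j i e) = {}"
| "writes (p ;; q) = writes p \<union> writes q"
| "writes (If b p q) = writes p \<union> writes q"
| "writes (For r a b p) = insert r (writes p)"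

text \<open>If all registers and cells stay below a common bound, an expression stays below that
  bound raised to its number of leaves.\<close>

primrec leaves :: "aexp \<Rightarrow> nat" where
  "leaves (Num k) = 1"
| "leaves (Reg r) = 1"
| "leaves (Mem a) = leaves a"
| "leaves (Plus a b) = leaves a + leaves b"
| "leaves (Minus a b) = leaves a + leaves b"
| "leaves (Times a b) = leaves a + leaves b"

primrec small_consts :: "aexp \<Rightarrow> bool" where
  "small_consts (Num k) \<longleftrightarrow> k < 20"
| "small_consts (Reg r) \<longleftrightarrow> True"
| "small_consts (Mem a) \<longleftrightarrow> small_consts a"
| "small_consts (Plus a b) \<longleftrightarrow> small_consts a \<and> small_consts b"
| "small_consts (Minus a b) \<longleftrightarrow> small_consts a \<and> small_consts b"
| "small_consts (Times a b) \<longleftrightarrow> small_consts a \<and> small_consts b"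

text \<open>Generous limits that every expression of the program meets. The 30 leaves become the
  exponent in the word size, and the cost limit enters the factor 400 of
  \<open>wp_sound\<close>.\<close>

definition small_aexp :: "aexp \<Rightarrow> bool" where
  "small_aexp a \<longleftrightarrow> leaves a \<le> 30 \<and> small_consts a \<and> acost a \<le> 90"

primrec small_bexp :: "bexp \<Rightarrow> bool" where
  "small_bexp (Less a b) \<longleftrightarrow> small_aexp a \<and> small_aexp b"
| "small_bexp (Equal a b) \<longleftrightarrow> small_aexp a \<and> small_aexp b"
| "small_bexp (Neg b) \<longleftrightarrow> small_bexp b"
| "small_bexp (Conj a b) \<longleftrightarrow> small_bexp a \<and> small_bexp b"

primrec arrays_x :: "ex \<Rightarrow> bool" where
  "arrays_x (Cst k) \<longleftrightarrow> True"
| "arrays_x (Var r) \<longleftrightarrow> True"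
| "arrays_x Size \<longleftrightarrow> True"
| "arrays_x Source \<longleftrightarrow> True"
| "arrays_x (Arr j e) \<longleftrightarrow> j < 16 \<and> arrays_x e"
| "arrays_x (Adj a b) \<longleftrightarrow> arrays_x a \<and> arrays_x b"
| "arrays_x (Add a b) \<longleftrightarrow> arrays_x a \<and> arrays_x b"
| "arrays_x (Sub a b) \<longleftrightarrow> arrays_x a \<and> arrays_x b"
| "arrays_x (Mul a b) \<longleftrightarrow> arrays_x a \<and> arrays_x b"

primrec arrays_b :: "bx \<Rightarrow> bool" where
  "arrays_b (Lt a b) \<longleftrightarrow> arrays_x a \<and> arrays_x b"
| "arrays_b (Eq a b) \<longleftrightarrow> arrays_x a \<and> arrays_x b"
| "arrays_b (Not b) \<longleftrightarrow> arrays_b b"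
| "arrays_b (And a b) \<longleftrightarrow> arrays_b a \<and> arrays_b b"

text \<open>Each limit pays for one part of soundness: array indices for disjoint cells, sizes and
  costs for words and time, loop bounds for counters below \<open>4 * n + 20\<close>, and the
  \<open>writes\<close> condition for counters that the body leaves alone.\<close>

primrec tame :: "pr \<Rightarrow> bool" where
  "tame Nop \<longleftrightarrow> True"
| "tame (Set r e) \<longleftrightarrow> arrays_x e \<and> small_aexp (cx e)"
| "tame (Put j i e) \<longleftrightarrow> j < 16 \<and> arrays_x i \<and> arrays_x e \<and> small_aexp (cell j (cx i)) \<and> small_aexp (cx e)"
| "tame (p ;; q) \<longleftrightarrow> tame p \<and> tame q"
| "tame (If b p q) \<longleftrightarrow> arrays_b b \<and> small_bexp (cb b) \<and> bcost (cb b) \<le> 300 \<and> tame p \<and> tame q"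
| "tame (For r a b p) \<longleftrightarrow> a \<le> 3 \<and> b < 20 \<and> r \<notin> writes p \<and> tame p"

section \<open>Semantics of array programs and soundness of the compilation\<close>

locale ram =
  fixes n v :: nat and adj :: "nat \<Rightarrow> nat \<Rightarrow> bool"
  assumes v_less: "v < n"
begin

text \<open>Large enough for node codes, which are below \<open>2 * n\<close>, for loop counters,
  which reach at most \<open>3 * n + 19\<close>, and for all constants.\<close>

abbreviation lim :: nat where
  "lim \<equiv> 4 * n + 20"

primrec ev :: "ex \<Rightarrow> (nat \<Rightarrow> nat) \<Rightarrow> (nat \<Rightarrow> nat \<Rightarrow> nat) \<Rightarrow> nat" where
  "ev (Cst k) \<rho> \<alpha> = k"
| "ev (Var r) \<rho> \<alpha> = \<rho> r"
| "ev Size \<rho> \<alpha> = n"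
| "ev Source \<rho> \<alpha> = v"
| "ev (Arr j e) \<rho> \<alpha> = \<alpha> j (ev e \<rho> \<alpha>)"
| "ev (Adj a b) \<rho> \<alpha> = of_bool (adj (ev a \<rho> \<alpha>) (ev b \<rho> \<alpha>))"
| "ev (Add a b) \<rho> \<alpha> = ev a \<rho> \<alpha> + ev b \<rho> \<alpha>"
| "ev (Sub a b) \<rho> \<alpha> = ev a \<rho> \<alpha> - ev b \<rho> \<alpha>"
| "ev (Mul a b) \<rho> \<alpha> = ev a \<rho> \<alpha> * ev b \<rho> \<alpha>"

text \<open>Only accesses to the adjacency matrix need a range check: beyond the range, the address
  would denote another entry or an array cell.\<close>

primrec okx :: "ex \<Rightarrow> (nat \<Rightarrow> nat) \<Rightarrow> (nat \<Rightarrow> nat \<Rightarrow> nat) \<Rightarrow> bool" where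
  "okx (Cst k) \<rho> \<alpha> \<longleftrightarrow> True"
| "okx (Var r) \<rho> \<alpha> \<longleftrightarrow> True"
| "okx Size \<rho> \<alpha> \<longleftrightarrow> True"
| "okx Source \<rho> \<alpha> \<longleftrightarrow> True"
| "okx (Arr j e) \<rho> \<alpha> \<longleftrightarrow> okx e \<rho> \<alpha>"
| "okx (Adj a b) \<rho> \<alpha> \<longleftrightarrow> okx a \<rho> \<alpha> \<and> okx b \<rho> \<alpha> \<and> ev a \<rho> \<alpha> < n \<and> ev b \<rho> \<alpha> < n"
| "okx (Add a b) \<rho> \<alpha> \<longleftrightarrow> okx a \<rho> \<alpha> \<and> okx b \<rho> \<alpha>"
| "okx (Sub a b) \<rho> \<alpha> \<longleftrightarrow> okx a \<rho> \<alpha> \<and> okx b \<rho> \<alpha>"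
| "okx (Mul a b) \<rho> \<alpha> \<longleftrightarrow> okx a \<rho> \<alpha> \<and> okx b \<rho> \<alpha>"

primrec bv :: "bx \<Rightarrow> (nat \<Rightarrow> nat) \<Rightarrow> (nat \<Rightarrow> nat \<Rightarrow> nat) \<Rightarrow> bool" where
  "bv (Lt a b) \<rho> \<alpha> \<longleftrightarrow> ev a \<rho> \<alpha> < ev b \<rho> \<alpha>"
| "bv (Eq a b) \<rho> \<alpha> \<longleftrightarrow> ev a \<rho> \<alpha> = ev b \<rho> \<alpha>"
| "bv (Not b) \<rho> \<alpha> \<longleftrightarrow> \<not> bv b \<rho> \<alpha>"
| "bv (And a b) \<rho> \<alpha> \<longleftrightarrow> bv a \<rho> \<alpha> \<and> bv b \<rho> \<alpha>"

primrec okb :: "bx \<Rightarrow> (nat \<Rightarrow> nat) \<Rightarrow> (nat \<Rightarrow> nat \<Rightarrow> nat) \<Rightarrow> bool" where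
  "okb (Lt a b) \<rho> \<alpha> \<longleftrightarrow> okx a \<rho> \<alpha> \<and> okx b \<rho> \<alpha>"
| "okb (Eq a b) \<rho> \<alpha> \<longleftrightarrow> okx a \<rho> \<alpha> \<and> okx b \<rho> \<alpha>"
| "okb (Not b) \<rho> \<alpha> \<longleftrightarrow> okb b \<rho> \<alpha>"
| "okb (And a b) \<rho> \<alpha> \<longleftrightarrow> okb a \<rho> \<alpha> \<and> okb b \<rho> \<alpha>"

text \<open>Weakest preconditions; the last argument counts executed commands and loop iterations.\<close>

primrec wpl :: "nat \<Rightarrow> (((nat \<Rightarrow> nat) \<Rightarrow> (nat \<Rightarrow> nat \<Rightarrow> nat) \<Rightarrow> nat \<Rightarrow> bool) \<Rightarrow> (nat \<Rightarrow> nat) \<Rightarrow> (nat \<Rightarrow> nat \<Rightarrow> nat) \<Rightarrow> nat \<Rightarrow> bool)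
    \<Rightarrow> nat \<Rightarrow> ((nat \<Rightarrow> nat) \<Rightarrow> (nat \<Rightarrow> nat \<Rightarrow> nat) \<Rightarrow> nat \<Rightarrow> bool) \<Rightarrow> nat \<Rightarrow> (nat \<Rightarrow> nat) \<Rightarrow> (nat \<Rightarrow> nat \<Rightarrow> nat) \<Rightarrow> nat \<Rightarrow> bool" where
  "wpl 0 F r Q i \<rho> \<alpha> c = Q (\<rho>(r := i)) \<alpha> (c + 1)"
| "wpl (Suc m) F r Q i \<rho> \<alpha> c = F (wpl m F r Q (Suc i)) (\<rho>(r := i)) \<alpha> (c + 1)"

primrec wp :: "pr \<Rightarrow> ((nat \<Rightarrow> nat) \<Rightarrow> (nat \<Rightarrow> nat \<Rightarrow> nat) \<Rightarrow> nat \<Rightarrow> bool) \<Rightarrow> (nat \<Rightarrow> nat) \<Rightarrow> (nat \<Rightarrow> nat \<Rightarrow> nat) \<Rightarrow> nat \<Rightarrow> bool" where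
  "wp Nop Q \<rho> \<alpha> c = Q \<rho> \<alpha> (c + 1)"
| "wp (Set r e) Q \<rho> \<alpha> c = (okx e \<rho> \<alpha> \<and> ev e \<rho> \<alpha> < lim \<and> Q (\<rho>(r := ev e \<rho> \<alpha>)) \<alpha> (c + 1))"
| "wp (Put j i e) Q \<rho> \<alpha> c = (okx i \<rho> \<alpha> \<and> okx e \<rho> \<alpha> \<and> ev e \<rho> \<alpha> < lim \<and>
    Q \<rho> (\<alpha>(j := (\<alpha> j)(ev i \<rho> \<alpha> := ev e \<rho> \<alpha>))) (c + 1))"
| "wp (p ;; q) Q \<rho> \<alpha> c = wp p (wp q Q) \<rho> \<alpha> c"
| "wp (If b p q) Q \<rho> \<alpha> c = (okb b \<rho> \<alpha> \<and> (if bv b \<rho> \<alpha> then wp p Q \<rho> \<alpha> (c + 1) else wp q Q \<rho> \<alpha> (c + 1)))"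
| "wp (For r a b p) Q \<rho> \<alpha> c = wpl (a * n + b) (wp p) r Q 0 \<rho> \<alpha> c"

text \<open>All values are bounded, even in cells that are never written, so that word sizes can be
  checked without knowing which cells are read.\<close>

definition rel :: "(nat \<Rightarrow> nat) \<Rightarrow> (nat \<Rightarrow> nat \<Rightarrow> nat) \<Rightarrow> state \<Rightarrow> bool" where
  "rel \<rho> \<alpha> \<sigma> \<longleftrightarrow> reg \<sigma> 0 = n \<and> reg \<sigma> 1 = v \<and> (\<forall>r. reg \<sigma> (r + 2) = \<rho> r) \<and>
    (\<forall>j<16. \<forall>i. mem \<sigma> (n * n + 16 * i + j) = \<alpha> j i) \<and>
    (\<forall>a<n. \<forall>b<n. mem \<sigma> (a * n + b) = of_bool (adj a b)) \<and>
    (\<forall>r. \<rho> r < lim) \<and> (\<forall>j i. \<alpha> j i < lim)"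

lemma rel_aval:
  assumes "rel \<rho> \<alpha> \<sigma>" "okx e \<rho> \<alpha>" "arrays_x e"
  shows "aval (cx e) \<sigma> = ev e \<rho> \<alpha>"
  using assms(2,3)
proof (induction e)
  case (Arr j e)
  then have "aval (cx e) \<sigma> = ev e \<rho> \<alpha>" "j < 16" by auto
  then show ?case using assms(1) by (simp add: rel_def cell_def)
qed (use assms(1) in \<open>auto simp: rel_def\<close>)

lemma rel_bval:
  assumes "rel \<rho> \<alpha> \<sigma>" "okb b \<rho> \<alpha>" "arrays_b b"
  shows "bval (cb b) \<sigma> = bv b \<rho> \<alpha>"
  using assms(2,3) by (induction b) (use rel_aval[OF assms(1)] in auto)

lemma rel_bounds:
  assumes "rel \<rho> \<alpha> \<sigma>"
  shows "reg \<sigma> r < lim" "mem \<sigma> p < lim"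
proof -
  have "r = 0 \<or> r = 1 \<or> r = (r - 2) + 2" by arith
  then consider "r = 0" | "r = 1" | r' where "r = r' + 2" by blast
  then show "reg \<sigma> r < lim" by cases (use assms v_less in \<open>auto simp: rel_def\<close>)
  show "mem \<sigma> p < lim"
  proof (cases "p < n * n")
    case True
    then have "p div n < n" "p mod n < n" using v_less by (auto simp: less_mult_imp_div_less)
    then have "mem \<sigma> (p div n * n + p mod n) = of_bool (adj (p div n) (p mod n))" using assms unfolding rel_def by blast
    then show ?thesis by simp
  next
    case False
    let ?k = "p - n * n"
    have "\<forall>j<16. \<forall>i. mem \<sigma> (n * n + 16 * i + j) = \<alpha> j i" using assms unfolding rel_def by (elim conjE)
    then have "mem \<sigma> (n * n + 16 * (?k div 16) + ?k mod 16) = \<alpha> (?k mod 16) (?k div 16)"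
      by (rule allE[of _ "?k mod 16"]) (blast intro: mod_less_divisor[of 16, OF zero_less_numeral])
    moreover have "n * n + 16 * (?k div 16) + ?k mod 16 = p" using False by simp
    ultimately show ?thesis using assms by (simp add: rel_def)
  qed
qed

lemma leaves_pos: "0 < leaves a"
  by (induction a) auto

lemma aval_less_power:
  assumes "\<And>r. reg \<sigma> r < lim" "\<And>p. mem \<sigma> p < lim" "small_consts a"
  shows "aval a \<sigma> < lim ^ leaves a"
  using assms(3)
proof (induction a)
  case (Mem a)
  have "mem \<sigma> (aval a \<sigma>) < lim ^ 1" using assms(2) by simp
  also have "\<dots> \<le> lim ^ leaves a" using leaves_pos[of a] by (intro power_increasing) auto
  finally show ?case by simp
next
  case (Plus a b)
  \<comment> \<open>Both factors are at least 2, so the product of the bounds is at least their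
    sum.\<close>
  have "2 * lim ^ leaves a \<le> lim ^ leaves a * lim ^ leaves b" "2 * lim ^ leaves b \<le> lim ^ leaves a * lim ^ leaves b"
  proof -
    have *: "2 \<le> lim ^ leaves x" for x
      using power_increasing[of 1 "leaves x" lim] leaves_pos[of x] by simp
    show "2 * lim ^ leaves a \<le> lim ^ leaves a * lim ^ leaves b" using mult_le_mono2[OF *[of b], of "lim ^ leaves a"] by (simp add: mult.commute)
    show "2 * lim ^ leaves b \<le> lim ^ leaves a * lim ^ leaves b" using mult_le_mono1[OF *[of a], of "lim ^ leaves b"] by simp
  qed
  moreover have "aval a \<sigma> < lim ^ leaves a" "aval b \<sigma> < lim ^ leaves b" using Plus by auto
  ultimately have "aval a \<sigma> + aval b \<sigma> < lim ^ leaves a * lim ^ leaves b" by linarith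
  then show ?case by (simp add: power_add)
next
  case (Minus a b)
  have "aval a \<sigma> < lim ^ leaves a" using Minus by simp
  also have "\<dots> \<le> lim ^ (leaves a + leaves b)" by (intro power_increasing) auto
  finally show ?case by (simp add: less_imp_diff_less)
next
  case (Times a b)
  then show ?case by (simp add: power_add mult_strict_mono')
qed (use assms in \<open>auto intro: less_le_trans\<close>)

lemma small_afits:
  assumes "\<And>r. reg \<sigma> r < lim" "\<And>p. mem \<sigma> p < lim" "small_consts a" "leaves a \<le> m" "lim ^ m \<le> 2 ^ w"
  shows "afits w a \<sigma>"
proof -
  have le: "x < 2 ^ w" if "x < lim ^ k" "k \<le> m" for x k
  proof -
    have "lim ^ k \<le> lim ^ m" using that by (intro power_increasing) auto
    then show ?thesis using that assms(5) by linarith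
  qed
  show ?thesis
    using assms(3,4)
  proof (induction a)
    case (Num k)
    then show ?case using le[of k 1] by simp
  next
    case (Reg r)
    then show ?case using le[of "reg \<sigma> r" 1] assms(1) by simp
  next
    case (Mem a)
    then show ?case using le[of "mem \<sigma> (aval a \<sigma>)" 1] assms(2) leaves_pos[of a] by simp
  next
    case (Plus a b)
    then show ?case using le[OF aval_less_power[OF assms(1,2), of "Plus a b"]] by simp
  next
    case (Times a b)
    then show ?case using le[OF aval_less_power[OF assms(1,2), of "Times a b"]] by simp
  qed auto
qed

lemma wpl_mono:
  assumes "\<And>Q Q' \<rho> \<alpha> c. F Q \<rho> \<alpha> c \<Longrightarrow> (\<And>\<rho> \<alpha> c. Q \<rho> \<alpha> c \<Longrightarrow> Q' \<rho> \<alpha> c) \<Longrightarrow> F Q' \<rho> \<alpha> c"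
    and "\<And>\<rho> \<alpha> c. Q \<rho> \<alpha> c \<Longrightarrow> Q' \<rho> \<alpha> c"
  shows "wpl m F r Q i \<rho> \<alpha> c \<Longrightarrow> wpl m F r Q' i \<rho> \<alpha> c"
proof (induction m arbitrary: i \<rho> \<alpha> c)
  case (Suc m)
  then show ?case by (auto intro: assms(1))
qed (use assms(2) in auto)

lemma wp_mono: "wp p Q \<rho> \<alpha> c \<Longrightarrow> (\<And>\<rho> \<alpha> c. Q \<rho> \<alpha> c \<Longrightarrow> Q' \<rho> \<alpha> c) \<Longrightarrow> wp p Q' \<rho> \<alpha> c"
proof (induction p arbitrary: Q Q' \<rho> \<alpha> c)
  case (Then p q)
  have "wp p (wp q Q) \<rho> \<alpha> c" using Then.prems by simp
  then show ?case unfolding wp.simps by (rule Then.IH(1)) (rule Then.IH(2), assumption, rule Then.prems(2))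
next
  case (If b p q)
  then show ?case by (auto split: if_splits)
next
  case (For r a b p)
  have "wpl (a * n + b) (wp p) r Q 0 \<rho> \<alpha> c" using For.prems by simp
  then show ?case unfolding wp.simps by (rule wpl_mono[rotated 2]) (rule For.IH, assumption+, rule For.prems(2))
qed auto

lemma wp_For:
  assumes "J 0 \<rho> \<alpha> c"
    and "\<And>i \<rho> \<alpha> c. i < a * n + b \<Longrightarrow> J i \<rho> \<alpha> c \<Longrightarrow> wp p (J (Suc i)) (\<rho>(r := i)) \<alpha> (c + 1)"
    and "\<And>\<rho> \<alpha> c. J (a * n + b) \<rho> \<alpha> c \<Longrightarrow> Q (\<rho>(r := a * n + b)) \<alpha> (c + 1)"
  shows "wp (For r a b p) Q \<rho> \<alpha> c"
proof -
  have "i + m = a * n + b \<Longrightarrow> J i \<rho> \<alpha> c \<Longrightarrow> wpl m (wp p) r Q i \<rho> \<alpha> c" for i m \<rho> \<alpha> c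
  proof (induction m arbitrary: i \<rho> \<alpha> c)
    case 0
    then show ?case using assms(3) by simp
  next
    case (Suc m)
    have "wp p (J (Suc i)) (\<rho>(r := i)) \<alpha> (c + 1)" using assms(2) Suc.prems by simp
    then show ?case unfolding wpl.simps by (rule wp_mono) (use Suc in auto)
  qed
  then show ?thesis using assms(1) by simp
qed

lemma rel_Set:
  assumes "rel \<rho> \<alpha> \<sigma>" "x < lim"
  shows "rel (\<rho>(r := x)) \<alpha> (\<sigma>\<lparr>reg := (reg \<sigma>)(r + 2 := x)\<rparr>)"
  using assms by (auto simp: rel_def)

lemma cell_inj:
  assumes "j < 16" "j' < (16::nat)"
  shows "n * n + 16 * i + j = n * n + 16 * i' + j' \<longleftrightarrow> i = i' \<and> j = j'"
proof -
  have "16 * i + j = 16 * i' + j' \<longleftrightarrow> i = i' \<and> j = j'"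
  proof
    assume "16 * i + j = 16 * i' + j'"
    then have "(16 * i + j) div 16 = (16 * i' + j') div 16" "(16 * i + j) mod 16 = (16 * i' + j') mod 16" by simp_all
    then show "i = i' \<and> j = j'" using assms by simp
  qed simp
  then show ?thesis by (simp only: add.assoc add_left_cancel)
qed

lemma rel_Put:
  assumes "rel \<rho> \<alpha> \<sigma>" "x < lim" "j < 16"
  shows "rel \<rho> (\<alpha>(j := (\<alpha> j)(i := x))) (\<sigma>\<lparr>mem := (mem \<sigma>)(n * n + 16 * i + j := x)\<rparr>)"
proof -
  have "a * n + b < n * n" if "a < n" "b < n" for a b
  proof -
    have "a * n + b < Suc a * n" using that by simp
    also have "\<dots> \<le> n * n" using that by (intro mult_le_mono1) simp
    finally show ?thesis .
  qed
  then have "a * n + b \<noteq> n * n + 16 * i + j" if "a < n" "b < n" for a b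
    using that by fastforce
  then show ?thesis using assms cell_inj[OF _ assms(3)] unfolding rel_def by auto
qed

context
  fixes w :: nat
  assumes w: "lim ^ 30 \<le> 2 ^ w"
begin

lemma rel_afits: "rel \<rho> \<alpha> \<sigma> \<Longrightarrow> small_aexp a \<Longrightarrow> afits w a \<sigma>"
  by (rule small_afits[where m = 30]) (use rel_bounds w in \<open>auto simp: small_aexp_def\<close>)

lemma rel_bfits: "rel \<rho> \<alpha> \<sigma> \<Longrightarrow> small_bexp b \<Longrightarrow> bfits w b \<sigma>"
  by (induction b) (auto simp: rel_afits)

text \<open>The reserve of 2 units pays for the assignment that initialises the counter in front of
  the loop.\<close>

lemma exec_loop:
  assumes r: "r \<notin> writes p" and ab: "a \<le> 3" "b < 20"
    and body: "\<And>\<rho> \<alpha> \<sigma> Q c. rel \<rho> \<alpha> \<sigma> \<Longrightarrow> wp p Q \<rho> \<alpha> c \<Longrightarrow>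
      \<exists>t \<sigma>' \<rho>' \<alpha>' c'. exec w (cp p) \<sigma> t \<sigma>' \<and> rel \<rho>' \<alpha>' \<sigma>' \<and> Q \<rho>' \<alpha>' c' \<and> c \<le> c' \<and> t \<le> 400 * (c' - c) \<and> (\<forall>r. r \<notin> writes p \<longrightarrow> \<rho>' r = \<rho> r)"
  defines "W \<equiv> While (Less (Reg (r + 2)) (Plus (Times (Num a) (Reg 0)) (Num b))) (Seq (cp p) (Assign (r + 2) (Plus (Reg (r + 2)) (Num 1))))"
  shows "i + m = a * n + b \<Longrightarrow> rel (\<rho>(r := i)) \<alpha> \<sigma> \<Longrightarrow> wpl m (wp p) r Q i \<rho> \<alpha> c \<Longrightarrow>
    \<exists>t \<sigma>' \<rho>' \<alpha>' c'. exec w W \<sigma> t \<sigma>' \<and> rel \<rho>' \<alpha>' \<sigma>' \<and> Q \<rho>' \<alpha>' c' \<and> c < c' \<and> t + 2 \<le> 400 * (c' - c) \<and> (\<forall>x. x \<notin> insert r (writes p) \<longrightarrow> \<rho>' x = \<rho> x)"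
proof (induction m arbitrary: i \<rho> \<alpha> \<sigma> c)
  case 0
  let ?b = "Less (Reg (r + 2)) (Plus (Times (Num a) (Reg 0)) (Num b))"
  have "bfits w ?b \<sigma>" using 0(2) ab by (intro rel_bfits) (auto simp: small_aexp_def)
  moreover have "\<not> bval ?b \<sigma>" using 0 by (simp add: rel_def)
  ultimately have ex: "exec w W \<sigma> (bcost ?b + 1) \<sigma>" unfolding W_def by (rule exec.WhileFalse)
  show ?case
  proof (intro exI conjI)
    show "exec w W \<sigma> (bcost ?b + 1) \<sigma>" by fact
    show "rel (\<rho>(r := i)) \<alpha> \<sigma>" by fact
    show "Q (\<rho>(r := i)) \<alpha> (c + 1)" using 0 by simp
  qed auto
next
  case (Suc m)
  let ?b = "Less (Reg (r + 2)) (Plus (Times (Num a) (Reg 0)) (Num b))"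
  have fb: "bfits w ?b \<sigma>" using Suc.prems(2) ab by (intro rel_bfits) (auto simp: small_aexp_def)
  have tb: "bval ?b \<sigma>" using Suc.prems by (simp add: rel_def)
  have "wp p (wpl m (wp p) r Q (Suc i)) (\<rho>(r := i)) \<alpha> (c + 1)" using Suc.prems(3) by simp
  from body[OF Suc.prems(2) this] obtain t \<sigma>' \<rho>' \<alpha>' c' where e: "exec w (cp p) \<sigma> t \<sigma>'" "rel \<rho>' \<alpha>' \<sigma>'"
    "wpl m (wp p) r Q (Suc i) \<rho>' \<alpha>' c'" "c + 1 \<le> c'" "t \<le> 400 * (c' - (c + 1))"
    "\<forall>x. x \<notin> writes p \<longrightarrow> \<rho>' x = (\<rho>(r := i)) x" by blast
  have r': "\<rho>' r = i" using e(6) r by auto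
  have "a * n \<le> 3 * n" using ab by simp
  then have lim: "Suc i < lim" using Suc.prems(1) ab by linarith
  let ?\<sigma> = "\<sigma>'\<lparr>reg := (reg \<sigma>')(r + 2 := Suc i)\<rparr>"
  have av: "aval (Plus (Reg (r + 2)) (Num 1)) \<sigma>' = Suc i" using e(2) r' by (simp add: rel_def)
  have "afits w (Plus (Reg (r + 2)) (Num 1)) \<sigma>'" using e(2) by (rule rel_afits) (simp add: small_aexp_def)
  from exec.Assign[OF this, of "r + 2", unfolded av]
  have as: "exec w (Assign (r + 2) (Plus (Reg (r + 2)) (Num 1))) \<sigma>' 4 ?\<sigma>" by (simp add: eval_nat_numeral)
  have "rel (\<rho>'(r := Suc i)) \<alpha>' ?\<sigma>" using rel_Set[OF e(2) lim] .
  from Suc.IH[OF _ this e(3)] Suc.prems(1) obtain t' \<sigma>'' \<rho>'' \<alpha>'' c'' where f: "exec w W ?\<sigma> t' \<sigma>''" "rel \<rho>'' \<alpha>'' \<sigma>''"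
    "Q \<rho>'' \<alpha>'' c''" "c' < c''" "t' + 2 \<le> 400 * (c'' - c')" "\<forall>x. x \<notin> insert r (writes p) \<longrightarrow> \<rho>'' x = \<rho>' x" by auto
  have "exec w W \<sigma> (bcost ?b + (t + 4) + t' + 1) \<sigma>''"
    unfolding W_def by (rule exec.WhileTrue[OF fb tb exec.Seq[OF e(1) as] f(1)[unfolded W_def]])
  moreover have "bcost ?b + (t + 4) + t' + 1 + 2 \<le> 400 * (c'' - c)" using e(4,5) f(4,5) by simp
  moreover have "c < c''" using e(4) f(4) by simp
  moreover have "\<forall>x. x \<notin> insert r (writes p) \<longrightarrow> \<rho>'' x = \<rho> x" using e(6) f(6) by auto
  ultimately show ?case using f(2,3) by blast
qed

text \<open>Each counted step buys 400 units, more than any single command or loop test can cost.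
  The clause on unwritten variables is what the loop case needs to know about the counter.\<close>

theorem wp_sound:
  "tame p \<Longrightarrow> rel \<rho> \<alpha> \<sigma> \<Longrightarrow> wp p Q \<rho> \<alpha> c \<Longrightarrow>
    \<exists>t \<sigma>' \<rho>' \<alpha>' c'. exec w (cp p) \<sigma> t \<sigma>' \<and> rel \<rho>' \<alpha>' \<sigma>' \<and> Q \<rho>' \<alpha>' c' \<and> c \<le> c' \<and> t \<le> 400 * (c' - c) \<and>
      (\<forall>r. r \<notin> writes p \<longrightarrow> \<rho>' r = \<rho> r)"
proof (induction p arbitrary: \<rho> \<alpha> \<sigma> Q c)
  case Nop
  show ?case
  proof (intro exI conjI)
    show "exec w (cp Nop) \<sigma> 1 \<sigma>" using exec.Skip by simp
    show "rel \<rho> \<alpha> \<sigma>" by fact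
    show "Q \<rho> \<alpha> (c + 1)" using Nop by simp
  qed auto
next
  case (Set r e)
  have av: "aval (cx e) \<sigma> = ev e \<rho> \<alpha>" using Set by (intro rel_aval) auto
  show ?case
  proof (intro exI conjI)
    show "exec w (cp (Set r e)) \<sigma> (acost (cx e) + 1) (\<sigma>\<lparr>reg := (reg \<sigma>)(r + 2 := ev e \<rho> \<alpha>)\<rparr>)"
      using exec.Assign[OF rel_afits[OF Set.prems(2)], of "cx e" "r + 2"] Set.prems(1) av by auto
    show "rel (\<rho>(r := ev e \<rho> \<alpha>)) \<alpha> (\<sigma>\<lparr>reg := (reg \<sigma>)(r + 2 := ev e \<rho> \<alpha>)\<rparr>)"
      using Set by (intro rel_Set) auto
    show "Q (\<rho>(r := ev e \<rho> \<alpha>)) \<alpha> (c + 1)" using Set.prems(3) by simp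
    show "acost (cx e) + 1 \<le> 400 * (c + 1 - c)" using Set.prems(1) by (simp add: small_aexp_def)
  qed auto
next
  case (Put j i e)
  have j: "j < 16" using Put by simp
  have av: "aval (cx e) \<sigma> = ev e \<rho> \<alpha>" "aval (cx i) \<sigma> = ev i \<rho> \<alpha>" using Put by (auto intro!: rel_aval)
  have ad: "aval (cell j (cx i)) \<sigma> = n * n + 16 * ev i \<rho> \<alpha> + j" using Put.prems(2) av by (simp add: cell_def rel_def)
  show ?case
  proof (intro exI conjI)
    show "exec w (cp (Put j i e)) \<sigma> (acost (cell j (cx i)) + acost (cx e) + 1)
        (\<sigma>\<lparr>mem := (mem \<sigma>)(n * n + 16 * ev i \<rho> \<alpha> + j := ev e \<rho> \<alpha>)\<rparr>)"
      using exec.Store[OF rel_afits[OF Put.prems(2)] rel_afits[OF Put.prems(2)], of "cell j (cx i)" "cx e"] Put.prems(1) av ad by auto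
    show "rel \<rho> (\<alpha>(j := (\<alpha> j)(ev i \<rho> \<alpha> := ev e \<rho> \<alpha>))) (\<sigma>\<lparr>mem := (mem \<sigma>)(n * n + 16 * ev i \<rho> \<alpha> + j := ev e \<rho> \<alpha>)\<rparr>)"
      using Put by (intro rel_Put) auto
    show "Q \<rho> (\<alpha>(j := (\<alpha> j)(ev i \<rho> \<alpha> := ev e \<rho> \<alpha>))) (c + 1)" using Put.prems(3) by simp
    show "acost (cell j (cx i)) + acost (cx e) + 1 \<le> 400 * (c + 1 - c)" using Put.prems(1) by (simp add: small_aexp_def)
  qed auto
next
  case (Then p q)
  from Then.IH(1)[OF _ Then.prems(2), of "wp q Q" c] Then.prems(1,3) obtain t \<sigma>' \<rho>' \<alpha>' c' where e: "exec w (cp p) \<sigma> t \<sigma>'" "rel \<rho>' \<alpha>' \<sigma>'"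
    "wp q Q \<rho>' \<alpha>' c'" "c \<le> c'" "t \<le> 400 * (c' - c)" "\<forall>r. r \<notin> writes p \<longrightarrow> \<rho>' r = \<rho> r" by auto
  from Then.IH(2)[OF _ e(2,3)] Then.prems(1) obtain t' \<sigma>'' \<rho>'' \<alpha>'' c'' where f: "exec w (cp q) \<sigma>' t' \<sigma>''" "rel \<rho>'' \<alpha>'' \<sigma>''"
    "Q \<rho>'' \<alpha>'' c''" "c' \<le> c''" "t' \<le> 400 * (c'' - c')" "\<forall>r. r \<notin> writes q \<longrightarrow> \<rho>'' r = \<rho>' r" by auto
  have "exec w (cp (p ;; q)) \<sigma> (t + t') \<sigma>''" using exec.Seq[OF e(1) f(1)] by simp
  moreover have "t + t' \<le> 400 * (c'' - c)" "c \<le> c''" using e(4,5) f(4,5) by simp_all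
  moreover have "\<forall>r. r \<notin> writes (p ;; q) \<longrightarrow> \<rho>'' r = \<rho> r" using e(6) f(6) by auto
  ultimately show ?case using f(2,3) by blast
next
  case (If b p q)
  have fb: "bfits w (cb b) \<sigma>" using If.prems by (intro rel_bfits) auto
  have vb: "bval (cb b) \<sigma> = bv b \<rho> \<alpha>" using If.prems by (intro rel_bval) auto
  have cb: "bcost (cb b) \<le> 300" using If.prems by simp
  show ?case
  proof (cases "bv b \<rho> \<alpha>")
    case True
    then have "wp p Q \<rho> \<alpha> (c + 1)" "tame p" using If.prems by auto
    from If.IH(1)[OF this(2) If.prems(2) this(1)] obtain t \<sigma>' \<rho>' \<alpha>' c' where e: "exec w (cp p) \<sigma> t \<sigma>'" "rel \<rho>' \<alpha>' \<sigma>'"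
      "Q \<rho>' \<alpha>' c'" "c + 1 \<le> c'" "t \<le> 400 * (c' - (c + 1))" "\<forall>r. r \<notin> writes p \<longrightarrow> \<rho>' r = \<rho> r" by blast
    have ex: "exec w (cp (If b p q)) \<sigma> (bcost (cb b) + t + 1) \<sigma>'" using exec.CondTrue[OF fb _ e(1)] vb True by simp
    show ?thesis
    proof (intro exI conjI)
      show "bcost (cb b) + t + 1 \<le> 400 * (c' - c)" "c \<le> c'" using cb e(4,5) by simp_all
    qed (fact ex e(2,3) | use e(6) in auto)+
  next
    case False
    then have "wp q Q \<rho> \<alpha> (c + 1)" "tame q" using If.prems by auto
    from If.IH(2)[OF this(2) If.prems(2) this(1)] obtain t \<sigma>' \<rho>' \<alpha>' c' where e: "exec w (cp q) \<sigma> t \<sigma>'" "rel \<rho>' \<alpha>' \<sigma>'"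
      "Q \<rho>' \<alpha>' c'" "c + 1 \<le> c'" "t \<le> 400 * (c' - (c + 1))" "\<forall>r. r \<notin> writes q \<longrightarrow> \<rho>' r = \<rho> r" by blast
    have ex: "exec w (cp (If b p q)) \<sigma> (bcost (cb b) + t + 1) \<sigma>'" using exec.CondFalse[OF fb _ e(1)] vb False by simp
    show ?thesis
    proof (intro exI conjI)
      show "bcost (cb b) + t + 1 \<le> 400 * (c' - c)" "c \<le> c'" using cb e(4,5) by simp_all
    qed (fact ex e(2,3) | use e(6) in auto)+
  qed
next
  case (For r a b p)
  have tm: "r \<notin> writes p" "a \<le> 3" "b < 20" "tame p" using For.prems by auto
  have "afits w (Num 0) \<sigma>" by simp
  from exec.Assign[OF this, of "r + 2"] have i: "exec w (Assign (r + 2) (Num 0)) \<sigma> 2 (\<sigma>\<lparr>reg := (reg \<sigma>)(r + 2 := 0)\<rparr>)" by (simp add: eval_nat_numeral)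
  have rl: "rel (\<rho>(r := 0)) \<alpha> (\<sigma>\<lparr>reg := (reg \<sigma>)(r + 2 := 0)\<rparr>)" using For.prems(2) by (intro rel_Set) auto
  have wl: "wpl (a * n + b) (wp p) r Q 0 \<rho> \<alpha> c" using For.prems(3) by simp
  have "\<exists>t \<sigma>' \<rho>' \<alpha>' c'. exec w (While (Less (Reg (r + 2)) (Plus (Times (Num a) (Reg 0)) (Num b))) (Seq (cp p) (Assign (r + 2) (Plus (Reg (r + 2)) (Num 1)))))
        (\<sigma>\<lparr>reg := (reg \<sigma>)(r + 2 := 0)\<rparr>) t \<sigma>' \<and> rel \<rho>' \<alpha>' \<sigma>' \<and> Q \<rho>' \<alpha>' c' \<and> c < c' \<and> t + 2 \<le> 400 * (c' - c) \<and>
        (\<forall>x. x \<notin> insert r (writes p) \<longrightarrow> \<rho>' x = \<rho> x)"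
    by (rule exec_loop[OF tm(1-3) _ _ rl wl]) (rule For.IH[OF tm(4)], assumption+, simp)
  then obtain t \<sigma>' \<rho>' \<alpha>' c' where
    e: "exec w (While (Less (Reg (r + 2)) (Plus (Times (Num a) (Reg 0)) (Num b))) (Seq (cp p) (Assign (r + 2) (Plus (Reg (r + 2)) (Num 1)))))
        (\<sigma>\<lparr>reg := (reg \<sigma>)(r + 2 := 0)\<rparr>) t \<sigma>'" "rel \<rho>' \<alpha>' \<sigma>'" "Q \<rho>' \<alpha>' c'" "c < c'" "t + 2 \<le> 400 * (c' - c)"
      "\<forall>x. x \<notin> insert r (writes p) \<longrightarrow> \<rho>' x = \<rho> x" by blast
  show ?case
  proof (intro exI conjI)
    show "exec w (cp (For r a b p)) \<sigma> (2 + t) \<sigma>'" using exec.Seq[OF i e(1)] by simp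
    show "rel \<rho>' \<alpha>' \<sigma>'" "Q \<rho>' \<alpha>' c'" by fact+
    show "c \<le> c'" "2 + t \<le> 400 * (c' - c)" using e(4,5) by simp_all
  qed (use e(6) in auto)
qed

end

text \<open>The bound is relative to an arbitrary starting count, so bounds add under
  sequencing.\<close>

definition tr :: "nat \<Rightarrow> pr \<Rightarrow> (nat \<Rightarrow> nat) \<Rightarrow> (nat \<Rightarrow> nat \<Rightarrow> nat) \<Rightarrow> ((nat \<Rightarrow> nat) \<Rightarrow> (nat \<Rightarrow> nat \<Rightarrow> nat) \<Rightarrow> bool) \<Rightarrow> bool" where
  "tr k p \<rho> \<alpha> Q \<longleftrightarrow> (\<forall>c. wp p (\<lambda>\<rho>' \<alpha>' c'. Q \<rho>' \<alpha>' \<and> c' \<le> c + k) \<rho> \<alpha> c)"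

lemma tr_weaken: "tr k p \<rho> \<alpha> Q \<Longrightarrow> k \<le> k' \<Longrightarrow> (\<And>\<rho> \<alpha>. Q \<rho> \<alpha> \<Longrightarrow> Q' \<rho> \<alpha>) \<Longrightarrow> tr k' p \<rho> \<alpha> Q'"
  unfolding tr_def by (rule allI, erule allE, erule wp_mono) fastforce

lemma tr_Then: "tr k p \<rho> \<alpha> (\<lambda>\<rho> \<alpha>. tr k' q \<rho> \<alpha> Q) \<Longrightarrow> tr (k + k') (p ;; q) \<rho> \<alpha> Q"
  unfolding tr_def wp.simps
proof
  fix c assume *: "\<forall>c. wp p (\<lambda>\<rho>' \<alpha>' c'. (\<forall>c. wp q (\<lambda>\<rho>' \<alpha>' c'. Q \<rho>' \<alpha>' \<and> c' \<le> c + k') \<rho>' \<alpha>' c) \<and> c' \<le> c + k) \<rho> \<alpha> c"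
  show "wp p (wp q (\<lambda>\<rho>' \<alpha>' c'. Q \<rho>' \<alpha>' \<and> c' \<le> c + (k + k'))) \<rho> \<alpha> c"
  proof (rule wp_mono[OF *[rule_format]], elim conjE)
    fix \<rho>' \<alpha>' c' assume q: "\<forall>c. wp q (\<lambda>\<rho>' \<alpha>' c'. Q \<rho>' \<alpha>' \<and> c' \<le> c + k') \<rho>' \<alpha>' c" and "c' \<le> c + k"
    show "wp q (\<lambda>\<rho>' \<alpha>' c'. Q \<rho>' \<alpha>' \<and> c' \<le> c + (k + k')) \<rho>' \<alpha>' c'"
      by (rule wp_mono[OF q[rule_format]]) (use \<open>c' \<le> c + k\<close> in auto)
  qed
qed

lemma tr_wp: "tr k p \<rho> \<alpha> Q \<Longrightarrow> (\<And>\<rho>' \<alpha>' c'. Q \<rho>' \<alpha>' \<Longrightarrow> c' \<le> c + k \<Longrightarrow> R \<rho>' \<alpha>' c') \<Longrightarrow> wp p R \<rho> \<alpha> c"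
  unfolding tr_def by (erule allE, erule wp_mono) blast

lemma tr_For:
  assumes "J 0 \<rho> \<alpha>"
    and "\<And>i \<rho> \<alpha>. i < a * n + b \<Longrightarrow> J i \<rho> \<alpha> \<Longrightarrow> tr k p (\<rho>(r := i)) \<alpha> (J (Suc i))"
    and "\<And>\<rho> \<alpha>. J (a * n + b) \<rho> \<alpha> \<Longrightarrow> Q (\<rho>(r := a * n + b)) \<alpha>"
  shows "tr ((a * n + b) * (k + 1) + 1) (For r a b p) \<rho> \<alpha> Q"
  unfolding tr_def
proof
  fix c
  show "wp (For r a b p) (\<lambda>\<rho>' \<alpha>' c'. Q \<rho>' \<alpha>' \<and> c' \<le> c + ((a * n + b) * (k + 1) + 1)) \<rho> \<alpha> c"
  proof (rule wp_For[where J = "\<lambda>i \<rho> \<alpha> c'. J i \<rho> \<alpha> \<and> c' \<le> c + i * (k + 1)"])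
    fix i \<rho> \<alpha> c' assume "i < a * n + b" "J i \<rho> \<alpha> \<and> c' \<le> c + i * (k + 1)"
    then show "wp p (\<lambda>\<rho> \<alpha> c'. J (Suc i) \<rho> \<alpha> \<and> c' \<le> c + Suc i * (k + 1)) (\<rho>(r := i)) \<alpha> (c' + 1)"
      by (intro tr_wp[OF assms(2)]) auto
  qed (use assms(1,3) in auto)
qed

text \<open>Loop-free code is evaluated by rewriting with the equations of \<open>wp\<close>.\<close>

lemma tr_straight: "(\<And>c. wp p (\<lambda>\<rho>' \<alpha>' c'. Q \<rho>' \<alpha>' \<and> c' \<le> c + k) \<rho> \<alpha> c) \<Longrightarrow> tr k p \<rho> \<alpha> Q"
  by (simp add: tr_def)

end

section \<open>Preparing a phase\<close>

context ram begin

lemma tr_Then': "tr k p \<rho> \<alpha> (\<lambda>\<rho> \<alpha>. tr k' q \<rho> \<alpha> Q) \<Longrightarrow> k + k' \<le> K \<Longrightarrow> tr K (p ;; q) \<rho> \<alpha> Q"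
  by (rule tr_weaken[OF tr_Then])

lemma tr_Seq:
  assumes "tr k p \<rho> \<alpha> M" "\<And>\<rho>' \<alpha>'. M \<rho>' \<alpha>' \<Longrightarrow> tr k' q \<rho>' \<alpha>' Q" "k + k' \<le> K"
  shows "tr K (p ;; q) \<rho> \<alpha> Q"
  by (rule tr_Then'[OF tr_weaken[OF assms(1) order_refl assms(2)] assms(3)])

lemma tr_For':
  assumes "J 0 \<rho> \<alpha>"
    and "\<And>i \<rho> \<alpha>. i < a * n + b \<Longrightarrow> J i \<rho> \<alpha> \<Longrightarrow> tr k p (\<rho>(r := i)) \<alpha> (J (Suc i))"
    and "\<And>\<rho> \<alpha>. J (a * n + b) \<rho> \<alpha> \<Longrightarrow> Q (\<rho>(r := a * n + b)) \<alpha>"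
    and "(a * n + b) * (k + 1) + 1 \<le> K"
  shows "tr K (For r a b p) \<rho> \<alpha> Q"
  by (rule tr_weaken[OF tr_For[where J = J and Q = Q, OF assms(1,2)] assms(4)]) (use assms(3) in auto)

text \<open>The double loop over vertices and their two ends, as a single loop over the end index.\<close>

lemma tr_pairs:
  assumes frame: "\<And>m \<rho> \<rho>' \<alpha>. I m \<rho> \<alpha> \<Longrightarrow> \<forall>r<10. \<rho>' r = \<rho> r \<Longrightarrow> I m \<rho>' \<alpha>"
    and init: "I 0 \<rho> \<alpha>"
    and body: "\<And>t i \<rho> \<alpha>. t < n \<Longrightarrow> i < 2 \<Longrightarrow> \<rho> 10 = t \<Longrightarrow> \<rho> 11 = i \<Longrightarrow> I (2 * t + i) \<rho> \<alpha> \<Longrightarrow>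
      tr k p \<rho> \<alpha> (\<lambda>\<rho>' \<alpha>'. \<rho>' 10 = t \<and> I (Suc (2 * t + i)) \<rho>' \<alpha>')"
    and final: "\<And>\<rho> \<alpha>. I (2 * n) \<rho> \<alpha> \<Longrightarrow> Q \<rho> \<alpha>"
  shows "tr (n * (2 * k + 4) + 1) (For 10 1 0 (For 11 0 2 p)) \<rho> \<alpha> Q"
proof (rule tr_For'[where k = "2 * k + 3" and J = "\<lambda>t. I (2 * t)"], goal_cases)
  case (2 t \<rho>1 \<alpha>1)
  show ?case
  proof (rule tr_For'[where k = k and J = "\<lambda>i \<rho>' \<alpha>'. \<rho>' 10 = t \<and> I (2 * t + i) \<rho>' \<alpha>'"], goal_cases)
    case 1
    then show ?case using frame[OF 2(2)] by simp
  next
    case (2 i \<rho>2 \<alpha>2)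
    then show ?case using body[of t i "\<rho>2(11 := i)" \<alpha>2] frame[of "2 * t + i" \<rho>2 \<alpha>2] \<open>t < 1 * n + 0\<close> by simp
  next
    case (3 \<rho>2 \<alpha>2)
    then show ?case using frame[of "2 * t + 2" \<rho>2 \<alpha>2] by simp
  qed simp
next
  case (3 \<rho>1 \<alpha>1)
  then show ?case using frame[of "2 * n" \<rho>1 \<alpha>1] final by simp
qed (use init in auto)

definition Any :: "nat \<Rightarrow> nat \<Rightarrow> bx \<Rightarrow> pr" where
  "Any f i b = Set f (Cst 0) ;; For i 1 0 (If b (Set f (Cst 1)) Nop)"

text \<open>The condition is evaluated while the flag changes, hence the assumptions for every value
  \<open>x\<close> of the flag.\<close>

lemma tr_Any:
  assumes "f \<noteq> i"
    and "\<And>x y. y < n \<Longrightarrow> okb b (\<rho>(f := x, i := y)) \<alpha>"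
    and "\<And>x y. y < n \<Longrightarrow> bv b (\<rho>(f := x, i := y)) \<alpha> \<longleftrightarrow> B y"
    and "Q (\<rho>(f := of_bool (\<exists>y<n. B y), i := n)) \<alpha>"
  shows "tr (3 * n + 2) (Any f i b) \<rho> \<alpha> Q"
  unfolding Any_def
proof (rule tr_Then'[where k = 1 and k' = "3 * n + 1"])
  let ?J = "\<lambda>k \<rho>' \<alpha>'. \<alpha>' = \<alpha> \<and> (\<forall>r. r \<noteq> i \<longrightarrow> \<rho>' r = (\<rho>(f := of_bool (\<exists>y<k. B y))) r)"
  have "tr (3 * n + 1) (For i 1 0 (If b (Set f (Cst 1)) Nop)) (\<rho>(f := 0)) \<alpha> Q"
  proof (rule tr_For'[where J = ?J and k = 2])
    fix k \<rho>' \<alpha>' assume k: "k < 1 * n + 0" and J: "?J k \<rho>' \<alpha>'"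
    then have eq: "\<rho>'(i := k) = \<rho>(f := of_bool (\<exists>y<k. B y), i := k)" "\<alpha>' = \<alpha>"
      using assms(1) by (auto simp only: fun_eq_iff fun_upd_apply split: if_split)
    show "tr 2 (If b (Set f (Cst 1)) Nop) (\<rho>'(i := k)) \<alpha>' (?J (Suc k))"
      unfolding eq using assms(1,2,3) k
      by (intro tr_straight) (auto simp: less_Suc_eq)
  next
    fix \<rho>' \<alpha>' assume "?J (1 * n + 0) \<rho>' \<alpha>'"
    then have "\<rho>'(i := 1 * n + 0) = \<rho>(f := of_bool (\<exists>y<n. B y), i := n)" "\<alpha>' = \<alpha>"
      using assms(1) by (auto simp only: fun_eq_iff fun_upd_apply mult_1 add_0_right split: if_split)
    then show "Q (\<rho>'(i := 1 * n + 0)) \<alpha>'" using assms(4) by simp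
  qed auto
  then show "tr 1 (Set f (Cst 0)) \<rho> \<alpha> (\<lambda>\<rho> \<alpha>. tr (3 * n + 1) (For i 1 0 (If b (Set f (Cst 1)) Nop)) \<rho> \<alpha> Q)"
    by (intro tr_straight) simp
qed simp

text \<open>Memory layout. Array 0 is the current cover \<open>S\<close>, 1 the kind of a vertex, 2 holds at \<open>2 * t + i\<close> the
  \<open>i\<close>-th neighbour of \<open>t\<close> in \<open>S\<close>, and 3 and 4 tell there whether \<open>t\<close> is terminal or initial at it; 5 and 6 are
  \<open>has_terminal\<close> and \<open>has_initial\<close>, 7 the representatives, 8 the node codes of the ends of a wing.
  In the search 9 marks the even nodes, row \<open>k\<close> of 10 is the set of vertices and labels on the path to node \<open>k\<close>,
  11 the first vertex of that path, 12 the merged edges. Variable 0 is set once the search has failed,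
  variable 1 is \<open>u\<close>, all others are temporary.\<close>

definition count_step :: pr where
  "count_step = If (And (Eq (Arr 0 (Var 12)) (Cst 1)) (Eq (Adj (Var 12) (Var 10)) (Cst 1)))
    (If (Lt (Var 11) (Cst 2)) (Put 2 (Add (Mul (Cst 2) (Var 10)) (Var 11)) (Var 12)) Nop ;;
      Set 11 (Add (Var 11) (Cst 1))) Nop"

definition count_prog :: pr where
  "count_prog = Set 11 (Cst 0) ;; For 12 1 0 count_step"

text \<open>Kind 1 is \<open>one\<close>, 2 is \<open>two\<close>, 3 is \<open>start\<close>, 4 a
  neighbour of \<open>u\<close> in \<open>D\<close> without neighbours in \<open>S\<close>; kind 0
  plays no part in a path.\<close>

definition classify_prog :: pr where
  "classify_prog =
    If (Eq (Var 10) Source) (Put 1 (Var 10) (Cst 0))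
    (If (Eq (Adj Source (Var 10)) (Cst 1)) (Put 1 (Var 10) (Cst 0))
    (If (Eq (Adj (Var 1) (Var 10)) (Cst 1))
      (If (Eq (Var 11) (Cst 0)) (Put 1 (Var 10) (Cst 4)) (If (Eq (Var 11) (Cst 1)) (Put 1 (Var 10) (Cst 3)) (Put 1 (Var 10) (Cst 0))))
      (If (Eq (Var 11) (Cst 1)) (Put 1 (Var 10) (Cst 1)) (If (Eq (Var 11) (Cst 2)) (Put 1 (Var 10) (Cst 2)) (Put 1 (Var 10) (Cst 0))))))"

definition kinds_prog :: pr where
  "kinds_prog = For 10 1 0 (count_prog ;; classify_prog)"

text \<open>The flags are computed at both stored ends of every vertex; entries without meaning are
  still legal vertices and are ignored through the kind.\<close>

definition flag_prog :: pr where
  "flag_prog =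
    Set 12 (Arr 2 (Add (Mul (Cst 2) (Var 10)) (Var 11))) ;;
    Any 13 14 (And (And (Eq (Adj Source (Var 14)) (Cst 1)) (Eq (Adj (Var 12) (Var 14)) (Cst 1))) (Eq (Adj (Var 10) (Var 14)) (Cst 0))) ;;
    Any 15 14 (And (And (Eq (Arr 1 (Var 14)) (Cst 1)) (Eq (Arr 2 (Mul (Cst 2) (Var 14))) (Var 12))) (Eq (Adj (Var 14) (Var 10)) (Cst 0))) ;;
    If (And (Eq (Var 13) (Cst 1)) (Eq (Var 15) (Cst 0)))
      (Put 3 (Add (Mul (Cst 2) (Var 10)) (Var 11)) (Cst 0)) (Put 3 (Add (Mul (Cst 2) (Var 10)) (Var 11)) (Cst 1)) ;;
    Any 15 14 (And (And (Eq (Arr 1 (Var 14)) (Cst 3)) (Eq (Arr 2 (Mul (Cst 2) (Var 14))) (Var 12))) (Eq (Adj (Var 14) (Var 10)) (Cst 0))) ;;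
    Put 4 (Add (Mul (Cst 2) (Var 10)) (Var 11)) (Var 15)"

definition flags_prog :: pr where
  "flags_prog = For 10 1 0 (For 11 0 2 flag_prog)"

text \<open>The nested negations express a disjunction: \<open>s\<close> may be stored as the first
  or as the second end of the wing.\<close>

definition has_step :: "nat \<Rightarrow> nat \<Rightarrow> pr" where
  "has_step j k =
    Any 13 14 (And (Eq (Arr 1 (Var 14)) (Cst 2)) (Not (And
      (Not (And (Eq (Arr 2 (Mul (Cst 2) (Var 14))) (Var 10)) (Eq (Arr j (Mul (Cst 2) (Var 14))) (Cst 1))))
      (Not (And (Eq (Arr 2 (Add (Mul (Cst 2) (Var 14)) (Cst 1))) (Var 10)) (Eq (Arr j (Add (Mul (Cst 2) (Var 14)) (Cst 1))) (Cst 1))))))) ;;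
    Put k (Var 10) (Var 13)"

text \<open>Initialising the representative by 0 is harmless: it is used only if some candidate exists.\<close>

definition rep_prog :: pr where
  "rep_prog = Set 13 (Cst 0) ;;
    For 14 1 0 (If (And (Eq (Adj Source (Var 14)) (Cst 1)) (Eq (Adj (Var 10) (Var 14)) (Cst 1))) (Set 13 (Var 14)) Nop) ;;
    Put 7 (Var 10) (Var 13)"

definition has_prog :: pr where
  "has_prog = For 10 1 0 (has_step 3 5 ;; has_step 4 6 ;; rep_prog)"

definition node_prog :: pr where
  "node_prog =
    Set 12 (Arr 2 (Add (Mul (Cst 2) (Var 10)) (Var 11))) ;;
    If (Eq (Arr 5 (Var 12)) (Cst 1)) (Set 13 (Arr 3 (Add (Mul (Cst 2) (Var 10)) (Var 11))))
      (If (Eq (Arr 6 (Var 12)) (Cst 1)) (Set 13 (Arr 4 (Add (Mul (Cst 2) (Var 10)) (Var 11))))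
        (Set 13 (Adj (Var 10) (Arr 7 (Var 12))))) ;;
    Put 8 (Add (Mul (Cst 2) (Var 10)) (Var 11)) (Add (Mul (Cst 2) (Var 12)) (Var 13))"

definition nodes_prog :: pr where
  "nodes_prog = For 10 1 0 (For 11 0 2 node_prog)"

end

section \<open>Correctness of the preparation\<close>

locale phase_ram = ram n v adj + partial_cover "{..<n}" adj v S u
  for n v :: nat and adj :: "nat \<Rightarrow> nat \<Rightarrow> bool" and S :: "nat set" and u :: nat
begin

lemma adj_less: "adj x y \<Longrightarrow> x < n" "adj x y \<Longrightarrow> y < n"
  using adj_V adj_sym by (simp, metis lessThan_iff)

lemma u_less: "u < n"
  using u_nbr adj_less by blast

lemma D_less: "t \<in> D \<Longrightarrow> t < n"
  by (simp add: D_def)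

lemma S_less: "s \<in> S \<Longrightarrow> s < n"
  using S_D D_less by blast

definition kind :: "nat \<Rightarrow> nat" where
  "kind t = (if t \<notin> D then 0 else if adj u t then (if card (NS t) = 0 then 4 else if card (NS t) = 1 then 3 else 0)
    else (if card (NS t) = 1 then 1 else if card (NS t) = 2 then 2 else 0))"

lemma kind_iff: "kind t = 2 \<longleftrightarrow> two t" "kind t = 1 \<longleftrightarrow> one t" "kind t = 3 \<longleftrightarrow> start t"
  "kind t = 4 \<longleftrightarrow> t \<in> D \<and> adj u t \<and> NS t = {}"
  using finite_NS by (auto simp: kind_def two_def one_def start_def)

text \<open>The bound on array 2 includes stale entries, so that they can always be used as vertices
  in matrix accesses.\<close>

definition st0 :: "(nat \<Rightarrow> nat) \<Rightarrow> (nat \<Rightarrow> nat \<Rightarrow> nat) \<Rightarrow> bool" where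
  "st0 \<rho> \<alpha> \<longleftrightarrow> \<rho> 0 = 0 \<and> \<rho> 1 = u \<and> (\<forall>y. \<alpha> 0 y = of_bool (y \<in> S)) \<and> (\<forall>i. \<alpha> 2 i < n)"

definition ends :: "(nat \<Rightarrow> nat) \<Rightarrow> nat \<Rightarrow> bool" where
  "ends e t \<longleftrightarrow> (card (NS t) = 1 \<longrightarrow> NS t = {e (2 * t)}) \<and>
    (card (NS t) = 2 \<longrightarrow> NS t = {e (2 * t), e (2 * t + 1)} \<and> e (2 * t) \<noteq> e (2 * t + 1))"

definition st1 :: "(nat \<Rightarrow> nat \<Rightarrow> nat) \<Rightarrow> bool" where
  "st1 \<alpha> \<longleftrightarrow> (\<forall>t<n. \<alpha> 1 t = kind t \<and> ends (\<alpha> 2) t)"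

text \<open>Variables from 10 on are temporaries of the preparation.\<close>

definition frame :: "nat set \<Rightarrow> (nat \<Rightarrow> nat) \<Rightarrow> (nat \<Rightarrow> nat \<Rightarrow> nat) \<Rightarrow> (nat \<Rightarrow> nat) \<Rightarrow> (nat \<Rightarrow> nat \<Rightarrow> nat) \<Rightarrow> bool" where
  "frame A \<rho> \<alpha> \<rho>' \<alpha>' \<longleftrightarrow> (\<forall>r<10. \<rho>' r = \<rho> r) \<and> (\<forall>j. j \<notin> A \<longrightarrow> \<alpha>' j = \<alpha> j)"

lemma count_step_spec:
  assumes t: "t < n" "\<rho> 10 = t" and i: "i < n" "\<rho> 12 = i" and S: "\<And>y. \<alpha> 0 y = of_bool (y \<in> S)"
    and c: "\<rho> 11 = card {s \<in> S. s < i \<and> adj s t}"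
  shows "tr 4 count_step \<rho> \<alpha> (\<lambda>\<rho>' \<alpha>'.
    \<rho>' = \<rho>(11 := card {s \<in> S. s < Suc i \<and> adj s t}) \<and>
    \<alpha>' = (if i \<in> S \<and> adj i t \<and> \<rho> 11 < 2 then \<alpha>(2 := (\<alpha> 2)(2 * t + \<rho> 11 := i)) else \<alpha>))"
proof -
  have eq: "{s \<in> S. s < Suc i \<and> adj s t} = (if i \<in> S \<and> adj i t then insert i {s \<in> S. s < i \<and> adj s t} else {s \<in> S. s < i \<and> adj s t})"
    by (auto simp: less_Suc_eq)
  have fin: "finite {s \<in> S. s < i \<and> adj s t}" using finite_S by simp
  have "{s \<in> S. s < i \<and> adj s t} \<subseteq> {..<i}" by auto
  then have "card {s \<in> S. s < i \<and> adj s t} \<le> i" using card_mono[of "{..<i}"] by simp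
  then have le: "\<rho> 11 < n" using c i by simp
  have C: "card {s \<in> S. s < Suc i \<and> adj s t} = (if i \<in> S \<and> adj i t then Suc (\<rho> 11) else \<rho> 11)"
    unfolding eq c using fin by simp
  show ?thesis
    unfolding C count_step_def using t i S le by (intro tr_straight) (auto simp: fun_eq_iff)
qed

lemma count_spec:
  assumes t: "t < n" "\<rho> 10 = t" and S: "\<And>y. \<alpha> 0 y = of_bool (y \<in> S)" and e: "\<And>i. \<alpha> 2 i < n"
  shows "tr (5 * n + 2) count_prog \<rho> \<alpha> (\<lambda>\<rho>' \<alpha>'. (\<forall>r. r \<notin> {11, 12} \<longrightarrow> \<rho>' r = \<rho> r) \<and> \<rho>' 11 = card (NS t) \<and>
    (\<forall>j. j \<noteq> 2 \<longrightarrow> \<alpha>' j = \<alpha> j) \<and> (\<forall>i. \<alpha>' 2 i < n) \<and> (\<forall>j<2 * t. \<alpha>' 2 j = \<alpha> 2 j) \<and> ends (\<alpha>' 2) t)"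
  unfolding count_prog_def
proof (rule tr_Seq[where k = 1 and k' = "5 * n + 1" and M = "\<lambda>\<rho>' \<alpha>'. \<rho>' = \<rho>(11 := 0) \<and> \<alpha>' = \<alpha>"], goal_cases)
  case 1
  show ?case by (intro tr_straight) simp
next
  case (2 \<rho>1 \<alpha>1)
  define X where "X i = {s \<in> S. s < i \<and> adj s t}" for i
  let ?J = "\<lambda>i \<rho>' \<alpha>'. (\<forall>r. r \<notin> {11, 12} \<longrightarrow> \<rho>' r = \<rho> r) \<and> \<rho>' 11 = card (X i) \<and> (\<forall>j. j \<noteq> 2 \<longrightarrow> \<alpha>' j = \<alpha> j) \<and>
    (\<forall>j. \<alpha>' 2 j < n) \<and> (\<forall>j<2 * t. \<alpha>' 2 j = \<alpha> 2 j) \<and> (card (X i) = 1 \<longrightarrow> X i = {\<alpha>' 2 (2 * t)}) \<and>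
    (card (X i) = 2 \<longrightarrow> X i = {\<alpha>' 2 (2 * t), \<alpha>' 2 (2 * t + 1)} \<and> \<alpha>' 2 (2 * t) \<noteq> \<alpha>' 2 (2 * t + 1))"
  have X0: "X 0 = {}" by (simp add: X_def)
  have NSX: "X n = NS t" using S_less by (auto simp: NS_def X_def)
  show ?case
  proof (rule tr_For'[where k = 4 and J = ?J], goal_cases)
    case 1
    show ?case using 2 e X0 by simp
  next
    case (2 i \<rho>' \<alpha>')
    then have i: "i < n" and J: "?J i \<rho>' \<alpha>'" by simp_all
    have Si: "\<alpha>' 0 y = of_bool (y \<in> S)" for y using J S by simp
    have fin: "finite (X i)" using finite_S by (simp add: X_def)
    have X: "X (Suc i) = (if i \<in> S \<and> adj i t then insert i (X i) else X i)" by (auto simp: less_Suc_eq X_def)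
    have niX: "i \<notin> X i" by (simp add: X_def)
    have zX: "card (X i) = 0 \<Longrightarrow> X i = {}" using fin by simp
    note J' = J[THEN conjunct1] J[THEN conjunct2, THEN conjunct1] J[THEN conjunct2, THEN conjunct2, THEN conjunct1]
    show ?case
    proof (rule tr_weaken[OF count_step_spec[of t "\<rho>'(12 := i)" i \<alpha>']], goal_cases)
      case (8 \<rho>2 \<alpha>2)
      then have r2: "\<rho>2 = \<rho>'(12 := i, 11 := card (X (Suc i)))"
        and a2: "\<alpha>2 = (if i \<in> S \<and> adj i t \<and> card (X i) < 2 then \<alpha>'(2 := (\<alpha>' 2)(2 * t + card (X i) := i)) else \<alpha>')"
        using J'(2) by (simp_all add: X_def)
      show ?case
      proof (cases "i \<in> S \<and> adj i t")
        case False
        then have "X (Suc i) = X i" "\<alpha>2 = \<alpha>'" using X a2 by auto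
        then show ?thesis using J r2 by simp
      next
        case True
        then have X': "X (Suc i) = insert i (X i)" "card (X (Suc i)) = Suc (card (X i))" using X fin niX by auto
        consider "card (X i) = 0" | "card (X i) = 1" | "2 \<le> card (X i)" by linarith
        then show ?thesis
        proof cases
          case 1
          then have "\<alpha>2 = \<alpha>'(2 := (\<alpha>' 2)(2 * t := i))" using a2 True by simp
          then show ?thesis using J r2 X' zX[OF 1] 1 i by simp
        next
          case 2
          then have Xi: "X i = {\<alpha>' 2 (2 * t)}" using J by simp
          then have "\<alpha>' 2 (2 * t) \<noteq> i" using niX by simp
          moreover have "\<alpha>2 = \<alpha>'(2 := (\<alpha>' 2)(2 * t + 1 := i))" using a2 True 2 by simp
          ultimately show ?thesis using J r2 X' Xi 2 i by (simp add: insert_commute)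
        next
          case 3
          then have "\<alpha>2 = \<alpha>'" using a2 by simp
          then show ?thesis using J r2 X' 3 by simp
        qed
      qed
    qed (use J i t Si in \<open>simp_all add: X_def\<close>)
  next
    case (3 \<rho>' \<alpha>')
    then show ?case using NSX by (simp add: ends_def)
  qed simp
qed simp

lemma kinds_spec:
  assumes "st0 \<rho> \<alpha>"
  shows "tr (n * (5 * n + 10) + 1) kinds_prog \<rho> \<alpha> (\<lambda>\<rho>' \<alpha>'. frame {1, 2} \<rho> \<alpha> \<rho>' \<alpha>' \<and> st0 \<rho>' \<alpha>' \<and> st1 \<alpha>')"
  unfolding kinds_prog_def
proof (rule tr_For'[where k = "5 * n + 9" and J = "\<lambda>i \<rho>' \<alpha>'. frame {1, 2} \<rho> \<alpha> \<rho>' \<alpha>' \<and> st0 \<rho>' \<alpha>' \<and>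
    (\<forall>t<i. \<alpha>' 1 t = kind t \<and> ends (\<alpha>' 2) t)"], goal_cases)
  case (2 t \<rho>1 \<alpha>1)
  then have t: "t < n" and fr: "frame {1, 2} \<rho> \<alpha> \<rho>1 \<alpha>1" and s0: "st0 \<rho>1 \<alpha>1"
    and old: "\<And>x. x < t \<Longrightarrow> \<alpha>1 1 x = kind x" "\<And>x. x < t \<Longrightarrow> ends (\<alpha>1 2) x" by auto
  show ?case
  proof (rule tr_Seq[OF count_spec[of t "\<rho>1(10 := t)" \<alpha>1], where k' = 6], goal_cases)
    case (5 \<rho>2 \<alpha>2)
    have en: "ends (\<alpha>2 2) x" if "x < t" for x
    proof -
      have "\<alpha>2 2 (2 * x) = \<alpha>1 2 (2 * x)" "\<alpha>2 2 (2 * x + 1) = \<alpha>1 2 (2 * x + 1)" using 5 that by auto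
      then show ?thesis using old(2)[OF that] by (simp add: ends_def)
    qed
    have r: "\<rho>2 10 = t" "\<rho>2 11 = card (NS t)" "\<rho>2 1 = u" and k1: "\<alpha>2 1 = \<alpha>1 1" using 5 s0 by (auto simp: st0_def)
    have "tr 6 classify_prog \<rho>2 \<alpha>2 (\<lambda>\<rho>' \<alpha>'. \<rho>' = \<rho>2 \<and> \<alpha>' = \<alpha>2(1 := (\<alpha>2 1)(t := kind t)))"
      unfolding classify_prog_def using t r u_less v_less
      by (intro tr_straight) (auto simp: kind_def D_def)
    then show ?case
    proof (rule tr_weaken, goal_cases)
      case (2 \<rho>3 \<alpha>3)
      then show ?case using 5 en fr s0 old(1) by (auto simp: frame_def st0_def less_Suc_eq k1)
    qed simp
  qed (use t s0 in \<open>auto simp: st0_def\<close>)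
qed (use assms in \<open>auto simp: frame_def st0_def st1_def\<close>)

lemma one_end: "st1 \<alpha> \<Longrightarrow> z < n \<Longrightarrow> one z \<and> NS z = {s} \<longleftrightarrow> \<alpha> 1 z = 1 \<and> \<alpha> 2 (2 * z) = s"
  using kind_iff(2) by (auto simp: st1_def ends_def one_def)

lemma start_end: "st1 \<alpha> \<Longrightarrow> z < n \<Longrightarrow> start z \<and> NS z = {s} \<longleftrightarrow> \<alpha> 1 z = 3 \<and> \<alpha> 2 (2 * z) = s"
  using kind_iff(3) by (auto simp: st1_def ends_def start_def)

lemma two_end: "st1 \<alpha> \<Longrightarrow> t < n \<Longrightarrow> two t \<longleftrightarrow> \<alpha> 1 t = 2"
  using kind_iff(1) by (auto simp: st1_def)

lemma two_wing_end: "st1 \<alpha> \<Longrightarrow> t < n \<Longrightarrow> \<alpha> 1 t = 2 \<Longrightarrow> wing t (\<alpha> 2 (2 * t)) (\<alpha> 2 (2 * t + 1))"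
  using kind_iff(1) unfolding st1_def ends_def wing_def two_def by metis

lemma wing_end: "st1 \<alpha> \<Longrightarrow> t < n \<Longrightarrow> (\<exists>a. wing t s a) \<longleftrightarrow> \<alpha> 1 t = 2 \<and> (\<alpha> 2 (2 * t) = s \<or> \<alpha> 2 (2 * t + 1) = s)"
  using two_wing_end[of \<alpha> t] two_end[of \<alpha> t] wing_sym by (auto simp: wing_def doubleton_eq_iff)

lemma terminal_iff:
  assumes "st1 \<alpha>"
  shows "terminal t s \<longleftrightarrow> \<not> ((\<exists>x<n. adj v x \<and> adj s x \<and> \<not> adj t x) \<and> \<not> (\<exists>z<n. \<alpha> 1 z = 1 \<and> \<alpha> 2 (2 * z) = s \<and> \<not> adj z t))"
proof -
  have "(\<exists>z. one z \<and> NS z = {s} \<and> \<not> adj z t) \<longleftrightarrow> (\<exists>z<n. \<alpha> 1 z = 1 \<and> \<alpha> 2 (2 * z) = s \<and> \<not> adj z t)"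
    using one_end[OF assms, of _ s] D_less by (metis one_def)
  moreover have "(\<forall>x. adj v x \<and> adj s x \<longrightarrow> adj t x) \<longleftrightarrow> \<not> (\<exists>x<n. adj v x \<and> adj s x \<and> \<not> adj t x)" using adj_less by blast
  ultimately show ?thesis unfolding terminal_def by blast
qed

lemma initial_iff:
  assumes "st1 \<alpha>"
  shows "initial t s \<longleftrightarrow> (\<exists>z<n. \<alpha> 1 z = 3 \<and> \<alpha> 2 (2 * z) = s \<and> \<not> adj z t)"
  unfolding initial_def using start_end[OF assms, of _ s] D_less by (metis start_def)

lemma flag_spec:
  assumes t: "t < n" "\<rho> 10 = t" "i < 2" "\<rho> 11 = i" and s0: "st0 \<rho> \<alpha>" and s1: "st1 \<alpha>"
  shows "tr (9 * n + 10) flag_prog \<rho> \<alpha> (\<lambda>\<rho>' \<alpha>'. (\<forall>r<12. \<rho>' r = \<rho> r) \<and>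
    \<alpha>' = \<alpha>(3 := (\<alpha> 3)(2 * t + i := of_bool (terminal t (\<alpha> 2 (2 * t + i)))), 4 := (\<alpha> 4)(2 * t + i := of_bool (initial t (\<alpha> 2 (2 * t + i))))))"
proof -
  define s where "s = \<alpha> 2 (2 * t + i)"
  have sn: "s < n" "\<And>i. \<alpha> 2 i < n" using s0 by (auto simp: st0_def s_def)
  let ?A = "\<exists>x<n. adj v x \<and> adj s x \<and> \<not> adj t x" and ?B = "\<exists>z<n. \<alpha> 1 z = 1 \<and> \<alpha> 2 (2 * z) = s \<and> \<not> adj z t"
  let ?C = "\<exists>z<n. \<alpha> 1 z = 3 \<and> \<alpha> 2 (2 * z) = s \<and> \<not> adj z t"
  let ?r1 = "\<rho>(12 := s, 13 := of_bool ?A, 14 := n)" and ?a1 = "\<alpha>(3 := (\<alpha> 3)(2 * t + i := of_bool (terminal t s)))"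
  show ?thesis
    unfolding flag_prog_def s_def[symmetric]
  proof (rule tr_Seq[where k = 1 and k' = "9 * n + 9" and M = "\<lambda>\<rho>' \<alpha>'. \<rho>' = \<rho>(12 := s) \<and> \<alpha>' = \<alpha>"], goal_cases)
    case 1
    show ?case using t sn(1) by (intro tr_straight) (simp add: s_def)
  next
    case (2 \<rho>1 \<alpha>1)
    show ?case
    proof (rule tr_Seq[where k = "3 * n + 2" and k' = "6 * n + 7" and M = "\<lambda>\<rho>' \<alpha>'. \<rho>' = ?r1 \<and> \<alpha>' = \<alpha>"], goal_cases)
      case 1
      show ?case using 2 t v_less sn by (intro tr_Any[where B = "\<lambda>x. adj v x \<and> adj s x \<and> \<not> adj t x"]) auto
    next
      case (2 \<rho>1 \<alpha>1)
      show ?case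
      proof (rule tr_Seq[where k = "3 * n + 2" and k' = "3 * n + 5" and M = "\<lambda>\<rho>' \<alpha>'. \<rho>' = ?r1(15 := of_bool ?B, 14 := n) \<and> \<alpha>' = \<alpha>"], goal_cases)
        case 1
        show ?case using 2 t sn by (intro tr_Any[where B = "\<lambda>z. \<alpha> 1 z = 1 \<and> \<alpha> 2 (2 * z) = s \<and> \<not> adj z t"]) auto
      next
        case (2 \<rho>1 \<alpha>1)
        show ?case
        proof (rule tr_Seq[where k = 2 and k' = "3 * n + 3" and M = "\<lambda>\<rho>' \<alpha>'. \<rho>' = ?r1(15 := of_bool ?B, 14 := n) \<and> \<alpha>' = ?a1"], goal_cases)
          case 1
          show ?case using 2 t sn terminal_iff[OF s1, of t s] by (intro tr_straight) auto
        next
          case (2 \<rho>1 \<alpha>1)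
          show ?case
          proof (rule tr_Seq[where k = "3 * n + 2" and k' = 1 and M = "\<lambda>\<rho>' \<alpha>'. \<rho>' = ?r1(15 := of_bool ?C, 14 := n) \<and> \<alpha>' = ?a1"], goal_cases)
            case 1
            show ?case using 2 t sn by (intro tr_Any[where B = "\<lambda>z. \<alpha> 1 z = 3 \<and> \<alpha> 2 (2 * z) = s \<and> \<not> adj z t"]) auto
          next
            case (2 \<rho>1 \<alpha>1)
            show ?case using 2 t initial_iff[OF s1, of t s] by (intro tr_straight) auto
          qed simp
        qed simp
      qed simp
    qed simp
  qed simp
qed

definition st2 :: "(nat \<Rightarrow> nat \<Rightarrow> nat) \<Rightarrow> bool" where
  "st2 \<alpha> \<longleftrightarrow> (\<forall>m<2 * n. \<alpha> 3 m = of_bool (terminal (m div 2) (\<alpha> 2 m)) \<and> \<alpha> 4 m = of_bool (initial (m div 2) (\<alpha> 2 m)))"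

lemma frame_st0: "frame A \<rho> \<alpha> \<rho>' \<alpha>' \<Longrightarrow> 0 \<notin> A \<Longrightarrow> 2 \<notin> A \<Longrightarrow> st0 \<rho> \<alpha> \<Longrightarrow> st0 \<rho>' \<alpha>'"
  by (auto simp: frame_def st0_def)

lemma frame_st1: "frame A \<rho> \<alpha> \<rho>' \<alpha>' \<Longrightarrow> 1 \<notin> A \<Longrightarrow> 2 \<notin> A \<Longrightarrow> st1 \<alpha> \<Longrightarrow> st1 \<alpha>'"
  by (auto simp: frame_def st1_def)

lemma flags_spec:
  assumes s0: "st0 \<rho> \<alpha>" and s1: "st1 \<alpha>"
  shows "tr (n * (18 * n + 24) + 1) flags_prog \<rho> \<alpha> (\<lambda>\<rho>' \<alpha>'. frame {3, 4} \<rho> \<alpha> \<rho>' \<alpha>' \<and> st2 \<alpha>')"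
  unfolding flags_prog_def
proof (rule tr_weaken[OF tr_pairs[where k = "9 * n + 10" and I = "\<lambda>m \<rho>' \<alpha>'. frame {3, 4} \<rho> \<alpha> \<rho>' \<alpha>' \<and>
    (\<forall>m'<m. \<alpha>' 3 m' = of_bool (terminal (m' div 2) (\<alpha> 2 m')) \<and> \<alpha>' 4 m' = of_bool (initial (m' div 2) (\<alpha> 2 m')))"]], goal_cases)
  case (3 t i \<rho>1 \<alpha>1)
  then have fr: "frame {3, 4} \<rho> \<alpha> \<rho>1 \<alpha>1" by simp
  have s: "st0 \<rho>1 \<alpha>1" "st1 \<alpha>1" and a2: "\<alpha>1 2 = \<alpha> 2"
    using frame_st0[OF fr] frame_st1[OF fr] s0 s1 fr by (auto simp: frame_def)
  show ?case
  proof (rule tr_weaken[OF flag_spec[OF 3(1) 3(3) 3(2) 3(4) s]], goal_cases)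
    case (2 \<rho>2 \<alpha>2)
    then show ?case using 3 a2 by (auto simp: frame_def less_Suc_eq)
  qed simp
qed (auto simp: frame_def st2_def)

definition st3 :: "(nat \<Rightarrow> nat \<Rightarrow> nat) \<Rightarrow> bool" where
  "st3 \<alpha> \<longleftrightarrow> (\<forall>s<n. \<alpha> 5 s = of_bool (has_terminal s) \<and> \<alpha> 6 s = of_bool (has_initial s) \<and> \<alpha> 7 s < n \<and>
    ((\<exists>x. adj v x \<and> adj s x) \<longrightarrow> adj v (\<alpha> 7 s) \<and> adj s (\<alpha> 7 s)))"

lemma has_step_spec:
  assumes s: "s < n" "\<rho> 10 = s" and s0: "st0 \<rho> \<alpha>" and s1: "st1 \<alpha>"
    and j: "\<And>m. m < 2 * n \<Longrightarrow> \<alpha> j m = of_bool (F (m div 2) (\<alpha> 2 m))"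
  shows "tr (3 * n + 3) (has_step j k) \<rho> \<alpha> (\<lambda>\<rho>' \<alpha>'. (\<forall>r<13. \<rho>' r = \<rho> r) \<and>
    \<alpha>' = \<alpha>(k := (\<alpha> k)(s := of_bool (\<exists>t a. wing t s a \<and> F t s))))"
proof -
  let ?B = "\<lambda>t. \<alpha> 1 t = 2 \<and> (\<alpha> 2 (2 * t) = s \<and> \<alpha> j (2 * t) = 1 \<or> \<alpha> 2 (2 * t + 1) = s \<and> \<alpha> j (2 * t + 1) = 1)"
  have B: "?B t \<longleftrightarrow> (\<exists>a. wing t s a) \<and> F t s" if "t < n" for t
    using wing_end[OF s1 that, of s] j[of "2 * t"] j[of "2 * t + 1"] that by auto
  have ex: "(\<exists>t<n. ?B t) \<longleftrightarrow> (\<exists>t a. wing t s a \<and> F t s)" using B wingD(1) D_less by blast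
  have "tr (3 * n + 2) (Any 13 14 (And (Eq (Arr 1 (Var 14)) (Cst 2)) (Not (And
      (Not (And (Eq (Arr 2 (Mul (Cst 2) (Var 14))) (Var 10)) (Eq (Arr j (Mul (Cst 2) (Var 14))) (Cst 1))))
      (Not (And (Eq (Arr 2 (Add (Mul (Cst 2) (Var 14)) (Cst 1))) (Var 10)) (Eq (Arr j (Add (Mul (Cst 2) (Var 14)) (Cst 1))) (Cst 1)))))))) \<rho> \<alpha>
      (\<lambda>\<rho>' \<alpha>'. \<rho>' = \<rho>(13 := of_bool (\<exists>t<n. ?B t), 14 := n) \<and> \<alpha>' = \<alpha>)"
    using s by (intro tr_Any[where B = ?B]) auto
  then show ?thesis
    unfolding has_step_def
  proof (rule tr_Seq[where k' = 1], goal_cases)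
    case (1 \<rho>1 \<alpha>1)
    then show ?case unfolding ex using s by (intro tr_straight) auto
  qed simp
qed

lemma rep_spec:
  assumes s: "s < n" "\<rho> 10 = s"
  shows "tr (3 * n + 3) rep_prog \<rho> \<alpha> (\<lambda>\<rho>' \<alpha>'. (\<forall>r<13. \<rho>' r = \<rho> r) \<and>
    (\<exists>x<n. \<alpha>' = \<alpha>(7 := (\<alpha> 7)(s := x)) \<and> ((\<exists>x. adj v x \<and> adj s x) \<longrightarrow> adj v x \<and> adj s x)))"
  unfolding rep_prog_def
proof (rule tr_Seq[where k = 1 and k' = "3 * n + 2" and M = "\<lambda>\<rho>' \<alpha>'. \<rho>' = \<rho>(13 := 0) \<and> \<alpha>' = \<alpha>"], goal_cases)
  case 1
  show ?case by (intro tr_straight) simp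
next
  case (2 \<rho>1 \<alpha>1)
  show ?case
  proof (rule tr_Seq[where k = "3 * n + 1" and k' = 1 and M = "\<lambda>\<rho>' \<alpha>'. (\<forall>r<13. \<rho>' r = \<rho> r) \<and> \<alpha>' = \<alpha> \<and> \<rho>' 13 < n \<and>
      ((\<exists>x<n. adj v x \<and> adj s x) \<longrightarrow> adj v (\<rho>' 13) \<and> adj s (\<rho>' 13))"], goal_cases)
    case 1
    show ?case
    proof (rule tr_For'[where k = 2 and J = "\<lambda>i \<rho>' \<alpha>'. (\<forall>r<13. \<rho>' r = \<rho> r) \<and> \<alpha>' = \<alpha> \<and> \<rho>' 13 < n \<and>
      ((\<exists>x<i. adj v x \<and> adj s x) \<longrightarrow> adj v (\<rho>' 13) \<and> adj s (\<rho>' 13))"], goal_cases)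
      case (2 i \<rho>2 \<alpha>2)
      then have i: "i < n" and r: "\<forall>r<13. \<rho>2 r = \<rho> r" "\<alpha>2 = \<alpha>" "\<rho>2 13 < n" "\<rho>2 10 = s"
        and h: "(\<exists>x<i. adj v x \<and> adj s x) \<longrightarrow> adj v (\<rho>2 13) \<and> adj s (\<rho>2 13)" using s by auto
      show ?case using i r s h v_less by (intro tr_straight) (auto simp: less_Suc_eq)
    qed (use 2 v_less in auto)
  next
    case (2 \<rho>2 \<alpha>2)
    have rp: "(\<exists>x. adj v x \<and> adj s x) \<longrightarrow> adj v (\<rho>2 13) \<and> adj s (\<rho>2 13)" using 2 adj_less by blast
    have r: "\<forall>r<13. \<rho>2 r = \<rho> r" "\<alpha>2 = \<alpha>" "\<rho>2 13 < n" using 2 by simp_all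
    show ?case using r s rp by (intro tr_straight) (simp, blast)
  qed simp
qed simp

lemma has_spec:
  assumes s0: "st0 \<rho> \<alpha>" and s1: "st1 \<alpha>" and s2: "st2 \<alpha>"
  shows "tr (n * (9 * n + 10) + 1) has_prog \<rho> \<alpha> (\<lambda>\<rho>' \<alpha>'. frame {5, 6, 7} \<rho> \<alpha> \<rho>' \<alpha>' \<and> st3 \<alpha>')"
  unfolding has_prog_def
proof (rule tr_For'[where k = "9 * n + 9" and J = "\<lambda>i \<rho>' \<alpha>'. frame {5, 6, 7} \<rho> \<alpha> \<rho>' \<alpha>' \<and>
    (\<forall>s<i. \<alpha>' 5 s = of_bool (has_terminal s) \<and> \<alpha>' 6 s = of_bool (has_initial s) \<and> \<alpha>' 7 s < n \<and>
    ((\<exists>x. adj v x \<and> adj s x) \<longrightarrow> adj v (\<alpha>' 7 s) \<and> adj s (\<alpha>' 7 s)))"], goal_cases)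
  case (2 s \<rho>1 \<alpha>1)
  then have s: "s < n" and fr: "frame {5, 6, 7} \<rho> \<alpha> (\<rho>1(10 := s)) \<alpha>1"
    and old: "\<forall>x<s. \<alpha>1 5 x = of_bool (has_terminal x) \<and> \<alpha>1 6 x = of_bool (has_initial x) \<and> \<alpha>1 7 x < n \<and>
    ((\<exists>y. adj v y \<and> adj x y) \<longrightarrow> adj v (\<alpha>1 7 x) \<and> adj x (\<alpha>1 7 x))" by (simp_all add: frame_def)
  have t0: "st0 (\<rho>1(10 := s)) \<alpha>1" and t1: "st1 \<alpha>1" using frame_st0[OF fr] frame_st1[OF fr] s0 s1 by auto
  have t2: "\<alpha>1 3 m = of_bool (terminal (m div 2) (\<alpha>1 2 m))" "\<alpha>1 4 m = of_bool (initial (m div 2) (\<alpha>1 2 m))" if "m < 2 * n" for m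
    using s2 fr that by (auto simp: st2_def frame_def)
  show ?case
  proof (rule tr_Seq[OF has_step_spec[OF s _ t0 t1 t2(1)], where k' = "6 * n + 6"], goal_cases)
    case (3 \<rho>2 \<alpha>2)
    then have a2: "\<forall>r<13. \<rho>2 r = (\<rho>1(10 := s)) r" "\<alpha>2 = \<alpha>1(5 := (\<alpha>1 5)(s := of_bool (has_terminal s)))"
      by (simp_all add: has_terminal_def)
    have fr2: "frame {5} (\<rho>1(10 := s)) \<alpha>1 \<rho>2 \<alpha>2" using a2 by (simp add: frame_def)
    have t0': "st0 \<rho>2 \<alpha>2" and t1': "st1 \<alpha>2" using frame_st0[OF fr2] frame_st1[OF fr2] t0 t1 by auto
    have t2': "\<alpha>2 4 m = of_bool (initial (m div 2) (\<alpha>2 2 m))" if "m < 2 * n" for m using t2(2)[OF that] a2 by simp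
    have r2: "\<rho>2 10 = s" using a2 by simp
    show ?case
    proof (rule tr_Seq[OF has_step_spec[OF s r2 t0' t1' t2'], where k' = "3 * n + 3"], goal_cases)
      case (2 \<rho>3 \<alpha>3)
      then have a3: "\<forall>r<13. \<rho>3 r = \<rho>2 r" "\<alpha>3 = \<alpha>2(6 := (\<alpha>2 6)(s := of_bool (has_initial s)))"
        by (simp_all add: has_initial_def)
      have r3: "\<rho>3 10 = s" using a3 r2 by simp
      show ?case
      proof (rule tr_weaken[OF rep_spec[of s \<rho>3 \<alpha>3, OF s r3]], goal_cases)
        case (2 \<rho>4 \<alpha>4)
        then obtain x where x: "\<forall>r<13. \<rho>4 r = \<rho>3 r" "x < n" "\<alpha>4 = \<alpha>3(7 := (\<alpha>3 7)(s := x))"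
          "(\<exists>x. adj v x \<and> adj s x) \<longrightarrow> adj v x \<and> adj s x" by blast
        have "frame {5, 6, 7} \<rho> \<alpha> \<rho>4 \<alpha>4" using fr a2 a3 x(1,3) by (simp add: frame_def)
        moreover have "\<alpha>4 5 = (\<alpha>1 5)(s := of_bool (has_terminal s))" "\<alpha>4 6 = (\<alpha>1 6)(s := of_bool (has_initial s))"
          "\<alpha>4 7 = (\<alpha>1 7)(s := x)" using a2 a3 x(3) by simp_all
        ultimately show ?case using old x(2,4) by (simp add: less_Suc_eq all_conj_distrib)
      qed simp
    qed simp_all
  qed auto
qed (auto simp: frame_def st3_def)

end

section \<open>Search steps in terms of stored vertex sets\<close>

context cover_phase begin

definition row :: "('a \<times> 'a \<times> bool) list \<Rightarrow> 'a set" where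
  "row L = fst ` nds L \<union> labs L"

lemma apath_labs_notin: "apath L \<Longrightarrow> t \<in> labs L \<Longrightarrow> t \<notin> S"
proof (induction rule: apath.induct)
  case (apath_snoc L t' y)
  have "t' \<notin> S" using wingD(11) apath_snoc(2) unfolding edge_def by blast
  then show ?case using apath_snoc(4,5) apath_nonempty[OF apath_snoc(1)] by auto
qed (simp add: labs_def)

lemma apath_nds_S: "apath L \<Longrightarrow> fst ` nds L \<subseteq> S"
  using apath_Nd[of L] by (auto simp: nodes_def)

text \<open>Nodes contribute members of \<open>S\<close> and labels nonmembers, so an overlap could
  occur only among nodes or only among labels, and a path repeats neither.\<close>

lemma row_append_disjoint:
  assumes "apath (L @ R)" "L \<noteq> []"
  shows "row (L @ R) = row L \<union> (fst ` nds R \<union> fst ` set R)" "row L \<inter> (fst ` nds R \<union> fst ` set R) = {}"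
proof -
  have la: "labs (L @ R) = labs L \<union> fst ` set R" using assms(2) by (rule labs_append)
  have na: "fst ` nds (L @ R) = fst ` nds L \<union> fst ` nds R" by (simp only: nds_simps image_Un)
  show "row (L @ R) = row L \<union> (fst ` nds R \<union> fst ` set R)" unfolding row_def la na by (simp only: Un_ac)
  have "fst ` nds (L @ R) \<subseteq> S" using apath_nds_S[OF assms(1)] .
  then have S: "fst ` nds L \<subseteq> S" "fst ` nds R \<subseteq> S" unfolding na by blast+
  have "labs (L @ R) \<inter> S = {}" using apath_labs_notin[OF assms(1)] by blast
  then have T: "labs L \<inter> S = {}" "fst ` set R \<inter> S = {}" unfolding la by blast+
  have F: "False" if y: "y \<in> nds L" "y' \<in> nds R" "fst y = fst y'" for y y'
  proof -
    have "fst y' \<in> fst ` nds L" unfolding y(3)[symmetric] using y(1) by (rule imageI)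
    then have "y' \<in> sup2 L" using sup2_fst by blast
    then show False using apath_disjoint[OF assms] nds_sup2[OF y(2)] by blast
  qed
  have "fst ` nds L \<inter> fst ` nds R = {}"
  proof (rule equals0I, elim IntE imageE)
    fix x y y' assume "x = fst y" "y \<in> nds L" "x = fst y'" "y' \<in> nds R"
    then show False using F[of y y'] by simp
  qed
  moreover have "labs L \<inter> fst ` set R = {}" using apath_labs_disjoint[OF assms] .
  moreover have "(A \<union> C) \<inter> (B \<union> E) = {}"
    if "A \<subseteq> S" "B \<subseteq> S" "C \<inter> S = {}" "E \<inter> S = {}" "A \<inter> B = {}" "C \<inter> E = {}" for A B C E
    using that by blast
  ultimately show "row L \<inter> (fst ` nds R \<union> fst ` set R) = {}" using S T unfolding row_def by metis
qed

text \<open>With \<open>C\<close> a subset of \<open>A\<close>, this is \<open>B\<close> together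
  with the difference of \<open>A\<close> and \<open>C\<close>: the path to one end plus the part of
  the other path beyond the base. The symmetric form spares the program the question which of the
  two paths contains the base.\<close>

definition blend :: "'a set \<Rightarrow> 'a set \<Rightarrow> 'a set \<Rightarrow> 'a set" where
  "blend A B C = {y. if y \<in> C then y \<in> A \<and> y \<in> B else y \<in> A \<or> y \<in> B}"

lemma blend_commute: "blend A B C = blend B A C"
  by (auto simp: blend_def)

text \<open>Every root node is the base of a singleton blossom. The label in its path is a
  placeholder, since \<open>labs\<close> skips the first one.\<close>

lemma search_init:
  "search_state nodes flip edge entry {y. snd y \<and> has_initial (fst y)} (\<lambda>y. [(fst y, y)]) Some"
proof
  fix y :: "'a \<times> bool" assume "entry y"
  then show "y \<in> {y. snd y \<and> has_initial (fst y)} \<and> Some y = None \<or>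
    y \<notin> {y. snd y \<and> has_initial (fst y)} \<and> flip y \<in> {y. snd y \<and> has_initial (fst y)} \<and>
    (\<exists>t. [(fst (flip y), flip y)] = [(t, flip y)])"
    by (auto simp: entry_def flip_def)
next
  fix p :: "'a \<times> bool" assume "p \<in> {y. snd y \<and> has_initial (fst y)}"
  then show "apath [(fst p, p)]" by (intro apath_single) (auto simp: entry_def flip_def)
qed (auto simp: flip_def)

lemma search_grow:
  assumes st: "search_state nodes flip edge entry Ou P B" and p: "p \<in> Ou" and e: "edge t p w"
    and w: "w \<notin> Ou" "flip w \<notin> Ou"
  shows "\<exists>P' B'. search_state nodes flip edge entry (insert (flip w) Ou) P' B' \<and> (\<forall>x\<in>Ou. P' x = P x \<and> B' x = B x) \<and>
    row (P' (flip w)) = insert t (insert (fst w) (row (P p))) \<and> hd (P' (flip w)) = hd (P p)"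
proof (intro exI conjI)
  interpret search_state nodes flip edge entry Ou P B by (fact st)
  show "search_state nodes flip edge entry (insert (flip w) Ou) (P(flip w := P p @ [(t, flip w)])) (B(flip w := Some (flip w)))"
    using grow[OF p e w] .
  show "\<forall>x\<in>Ou. (P(flip w := P p @ [(t, flip w)])) x = P x \<and> (B(flip w := Some (flip w))) x = B x" using w by auto
  show "row ((P(flip w := P p @ [(t, flip w)])) (flip w)) = insert t (insert (fst w) (row (P p)))"
    using P_nonempty[OF p] by (auto simp: row_def)
  show "hd ((P(flip w := P p @ [(t, flip w)])) (flip w)) = hd (P p)" using P_nonempty[OF p] by simp
qed

text \<open>\<open>X\<close> describes \<open>branch p q\<close> by stored data: a base is an even
  node with a mate that is not even, and rows tell which paths pass through it.\<close>

lemma search_merge: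
  assumes st: "search_state nodes flip edge entry Ou P B" and p: "p \<in> Ou" and q: "q \<in> Ou" and e: "edge t p q"
  defines "X \<equiv> {m \<in> Ou. flip m \<notin> Ou \<and> (fst m \<in> row (P p)) \<noteq> (fst m \<in> row (P q))}"
  shows "\<exists>P' B'. search_state nodes flip edge entry (Ou \<union> flip ` X) P' B' \<and> (\<forall>x\<in>Ou. P' x = P x) \<and>
    (\<forall>x\<in>Ou. \<forall>y\<in>Ou. B x = B y \<longrightarrow> B' x = B' y) \<and> B' p = B' q \<and>
    (\<forall>m\<in>X. row (P' (flip m)) = insert t (insert (fst m) (blend (row (P p)) (row (P q)) (row (P m)))) \<and>
      hd (P' (flip m)) = hd (P (if fst m \<in> row (P p) then q else p)))"
proof -
  interpret search_state nodes flip edge entry Ou P B by (fact st)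
  have nodeS: "fst m \<in> S" if "m \<in> Ou" for m using Ou_Nd that by (auto simp: nodes_def)
  have mem: "fst m \<in> row (P x) \<longleftrightarrow> m \<in> nds (P x)" if m: "base m" and x: "x \<in> Ou" for m x
  proof -
    have "fst m \<notin> labs (P x)" using apath_labs_notin[OF P_path[OF x]] nodeS baseD(1)[OF m] by blast
    then have "fst m \<in> row (P x) \<longleftrightarrow> m \<in> sup2 (P x)" using sup2_fst[of m "P x"] by (simp add: row_def)
    then show ?thesis using base_sup2[OF x m] by simp
  qed
  have X: "X = branch p q"
  proof -
    have "m \<in> X \<longleftrightarrow> m \<in> branch p q" for m
      using mem[of m p] mem[of m q] p q base_iff[of m] unfolding X_def branch_def by blast
    then show ?thesis by blast
  qed
  from merge[OF p q e] obtain P' B' where M: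
    "search_state nodes flip edge entry (Ou \<union> flip ` branch p q) P' B'"
    "\<And>x. x \<in> Ou \<Longrightarrow> P' x = P x"
    "\<And>x y. x \<in> Ou \<Longrightarrow> y \<in> Ou \<Longrightarrow> B x = B y \<Longrightarrow> B' x = B' y"
    "B' p = B' q"
    "\<And>b. b \<in> branch p q \<Longrightarrow> b \<in> nds (P p) \<Longrightarrow>
      \<exists>R R'. P p = P b @ R \<and> P' (flip b) = P q @ R' \<and> nds (P' (flip b)) = nds (P q) \<union> flip ` insert b (nds R) \<and>
        labs (P' (flip b)) = labs (P q) \<union> {t} \<union> fst ` set R"
    "\<And>b. b \<in> branch p q \<Longrightarrow> b \<notin> nds (P p) \<Longrightarrow>
      \<exists>R R'. P q = P b @ R \<and> P' (flip b) = P p @ R' \<and> nds (P' (flip b)) = nds (P p) \<union> flip ` insert b (nds R) \<and>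
        labs (P' (flip b)) = labs (P p) \<union> {t} \<union> fst ` set R" by blast
  have eq: "row (P' (flip m)) = insert t (insert (fst m) (blend (row (P x)) (row (P y)) (row (P m)))) \<and> hd (P' (flip m)) = hd (P y)"
    if "P x = P m @ R" "P' (flip m) = P y @ R'" "nds (P' (flip m)) = nds (P y) \<union> flip ` insert m (nds R)"
      "labs (P' (flip m)) = labs (P y) \<union> {t} \<union> fst ` set R" "base m" "x \<in> Ou" "y \<in> Ou" for x y m R R'
  proof
    have ne: "P m \<noteq> []" using P_nonempty baseD(1) that(5) by blast
    have path: "apath (P m @ R)" using P_path[OF that(6)] that(1) by simp
    note rr = row_append_disjoint[OF path ne]
    have "fst ` flip ` A = fst ` A" for A by (simp add: image_image)
    then have "row (P' (flip m)) = row (P y) \<union> {t, fst m} \<union> (fst ` nds R \<union> fst ` set R)"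
      using that(3,4) by (auto simp: row_def image_Un)
    also have "\<dots> = insert t (insert (fst m) (blend (row (P x)) (row (P y)) (row (P m))))"
      using rr that(1) by (auto simp: blend_def)
    finally show "row (P' (flip m)) = insert t (insert (fst m) (blend (row (P x)) (row (P y)) (row (P m))))" .
    show "hd (P' (flip m)) = hd (P y)" using that(2) P_nonempty[OF that(7)] by simp
  qed
  have "row (P' (flip m)) = insert t (insert (fst m) (blend (row (P p)) (row (P q)) (row (P m)))) \<and>
      hd (P' (flip m)) = hd (P (if fst m \<in> row (P p) then q else p))" if m: "m \<in> X" for m
  proof -
    have mb: "m \<in> branch p q" "base m" using m X by (auto simp: branch_def)
    show ?thesis
    proof (cases "m \<in> nds (P p)")
      case True
      from M(5)[OF mb(1) True] obtain R R' where "P p = P m @ R" "P' (flip m) = P q @ R'"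
        "nds (P' (flip m)) = nds (P q) \<union> flip ` insert m (nds R)" "labs (P' (flip m)) = labs (P q) \<union> {t} \<union> fst ` set R" by blast
      from eq[OF this mb(2) p q] show ?thesis using mem[OF mb(2) p] True by simp
    next
      case False
      from M(6)[OF mb(1) False] obtain R R' where "P q = P m @ R" "P' (flip m) = P p @ R'"
        "nds (P' (flip m)) = nds (P p) \<union> flip ` insert m (nds R)" "labs (P' (flip m)) = labs (P p) \<union> {t} \<union> fst ` set R" by blast
      from eq[OF this mb(2) q p] show ?thesis using mem[OF mb(2) p] False by (simp add: blend_commute)
    qed
  qed
  then show ?thesis using M(1-4) unfolding X by (intro exI[of _ P'] exI[of _ B']) blast
qed

lemma search_stuck:
  assumes st: "search_state nodes flip edge entry Ou P B"
    and no_grow: "\<And>t p w. edge t p w \<Longrightarrow> p \<in> Ou \<Longrightarrow> w \<notin> Ou \<Longrightarrow> flip w \<in> Ou"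
    and merged: "\<And>t p q. edge t p q \<Longrightarrow> p \<in> Ou \<Longrightarrow> q \<in> Ou \<Longrightarrow> B p = B q"
    and T: "T \<subseteq> D" "indep T" "\<And>x. adj v x \<Longrightarrow> covers T x"
  shows "\<exists>s. has_terminal s \<and> (s, False) \<in> Ou"
proof -
  interpret search_state nodes flip edge entry Ou P B by (fact st)
  obtain L s where L: "apath L" "snd (last L) = (s, False)" "has_terminal s" using apath_of_cover[OF T] by blast
  have "snd (last L) \<in> Ou"
    by (rule stuck_search[OF _ L(1)]) (use no_grow merged in metis)
  then show ?thesis using L by auto
qed

end

section \<open>Searching\<close>

context ram begin

text \<open>Variable 4 is one more than the label found, or 0; variable 5 selects shrinking (0) or
  growing from the first (1) or second (2) end. The two node codes over \<open>s\<close> add up to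
  \<open>4 * s + 1\<close>, which gives the code of the mate.\<close>

definition scan_step :: pr where
  "scan_step =
    Set 12 (Arr 9 (Arr 8 (Mul (Cst 2) (Var 10)))) ;;
    Set 13 (Arr 9 (Arr 8 (Add (Mul (Cst 2) (Var 10)) (Cst 1)))) ;;
    If (And (Eq (Var 12) (Cst 1)) (Eq (Var 13) (Cst 1)))
      (If (Eq (Arr 12 (Var 10)) (Cst 0)) (Set 4 (Add (Var 10) (Cst 1)) ;; Set 5 (Cst 0)) Nop)
    (If (And (Eq (Var 12) (Cst 1)) (And (Eq (Var 13) (Cst 0)) (Eq (Arr 9 (Sub (Add (Mul (Cst 4) (Arr 2 (Add (Mul (Cst 2) (Var 10)) (Cst 1)))) (Cst 1))
        (Arr 8 (Add (Mul (Cst 2) (Var 10)) (Cst 1))))) (Cst 0))))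
      (Set 4 (Add (Var 10) (Cst 1)) ;; Set 5 (Cst 1))
    (If (And (Eq (Var 13) (Cst 1)) (And (Eq (Var 12) (Cst 0)) (Eq (Arr 9 (Sub (Add (Mul (Cst 4) (Arr 2 (Mul (Cst 2) (Var 10)))) (Cst 1))
        (Arr 8 (Mul (Cst 2) (Var 10))))) (Cst 0))))
      (Set 4 (Add (Var 10) (Cst 1)) ;; Set 5 (Cst 2)) Nop))"

definition scan_prog :: pr where
  "scan_prog = Set 4 (Cst 0) ;; For 10 1 0 (If (Eq (Arr 1 (Var 10)) (Cst 2)) scan_step Nop)"

text \<open>Variable 7 is the code of the even end, 8 and 12 the vertex and the code of the new odd
  node, 13 the code of its mate.\<close>

definition grow_prog :: pr where
  "grow_prog =
    If (Eq (Var 5) (Cst 1))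
      (Set 7 (Arr 8 (Mul (Cst 2) (Var 3))) ;; Set 8 (Arr 2 (Add (Mul (Cst 2) (Var 3)) (Cst 1))) ;; Set 12 (Arr 8 (Add (Mul (Cst 2) (Var 3)) (Cst 1))))
      (Set 7 (Arr 8 (Add (Mul (Cst 2) (Var 3)) (Cst 1))) ;; Set 8 (Arr 2 (Mul (Cst 2) (Var 3))) ;; Set 12 (Arr 8 (Mul (Cst 2) (Var 3)))) ;;
    Set 13 (Sub (Add (Mul (Cst 4) (Var 8)) (Cst 1)) (Var 12)) ;;
    For 11 1 0 (Put 10 (Add (Mul (Var 13) Size) (Var 11)) (Arr 10 (Add (Mul (Var 7) Size) (Var 11)))) ;;
    Put 10 (Add (Mul (Var 13) Size) (Var 3)) (Cst 1) ;;
    Put 10 (Add (Mul (Var 13) Size) (Var 8)) (Cst 1) ;;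
    Put 11 (Var 13) (Arr 11 (Var 7)) ;;
    Put 9 (Var 13) (Cst 1)"

text \<open>The loop writes the \<open>blend\<close> of rows 7 and 8, the ends of the edge, with row
  13, the base, into row 12, its mate. The first vertex is inherited from the path along which the
  new walk starts.\<close>

definition turn_prog :: pr where
  "turn_prog =
    For 11 1 0 (If (Eq (Arr 10 (Add (Mul (Var 13) Size) (Var 11))) (Cst 1))
      (If (And (Eq (Arr 10 (Add (Mul (Var 7) Size) (Var 11))) (Cst 1)) (Eq (Arr 10 (Add (Mul (Var 8) Size) (Var 11))) (Cst 1)))
        (Put 10 (Add (Mul (Var 12) Size) (Var 11)) (Cst 1)) (Put 10 (Add (Mul (Var 12) Size) (Var 11)) (Cst 0)))
      (If (And (Eq (Arr 10 (Add (Mul (Var 7) Size) (Var 11))) (Cst 0)) (Eq (Arr 10 (Add (Mul (Var 8) Size) (Var 11))) (Cst 0)))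
        (Put 10 (Add (Mul (Var 12) Size) (Var 11)) (Cst 0)) (Put 10 (Add (Mul (Var 12) Size) (Var 11)) (Cst 1)))) ;;
    Put 10 (Add (Mul (Var 12) Size) (Var 3)) (Cst 1) ;;
    Put 10 (Add (Mul (Var 12) Size) (Var 10)) (Cst 1) ;;
    If (Eq (Arr 10 (Add (Mul (Var 7) Size) (Var 10))) (Cst 1)) (Put 11 (Var 12) (Arr 11 (Var 8))) (Put 11 (Var 12) (Arr 11 (Var 7))) ;;
    Put 9 (Var 12) (Cst 1)"

text \<open>The vertex carries a base iff exactly one of its two nodes is marked, and the base is on
  a branch iff the two rows differ there. Adding the mark of node \<open>2 * s\<close> to
  \<open>2 * s\<close> yields the unmarked node.\<close>

definition merge_step :: pr where
  "merge_step =
    If (Eq (Arr 9 (Mul (Cst 2) (Var 10))) (Arr 9 (Add (Mul (Cst 2) (Var 10)) (Cst 1)))) Nop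
    (If (Eq (Arr 10 (Add (Mul (Var 7) Size) (Var 10))) (Arr 10 (Add (Mul (Var 8) Size) (Var 10)))) Nop
    (Set 12 (Add (Mul (Cst 2) (Var 10)) (Arr 9 (Mul (Cst 2) (Var 10)))) ;;
     Set 13 (Sub (Add (Mul (Cst 2) (Var 10)) (Cst 1)) (Arr 9 (Mul (Cst 2) (Var 10)))) ;;
     turn_prog))"

definition merge_prog :: pr where
  "merge_prog = (Put 12 (Var 3) (Cst 1) ;; Set 7 (Arr 8 (Mul (Cst 2) (Var 3))) ;; Set 8 (Arr 8 (Add (Mul (Cst 2) (Var 3)) (Cst 1)))) ;;
    For 10 1 0 merge_step"

definition act_prog :: pr where
  "act_prog = If (Eq (Var 4) (Cst 0)) Nop (Set 3 (Sub (Var 4) (Cst 1)) ;; If (Eq (Var 5) (Cst 0)) merge_prog grow_prog)"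

text \<open>Every effective round adds an even node, of which there are at most
  \<open>2 * n\<close>, or a merged edge, of which there are at most \<open>n\<close>. So
  \<open>3 * n + 1\<close> rounds reach a state where nothing applies.\<close>

definition rounds_prog :: pr where
  "rounds_prog = For 16 3 1 (scan_prog ;; act_prog)"

definition roots_prog :: pr where
  "roots_prog = For 10 2 0 (Put 9 (Var 10) (Cst 0)) ;; For 10 1 0 (Put 12 (Var 10) (Cst 0)) ;;
    For 10 1 0 (If (Eq (Arr 6 (Var 10)) (Cst 1))
      (For 11 1 0 (Put 10 (Add (Mul (Add (Mul (Cst 2) (Var 10)) (Cst 1)) Size) (Var 11)) (Cst 0)) ;;
       Put 10 (Add (Mul (Add (Mul (Cst 2) (Var 10)) (Cst 1)) Size) (Var 10)) (Cst 1) ;;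
       Put 11 (Add (Mul (Cst 2) (Var 10)) (Cst 1)) (Var 10) ;;
       Put 9 (Add (Mul (Cst 2) (Var 10)) (Cst 1)) (Cst 1)) Nop)"

lemma row_index: "x < n \<Longrightarrow> y < n \<Longrightarrow> k * n + x = k' * n + y \<longleftrightarrow> k = k' \<and> x = y"
proof
  assume "x < n" "y < n" "k * n + x = k' * n + y"
  then have "(k * n + x) div n = (k' * n + y) div n" "(k * n + x) mod n = (k' * n + y) mod n" by simp_all
  then show "k = k' \<and> x = y" using \<open>x < n\<close> \<open>y < n\<close> by simp
qed simp

definition rowis :: "(nat \<Rightarrow> nat \<Rightarrow> nat) \<Rightarrow> nat \<Rightarrow> nat set \<Rightarrow> bool" where
  "rowis \<alpha> k A \<longleftrightarrow> (\<forall>x<n. \<alpha> 10 (k * n + x) = of_bool (x \<in> A))"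

definition same_rows :: "nat \<Rightarrow> (nat \<Rightarrow> nat \<Rightarrow> nat) \<Rightarrow> (nat \<Rightarrow> nat \<Rightarrow> nat) \<Rightarrow> bool" where
  "same_rows k \<alpha> \<alpha>' \<longleftrightarrow> (\<forall>k' x. k' \<noteq> k \<longrightarrow> x < n \<longrightarrow> \<alpha>' 10 (k' * n + x) = \<alpha> 10 (k' * n + x))"

lemma same_rowis: "same_rows k \<alpha> \<alpha>' \<Longrightarrow> k' \<noteq> k \<Longrightarrow> rowis \<alpha>' k' A \<longleftrightarrow> rowis \<alpha> k' A"
  by (simp add: same_rows_def rowis_def)

lemma rowis_upd: "rowis \<alpha> k A \<Longrightarrow> x < n \<Longrightarrow> rowis (\<alpha>(10 := (\<alpha> 10)(k * n + x := 1))) k (insert x A)"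
  by (simp add: rowis_def row_index)

lemma same_rows_upd: "same_rows k \<alpha> \<alpha>' \<Longrightarrow> x < n \<Longrightarrow> same_rows k \<alpha> (\<alpha>'(10 := (\<alpha>' 10)(k * n + x := z)))"
  by (simp add: same_rows_def row_index)

lemma rowis_other [simp]: "j \<noteq> 10 \<Longrightarrow> rowis (\<alpha>(j := f)) k A \<longleftrightarrow> rowis \<alpha> k A"
  by (simp add: rowis_def)

lemma same_rows_other [simp]: "j \<noteq> 10 \<Longrightarrow> same_rows k \<alpha> (\<alpha>'(j := f)) \<longleftrightarrow> same_rows k \<alpha> \<alpha>'"
  by (simp add: same_rows_def)

text \<open>The body reads other rows while row \<open>k\<close> is being written, so it is told
  that those are still unchanged.\<close>

lemma row_loop:
  assumes step: "\<And>y \<rho>' \<alpha>'. y < n \<Longrightarrow> \<forall>r. r \<noteq> 11 \<longrightarrow> \<rho>' r = \<rho> r \<Longrightarrow> \<rho>' 11 = y \<Longrightarrow> same_rows k \<alpha> \<alpha>' \<Longrightarrow> \<forall>j. j \<noteq> 10 \<longrightarrow> \<alpha>' j = \<alpha> j \<Longrightarrow>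
      tr c p \<rho>' \<alpha>' (\<lambda>\<rho>'' \<alpha>''. \<rho>'' = \<rho>' \<and> \<alpha>'' = \<alpha>'(10 := (\<alpha>' 10)(k * n + y := of_bool (y \<in> A))))"
  shows "tr (n * (c + 1) + 1) (For 11 1 0 p) \<rho> \<alpha> (\<lambda>\<rho>' \<alpha>'. (\<forall>r. r \<noteq> 11 \<longrightarrow> \<rho>' r = \<rho> r) \<and> rowis \<alpha>' k A \<and> same_rows k \<alpha> \<alpha>' \<and>
    (\<forall>j. j \<noteq> 10 \<longrightarrow> \<alpha>' j = \<alpha> j))"
proof (rule tr_For'[where k = c and J = "\<lambda>i \<rho>' \<alpha>'. (\<forall>r. r \<noteq> 11 \<longrightarrow> \<rho>' r = \<rho> r) \<and> same_rows k \<alpha> \<alpha>' \<and>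
    (\<forall>j. j \<noteq> 10 \<longrightarrow> \<alpha>' j = \<alpha> j) \<and> (\<forall>x<i. x < n \<longrightarrow> \<alpha>' 10 (k * n + x) = of_bool (x \<in> A))"], goal_cases)
  case (2 i \<rho>' \<alpha>')
  then have i: "i < n" by simp
  show ?case
  proof (rule tr_weaken[OF step[of i "\<rho>'(11 := i)" \<alpha>']], goal_cases)
    case (7 \<rho>2 \<alpha>2)
    then show ?case using 2 i same_rows_upd[of k \<alpha> \<alpha>' i "of_bool (i \<in> A)"] by (simp add: less_Suc_eq row_index)
  qed (use 2 i in auto)
qed (auto simp: same_rows_def rowis_def)

end

locale search_ram = phase_ram n v adj S u + cover_phase "{..<n}" adj v S u rep
  for n v :: nat and adj :: "nat \<Rightarrow> nat \<Rightarrow> bool" and S :: "nat set" and u :: nat and rep :: "nat \<Rightarrow> nat"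
begin

definition st4 :: "(nat \<Rightarrow> nat \<Rightarrow> nat) \<Rightarrow> bool" where
  "st4 \<alpha> \<longleftrightarrow> (\<forall>m<2 * n. \<alpha> 8 m = 2 * \<alpha> 2 m + of_bool (side (m div 2) (\<alpha> 2 m)))"

lemma nodes_spec:
  assumes s0: "st0 \<rho> \<alpha>" and s2: "st2 \<alpha>" and s3: "st3 \<alpha>" and rp: "\<alpha> 7 = rep"
  shows "tr (n * 16 + 1) nodes_prog \<rho> \<alpha> (\<lambda>\<rho>' \<alpha>'. frame {8} \<rho> \<alpha> \<rho>' \<alpha>' \<and> st4 \<alpha>')"
  unfolding nodes_prog_def
proof (rule tr_weaken[OF tr_pairs[where k = 6 and I = "\<lambda>m \<rho>' \<alpha>'. frame {8} \<rho> \<alpha> \<rho>' \<alpha>' \<and>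
    (\<forall>m'<m. \<alpha>' 8 m' = 2 * \<alpha> 2 m' + of_bool (side (m' div 2) (\<alpha> 2 m')))"]], goal_cases)
  case (3 t i \<rho>1 \<alpha>1)
  let ?s = "\<alpha> 2 (2 * t + i)"
  have s: "?s < n" using s0 by (simp add: st0_def)
  have a: "\<alpha>1 j = \<alpha> j" if "j \<noteq> 8" for j using 3 that by (simp add: frame_def)
  have lt: "2 * t + i < 2 * n" "(2 * t + i) div 2 = t" using 3 by auto
  have e: "\<alpha> 3 (2 * t + i) = of_bool (terminal t ?s)" "\<alpha> 4 (2 * t + i) = of_bool (initial t ?s)"
    using s2 lt by (auto simp: st2_def)
  have h: "\<alpha> 5 ?s = of_bool (has_terminal ?s)" "\<alpha> 6 ?s = of_bool (has_initial ?s)" "rep ?s < n"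
    using s3 s rp by (auto simp: st3_def)
  have "tr 6 node_prog \<rho>1 \<alpha>1 (\<lambda>\<rho>' \<alpha>'. (\<forall>r<12. \<rho>' r = \<rho>1 r) \<and> \<alpha>' = \<alpha>1(8 := (\<alpha>1 8)(2 * t + i := 2 * ?s + of_bool (side t ?s))))"
    unfolding node_prog_def using 3 s e h rp a by (intro tr_straight) (simp add: side_def)
  then show ?case
  proof (rule tr_weaken, goal_cases)
    case (2 \<rho>2 \<alpha>2)
    then show ?case using 3 lt by (simp add: frame_def less_Suc_eq)
  qed simp
qed (auto simp: frame_def st4_def)

definition code :: "nat \<times> bool \<Rightarrow> nat" where
  "code y = 2 * fst y + of_bool (snd y)"

lemma code_inj [simp]: "code x = code y \<longleftrightarrow> x = y"
  unfolding code_def prod_eq_iff by (cases "snd x"; cases "snd y") (simp_all, presburger+)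

lemma code_less: "fst y < n \<Longrightarrow> code y < 2 * n"
  by (simp add: code_def)

lemma code_flip: "code (flip y) = 4 * fst y + 1 - code y"
  by (simp add: code_def flip_def)

lemma two_less: "two t \<Longrightarrow> t < n"
  using D_less by (simp add: two_def)

end

section \<open>Invariant and running time of the search\<close>

locale search_run = search_ram +
  fixes \<alpha>0 :: "nat \<Rightarrow> nat \<Rightarrow> nat"
  assumes st1: "st1 \<alpha>0" and st3: "st3 \<alpha>0" and st4: "st4 \<alpha>0" and ends_less: "\<And>i. \<alpha>0 2 i < n"
begin

definition pt :: "nat \<Rightarrow> nat \<Rightarrow> nat \<times> bool" where
  "pt t i = (\<alpha>0 2 (2 * t + i), side t (\<alpha>0 2 (2 * t + i)))"

lemma pt_less: "fst (pt t i) < n"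
  using ends_less by (simp add: pt_def)

lemma pt_code: "t < n \<Longrightarrow> \<alpha>0 8 (2 * t) = code (pt t 0)" "t < n \<Longrightarrow> \<alpha>0 8 (2 * t + 1) = code (pt t (Suc 0))"
  using st4 by (auto simp: st4_def pt_def code_def)

lemma pt_edge: "two t \<Longrightarrow> edge t (pt t 0) (pt t (Suc 0))"
  using two_wing_end[OF st1 two_less] two_end[OF st1 two_less] by (simp add: edge_def pt_def)

lemma edge_pt: "edge t p q \<Longrightarrow> two t \<and> (p = pt t 0 \<and> q = pt t (Suc 0) \<or> p = pt t (Suc 0) \<and> q = pt t 0)"
  using pt_edge[of t] ed_unique[of t p q "pt t 0" "pt t (Suc 0)"] by (auto simp: edge_def wing_def doubleton_eq_iff)

text \<open>The paths \<open>P\<close> and the bases \<open>B\<close> exist only in the proof;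
  memory keeps marks, rows and first vertices. For edges in \<open>dn\<close> the ends have a common
  base, which persists because blossoms only merge.\<close>

definition sinv :: "(nat \<times> bool) set \<Rightarrow> (nat \<times> bool \<Rightarrow> (nat \<times> nat \<times> bool) list) \<Rightarrow> (nat \<times> bool \<Rightarrow> (nat \<times> bool) option) \<Rightarrow> nat set \<Rightarrow> (nat \<Rightarrow> nat \<Rightarrow> nat) \<Rightarrow> bool" where
  "sinv Ou P B dn \<alpha> \<longleftrightarrow> search_state nodes flip edge entry Ou P B \<and> (\<forall>j<9. \<alpha> j = \<alpha>0 j) \<and>
    (\<forall>m<2 * n. \<alpha> 9 m = of_bool (m \<in> code ` Ou)) \<and>
    (\<forall>y\<in>Ou. rowis \<alpha> (code y) (row (P y)) \<and> \<alpha> 11 (code y) = fst (snd (hd (P y)))) \<and>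
    (\<forall>t<n. \<alpha> 12 t = of_bool (t \<in> dn)) \<and> dn \<subseteq> Collect two \<and>
    (\<forall>t\<in>dn. pt t 0 \<in> Ou \<and> pt t (Suc 0) \<in> Ou \<and> B (pt t 0) = B (pt t (Suc 0)))"

lemma sinvD:
  assumes "sinv Ou P B dn \<alpha>"
  shows "search_state nodes flip edge entry Ou P B" "j < 9 \<Longrightarrow> \<alpha> j = \<alpha>0 j" "fst y < n \<Longrightarrow> \<alpha> 9 (code y) = of_bool (y \<in> Ou)"
    "y \<in> Ou \<Longrightarrow> rowis \<alpha> (code y) (row (P y))" "y \<in> Ou \<Longrightarrow> \<alpha> 11 (code y) = fst (snd (hd (P y)))"
    "t < n \<Longrightarrow> \<alpha> 12 t = of_bool (t \<in> dn)" "dn \<subseteq> Collect two" "Ou \<subseteq> nodes"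
proof -
  have st: "search_state nodes flip edge entry Ou P B" using assms by (simp add: sinv_def)
  show "Ou \<subseteq> nodes" using search_state.Ou_Nd[OF st] .
  show "fst y < n \<Longrightarrow> \<alpha> 9 (code y) = of_bool (y \<in> Ou)" using assms code_less[of y] by (auto simp: sinv_def)
qed (use assms in \<open>auto simp: sinv_def\<close>)

lemma nodes_less: "y \<in> nodes \<Longrightarrow> fst y < n"
  using S_less by (auto simp: nodes_def)

definition applicable :: "(nat \<times> bool) set \<Rightarrow> nat set \<Rightarrow> nat \<Rightarrow> nat \<Rightarrow> bool" where
  "applicable Ou dn k t \<longleftrightarrow> two t \<and> (k = 0 \<and> pt t 0 \<in> Ou \<and> pt t (Suc 0) \<in> Ou \<and> t \<notin> dn \<or>
    k = 1 \<and> pt t 0 \<in> Ou \<and> pt t (Suc 0) \<notin> Ou \<and> flip (pt t (Suc 0)) \<notin> Ou \<or> k = 2 \<and> pt t (Suc 0) \<in> Ou \<and> pt t 0 \<notin> Ou \<and> flip (pt t 0) \<notin> Ou)"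

lemma scan_spec:
  assumes inv: "sinv Ou P B dn \<alpha>"
  shows "tr (9 * n + 2) scan_prog \<rho> \<alpha> (\<lambda>\<rho>' \<alpha>'. \<alpha>' = \<alpha> \<and> (\<forall>r<2. \<rho>' r = \<rho> r) \<and>
    (\<rho>' 4 = 0 \<and> (\<forall>k. \<forall>t<n. \<not> applicable Ou dn k t) \<or> (\<exists>t<n. \<rho>' 4 = Suc t \<and> applicable Ou dn (\<rho>' 5) t)))"
  unfolding scan_prog_def
proof (rule tr_Seq[where k = 1 and k' = "9 * n + 1" and M = "\<lambda>\<rho>' \<alpha>'. \<rho>' = \<rho>(4 := 0) \<and> \<alpha>' = \<alpha>"], goal_cases)
  case 1
  show ?case by (intro tr_straight) simp
next
  case (2 \<rho>1 \<alpha>1)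
  show ?case
  proof (rule tr_For'[where k = 8 and J = "\<lambda>i \<rho>' \<alpha>'. \<alpha>' = \<alpha> \<and> (\<forall>r<2. \<rho>' r = \<rho> r) \<and>
    (\<rho>' 4 = 0 \<and> (\<forall>k. \<forall>t<i. \<not> applicable Ou dn k t) \<or> (\<exists>t<n. \<rho>' 4 = Suc t \<and> applicable Ou dn (\<rho>' 5) t))"], goal_cases)
    case (2 t \<rho>2 \<alpha>2)
    then have t: "t < n" and a: "\<alpha>2 = \<alpha>" and r: "\<forall>r<2. \<rho>2 r = \<rho> r"
      and J: "\<rho>2 4 = 0 \<and> (\<forall>k. \<forall>t'<t. \<not> applicable Ou dn k t') \<or> (\<exists>t<n. \<rho>2 4 = Suc t \<and> applicable Ou dn (\<rho>2 5) t)" by auto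
    have tw: "two t \<longleftrightarrow> \<alpha> 1 t = 2" using two_end[OF st1 t] sinvD(2)[OF inv, of 1] by simp
    have n8: "\<alpha> 8 (2 * t) = code (pt t 0)" "\<alpha> 8 (Suc (2 * t)) = code (pt t (Suc 0))"
      using pt_code[OF t] sinvD(2)[OF inv, of 8] by simp_all
    have o: "\<alpha> 9 (code (pt t 0)) = of_bool (pt t 0 \<in> Ou)" "\<alpha> 9 (code (pt t (Suc 0))) = of_bool (pt t (Suc 0) \<in> Ou)"
      using sinvD(3)[OF inv] pt_less by simp_all
    have e: "\<alpha> 2 (2 * t) = fst (pt t 0)" "\<alpha> 2 (Suc (2 * t)) = fst (pt t (Suc 0))"
      using sinvD(2)[OF inv, of 2] by (simp_all add: pt_def)
    have f: "\<alpha> 9 (Suc (4 * fst (pt t 0)) - code (pt t 0)) = of_bool (flip (pt t 0) \<in> Ou)"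
      "\<alpha> 9 (Suc (4 * fst (pt t (Suc 0))) - code (pt t (Suc 0))) = of_bool (flip (pt t (Suc 0)) \<in> Ou)"
      using sinvD(3)[OF inv, of "flip (pt t 0)"] sinvD(3)[OF inv, of "flip (pt t (Suc 0))"] pt_less by (simp_all add: code_flip)
    have d: "\<alpha> 12 t = of_bool (t \<in> dn)" using sinvD(6)[OF inv t] .
    define m :: "nat option" where "m = (if two t \<and> pt t 0 \<in> Ou \<and> pt t (Suc 0) \<in> Ou \<and> t \<notin> dn then Some 0
      else if two t \<and> pt t 0 \<in> Ou \<and> pt t (Suc 0) \<notin> Ou \<and> flip (pt t (Suc 0)) \<notin> Ou then Some 1
      else if two t \<and> pt t (Suc 0) \<in> Ou \<and> pt t 0 \<notin> Ou \<and> flip (pt t 0) \<notin> Ou then Some 2 else None)"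
    have "tr 8 (If (Eq (Arr 1 (Var 10)) (Cst 2)) scan_step Nop) (\<rho>2(10 := t)) \<alpha>2 (\<lambda>\<rho>' \<alpha>'. \<alpha>' = \<alpha> \<and> (\<forall>r<2. \<rho>' r = \<rho>2 r) \<and>
        (case m of None \<Rightarrow> \<rho>' 4 = \<rho>2 4 \<and> \<rho>' 5 = \<rho>2 5 | Some k \<Rightarrow> \<rho>' 4 = Suc t \<and> \<rho>' 5 = k))"
      unfolding scan_step_def a m_def using t
      by (intro tr_straight) (simp add: n8 o e f d tw)
    then show ?case
    proof (rule tr_weaken, goal_cases)
      case (2 \<rho>3 \<alpha>3)
      show ?case
      proof (cases m)
        case None
        then have "\<rho>3 4 = \<rho>2 4" "\<rho>3 5 = \<rho>2 5" using 2 by auto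
        moreover have "\<not> applicable Ou dn k t" for k using None by (auto simp: applicable_def m_def split: if_splits)
        ultimately show ?thesis using J 2 r by (auto simp: less_Suc_eq)
      next
        case (Some k)
        then have "\<rho>3 4 = Suc t" "\<rho>3 5 = k" using 2 by auto
        moreover have "applicable Ou dn k t" using Some by (auto simp: applicable_def m_def split: if_splits)
        ultimately show ?thesis using 2 r t by auto
      qed
    qed simp
  qed (use 2 in auto)
qed simp

lemma turn_spec:
  assumes t: "t < n" "\<rho> 3 = t" and s: "s < n" "\<rho> 10 = s" and r: "\<rho> 7 = a" "\<rho> 8 = b" "\<rho> 12 = w" "\<rho> 13 = m"
    and ne: "w \<noteq> a" "w \<noteq> b" "w \<noteq> m" and rows: "rowis \<alpha> a A" "rowis \<alpha> b A'" "rowis \<alpha> m C"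
    and lim: "\<alpha> 11 a < n" "\<alpha> 11 b < n"
  shows "tr (4 * n + 6) turn_prog \<rho> \<alpha> (\<lambda>\<rho>' \<alpha>'. (\<forall>r. r \<noteq> 11 \<longrightarrow> \<rho>' r = \<rho> r) \<and> rowis \<alpha>' w (insert t (insert s (blend A A' C))) \<and>
    same_rows w \<alpha> \<alpha>' \<and> \<alpha>' 11 = (\<alpha> 11)(w := if s \<in> A then \<alpha> 11 b else \<alpha> 11 a) \<and> \<alpha>' 9 = (\<alpha> 9)(w := 1) \<and>
    (\<forall>j. j \<notin> {9, 10, 11} \<longrightarrow> \<alpha>' j = \<alpha> j))"
  unfolding turn_prog_def
proof (rule tr_Seq[OF row_loop[where c = 3 and k = w and A = "blend A A' C"], where k' = 5], goal_cases)
  case (1 y \<rho>1 \<alpha>1)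
  have row: "\<alpha>1 10 (k * n + y) = of_bool (y \<in> X)" if "k \<noteq> w" "rowis \<alpha> k X" for k X
    using 1(1,4) that by (simp add: rowis_def same_rows_def)
  note rr = row[OF ne(1)[symmetric] rows(1)] row[OF ne(2)[symmetric] rows(2)] row[OF ne(3)[symmetric] rows(3)]
  have "\<rho>1 7 = a" "\<rho>1 8 = b" "\<rho>1 12 = w" "\<rho>1 13 = m" using 1(2) r by auto
  then show ?case using 1(3) rr by (intro tr_straight) (auto simp: blend_def)
next
  case (2 \<rho>1 \<alpha>1)
  then have rw: "rowis \<alpha>1 w (blend A A' C)" and sr: "same_rows w \<alpha> \<alpha>1" and fr: "\<forall>r. r \<noteq> 11 \<longrightarrow> \<rho>1 r = \<rho> r" "\<forall>j. j \<noteq> 10 \<longrightarrow> \<alpha>1 j = \<alpha> j" by auto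
  let ?a = "\<alpha>1(10 := (\<alpha>1 10)(w * n + t := 1, w * n + s := 1))"
  have "rowis \<alpha>1 a A" using same_rowis[OF sr ne(1)[symmetric], of A] rows(1) by simp
  then have as: "\<alpha>1 10 (a * n + s) = of_bool (s \<in> A)" using s(1) by (simp only: rowis_def)
  have asn: "a * n + s \<noteq> w * n + t" "a * n + s \<noteq> w * n + s" using row_index[OF s(1) t(1), of a w] row_index[OF s(1) s(1), of a w] ne(1) by auto
  have R: "rowis ?a w (insert s (insert t (blend A A' C)))"
    using rowis_upd[OF rowis_upd[OF rw t(1)] s(1)] by simp
  have Sm: "same_rows w \<alpha> ?a" using same_rows_upd[OF same_rows_upd[OF sr t(1)] s(1), of 1 1] by simp
  have "tr 5 (Put 10 (Add (Mul (Var 12) Size) (Var 3)) (Cst 1) ;; Put 10 (Add (Mul (Var 12) Size) (Var 10)) (Cst 1) ;;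
    If (Eq (Arr 10 (Add (Mul (Var 7) Size) (Var 10))) (Cst 1)) (Put 11 (Var 12) (Arr 11 (Var 8))) (Put 11 (Var 12) (Arr 11 (Var 7))) ;;
    Put 9 (Var 12) (Cst 1)) \<rho>1 \<alpha>1 (\<lambda>\<rho>' \<alpha>'. \<rho>' = \<rho>1 \<and> \<alpha>' = ?a(11 := (\<alpha> 11)(w := if s \<in> A then \<alpha> 11 b else \<alpha> 11 a), 9 := (\<alpha> 9)(w := 1)))"
    using fr r t s lim asn by (intro tr_straight) (simp add: as)
  then show ?case
  proof (rule tr_weaken, goal_cases)
    case (2 \<rho>2 \<alpha>2)
    then show ?case using fr R Sm by (simp add: insert_commute)
  qed simp
qed simp

lemma grow_spec:
  assumes inv: "sinv Ou P B dn \<alpha>" and ap: "applicable Ou dn k t" and k: "k \<noteq> 0" and r: "\<rho> 3 = t" "\<rho> 5 = k"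
  shows "tr (2 * n + 10) grow_prog \<rho> \<alpha> (\<lambda>\<rho>' \<alpha>'. (\<forall>r<2. \<rho>' r = \<rho> r) \<and>
    (\<exists>Ou' P' B'. sinv Ou' P' B' dn \<alpha>' \<and> card Ou < card Ou'))"
proof -
  have tw: "two t" and t: "t < n" using ap two_less by (auto simp: applicable_def)
  obtain p w where pw: "p \<in> Ou" "w \<notin> Ou" "flip w \<notin> Ou" "edge t p w"
    "k = 1 \<and> p = pt t 0 \<and> w = pt t (Suc 0) \<or> k = 2 \<and> p = pt t (Suc 0) \<and> w = pt t 0"
  proof (cases "k = 1")
    case True
    then show ?thesis using ap pt_edge[OF tw] by (intro that[of "pt t 0" "pt t (Suc 0)"]) (auto simp: applicable_def)
  next
    case False
    then show ?thesis using ap k ed_sym[OF pt_edge[OF tw]] by (intro that[of "pt t (Suc 0)" "pt t 0"]) (auto simp: applicable_def)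
  qed
  have wn: "fst w < n" using pw(5) pt_less by auto
  let ?m = "code (flip w)"
  from search_grow[OF sinvD(1)[OF inv] pw(1,4,2,3)] obtain P' B' where
    G: "search_state nodes flip edge entry (insert (flip w) Ou) P' B'" "\<forall>x\<in>Ou. P' x = P x \<and> B' x = B x"
    "row (P' (flip w)) = insert t (insert (fst w) (row (P p)))" "hd (P' (flip w)) = hd (P p)" by blast
  have finO: "finite Ou" using sinvD(8)[OF inv] finite_Nd finite_subset by blast
  have cn: "code y \<noteq> ?m" if "y \<in> Ou" for y using that pw(3) by auto
  have a0: "\<alpha> 8 (2 * t) = code (pt t 0)" "\<alpha> 8 (Suc (2 * t)) = code (pt t (Suc 0))" "\<alpha> 2 (2 * t) = fst (pt t 0)" "\<alpha> 2 (Suc (2 * t)) = fst (pt t (Suc 0))"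
    using pt_code[OF t] sinvD(2)[OF inv, of 8] sinvD(2)[OF inv, of 2] by (simp_all add: pt_def)
  have cl: "code (pt t 0) < 2 * n" "code (pt t (Suc 0)) < 2 * n" using code_less pt_less by blast+
  have ml: "?m < 2 * n" using wn code_less by simp
  let ?r = "\<rho>(7 := code p, 8 := fst w, 12 := code w, 13 := ?m)"
  show ?thesis
    unfolding grow_prog_def
  proof (rule tr_Seq[where k = 4 and k' = "2 * n + 6" and M = "\<lambda>\<rho>' \<alpha>'. \<rho>' = \<rho>(7 := code p, 8 := fst w, 12 := code w) \<and> \<alpha>' = \<alpha>"], goal_cases)
    case 1
    show ?case using pw(5) r a0 cl pt_less[of t 0] pt_less[of t "Suc 0"] by (intro tr_straight) auto
  next
    case (2 \<rho>1 \<alpha>1)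
    show ?case
    proof (rule tr_Seq[where k = 1 and k' = "2 * n + 5" and M = "\<lambda>\<rho>' \<alpha>'. \<rho>' = ?r \<and> \<alpha>' = \<alpha>"], goal_cases)
      case 1
      show ?case using 2 ml by (intro tr_straight) (simp add: code_flip)
    next
      case (2 \<rho>1 \<alpha>1)
      show ?case
      proof (rule tr_Seq[OF row_loop[where c = 1 and k = ?m and A = "row (P p)"], where k' = 4], goal_cases)
        case (1 y \<rho>2 \<alpha>2)
        have "\<alpha>2 10 (code p * n + y) = of_bool (y \<in> row (P p))"
          using 1 cn[OF pw(1)] sinvD(4)[OF inv pw(1)] 2 by (simp add: rowis_def same_rows_def)
        moreover have "\<rho>2 7 = code p" "\<rho>2 13 = ?m" using 1(2) 2 by auto
        ultimately show ?case using 1(3) by (intro tr_straight) simp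
      next
        case (2 \<rho>2 \<alpha>2)
        then have fr: "\<forall>r. r \<noteq> 11 \<longrightarrow> \<rho>2 r = ?r r" "\<forall>j. j \<noteq> 10 \<longrightarrow> \<alpha>2 j = \<alpha> j" and rw: "rowis \<alpha>2 ?m (row (P p))" and sr: "same_rows ?m \<alpha> \<alpha>2"
          using \<open>\<rho>1 = ?r \<and> \<alpha>1 = \<alpha>\<close> by auto
        let ?a = "\<alpha>2(10 := (\<alpha>2 10)(?m * n + t := 1, ?m * n + fst w := 1))"
        have R: "rowis ?a ?m (insert (fst w) (insert t (row (P p))))" using rowis_upd[OF rowis_upd[OF rw t] wn] by simp
        have Sm: "same_rows ?m \<alpha> ?a" using same_rows_upd[OF same_rows_upd[OF sr t] wn, of 1 1] by simp
        have h: "\<alpha> 11 (code p) = fst (snd (hd (P p)))" using sinvD(5)[OF inv pw(1)] .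
        interpret ss: search_state nodes flip edge entry Ou P B by (rule sinvD(1)[OF inv])
        have "hd (P p) \<in> set (P p)" using ss.P_nonempty[OF pw(1)] by simp
        then have "snd (hd (P p)) \<in> nodes" using apath_Nd[OF ss.P_path[OF pw(1)]] by (auto simp: nds_def)
        then have hl: "fst (snd (hd (P p))) < n" by (rule nodes_less)
        have "tr 4 (Put 10 (Add (Mul (Var 13) Size) (Var 3)) (Cst 1) ;; Put 10 (Add (Mul (Var 13) Size) (Var 8)) (Cst 1) ;;
            Put 11 (Var 13) (Arr 11 (Var 7)) ;; Put 9 (Var 13) (Cst 1)) \<rho>2 \<alpha>2
          (\<lambda>\<rho>' \<alpha>'. \<rho>' = \<rho>2 \<and> \<alpha>' = ?a(11 := (\<alpha> 11)(?m := fst (snd (hd (P p)))), 9 := (\<alpha> 9)(?m := 1)))"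
          using fr r h hl by (intro tr_straight) simp
        then show ?case
        proof (rule tr_weaken, goal_cases)
          case (2 \<rho>3 \<alpha>3)
          have "sinv (insert (flip w) Ou) P' B' dn \<alpha>3"
            unfolding sinv_def
          proof (intro conjI)
            show "search_state nodes flip edge entry (insert (flip w) Ou) P' B'" by (fact G(1))
            show "\<forall>j<9. \<alpha>3 j = \<alpha>0 j" using 2 fr sinvD(2)[OF inv] by simp
            show "\<forall>m<2 * n. \<alpha>3 9 m = of_bool (m \<in> code ` insert (flip w) Ou)" using 2 inv by (auto simp: sinv_def)
            show "\<forall>t<n. \<alpha>3 12 t = of_bool (t \<in> dn)" using 2 fr inv by (simp add: sinv_def)
            show "dn \<subseteq> Collect two" using sinvD(7)[OF inv] .
            show "\<forall>t\<in>dn. pt t 0 \<in> insert (flip w) Ou \<and> pt t (Suc 0) \<in> insert (flip w) Ou \<and> B' (pt t 0) = B' (pt t (Suc 0))"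
              using inv G(2) by (simp add: sinv_def)
            show "\<forall>y\<in>insert (flip w) Ou. rowis \<alpha>3 (code y) (row (P' y)) \<and> \<alpha>3 11 (code y) = fst (snd (hd (P' y)))"
            proof
              fix y assume y: "y \<in> insert (flip w) Ou"
              show "rowis \<alpha>3 (code y) (row (P' y)) \<and> \<alpha>3 11 (code y) = fst (snd (hd (P' y)))"
              proof (cases "y = flip w")
                case True
                then show ?thesis using 2 R G(3,4) by (simp add: insert_commute)
              next
                case False
                then have yO: "y \<in> Ou" using y by simp
                then show ?thesis using 2 G(2) same_rowis[OF Sm cn[OF yO]] sinvD(4,5)[OF inv yO] cn[OF yO] by simp
              qed
            qed
          qed
          moreover have "card Ou < card (insert (flip w) Ou)" using finO pw(3) by simp
          moreover have "\<forall>r<2. \<rho>3 r = \<rho> r" using 2 fr by simp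
          ultimately show ?case by blast
        qed simp
      qed simp
    qed simp
  qed simp
qed

lemma row_hd:
  assumes inv: "sinv Ou P B dn \<alpha>" and y: "y \<in> Ou"
  shows "\<alpha> 11 (code y) < n"
proof -
  interpret ss: search_state nodes flip edge entry Ou P B by (rule sinvD(1)[OF inv])
  have "hd (P y) \<in> set (P y)" using ss.P_nonempty[OF y] by simp
  then have "snd (hd (P y)) \<in> nodes" using apath_Nd[OF ss.P_path[OF y]] by (auto simp: nds_def)
  then show ?thesis using nodes_less sinvD(5)[OF inv y] by simp
qed

text \<open>\<open>\<alpha>0'\<close> is the memory before the merge and \<open>\<alpha>\<close> the
  current one, in which mates over other vertices may already be marked; the data of old even nodes
  and the marks over \<open>s\<close> are still the original ones.\<close>

lemma merge_step_spec:
  assumes inv: "sinv Ou P B dn \<alpha>0'" and p: "p \<in> Ou" and q: "q \<in> Ou" and t: "t < n" "\<rho> 3 = t" and s: "s < n" "\<rho> 10 = s"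
    and r: "\<rho> 7 = code p" "\<rho> 8 = code q"
    and X: "X = {m \<in> Ou. flip m \<notin> Ou \<and> (fst m \<in> row (P p)) \<noteq> (fst m \<in> row (P q))}"
    and o: "\<And>c. \<alpha> 9 (code (s, c)) = of_bool ((s, c) \<in> Ou)"
    and rows: "\<And>y. y \<in> Ou \<Longrightarrow> rowis \<alpha> (code y) (row (P y)) \<and> \<alpha> 11 (code y) = \<alpha>0' 11 (code y)"
  shows "tr (if s \<in> fst ` X then 4 * n + 10 else 3) merge_step \<rho> \<alpha> (\<lambda>\<rho>' \<alpha>'.
    (\<forall>r. r \<notin> {11, 12, 13} \<longrightarrow> \<rho>' r = \<rho> r) \<and> (\<forall>j. j \<notin> {9, 10, 11} \<longrightarrow> \<alpha>' j = \<alpha> j) \<and>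
    (if s \<in> fst ` X then \<exists>m\<in>X. fst m = s \<and> rowis \<alpha>' (code (flip m)) (insert t (insert s (blend (row (P p)) (row (P q)) (row (P m))))) \<and>
        same_rows (code (flip m)) \<alpha> \<alpha>' \<and> \<alpha>' 11 = (\<alpha> 11)(code (flip m) := \<alpha>0' 11 (code (if s \<in> row (P p) then q else p))) \<and>
        \<alpha>' 9 = (\<alpha> 9)(code (flip m) := 1)
      else \<alpha>' = \<alpha>))"
proof -
  have o': "\<alpha> 9 (2 * s) = of_bool ((s, False) \<in> Ou)" "\<alpha> 9 (Suc (2 * s)) = of_bool ((s, True) \<in> Ou)"
    using o[of False] o[of True] by (simp_all add: code_def)
  have v: "\<alpha> 10 (code p * n + s) = of_bool (s \<in> row (P p))" "\<alpha> 10 (code q * n + s) = of_bool (s \<in> row (P q))"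
    using rows[OF p] rows[OF q] s by (auto simp: rowis_def)
  have sX: "s \<in> fst ` X \<longleftrightarrow> ((s, False) \<in> Ou) \<noteq> ((s, True) \<in> Ou) \<and> (s \<in> row (P p)) \<noteq> (s \<in> row (P q))"
  proof
    assume "s \<in> fst ` X"
    then obtain c where "(s, c) \<in> X" by auto
    then show "((s, False) \<in> Ou) \<noteq> ((s, True) \<in> Ou) \<and> (s \<in> row (P p)) \<noteq> (s \<in> row (P q))"
      unfolding X by (cases c) (auto simp: flip_def)
  next
    assume a: "((s, False) \<in> Ou) \<noteq> ((s, True) \<in> Ou) \<and> (s \<in> row (P p)) \<noteq> (s \<in> row (P q))"
    then have "(s, (s, True) \<in> Ou) \<in> X" unfolding X by (cases "(s, True) \<in> Ou") (auto simp: flip_def)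
    then show "s \<in> fst ` X" by force
  qed
  show ?thesis
  proof (cases "s \<in> fst ` X")
    case False
    then show ?thesis unfolding merge_step_def using r s sX by (intro tr_straight) (auto simp: o' v)
  next
    case True
    \<comment> \<open>Exactly one node over \<open>s\<close> is even, so its second component is the
      mark of \<open>(s, True)\<close>.\<close>
    define m where "m = (s, (s, True) \<in> Ou)"
    from True have T: "((s, False) \<in> Ou) \<noteq> ((s, True) \<in> Ou)" "(s \<in> row (P p)) \<noteq> (s \<in> row (P q))" unfolding sX by blast+
    then have mX: "m \<in> X" unfolding X m_def by (cases "(s, True) \<in> Ou") (auto simp: flip_def)
    have mO: "m \<in> Ou" "flip m \<notin> Ou" using mX X by auto
    have cm: "code (flip m) = 2 * s + \<alpha> 9 (2 * s)" "code m = 2 * s + 1 - \<alpha> 9 (2 * s)"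
      using T(1) unfolding m_def o' by (auto simp: code_def flip_def)
    have cl: "code (flip m) < 2 * n" "code m < 2 * n" using code_less[of m] code_less[of "flip m"] s by (auto simp: m_def)
    let ?T = "turn_prog" and ?r = "\<rho>(12 := code (flip m), 13 := code m)"
    have turn: "tr (4 * n + 6) ?T ?r \<alpha> (\<lambda>\<rho>' \<alpha>'. (\<forall>r. r \<noteq> 11 \<longrightarrow> \<rho>' r = ?r r) \<and>
        rowis \<alpha>' (code (flip m)) (insert t (insert s (blend (row (P p)) (row (P q)) (row (P m))))) \<and>
        same_rows (code (flip m)) \<alpha> \<alpha>' \<and> \<alpha>' 11 = (\<alpha> 11)(code (flip m) := if s \<in> row (P p) then \<alpha> 11 (code q) else \<alpha> 11 (code p)) \<and>
        \<alpha>' 9 = (\<alpha> 9)(code (flip m) := 1) \<and> (\<forall>j. j \<notin> {9, 10, 11} \<longrightarrow> \<alpha>' j = \<alpha> j))"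
    proof (rule turn_spec)
      show "code (flip m) \<noteq> code p" "code (flip m) \<noteq> code q" "code (flip m) \<noteq> code m" using mO p q by auto
      show "\<alpha> 11 (code p) < n" "\<alpha> 11 (code q) < n" using rows[OF p] rows[OF q] row_hd[OF inv p] row_hd[OF inv q] by simp_all
    qed (use t s r rows mO p q in auto)
    have "tr (4 * n + 10) merge_step \<rho> \<alpha> (\<lambda>\<rho>' \<alpha>'. (\<forall>r. r \<noteq> 11 \<longrightarrow> \<rho>' r = ?r r) \<and>
        rowis \<alpha>' (code (flip m)) (insert t (insert s (blend (row (P p)) (row (P q)) (row (P m))))) \<and>
        same_rows (code (flip m)) \<alpha> \<alpha>' \<and> \<alpha>' 11 = (\<alpha> 11)(code (flip m) := if s \<in> row (P p) then \<alpha> 11 (code q) else \<alpha> 11 (code p)) \<and>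
        \<alpha>' 9 = (\<alpha> 9)(code (flip m) := 1) \<and> (\<forall>j. j \<notin> {9, 10, 11} \<longrightarrow> \<alpha>' j = \<alpha> j))"
      unfolding tr_def
    proof
      fix c
      have "wp ?T (\<lambda>\<rho>' \<alpha>' c'. ((\<forall>r. r \<noteq> 11 \<longrightarrow> \<rho>' r = ?r r) \<and>
        rowis \<alpha>' (code (flip m)) (insert t (insert s (blend (row (P p)) (row (P q)) (row (P m))))) \<and>
        same_rows (code (flip m)) \<alpha> \<alpha>' \<and> \<alpha>' 11 = (\<alpha> 11)(code (flip m) := if s \<in> row (P p) then \<alpha> 11 (code q) else \<alpha> 11 (code p)) \<and>
        \<alpha>' 9 = (\<alpha> 9)(code (flip m) := 1) \<and> (\<forall>j. j \<notin> {9, 10, 11} \<longrightarrow> \<alpha>' j = \<alpha> j)) \<and> c' \<le> c + (4 * n + 10)) ?r \<alpha> (c + 4)"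
        by (rule tr_wp[OF turn]) auto
      moreover have "\<alpha> 9 (2 * s) \<noteq> \<alpha> 9 (Suc (2 * s))" "\<alpha> 10 (code p * n + s) \<noteq> \<alpha> 10 (code q * n + s)"
        using T by (auto simp: o' v)
      ultimately show "wp merge_step (\<lambda>\<rho>' \<alpha>' c'. ((\<forall>r. r \<noteq> 11 \<longrightarrow> \<rho>' r = ?r r) \<and>
        rowis \<alpha>' (code (flip m)) (insert t (insert s (blend (row (P p)) (row (P q)) (row (P m))))) \<and>
        same_rows (code (flip m)) \<alpha> \<alpha>' \<and> \<alpha>' 11 = (\<alpha> 11)(code (flip m) := if s \<in> row (P p) then \<alpha> 11 (code q) else \<alpha> 11 (code p)) \<and>
        \<alpha>' 9 = (\<alpha> 9)(code (flip m) := 1) \<and> (\<forall>j. j \<notin> {9, 10, 11} \<longrightarrow> \<alpha>' j = \<alpha> j)) \<and> c' \<le> c + (4 * n + 10)) \<rho> \<alpha> c"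
        unfolding merge_step_def using r s cl cm by (simp add: numeral_eq_Suc)
    qed
    then show ?thesis
    proof (rule tr_weaken, goal_cases)
      case (2 \<rho>1 \<alpha>1)
      have "fst m = s" by (simp add: m_def)
      moreover have "(if s \<in> row (P p) then \<alpha> 11 (code q) else \<alpha> 11 (code p)) = \<alpha>0' 11 (code (if s \<in> row (P p) then q else p))"
        using rows[OF p] rows[OF q] by simp
      ultimately show ?case using 2 mX True by (auto intro!: bexI[of _ m])
    qed (use True in simp)
  qed
qed

end

context search_run begin

lemma card_Ou: "sinv Ou P B dn \<alpha> \<Longrightarrow> finite Ou \<and> card Ou \<le> 2 * n \<and> finite dn \<and> card dn \<le> n"
proof -
  assume inv: "sinv Ou P B dn \<alpha>"
  have f: "finite Ou" using sinvD(8)[OF inv] finite_Nd finite_subset by blast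
  have "code ` Ou \<subseteq> {..<2 * n}" using sinvD(8)[OF inv] nodes_less code_less by blast
  moreover have "inj_on code Ou" by (rule inj_onI) simp
  ultimately have "card Ou \<le> 2 * n" using card_inj_on_le[of code Ou "{..<2 * n}"] by simp
  moreover have "dn \<subseteq> {..<n}" using sinvD(7)[OF inv] two_less by blast
  ultimately show ?thesis using f finite_subset[of dn "{..<n}"] card_mono[of "{..<n}" dn] by simp
qed

text \<open>The cost depends on how many nodes become even, which \<open>tr\<close> cannot express;
  hence the formulation with \<open>wp\<close> and an arbitrary postcondition.\<close>

lemma merge_spec:
  assumes inv: "sinv Ou P B dn \<alpha>" and ap: "applicable Ou dn 0 t" and r: "\<rho> 3 = t"
    and Q: "\<And>\<rho>' \<alpha>' c' Ou' P' B' dn'. \<forall>r<2. \<rho>' r = \<rho> r \<Longrightarrow> sinv Ou' P' B' dn' \<alpha>' \<Longrightarrow>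
      card Ou + card dn < card Ou' + card dn' \<Longrightarrow> card Ou \<le> card Ou' \<Longrightarrow>
      c' \<le> c + (4 * n + 4) + (card Ou' - card Ou) * (4 * n + 10) \<Longrightarrow> Q \<rho>' \<alpha>' c'"
  shows "wp merge_prog Q \<rho> \<alpha> c"
proof -
  have tw: "two t" and t: "t < n" and tdn: "t \<notin> dn" using ap two_less by (auto simp: applicable_def)
  define p q where "p = pt t 0" and "q = pt t (Suc 0)"
  have pq: "p \<in> Ou" "q \<in> Ou" "edge t p q" using ap pt_edge[OF tw] by (auto simp: applicable_def p_def q_def)
  define X where "X = {m \<in> Ou. flip m \<notin> Ou \<and> (fst m \<in> row (P p)) \<noteq> (fst m \<in> row (P q))}"
  define N where "N m = insert t (insert (fst m) (blend (row (P p)) (row (P q)) (row (P m))))" for m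
  define H where "H m = \<alpha> 11 (code (if fst m \<in> row (P p) then q else p))" for m :: "nat \<times> bool"
  from search_merge[OF sinvD(1)[OF inv] pq, folded X_def] obtain P' B' where
    M: "search_state nodes flip edge entry (Ou \<union> flip ` X) P' B'" "\<forall>x\<in>Ou. P' x = P x"
      "\<forall>x\<in>Ou. \<forall>y\<in>Ou. B x = B y \<longrightarrow> B' x = B' y" "B' p = B' q"
      "\<forall>m\<in>X. row (P' (flip m)) = N m \<and> hd (P' (flip m)) = hd (P (if fst m \<in> row (P p) then q else p))"
    unfolding N_def by blast
  have fO: "finite Ou" "finite dn" using card_Ou[OF inv] by auto
  have XO: "X \<subseteq> Ou" "\<And>m. m \<in> X \<Longrightarrow> flip m \<notin> Ou" by (auto simp: X_def)
  have fX: "finite X" using XO(1) fO finite_subset by blast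
  have n8: "\<alpha> 8 (2 * t) = code p" "\<alpha> 8 (Suc (2 * t)) = code q"
    using pt_code[OF t] sinvD(2)[OF inv, of 8] by (simp_all add: p_def q_def)
  have cl: "code p < 2 * n" "code q < 2 * n" using code_less pt_less by (auto simp: p_def q_def)
  let ?r = "\<rho>(7 := code p, 8 := code q)" and ?a = "\<alpha>(12 := (\<alpha> 12)(t := 1))"
  define Xi where "Xi i = {m \<in> X. fst m < i}" for i
  have Xn: "Xi n = X"
    using XO(1) sinvD(8)[OF inv] nodes_less unfolding Xi_def by blast
  have XiS: "Xi (Suc i) = Xi i \<union> {m \<in> X. fst m = i}" for i by (auto simp: Xi_def)
  \<comment> \<open>Two different nodes over one vertex are mates, but the mate of a node in
    \<open>X\<close> is not even.\<close>
  have uniq: "m = m'" if "m \<in> X" "m' \<in> X" "fst m = fst m'" for m m'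
  proof (rule ccontr)
    assume "m \<noteq> m'"
    then have "m' = flip m" using that(3) by (cases m; cases m') (auto simp: flip_def)
    then have "flip m \<in> Ou" using XO(1) that(2) by blast
    then show False using XO(2)[OF that(1)] by simp
  qed
  define J where "J i \<rho>' \<alpha>' c' \<longleftrightarrow> (\<forall>r. r \<notin> {10, 11, 12, 13} \<longrightarrow> \<rho>' r = ?r r) \<and> (\<forall>j. j \<notin> {9, 10, 11} \<longrightarrow> \<alpha>' j = ?a j) \<and>
    (\<forall>y. fst y < n \<longrightarrow> \<alpha>' 9 (code y) = of_bool (y \<in> Ou \<union> flip ` Xi i)) \<and>
    (\<forall>y\<in>Ou. rowis \<alpha>' (code y) (row (P y)) \<and> \<alpha>' 11 (code y) = \<alpha> 11 (code y)) \<and>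
    (\<forall>m\<in>Xi i. rowis \<alpha>' (code (flip m)) (N m) \<and> \<alpha>' 11 (code (flip m)) = H m) \<and>
    c' \<le> c + 3 + 4 * i + card (Xi i) * (4 * n + 10)" for i \<rho>' \<alpha>' and c' :: nat
  have pre: "tr 3 (Put 12 (Var 3) (Cst 1) ;; Set 7 (Arr 8 (Mul (Cst 2) (Var 3))) ;; Set 8 (Arr 8 (Add (Mul (Cst 2) (Var 3)) (Cst 1)))) \<rho> \<alpha>
      (\<lambda>\<rho>' \<alpha>'. \<rho>' = ?r \<and> \<alpha>' = ?a)"
    using r n8 cl by (intro tr_straight) simp
  show ?thesis
    unfolding merge_prog_def wp.simps(4)[of "Put 12 (Var 3) (Cst 1) ;; Set 7 (Arr 8 (Mul (Cst 2) (Var 3))) ;; Set 8 (Arr 8 (Add (Mul (Cst 2) (Var 3)) (Cst 1)))"]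
  proof (rule tr_wp[OF pre])
    fix \<rho>1 \<alpha>1 c1 assume 1: "\<rho>1 = ?r \<and> \<alpha>1 = ?a" "c1 \<le> c + 3"
    show "wp (For 10 1 0 merge_step) Q \<rho>1 \<alpha>1 c1"
    proof (rule wp_For[where J = J])
      have "\<alpha> 9 (code y) = of_bool (y \<in> Ou)" if "fst y < n" for y using sinvD(3)[OF inv that] .
      moreover have "Xi 0 = {}" by (simp add: Xi_def)
      ultimately show "J 0 \<rho>1 \<alpha>1 c1" using 1 sinvD(4)[OF inv] unfolding J_def by simp
    next
      fix i \<rho>2 \<alpha>2 c2 assume i': "i < 1 * n + 0" and JJ: "J i \<rho>2 \<alpha>2 c2"
      then have i: "i < n" by simp
      have J1: "\<forall>r. r \<notin> {10, 11, 12, 13} \<longrightarrow> \<rho>2 r = ?r r" "\<forall>j. j \<notin> {9, 10, 11} \<longrightarrow> \<alpha>2 j = ?a j"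
        and J2: "\<And>y. fst y < n \<Longrightarrow> \<alpha>2 9 (code y) = of_bool (y \<in> Ou \<union> flip ` Xi i)"
        and J3: "\<And>y. y \<in> Ou \<Longrightarrow> rowis \<alpha>2 (code y) (row (P y)) \<and> \<alpha>2 11 (code y) = \<alpha> 11 (code y)"
        and J4: "\<And>m. m \<in> Xi i \<Longrightarrow> rowis \<alpha>2 (code (flip m)) (N m) \<and> \<alpha>2 11 (code (flip m)) = H m"
        and J5: "c2 \<le> c + 3 + 4 * i + card (Xi i) * (4 * n + 10)"
        using JJ unfolding J_def by blast+
      \<comment> \<open>So far only mates over vertices below \<open>i\<close> have been added, so
        the marks over \<open>i\<close> are unchanged.\<close>
      have o: "\<alpha>2 9 (code (i, b)) = of_bool ((i, b) \<in> Ou)" for b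
      proof -
        have "(i, b) \<notin> flip ` Xi i"
        proof
          assume "(i, b) \<in> flip ` Xi i"
          then obtain m where "m \<in> Xi i" "(i, b) = flip m" by blast
          then have "fst m = i" by (metis fst_conv fst_flip)
          then show False using \<open>m \<in> Xi i\<close> by (simp add: Xi_def)
        qed
        then show ?thesis using J2[of "(i, b)"] i by simp
      qed
      have rr: "(\<rho>2(10 := i)) 3 = t" "(\<rho>2(10 := i)) 10 = i" "(\<rho>2(10 := i)) 7 = code p" "(\<rho>2(10 := i)) 8 = code q"
        using J1(1) r by simp_all
      note step = merge_step_spec[OF inv pq(1,2) t rr(1) i rr(2,3,4) X_def o J3]
      show "wp merge_step (J (Suc i)) (\<rho>2(10 := i)) \<alpha>2 (c2 + 1)"
      proof (rule tr_wp[OF step])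
        fix \<rho>3 \<alpha>3 c3
        assume post: "(\<forall>r. r \<notin> {11, 12, 13} \<longrightarrow> \<rho>3 r = (\<rho>2(10 := i)) r) \<and> (\<forall>j. j \<notin> {9, 10, 11} \<longrightarrow> \<alpha>3 j = \<alpha>2 j) \<and>
          (if i \<in> fst ` X then \<exists>m\<in>X. fst m = i \<and> rowis \<alpha>3 (code (flip m)) (insert t (insert i (blend (row (P p)) (row (P q)) (row (P m))))) \<and>
            same_rows (code (flip m)) \<alpha>2 \<alpha>3 \<and> \<alpha>3 11 = (\<alpha>2 11)(code (flip m) := \<alpha> 11 (code (if i \<in> row (P p) then q else p))) \<and>
            \<alpha>3 9 = (\<alpha>2 9)(code (flip m) := 1)
          else \<alpha>3 = \<alpha>2)" and c3: "c3 \<le> c2 + 1 + (if i \<in> fst ` X then 4 * n + 10 else 3)"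
        have R: "\<forall>r. r \<notin> {10, 11, 12, 13} \<longrightarrow> \<rho>3 r = ?r r" "\<forall>j. j \<notin> {9, 10, 11} \<longrightarrow> \<alpha>3 j = ?a j"
          using post J1 by simp_all
        show "J (Suc i) \<rho>3 \<alpha>3 c3"
        proof (cases "i \<in> fst ` X")
          case False
          then have "Xi (Suc i) = Xi i" unfolding XiS by force
          moreover have "\<alpha>3 = \<alpha>2" using post False by simp
          ultimately show ?thesis using R J2 J3 J4 J5 c3 False unfolding J_def by simp
        next
          case True
          then obtain m where m: "m \<in> X" "fst m = i" "rowis \<alpha>3 (code (flip m)) (N m)" "same_rows (code (flip m)) \<alpha>2 \<alpha>3"
            "\<alpha>3 11 = (\<alpha>2 11)(code (flip m) := H m)" "\<alpha>3 9 = (\<alpha>2 9)(code (flip m) := 1)"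
            using post unfolding N_def H_def by auto
          have "{m' \<in> X. fst m' = i} = {m}" using uniq m(1,2) by blast
          then have XS: "Xi (Suc i) = insert m (Xi i)" unfolding XiS by simp
          have mn: "m \<notin> Xi i" using m(2) by (simp add: Xi_def)
          have "finite (Xi i)" using fX by (simp add: Xi_def)
          then have cX: "card (Xi (Suc i)) = Suc (card (Xi i))" unfolding XS using mn by simp
          have ne: "code y \<noteq> code (flip m)" if "y \<in> Ou" for y using XO(2)[OF m(1)] that by auto
          have ne': "code (flip m') \<noteq> code (flip m)" if "m' \<in> Xi i" for m' using that mn by auto
          have c: "c3 \<le> c + 3 + 4 * Suc i + card (Xi (Suc i)) * (4 * n + 10)"
            unfolding cX using c3 True J5 by simp
          have r9: "\<alpha>3 9 (code y) = of_bool (y \<in> Ou \<union> flip ` Xi (Suc i))" if "fst y < n" for y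
            using J2[OF that] m(6) unfolding XS by auto
          have rO: "rowis \<alpha>3 (code y) (row (P y)) \<and> \<alpha>3 11 (code y) = \<alpha> 11 (code y)" if "y \<in> Ou" for y
            using J3[OF that] same_rowis[OF m(4) ne[OF that]] m(5) ne[OF that] by simp
          have rX: "rowis \<alpha>3 (code (flip m')) (N m') \<and> \<alpha>3 11 (code (flip m')) = H m'" if "m' \<in> Xi (Suc i)" for m'
          proof (cases "m' = m")
            case False
            then have "m' \<in> Xi i" using that unfolding XS by simp
            then show ?thesis using J4 same_rowis[OF m(4) ne'] m(5) ne' by simp
          qed (use m(3,5) in simp)
          show ?thesis unfolding J_def using R r9 rO rX c by blast
        qed
      qed
    next
      fix \<rho>2 \<alpha>2 c2 assume "J (1 * n + 0) \<rho>2 \<alpha>2 c2"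
      then have J1: "\<forall>r. r \<notin> {10, 11, 12, 13} \<longrightarrow> \<rho>2 r = ?r r" "\<forall>j. j \<notin> {9, 10, 11} \<longrightarrow> \<alpha>2 j = ?a j"
        and J2: "\<And>y. fst y < n \<Longrightarrow> \<alpha>2 9 (code y) = of_bool (y \<in> Ou \<union> flip ` X)"
        and J3: "\<And>y. y \<in> Ou \<Longrightarrow> rowis \<alpha>2 (code y) (row (P y)) \<and> \<alpha>2 11 (code y) = \<alpha> 11 (code y)"
        and J4: "\<And>m. m \<in> X \<Longrightarrow> rowis \<alpha>2 (code (flip m)) (N m) \<and> \<alpha>2 11 (code (flip m)) = H m"
        and J5: "c2 \<le> c + 3 + 4 * n + card X * (4 * n + 10)"
        unfolding J_def mult_1 add_0_right Xn by blast+
      have S: "sinv (Ou \<union> flip ` X) P' B' (insert t dn) \<alpha>2"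
        unfolding sinv_def
      proof (intro conjI)
        show "search_state nodes flip edge entry (Ou \<union> flip ` X) P' B'" by (fact M(1))
        show "\<forall>j<9. \<alpha>2 j = \<alpha>0 j" using J1(2) sinvD(2)[OF inv] by simp
        show "\<forall>m<2 * n. \<alpha>2 9 m = of_bool (m \<in> code ` (Ou \<union> flip ` X))"
        proof (intro allI impI)
          fix m assume m: "m < 2 * n"
          let ?y = "(m div 2, odd m)"
          have c: "code ?y = m" by (simp add: code_def)
          have "fst ?y < n" using m by simp
          then have "\<alpha>2 9 m = of_bool (?y \<in> Ou \<union> flip ` X)" using J2[of ?y] c by simp
          moreover have "inj code" by (rule injI) simp
          then have "m \<in> code ` (Ou \<union> flip ` X) \<longleftrightarrow> ?y \<in> Ou \<union> flip ` X" using inj_image_mem_iff[of code ?y] c by simp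
          ultimately show "\<alpha>2 9 m = of_bool (m \<in> code ` (Ou \<union> flip ` X))" by simp
        qed
        show "\<forall>t'<n. \<alpha>2 12 t' = of_bool (t' \<in> insert t dn)" using J1(2) sinvD(6)[OF inv] by simp
        show "insert t dn \<subseteq> Collect two" using tw sinvD(7)[OF inv] by simp
        have "\<forall>t\<in>dn. pt t 0 \<in> Ou \<and> pt t (Suc 0) \<in> Ou \<and> B (pt t 0) = B (pt t (Suc 0))" using inv by (simp add: sinv_def)
        then show "\<forall>t'\<in>insert t dn. pt t' 0 \<in> Ou \<union> flip ` X \<and> pt t' (Suc 0) \<in> Ou \<union> flip ` X \<and> B' (pt t' 0) = B' (pt t' (Suc 0))"
          using M(3,4) pq(1,2) unfolding p_def q_def by blast
        show "\<forall>y\<in>Ou \<union> flip ` X. rowis \<alpha>2 (code y) (row (P' y)) \<and> \<alpha>2 11 (code y) = fst (snd (hd (P' y)))"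
        proof
          fix y assume "y \<in> Ou \<union> flip ` X"
          then consider "y \<in> Ou" | m where "m \<in> X" "y = flip m" by blast
          then show "rowis \<alpha>2 (code y) (row (P' y)) \<and> \<alpha>2 11 (code y) = fst (snd (hd (P' y)))"
          proof cases
            case 1
            then show ?thesis using J3[OF 1] M(2) sinvD(5)[OF inv 1] by simp
          next
            case 2
            have "H m = fst (snd (hd (P (if fst m \<in> row (P p) then q else p))))"
              using sinvD(5)[OF inv pq(1)] sinvD(5)[OF inv pq(2)] by (simp add: H_def)
            then show ?thesis using J4[OF 2(1)] M(5) 2 by simp
          qed
        qed
      qed
      have "card (flip ` X) = card X" by (rule card_image) (rule inj_onI, simp)
      moreover have "Ou \<inter> flip ` X = {}" using XO(2) by blast
      ultimately have cO: "card (Ou \<union> flip ` X) = card Ou + card X" using fO fX by (simp add: card_Un_disjoint)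
      have cd: "card (insert t dn) = Suc (card dn)" using fO tdn by simp
      show "Q (\<rho>2(10 := 1 * n + 0)) \<alpha>2 (c2 + 1)"
        by (rule Q[OF _ S]) (use J1(1) cO cd J5 in simp_all)
    qed
  qed
qed

lemma act_spec:
  assumes inv: "sinv Ou P B dn \<alpha>" and ap: "\<rho> 4 = Suc t" "applicable Ou dn (\<rho> 5) t"
    and Q: "\<And>\<rho>' \<alpha>' c' Ou' P' B' dn'. \<forall>r<2. \<rho>' r = \<rho> r \<Longrightarrow> sinv Ou' P' B' dn' \<alpha>' \<Longrightarrow>
      card Ou + card dn < card Ou' + card dn' \<Longrightarrow> card Ou \<le> card Ou' \<Longrightarrow>
      c' \<le> c + (4 * n + 13) + (card Ou' - card Ou) * (4 * n + 10) \<Longrightarrow> Q \<rho>' \<alpha>' c'"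
  shows "wp act_prog Q \<rho> \<alpha> c"
proof -
  have t: "t < n" using ap two_less by (auto simp: applicable_def)
  show ?thesis
  proof (cases "\<rho> 5 = 0")
    case True
    have "wp merge_prog Q (\<rho>(3 := t)) \<alpha> (c + 3)"
    proof (rule merge_spec[OF inv])
      show "applicable Ou dn 0 t" using ap True by simp
      fix \<rho>' \<alpha>' c' Ou' P' B' dn'
      assume a: "\<forall>r<2. \<rho>' r = (\<rho>(3 := t)) r" "sinv Ou' P' B' dn' \<alpha>'" "card Ou + card dn < card Ou' + card dn'" "card Ou \<le> card Ou'"
        and c': "c' \<le> c + 3 + (4 * n + 4) + (card Ou' - card Ou) * (4 * n + 10)"
      show "Q \<rho>' \<alpha>' c'"
      proof (rule Q[OF _ a(2-4)])
        show "c' \<le> c + (4 * n + 13) + (card Ou' - card Ou) * (4 * n + 10)" using c' by linarith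
      qed (use a(1) in simp)
    qed simp
    then show ?thesis unfolding act_prog_def using ap True t by (simp add: numeral_3_eq_3)
  next
    case False
    have "tr (2 * n + 10) grow_prog (\<rho>(3 := t)) \<alpha> (\<lambda>\<rho>' \<alpha>'. (\<forall>r<2. \<rho>' r = (\<rho>(3 := t)) r) \<and>
        (\<exists>Ou' P' B'. sinv Ou' P' B' dn \<alpha>' \<and> card Ou < card Ou'))"
      by (rule grow_spec[OF inv ap(2) False]) simp_all
    then have "wp grow_prog Q (\<rho>(3 := t)) \<alpha> (c + 3)"
    proof (rule tr_wp)
      fix \<rho>' \<alpha>' c' assume a: "(\<forall>r<2. \<rho>' r = (\<rho>(3 := t)) r) \<and> (\<exists>Ou' P' B'. sinv Ou' P' B' dn \<alpha>' \<and> card Ou < card Ou')"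
        and c: "c' \<le> c + 3 + (2 * n + 10)"
      then obtain Ou' P' B' where w: "sinv Ou' P' B' dn \<alpha>'" "card Ou < card Ou'" by blast
      show "Q \<rho>' \<alpha>' c'" by (rule Q[OF _ w(1)]) (use a c w(2) in simp_all)
    qed
    then show ?thesis unfolding act_prog_def using ap False t by (simp add: numeral_3_eq_3)
  qed
qed

text \<open>An amortised bound: the writing of rows in a merge is charged to the nodes that become
  even, through \<open>card Ou * (4 * n + 10)\<close> in the invariant. A round itself costs
  \<open>13 * n + 16\<close>: one for the iteration, \<open>9 * n + 2\<close> for the scan,
  \<open>4 * n + 13\<close> for the action.\<close>

lemma rounds_spec:
  assumes inv: "sinv Ou P B dn \<alpha>"
  shows "tr ((3 * n + 1) * (13 * n + 16) + 2 * n * (4 * n + 10) + 1) rounds_prog \<rho> \<alpha> (\<lambda>\<rho>' \<alpha>'. (\<forall>r<2. \<rho>' r = \<rho> r) \<and>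
    (\<exists>Ou P B dn. sinv Ou P B dn \<alpha>' \<and> (\<forall>k. \<forall>t<n. \<not> applicable Ou dn k t)))"
  unfolding tr_def
proof
  fix c
  define J where "J i \<rho>' \<alpha>' c' \<longleftrightarrow> (\<forall>r<2. \<rho>' r = \<rho> r) \<and> (\<exists>Ou P B dn. sinv Ou P B dn \<alpha>' \<and>
    (i \<le> card Ou + card dn \<or> (\<forall>k. \<forall>t<n. \<not> applicable Ou dn k t)) \<and>
    c' \<le> c + i * (13 * n + 16) + card Ou * (4 * n + 10))" for i \<rho>' \<alpha>' and c' :: nat
  show "wp rounds_prog (\<lambda>\<rho>' \<alpha>' c'. ((\<forall>r<2. \<rho>' r = \<rho> r) \<and>
      (\<exists>Ou P B dn. sinv Ou P B dn \<alpha>' \<and> (\<forall>k. \<forall>t<n. \<not> applicable Ou dn k t))) \<and>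
      c' \<le> c + ((3 * n + 1) * (13 * n + 16) + 2 * n * (4 * n + 10) + 1)) \<rho> \<alpha> c"
    unfolding rounds_prog_def
  proof (rule wp_For[where J = J])
    show "J 0 \<rho> \<alpha> c" unfolding J_def using inv by (intro conjI exI[of _ Ou] exI[of _ P] exI[of _ B] exI[of _ dn]) auto
  next
    fix i \<rho>1 \<alpha>1 c1 assume "J i \<rho>1 \<alpha>1 c1"
    then obtain Ou P B dn where r1: "\<forall>r<2. \<rho>1 r = \<rho> r" and inv1: "sinv Ou P B dn \<alpha>1"
      and pr: "i \<le> card Ou + card dn \<or> (\<forall>k. \<forall>t<n. \<not> applicable Ou dn k t)"
      and c1: "c1 \<le> c + i * (13 * n + 16) + card Ou * (4 * n + 10)" unfolding J_def by blast
    show "wp (scan_prog ;; act_prog) (J (Suc i)) (\<rho>1(16 := i)) \<alpha>1 (c1 + 1)"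
      unfolding wp.simps(4)
    proof (rule tr_wp[OF scan_spec[OF inv1]])
      fix \<rho>2 \<alpha>2 c2
      assume s: "\<alpha>2 = \<alpha>1 \<and> (\<forall>r<2. \<rho>2 r = (\<rho>1(16 := i)) r) \<and> (\<rho>2 4 = 0 \<and> (\<forall>k. \<forall>t<n. \<not> applicable Ou dn k t) \<or>
          (\<exists>t<n. \<rho>2 4 = Suc t \<and> applicable Ou dn (\<rho>2 5) t))" and c2: "c2 \<le> c1 + 1 + (9 * n + 2)"
      have r2: "\<forall>r<2. \<rho>2 r = \<rho> r" and a2: "\<alpha>2 = \<alpha>1" using s r1 by simp_all
      show "wp act_prog (J (Suc i)) \<rho>2 \<alpha>2 c2"
      proof (cases "\<rho>2 4 = 0")
        case True
        then have "\<forall>k. \<forall>t<n. \<not> applicable Ou dn k t" using s by auto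
        moreover have "c2 + 2 \<le> c + Suc i * (13 * n + 16) + card Ou * (4 * n + 10)" using c1 c2 by simp
        ultimately have "J (Suc i) \<rho>2 \<alpha>2 (c2 + 2)" unfolding J_def using r2 a2 inv1 by blast
        then show ?thesis unfolding act_prog_def using True by simp
      next
        case False
        then obtain t where t: "t < n" "\<rho>2 4 = Suc t" "applicable Ou dn (\<rho>2 5) t" using s by auto
        show ?thesis unfolding a2
        proof (rule act_spec[OF inv1 t(2,3)])
          fix \<rho>3 \<alpha>3 c3 Ou' P' B' dn'
          assume 3: "\<forall>r<2. \<rho>3 r = \<rho>2 r" "sinv Ou' P' B' dn' \<alpha>3" "card Ou + card dn < card Ou' + card dn'" "card Ou \<le> card Ou'"
            "c3 \<le> c2 + (4 * n + 13) + (card Ou' - card Ou) * (4 * n + 10)"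
          have "card Ou' * (4 * n + 10) = card Ou * (4 * n + 10) + (card Ou' - card Ou) * (4 * n + 10)"
            using 3(4) by (metis add_mult_distrib le_add_diff_inverse)
          then have c3: "c3 \<le> c + Suc i * (13 * n + 16) + card Ou' * (4 * n + 10)" using 3(5) c2 c1 by simp
          have "i \<le> card Ou + card dn" using pr t by blast
          then have "Suc i \<le> card Ou' + card dn'" using 3(3) by simp
          moreover have "\<forall>r<2. \<rho>3 r = \<rho> r" using 3(1) r2 by simp
          ultimately show "J (Suc i) \<rho>3 \<alpha>3 c3" unfolding J_def using 3(2) c3 by blast
        qed
      qed
    qed
  next
    fix \<rho>1 \<alpha>1 c1 assume "J (3 * n + 1) \<rho>1 \<alpha>1 c1"
    then obtain Ou P B dn where r1: "\<forall>r<2. \<rho>1 r = \<rho> r" and inv1: "sinv Ou P B dn \<alpha>1"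
      and pr: "3 * n + 1 \<le> card Ou + card dn \<or> (\<forall>k. \<forall>t<n. \<not> applicable Ou dn k t)"
      and c1: "c1 \<le> c + (3 * n + 1) * (13 * n + 16) + card Ou * (4 * n + 10)" unfolding J_def by blast
    have "card Ou * (4 * n + 10) \<le> 2 * n * (4 * n + 10)" using card_Ou[OF inv1] by (intro mult_le_mono1) simp
    moreover have "\<forall>k. \<forall>t<n. \<not> applicable Ou dn k t" using pr card_Ou[OF inv1] by auto
    moreover have "\<forall>r<2. (\<rho>1(16 := 3 * n + 1)) r = \<rho> r" using r1 by simp
    ultimately show "((\<forall>r<2. (\<rho>1(16 := 3 * n + 1)) r = \<rho> r) \<and>
        (\<exists>Ou P B dn. sinv Ou P B dn \<alpha>1 \<and> (\<forall>k. \<forall>t<n. \<not> applicable Ou dn k t))) \<and>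
        c1 + 1 \<le> c + ((3 * n + 1) * (13 * n + 16) + 2 * n * (4 * n + 10) + 1)" using inv1 c1 by (intro conjI) (blast, blast, linarith)
  qed
qed

lemma roots_spec:
  assumes a0: "\<forall>j<9. \<alpha> j = \<alpha>0 j"
  shows "tr (n * (2 * n + 13) + 3) roots_prog \<rho> \<alpha> (\<lambda>\<rho>' \<alpha>'. (\<forall>r<2. \<rho>' r = \<rho> r) \<and> (\<exists>Ou P B. sinv Ou P B {} \<alpha>'))"
  unfolding roots_prog_def
proof (rule tr_Seq[where k = "4 * n + 1" and k' = "n * (2 * n + 9) + 2" and M = "\<lambda>\<rho>' \<alpha>'. (\<forall>r<2. \<rho>' r = \<rho> r) \<and> (\<forall>j<9. \<alpha>' j = \<alpha>0 j) \<and>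
    (\<forall>m<2 * n. \<alpha>' 9 m = 0)"], goal_cases)
  case 1
  show ?case
    by (rule tr_For'[where k = 1 and J = "\<lambda>i \<rho>' \<alpha>'. (\<forall>r<2. \<rho>' r = \<rho> r) \<and> (\<forall>j<9. \<alpha>' j = \<alpha>0 j) \<and> (\<forall>m<i. \<alpha>' 9 m = 0)"])
      (use a0 in \<open>auto intro!: tr_straight simp: less_Suc_eq\<close>)
next
  case (2 \<rho>1 \<alpha>1)
  show ?case
  proof (rule tr_Seq[where k = "2 * n + 1" and k' = "n * (2 * n + 7) + 1" and M = "\<lambda>\<rho>' \<alpha>'. (\<forall>r<2. \<rho>' r = \<rho> r) \<and> (\<forall>j<9. \<alpha>' j = \<alpha>0 j) \<and>
      (\<forall>m<2 * n. \<alpha>' 9 m = 0) \<and> (\<forall>t<n. \<alpha>' 12 t = 0)"], goal_cases)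
    case 1
    show ?case
      by (rule tr_For'[where k = 1 and J = "\<lambda>i \<rho>' \<alpha>'. (\<forall>r<2. \<rho>' r = \<rho> r) \<and> (\<forall>j<9. \<alpha>' j = \<alpha>0 j) \<and> (\<forall>m<2 * n. \<alpha>' 9 m = 0) \<and> (\<forall>t<i. \<alpha>' 12 t = 0)"])
        (use 2 in \<open>auto intro!: tr_straight simp: less_Suc_eq\<close>)
  next
    case (2 \<rho>2 \<alpha>2)
    show ?case
    proof (rule tr_For'[where k = "2 * n + 6" and J = "\<lambda>i \<rho>' \<alpha>'. (\<forall>r<2. \<rho>' r = \<rho> r) \<and> (\<forall>j<9. \<alpha>' j = \<alpha>0 j) \<and>
        (\<forall>m<2 * n. \<alpha>' 9 m = of_bool (\<exists>s<i. has_initial s \<and> m = Suc (2 * s))) \<and> (\<forall>t<n. \<alpha>' 12 t = 0) \<and>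
        (\<forall>s<i. has_initial s \<longrightarrow> rowis \<alpha>' (Suc (2 * s)) {s} \<and> \<alpha>' 11 (Suc (2 * s)) = s)"], goal_cases)
      case (2 s \<rho>3 \<alpha>3)
      then have s: "s < n" and r3: "\<forall>r<2. \<rho>3 r = \<rho> r" and a3: "\<forall>j<9. \<alpha>3 j = \<alpha>0 j"
        and o3: "\<forall>m<2 * n. \<alpha>3 9 m = of_bool (\<exists>x<s. has_initial x \<and> m = Suc (2 * x))" and d3: "\<forall>t<n. \<alpha>3 12 t = 0"
        and w3: "\<forall>x<s. has_initial x \<longrightarrow> rowis \<alpha>3 (Suc (2 * x)) {x} \<and> \<alpha>3 11 (Suc (2 * x)) = x" by simp_all
      let ?k = "Suc (2 * s)"
      have h: "\<alpha>3 6 s = of_bool (has_initial s)" using a3 st3 s by (simp add: st3_def)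
      show ?case
      proof (cases "has_initial s")
        case False
        then have "(\<exists>x<Suc s. has_initial x \<and> m = Suc (2 * x)) \<longleftrightarrow> (\<exists>x<s. has_initial x \<and> m = Suc (2 * x))" for m
          by (auto simp: less_Suc_eq)
        moreover have "\<forall>x<Suc s. has_initial x \<longrightarrow> rowis \<alpha>3 (Suc (2 * x)) {x} \<and> \<alpha>3 11 (Suc (2 * x)) = x"
          using w3 False less_Suc_eq by blast
        ultimately show ?thesis using False h s r3 a3 o3 d3 by (intro tr_straight) simp
      next
        case True
        let ?body = "For 11 1 0 (Put 10 (Add (Mul (Add (Mul (Cst 2) (Var 10)) (Cst 1)) Size) (Var 11)) (Cst 0)) ;;
       Put 10 (Add (Mul (Add (Mul (Cst 2) (Var 10)) (Cst 1)) Size) (Var 10)) (Cst 1) ;;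
       Put 11 (Add (Mul (Cst 2) (Var 10)) (Cst 1)) (Var 10) ;;
       Put 9 (Add (Mul (Cst 2) (Var 10)) (Cst 1)) (Cst 1)"
        let ?post = "\<lambda>\<rho>' \<alpha>'. (\<forall>r<2. \<rho>' r = \<rho> r) \<and> rowis \<alpha>' ?k {s} \<and> same_rows ?k \<alpha>3 \<alpha>' \<and> \<alpha>' 11 = (\<alpha>3 11)(?k := s) \<and> \<alpha>' 9 = (\<alpha>3 9)(?k := 1) \<and>
          (\<forall>j. j \<notin> {9, 10, 11} \<longrightarrow> \<alpha>' j = \<alpha>3 j)"
        have B: "tr (2 * n + 4) ?body (\<rho>3(10 := s)) \<alpha>3 ?post"
        proof (rule tr_Seq[OF row_loop[where c = 1 and k = ?k and A = "{}"], where k' = 3], goal_cases)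
          case (1 y \<rho>4 \<alpha>4)
          then show ?case by (intro tr_straight) simp
        next
          case (2 \<rho>4 \<alpha>4)
          then have r4: "\<rho>4 10 = s" "\<forall>r<2. \<rho>4 r = \<rho> r" and rw: "rowis \<alpha>4 ?k {}" and sr: "same_rows ?k \<alpha>3 \<alpha>4" and a4: "\<forall>j. j \<noteq> 10 \<longrightarrow> \<alpha>4 j = \<alpha>3 j"
            using r3 by simp_all
          have R: "rowis (\<alpha>4(10 := (\<alpha>4 10)(?k * n + s := 1))) ?k {s}" using rowis_upd[OF rw s] .
          have Sm: "same_rows ?k \<alpha>3 (\<alpha>4(10 := (\<alpha>4 10)(?k * n + s := 1)))" using same_rows_upd[OF sr s] .
          have "tr 3 (Put 10 (Add (Mul (Add (Mul (Cst 2) (Var 10)) (Cst 1)) Size) (Var 10)) (Cst 1) ;; Put 11 (Add (Mul (Cst 2) (Var 10)) (Cst 1)) (Var 10) ;;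
              Put 9 (Add (Mul (Cst 2) (Var 10)) (Cst 1)) (Cst 1)) \<rho>4 \<alpha>4
            (\<lambda>\<rho>' \<alpha>'. \<rho>' = \<rho>4 \<and> \<alpha>' = \<alpha>4(10 := (\<alpha>4 10)(?k * n + s := 1), 11 := (\<alpha>3 11)(?k := s), 9 := (\<alpha>3 9)(?k := 1)))"
            using r4 a4 s by (intro tr_straight) simp
          then show ?case
          proof (rule tr_weaken, goal_cases)
            case (2 \<rho>5 \<alpha>5)
            then show ?case using r4 a4 R Sm by simp
          qed simp
        qed simp
        have "tr (2 * n + 6) (If (Eq (Arr 6 (Var 10)) (Cst 1)) ?body Nop) (\<rho>3(10 := s)) \<alpha>3 ?post"
          unfolding tr_def
        proof
          fix c
          have "wp ?body (\<lambda>\<rho>' \<alpha>' c'. ?post \<rho>' \<alpha>' \<and> c' \<le> c + (2 * n + 6)) (\<rho>3(10 := s)) \<alpha>3 (c + 1)"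
            by (rule tr_wp[OF B]) simp
          then show "wp (If (Eq (Arr 6 (Var 10)) (Cst 1)) ?body Nop) (\<lambda>\<rho>' \<alpha>' c'. ?post \<rho>' \<alpha>' \<and> c' \<le> c + (2 * n + 6)) (\<rho>3(10 := s)) \<alpha>3 c"
            unfolding wp.simps(5) using h True by simp
        qed
        then show ?thesis
        proof (rule tr_weaken, goal_cases)
          case (2 \<rho>4 \<alpha>4)
          have "rowis \<alpha>4 (Suc (2 * x)) {x} \<and> \<alpha>4 11 (Suc (2 * x)) = x" if "x < Suc s" "has_initial x" for x
          proof (cases "x = s")
            case False
            then have "x < s" using that by simp
            then show ?thesis using w3 that(2) 2 same_rowis[of ?k \<alpha>3 \<alpha>4 "Suc (2 * x)" "{x}"] by simp
          qed (use 2 in simp)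
          then show ?case using 2 a3 o3 d3 True by (auto simp: less_Suc_eq)
        qed simp
      qed
    next
      case (3 \<rho>3 \<alpha>3)
      let ?O = "{y. snd y \<and> has_initial (fst y)}" and ?P = "\<lambda>y :: nat \<times> bool. [(fst y, y)]"
      have hn: "s < n" if "has_initial s" for s using that wingD(4) S_less by (auto simp: has_initial_def)
      have c: "code y = Suc (2 * fst y)" if "y \<in> ?O" for y using that by (simp add: code_def)
      have "sinv ?O ?P Some {} \<alpha>3"
        unfolding sinv_def
      proof (intro conjI)
        show "search_state nodes flip edge entry ?O ?P Some" by (rule search_init)
        show "\<forall>j<9. \<alpha>3 j = \<alpha>0 j" using 3 by simp
        show "\<forall>m<2 * n. \<alpha>3 9 m = of_bool (m \<in> code ` ?O)"
        proof (intro allI impI)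
          fix m assume "m < 2 * n"
          then have "\<alpha>3 9 m = of_bool (\<exists>s<n. has_initial s \<and> m = Suc (2 * s))" using 3 by simp
          moreover have "(\<exists>s<n. has_initial s \<and> m = Suc (2 * s)) \<longleftrightarrow> m \<in> code ` ?O"
          proof
            assume "\<exists>s<n. has_initial s \<and> m = Suc (2 * s)"
            then obtain s where "has_initial s" "m = Suc (2 * s)" by blast
            then show "m \<in> code ` ?O" by (intro image_eqI[of _ _ "(s, True)"]) (simp_all add: code_def)
          next
            assume "m \<in> code ` ?O"
            then obtain y where "y \<in> ?O" "m = Suc (2 * fst y)" using c by auto
            then show "\<exists>s<n. has_initial s \<and> m = Suc (2 * s)" using hn by auto
          qed
          ultimately show "\<alpha>3 9 m = of_bool (m \<in> code ` ?O)" by simp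
        qed
        show "\<forall>y\<in>?O. rowis \<alpha>3 (code y) (row (?P y)) \<and> \<alpha>3 11 (code y) = fst (snd (hd (?P y)))"
          using 3 c hn by (simp add: row_def labs_def)
        show "\<forall>t<n. \<alpha>3 12 t = of_bool (t \<in> {})" using 3 by simp
      qed simp_all
      then show ?case using 3 by auto
    qed (use 2 in simp_all)
  qed (simp add: algebra_simps)
qed (simp add: algebra_simps)

end

section \<open>The algorithm\<close>

context ram begin

lemma tr_If:
  assumes "okb b \<rho> \<alpha>" "bv b \<rho> \<alpha> \<Longrightarrow> tr k p \<rho> \<alpha> Q" "\<not> bv b \<rho> \<alpha> \<Longrightarrow> tr k q \<rho> \<alpha> Q" "k + 1 \<le> K"
  shows "tr K (If b p q) \<rho> \<alpha> Q"
  unfolding tr_def wp.simps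
proof (intro allI conjI)
  fix c
  have "wp x (\<lambda>\<rho>' \<alpha>' c'. Q \<rho>' \<alpha>' \<and> c' \<le> c + K) \<rho> \<alpha> (c + 1)" if "tr k x \<rho> \<alpha> Q" for x
    by (rule tr_wp[OF that]) (use assms(4) in auto)
  then show "if bv b \<rho> \<alpha> then wp p (\<lambda>\<rho>' \<alpha>' c'. Q \<rho>' \<alpha>' \<and> c' \<le> c + K) \<rho> \<alpha> (c + 1)
    else wp q (\<lambda>\<rho>' \<alpha>' c'. Q \<rho>' \<alpha>' \<and> c' \<le> c + K) \<rho> \<alpha> (c + 1)" using assms(2,3) by simp
qed (fact assms(1))

text \<open>The result is shifted by one so that 0 can mean that nothing was found.\<close>

definition Find :: "bx \<Rightarrow> pr" where
  "Find b = Set 2 (Cst 0) ;; For 10 1 0 (If b (Set 2 (Add (Var 10) (Cst 1))) Nop)"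

lemma tr_Find:
  assumes "\<And>x y. y < n \<Longrightarrow> okb b (\<rho>(2 := x, 10 := y)) \<alpha>"
    and "\<And>x y. y < n \<Longrightarrow> bv b (\<rho>(2 := x, 10 := y)) \<alpha> \<longleftrightarrow> B y"
  shows "tr (3 * n + 2) (Find b) \<rho> \<alpha> (\<lambda>\<rho>' \<alpha>'. \<alpha>' = \<alpha> \<and> (\<forall>r. r \<notin> {2, 10} \<longrightarrow> \<rho>' r = \<rho> r) \<and>
    (\<rho>' 2 = 0 \<and> (\<forall>y<n. \<not> B y) \<or> (\<exists>y<n. \<rho>' 2 = Suc y \<and> B y)))"
  unfolding Find_def
proof (rule tr_Seq[where k = 1 and k' = "3 * n + 1" and M = "\<lambda>\<rho>' \<alpha>'. \<rho>' = \<rho>(2 := 0) \<and> \<alpha>' = \<alpha>"], goal_cases)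
  case 1
  show ?case by (intro tr_straight) simp
next
  case (2 \<rho>1 \<alpha>1)
  show ?case
  proof (rule tr_For'[where k = 2 and J = "\<lambda>i \<rho>' \<alpha>'. \<alpha>' = \<alpha> \<and> (\<forall>r. r \<notin> {2, 10} \<longrightarrow> \<rho>' r = \<rho> r) \<and>
      (\<rho>' 2 = 0 \<and> (\<forall>y<i. \<not> B y) \<or> (\<exists>y<n. \<rho>' 2 = Suc y \<and> B y))"], goal_cases)
    case (2 i \<rho>2 \<alpha>2)
    then have i: "i < n" and a: "\<alpha>2 = \<alpha>" and r: "\<forall>r. r \<notin> {2, 10} \<longrightarrow> \<rho>2 r = \<rho> r"
      and J: "\<rho>2 2 = 0 \<and> (\<forall>y<i. \<not> B y) \<or> (\<exists>y<n. \<rho>2 2 = Suc y \<and> B y)" by simp_all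
    have "\<rho>2(10 := i) = \<rho>(2 := \<rho>2 2, 10 := i)" using r by (auto simp: fun_eq_iff)
    then have b: "okb b (\<rho>2(10 := i)) \<alpha>" "bv b (\<rho>2(10 := i)) \<alpha> \<longleftrightarrow> B i" using assms[OF i] by metis+
    show ?case
    proof (cases "B i")
      case True
      then show ?thesis unfolding a using b i r by (intro tr_straight) auto
    next
      case False
      then have "\<rho>2 2 = 0 \<and> (\<forall>y<Suc i. \<not> B y) \<or> (\<exists>y<n. \<rho>2 2 = Suc y \<and> B y)" using J by (auto simp: less_Suc_eq)
      then show ?thesis unfolding a using b r False by (intro tr_straight) simp
    qed
  qed (use 2 in auto)
qed simp

text \<open>Variable 4 makes sure that at most one vertex is added. Arrays 1 and 2 still describe
  the cover at the beginning of the phase, as \<open>start\<close> and \<open>filler\<close>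
  require.\<close>

definition add_prog :: "nat \<Rightarrow> nat \<Rightarrow> pr" where
  "add_prog k r = Set 4 (Cst 0) ;; For 10 1 0
    (If (And (Eq (Var 4) (Cst 0)) (And (Eq (Arr 1 (Var 10)) (Cst k)) (Eq (Arr 2 (Mul (Cst 2) (Var 10))) (Var r))))
      (Any 5 11 (And (Eq (Arr 0 (Var 11)) (Cst 1)) (Eq (Adj (Var 11) (Var 10)) (Cst 1))) ;;
       If (Eq (Var 5) (Cst 0)) (Put 0 (Var 10) (Cst 1) ;; Set 4 (Cst 1)) Nop) Nop)"

lemma add_spec:
  assumes T: "\<And>y. \<alpha> 0 y = of_bool (y \<in> T)" "T \<subseteq> {..<n}" and r: "r \<notin> {4, 5, 10, 11}"
    and C: "\<And>z. C z \<longleftrightarrow> z < n \<and> \<alpha> 1 z = k \<and> \<alpha> 2 (2 * z) = \<rho> r \<and> (\<forall>y\<in>T. \<not> adj y z)"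
  shows "tr (n * (3 * n + 7) + 2) (add_prog k r) \<rho> \<alpha> (\<lambda>\<rho>' \<alpha>'. (\<forall>x. x \<notin> {4, 5, 10, 11} \<longrightarrow> \<rho>' x = \<rho> x) \<and>
    ((\<exists>z. C z \<and> \<alpha>' = \<alpha>(0 := (\<alpha> 0)(z := 1))) \<or> (\<forall>z. \<not> C z) \<and> \<alpha>' = \<alpha>))"
  unfolding add_prog_def
proof (rule tr_Seq[where k = 1 and k' = "n * (3 * n + 7) + 1" and M = "\<lambda>\<rho>' \<alpha>'. \<rho>' = \<rho>(4 := 0) \<and> \<alpha>' = \<alpha>"], goal_cases)
  case 1
  show ?case by (intro tr_straight) simp
next
  case (2 \<rho>1 \<alpha>1)
  let ?J = "\<lambda>i \<rho>' \<alpha>'. (\<forall>x. x \<notin> {4, 5, 10, 11} \<longrightarrow> \<rho>' x = \<rho> x) \<and>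
    (\<rho>' 4 = 1 \<and> (\<exists>z. C z \<and> \<alpha>' = \<alpha>(0 := (\<alpha> 0)(z := 1))) \<or> \<rho>' 4 = 0 \<and> (\<forall>z<i. \<not> C z) \<and> \<alpha>' = \<alpha>)"
  show ?case
  proof (rule tr_For'[where k = "3 * n + 6" and J = ?J], goal_cases)
    case (2 i \<rho>2 \<alpha>2)
    then have i: "i < n" and r2: "\<forall>x. x \<notin> {4, 5, 10, 11} \<longrightarrow> \<rho>2 x = \<rho> x"
      and J: "\<rho>2 4 = 1 \<and> (\<exists>z. C z \<and> \<alpha>2 = \<alpha>(0 := (\<alpha> 0)(z := 1))) \<or> \<rho>2 4 = 0 \<and> (\<forall>z<i. \<not> C z) \<and> \<alpha>2 = \<alpha>" by simp_all
    have rr: "\<rho>2 r = \<rho> r" using r r2 by blast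
    from J consider (found) "\<rho>2 4 = 1" "\<exists>z. C z \<and> \<alpha>2 = \<alpha>(0 := (\<alpha> 0)(z := 1))"
      | (skip) "\<rho>2 4 = 0" "\<forall>z<i. \<not> C z" "\<alpha>2 = \<alpha>" "\<not> (\<alpha> 1 i = k \<and> \<alpha> 2 (2 * i) = \<rho> r)"
      | (hit) "\<rho>2 4 = 0" "\<forall>z<i. \<not> C z" "\<alpha>2 = \<alpha>" "\<alpha> 1 i = k" "\<alpha> 2 (2 * i) = \<rho> r" by metis
    then show ?case
    proof cases
      case found
      then show ?thesis using r2 by (intro tr_straight) simp
    next
      case skip
      then have "\<forall>z<Suc i. \<not> C z" unfolding less_Suc_eq using C by blast
      then show ?thesis using skip r2 rr r by (intro tr_straight) auto
    next
      case hit
      let ?B = "\<lambda>y. y \<in> T \<and> adj y i"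
      have CB: "C i \<longleftrightarrow> \<not> (\<exists>y<n. ?B y)" using C[of i] hit(4,5) i T(2) by auto
      have "tr (3 * n + 5) (Any 5 11 (And (Eq (Arr 0 (Var 11)) (Cst 1)) (Eq (Adj (Var 11) (Var 10)) (Cst 1))) ;;
          If (Eq (Var 5) (Cst 0)) (Put 0 (Var 10) (Cst 1) ;; Set 4 (Cst 1)) Nop) (\<rho>2(10 := i)) \<alpha> (?J (Suc i))"
      proof (rule tr_Seq[where k = "3 * n + 2" and k' = 3 and M = "\<lambda>\<rho>' \<alpha>'. \<rho>' = \<rho>2(10 := i, 5 := of_bool (\<exists>y<n. ?B y), 11 := n) \<and> \<alpha>' = \<alpha>"], goal_cases)
        case 1
        show ?case using i T(1) by (intro tr_Any[where B = ?B]) auto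
      next
        case (2 \<rho>3 \<alpha>3)
        show ?case
        proof (cases "C i")
          case True
          then show ?thesis using 2 CB r2 by (intro tr_straight) auto
        next
          case False
          then have "\<forall>z<Suc i. \<not> C z" using hit(2) by (simp add: less_Suc_eq)
          then show ?thesis using 2 CB False r2 hit(1) by (intro tr_straight) auto
        qed
      qed simp
      then show ?thesis using hit(1,3-5) rr r by (intro tr_If) auto
    qed
  next
    case (3 \<rho>2 \<alpha>2)
    then show ?case using C by auto
  qed (use 2 in auto)
qed simp

text \<open>After the symmetric difference with the row, a start vertex is added at the first vertex
  of the path (variable 8) and, if there is one, a filler at the last (variable 3).\<close>

definition final_prog :: pr where
  "final_prog = Find (And (Eq (Arr 5 (Var 10)) (Cst 1)) (Eq (Arr 9 (Mul (Cst 2) (Var 10))) (Cst 1))) ;;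
    If (Eq (Var 2) (Cst 0)) (Set 0 (Cst 1))
      ((Set 3 (Sub (Var 2) (Cst 1)) ;; Set 7 (Mul (Cst 2) (Var 3)) ;; Set 8 (Arr 11 (Var 7))) ;;
       For 10 1 0 (If (Eq (Arr 10 (Add (Mul (Var 7) Size) (Var 10))) (Cst 1)) (Put 0 (Var 10) (Sub (Cst 1) (Arr 0 (Var 10)))) Nop) ;;
       add_prog 3 8 ;; add_prog 1 3)"

definition search_prog :: pr where
  "search_prog = has_prog ;; nodes_prog ;; roots_prog ;; rounds_prog ;; final_prog"

definition exchange_prog :: pr where
  "exchange_prog = Set 3 (Sub (Var 2) (Cst 1)) ;;
    If (Eq (Arr 1 (Var 3)) (Cst 4)) (Put 0 (Var 3) (Cst 1))
      ((Set 7 (Arr 2 (Mul (Cst 2) (Var 3))) ;; Put 0 (Var 7) (Cst 0) ;; Put 0 (Var 3) (Cst 1)) ;; add_prog 1 7)"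

text \<open>The improvements by a single start vertex are tried before any search; their absence is
  what \<open>stuck_cover\<close> assumes.\<close>

definition phase_prog :: pr where
  "phase_prog = kinds_prog ;; flags_prog ;;
    Find (Not (And (Not (Eq (Arr 1 (Var 10)) (Cst 4))) (Not (And (Eq (Arr 1 (Var 10)) (Cst 3)) (Eq (Arr 3 (Mul (Cst 2) (Var 10))) (Cst 1)))))) ;;
    If (Eq (Var 2) (Cst 0)) search_prog exchange_prog"

definition main_prog :: pr where
  "main_prog = For 1 1 0 (If (And (Eq (Var 0) (Cst 0)) (Eq (Adj Source (Var 1)) (Cst 1)))
    (Any 2 10 (And (Eq (Arr 0 (Var 10)) (Cst 1)) (Eq (Adj (Var 1) (Var 10)) (Cst 1))) ;; If (Eq (Var 2) (Cst 0)) phase_prog Nop) Nop)"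

end

context phase_ram begin

text \<open>Failure is a statement about all complete covers, independent of \<open>S\<close>; this
  is why the main loop may give up for good.\<close>

definition phase_post :: "(nat \<Rightarrow> nat) \<Rightarrow> (nat \<Rightarrow> nat \<Rightarrow> nat) \<Rightarrow> bool" where
  "phase_post \<rho> \<alpha> \<longleftrightarrow> (\<forall>i. \<alpha> 2 i < n) \<and>
    (\<rho> 0 = 0 \<and> (\<exists>T. improves T \<and> (\<forall>y. \<alpha> 0 y = of_bool (y \<in> T))) \<or>
     \<rho> 0 = 1 \<and> \<not> (\<exists>T\<subseteq>D. indep T \<and> (\<forall>x. adj v x \<longrightarrow> covers T x)))"

lemma filler_iff:
  assumes "st1 \<alpha>"
  shows "filler s T z \<longleftrightarrow> z < n \<and> \<alpha> 1 z = 1 \<and> \<alpha> 2 (2 * z) = s \<and> (\<forall>y\<in>T. \<not> adj y z)"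
  using one_end[OF assms, of z s] D_less[of z] unfolding filler_def one_def by blast

lemma add_filler_spec:
  assumes T: "\<And>y. \<alpha> 0 y = of_bool (y \<in> T)" "T \<subseteq> {..<n}" and s1: "st1 \<alpha>" and e: "\<And>i. \<alpha> 2 i < n" and r: "r \<notin> {4, 5, 10, 11}"
    and r0: "\<rho> 0 = 0" and F: "\<And>z. filler (\<rho> r) T z \<Longrightarrow> improves (insert z T)" "(\<nexists>z. filler (\<rho> r) T z) \<Longrightarrow> improves T"
  shows "tr (n * (3 * n + 7) + 2) (add_prog 1 r) \<rho> \<alpha> phase_post"
proof (rule tr_weaken[OF add_spec[where T = T and C = "filler (\<rho> r) T"]], goal_cases)
  case (6 \<rho>' \<alpha>')
  then have r0': "\<rho>' 0 = 0" using r0 by simp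
  from 6 consider z where "filler (\<rho> r) T z" "\<alpha>' = \<alpha>(0 := (\<alpha> 0)(z := 1))" | "\<nexists>z. filler (\<rho> r) T z" "\<alpha>' = \<alpha>" by blast
  then show ?case
  proof cases
    case 1
    have "\<forall>y. \<alpha>' 0 y = of_bool (y \<in> insert z T)" using T(1) 1(2) by simp
    moreover have "\<forall>i. \<alpha>' 2 i < n" using 1(2) e by simp
    ultimately show ?thesis unfolding phase_post_def using r0' F(1)[OF 1(1)] by blast
  next
    case 2
    then show ?thesis unfolding phase_post_def using r0' F(2)[OF 2(1)] e T(1) by blast
  qed
qed (use T r filler_iff[OF s1] in auto)

lemma exchange_spec:
  assumes s0: "st0 \<rho> \<alpha>" and s1: "st1 \<alpha>" and s2: "st2 \<alpha>" and q: "q < n" "\<rho> 2 = Suc q"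
    and im: "\<alpha> 1 q = 4 \<or> \<alpha> 1 q = 3 \<and> \<alpha> 3 (2 * q) = 1"
  shows "tr (n * (3 * n + 7) + 7) exchange_prog \<rho> \<alpha> phase_post"
  unfolding exchange_prog_def
proof (rule tr_Seq[where k = 1 and k' = "n * (3 * n + 7) + 6" and M = "\<lambda>\<rho>' \<alpha>'. \<rho>' = \<rho>(3 := q) \<and> \<alpha>' = \<alpha>"], goal_cases)
  case 1
  show ?case using q by (intro tr_straight) simp
next
  case (2 \<rho>1 \<alpha>1)
  have S: "\<And>y. \<alpha> 0 y = of_bool (y \<in> S)" and e: "\<And>i. \<alpha> 2 i < n" and r0: "\<rho> 0 = 0" using s0 by (auto simp: st0_def)
  have k: "\<alpha> 1 q = kind q" using s1 q by (simp add: st1_def)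
  show ?case
  proof (cases "\<alpha> 1 q = 4")
    case True
    then have "improves (insert q S)" using improve_free[of q] k kind_iff(4)[of q] by simp
    moreover have "\<forall>y. ((\<alpha> 0)(q := 1)) y = of_bool (y \<in> insert q S)" using S by simp
    ultimately have "phase_post \<rho>1 (\<alpha>1(0 := (\<alpha> 0)(q := 1)))" unfolding phase_post_def using 2 r0 e by auto
    then show ?thesis using 2 True by (intro tr_straight) simp
  next
    case False
    then have k3: "\<alpha> 1 q = 3" and t3: "\<alpha> 3 (2 * q) = 1" using im by auto
    define s where "s = \<alpha> 2 (2 * q)"
    have st: "start q" "NS q = {s}" using start_end[OF s1 q(1), of s] k3 s_def by auto
    have "\<alpha> 3 (2 * q) = of_bool (terminal q s)" using s2 q(1) by (simp add: st2_def s_def)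
    then have te: "terminal q s" using t3 by (cases "terminal q s") simp_all
    define T where "T = insert q (S - {s})"
    let ?r = "\<rho>(3 := q, 7 := s)" and ?a = "\<alpha>(0 := (\<alpha> 0)(s := 0, q := 1))"
    have sn: "s < n" using e s_def by simp
    have qs: "q \<noteq> s" using NS_singleD(1,4)[OF st(2)] by blast
    have "tr (n * (3 * n + 7) + 5) ((Set 7 (Arr 2 (Mul (Cst 2) (Var 3))) ;; Put 0 (Var 7) (Cst 0) ;; Put 0 (Var 3) (Cst 1)) ;; add_prog 1 7) \<rho>1 \<alpha>1 phase_post"
    proof (rule tr_Seq[where k = 3 and k' = "n * (3 * n + 7) + 2" and M = "\<lambda>\<rho>' \<alpha>'. \<rho>' = ?r \<and> \<alpha>' = ?a"], goal_cases)
      case 1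
      show ?case using 2 sn by (intro tr_straight) (simp add: s_def)
    next
      case (2 \<rho>2 \<alpha>2)
      have a2: "\<alpha>2 1 = \<alpha> 1" "\<alpha>2 2 = \<alpha> 2" using 2 by simp_all
      show ?case
      proof (rule add_filler_spec[where T = T])
        show "\<alpha>2 0 y = of_bool (y \<in> T)" for y using 2 S qs by (simp add: T_def)
        show "T \<subseteq> {..<n}" using S_less q(1) by (auto simp: T_def)
        show "st1 \<alpha>2" using s1 a2 by (simp add: st1_def)
        show "\<alpha>2 2 i < n" for i using e a2 by simp
        show "\<rho>2 0 = 0" using 2 r0 by simp
        have r7: "\<rho>2 7 = s" using 2 by simp
        show "filler (\<rho>2 7) T z \<Longrightarrow> improves (insert z T)" for z using improve_exchange(1)[OF st te] r7 by (simp add: T_def)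
        show "(\<nexists>z. filler (\<rho>2 7) T z) \<Longrightarrow> improves T" using improve_exchange(2)[OF st te] r7 by (simp add: T_def)
      qed simp
    qed simp
    then show ?thesis using 2 False by (intro tr_If[where k = "n * (3 * n + 7) + 5"]) simp_all
  qed
qed simp

end

context search_run begin

lemma final_spec:
  assumes inv: "sinv Ou P B dn \<alpha>" and na: "\<forall>k. \<forall>t<n. \<not> applicable Ou dn k t" and r0: "\<rho> 0 = 0"
    and S0: "\<And>y. \<alpha>0 0 y = of_bool (y \<in> S)"
  shows "tr (6 * n * n + 20 * n + 12) final_prog \<rho> \<alpha> phase_post"
  unfolding final_prog_def
proof (rule tr_Seq[OF tr_Find[where B = "\<lambda>s. has_terminal s \<and> (s, False) \<in> Ou"], where k' = "6 * n * n + 17 * n + 10"], goal_cases)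
  case (2 x y)
  have "\<alpha> 5 y = of_bool (has_terminal y)" using st3 sinvD(2)[OF inv, of 5] 2 by (simp add: st3_def)
  moreover have "\<alpha> 9 (2 * y) = of_bool ((y, False) \<in> Ou)" using sinvD(3)[OF inv, of "(y, False)"] 2 by (simp add: code_def)
  ultimately show ?case by simp
next
  case (3 \<rho>1 \<alpha>1)
  have a: "\<alpha>1 = \<alpha>" and r: "\<rho>1 0 = 0" using 3 r0 by simp_all
  have e: "\<alpha> 2 i < n" for i using ends_less sinvD(2)[OF inv, of 2] by simp
  have st: "search_state nodes flip edge entry Ou P B" using sinvD(1)[OF inv] .
  from 3 have "\<rho>1 2 = 0 \<and> (\<forall>y<n. \<not> (has_terminal y \<and> (y, False) \<in> Ou)) \<or> (\<exists>y<n. \<rho>1 2 = Suc y \<and> has_terminal y \<and> (y, False) \<in> Ou)" by (elim conjE)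
  then consider "\<rho>1 2 = 0" "\<forall>y<n. \<not> (has_terminal y \<and> (y, False) \<in> Ou)" | s where "s < n" "\<rho>1 2 = Suc s" "has_terminal s" "(s, False) \<in> Ou" by metis
  then show ?case
  proof cases
    case 1
    have "\<not> (\<exists>T\<subseteq>D. indep T \<and> (\<forall>x. adj v x \<longrightarrow> covers T x))"
    proof
      assume "\<exists>T\<subseteq>D. indep T \<and> (\<forall>x. adj v x \<longrightarrow> covers T x)"
      then obtain T where T: "T \<subseteq> D" "indep T" "\<And>x. adj v x \<Longrightarrow> covers T x" by blast
      have "\<exists>s. has_terminal s \<and> (s, False) \<in> Ou"
      proof (rule search_stuck[OF st _ _ T])
        fix t p w assume E: "edge t p w" and p: "p \<in> Ou" "w \<notin> Ou"
        have tw: "two t" "t < n" using edge_pt[OF E] two_less by blast+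
        show "flip w \<in> Ou"
          using edge_pt[OF E] na[rule_format, OF tw(2), of 1] na[rule_format, OF tw(2), of 2] tw(1) p by (auto simp: applicable_def)
      next
        fix t p q assume E: "edge t p q" and p: "p \<in> Ou" "q \<in> Ou"
        have tw: "two t" "t < n" using edge_pt[OF E] two_less by blast+
        \<comment> \<open>Since no shrinking step applies, every edge between even nodes has been
          merged, hence has both ends in one blossom.\<close>
        have "t \<in> dn" using edge_pt[OF E] na[rule_format, OF tw(2), of 0] tw(1) p by (auto simp: applicable_def)
        then have "B (pt t 0) = B (pt t (Suc 0))" using inv unfolding sinv_def by blast
        then show "B p = B q" using edge_pt[OF E] by auto
      qed
      then obtain s where "has_terminal s" "(s, False) \<in> Ou" by blast
      moreover have "s < n" using \<open>(s, False) \<in> Ou\<close> sinvD(8)[OF inv] nodes_less by fastforce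
      ultimately show False using 1(2) by blast
    qed
    then have "phase_post (\<rho>1(0 := 1)) \<alpha>" using e by (simp add: phase_post_def)
    then show ?thesis using 1(1) a by (intro tr_straight) simp
  next
    case (2 s)
    interpret ss: search_state nodes flip edge entry Ou P B by (fact st)
    let ?y = "(s, False)"
    define L where "L = P ?y"
    have L: "apath L" "snd (last L) = ?y" using ss.P_path[OF 2(4)] ss.P_last[OF 2(4)] by (simp_all add: L_def)
    define T where "T = (S - fst ` nds L) \<union> labs L"
    define s1 where "s1 = fst (snd (hd L))"
    note sw = improve_switch[OF L 2(3), folded T_def s1_def]
    have asw: "s1 \<in> S" "fst ` nds L \<subseteq> S" "\<And>t. t \<in> labs L \<Longrightarrow> t < n"
      using apath_switch[OF L(1)] wingD(1) D_less unfolding s1_def by blast+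
    have ro: "rowis \<alpha> (2 * s) (row L)" and h11: "\<alpha> 11 (2 * s) = s1"
      using sinvD(4)[OF inv 2(4)] sinvD(5)[OF inv 2(4)] by (simp_all add: code_def L_def s1_def)
    have Tn: "T \<subseteq> {..<n}" using asw S_less by (auto simp: T_def)
    \<comment> \<open>The nodes of the path are over \<open>S\<close> and its labels lie outside
      \<open>S\<close>, so switching is a symmetric difference.\<close>
    have Trow: "y \<in> T \<longleftrightarrow> (y \<in> row L) \<noteq> (y \<in> S)" for y
      using apath_labs_notin[OF L(1), of y] asw(2) unfolding T_def row_def by blast
    have S: "\<alpha> 0 y = of_bool (y \<in> S)" for y using S0 sinvD(2)[OF inv, of 0] by simp
    have s1a: "st1 \<alpha>" using st1 sinvD(2)[OF inv, of 1] sinvD(2)[OF inv, of 2] by (simp add: st1_def)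
    let ?r = "\<rho>1(3 := s, 7 := 2 * s, 8 := s1)"
    have "tr (6 * n * n + 17 * n + 9) ((Set 3 (Sub (Var 2) (Cst 1)) ;; Set 7 (Mul (Cst 2) (Var 3)) ;; Set 8 (Arr 11 (Var 7))) ;;
       For 10 1 0 (If (Eq (Arr 10 (Add (Mul (Var 7) Size) (Var 10))) (Cst 1)) (Put 0 (Var 10) (Sub (Cst 1) (Arr 0 (Var 10)))) Nop) ;;
       add_prog 3 8 ;; add_prog 1 3) \<rho>1 \<alpha>1 phase_post"
    proof (rule tr_Seq[where k = 3 and k' = "6 * n * n + 17 * n + 6" and M = "\<lambda>\<rho>' \<alpha>'. \<rho>' = ?r \<and> \<alpha>' = \<alpha>"], goal_cases)
      case 1
      show ?case using 2 a h11 asw(1) S_less[of s1] by (intro tr_straight) simp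
    next
      case (2 \<rho>2 \<alpha>2)
      show ?case
      proof (rule tr_Seq[where k = "3 * n + 1" and k' = "6 * n * n + 14 * n + 5" and M = "\<lambda>\<rho>' \<alpha>'. (\<forall>r. r \<noteq> 10 \<longrightarrow> \<rho>' r = ?r r) \<and>
          (\<forall>j. j \<noteq> 0 \<longrightarrow> \<alpha>' j = \<alpha> j) \<and> (\<forall>y. \<alpha>' 0 y = of_bool (y \<in> T))"], goal_cases)
        case 1
        show ?case
        proof (rule tr_For'[where k = 2 and J = "\<lambda>i \<rho>' \<alpha>'. (\<forall>r. r \<noteq> 10 \<longrightarrow> \<rho>' r = ?r r) \<and>
            (\<forall>j. j \<noteq> 0 \<longrightarrow> \<alpha>' j = \<alpha> j) \<and> (\<forall>y. \<alpha>' 0 y = of_bool (if y < i then y \<in> T else y \<in> S))"], goal_cases)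
          case (2 i \<rho>3 \<alpha>3)
          then have i: "i < n" and r3: "\<forall>r. r \<noteq> 10 \<longrightarrow> \<rho>3 r = ?r r" and a3: "\<forall>j. j \<noteq> 0 \<longrightarrow> \<alpha>3 j = \<alpha> j"
            and S3: "\<forall>y. \<alpha>3 0 y = of_bool (if y < i then y \<in> T else y \<in> S)" by simp_all
          have "\<alpha>3 10 (2 * s * n + i) = of_bool (i \<in> row L)" using ro a3 i by (simp add: rowis_def)
          moreover have "\<alpha>3 0 i = of_bool (i \<in> S)" using S3 by simp
          ultimately have "tr 2 (If (Eq (Arr 10 (Add (Mul (Var 7) Size) (Var 10))) (Cst 1)) (Put 0 (Var 10) (Sub (Cst 1) (Arr 0 (Var 10)))) Nop) (\<rho>3(10 := i)) \<alpha>3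
              (\<lambda>\<rho>' \<alpha>'. \<rho>' = \<rho>3(10 := i) \<and> (\<forall>j. j \<noteq> 0 \<longrightarrow> \<alpha>' j = \<alpha>3 j) \<and> \<alpha>' 0 = (\<alpha>3 0)(i := of_bool (i \<in> T)))"
            using r3 Trow[of i] by (intro tr_straight) (auto simp: fun_upd_idem_iff)
          then show ?case
          proof (rule tr_weaken, goal_cases)
            case (2 \<rho>4 \<alpha>4)
            then show ?case using r3 a3 S3 by (auto simp: less_Suc_eq)
          qed simp
        next
          case (3 \<rho>3 \<alpha>3)
          have "(if y < n then y \<in> T else y \<in> S) \<longleftrightarrow> y \<in> T" for y using Tn S_less[of y] by auto
          then show ?case using 3 by simp
        qed (use 2 S in auto)
      next
        case (2 \<rho>3 \<alpha>3)
        then have r3: "\<rho>3 0 = 0" "\<rho>3 3 = s" "\<rho>3 8 = s1" and a3: "\<forall>j. j \<noteq> 0 \<longrightarrow> \<alpha>3 j = \<alpha> j" and T3: "\<And>y. \<alpha>3 0 y = of_bool (y \<in> T)" using r by simp_all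
        let ?C = "\<lambda>q. start q \<and> NS q = {s1} \<and> (\<forall>y\<in>T. \<not> adj y q)"
        have C: "?C q \<longleftrightarrow> q < n \<and> \<alpha>3 1 q = 3 \<and> \<alpha>3 2 (2 * q) = \<rho>3 8 \<and> (\<forall>y\<in>T. \<not> adj y q)" for q
          using start_end[OF s1a, of q s1] D_less[of q] a3 r3(3) by (auto simp: start_def)
        show ?case
        proof (rule tr_Seq[OF add_spec[where T = T and C = ?C], where k' = "n * (3 * n + 7) + 2"], goal_cases)
          case (5 \<rho>4 \<alpha>4)
          then obtain q where q: "?C q" and a4: "\<alpha>4 = \<alpha>3(0 := (\<alpha>3 0)(q := 1))" using sw(1) by blast
          have r4: "\<rho>4 0 = 0" "\<rho>4 3 = s" using 5 r3 by simp_all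
          have qn: "q < n" using q C by blast
          have a4': "\<alpha>4 1 = \<alpha> 1" "\<alpha>4 2 = \<alpha> 2" using a4 a3 by simp_all
          show ?case
          proof (rule add_filler_spec[where T = "insert q T"])
            show "\<alpha>4 0 y = of_bool (y \<in> insert q T)" for y using a4 T3 by simp
            show "insert q T \<subseteq> {..<n}" using Tn qn by simp
            show "st1 \<alpha>4" using s1a a4' by (simp add: st1_def)
            show "\<alpha>4 2 i < n" for i using e a4' by simp
            show "filler (\<rho>4 3) (insert q T) z \<Longrightarrow> improves (insert z (insert q T))" for z using sw(2)[of q z] q r4 by simp
            show "(\<nexists>z. filler (\<rho>4 3) (insert q T) z) \<Longrightarrow> improves (insert q T)" using sw(3)[of q] q r4 by simp
          qed (simp_all add: r4)
        qed (use Tn T3 C in \<open>simp_all add: algebra_simps\<close>)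
      qed simp
    qed simp
    then show ?thesis using 2(2) by (intro tr_If[where k = "6 * n * n + 17 * n + 9"]) simp_all
  qed
qed simp_all

end

context phase_ram begin

lemma search_spec:
  assumes s0: "st0 \<rho> \<alpha>" and s1: "st1 \<alpha>" and s2: "st2 \<alpha>"
    and im: "\<And>q. q < n \<Longrightarrow> \<not> (\<alpha> 1 q = 4 \<or> \<alpha> 1 q = 3 \<and> \<alpha> 3 (2 * q) = 1)"
  shows "tr (64 * n * n + 140 * n + 34) search_prog \<rho> \<alpha> phase_post"
  unfolding search_prog_def
proof (rule tr_Seq[OF has_spec[OF s0 s1 s2], where k' = "55 * n * n + 130 * n + 33"], goal_cases)
  case (1 \<rho>1 \<alpha>1)
  then have fr: "frame {5, 6, 7} \<rho> \<alpha> \<rho>1 \<alpha>1" and s3: "st3 \<alpha>1" by simp_all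
  have t: "st0 \<rho>1 \<alpha>1" "st1 \<alpha>1" using frame_st0[OF fr] frame_st1[OF fr] s0 s1 by simp_all
  have t2: "st2 \<alpha>1" using s2 fr by (simp add: st2_def frame_def)
  have k4: "kind q \<noteq> 4" and k3: "kind q = 3 \<Longrightarrow> \<alpha> 3 (2 * q) \<noteq> 1" if "q < n" for q
    using im[OF that] s1 that by (auto simp: st1_def)
  have no_free: "NS t \<noteq> {}" if "t \<in> D" "adj u t" for t using k4[OF D_less[OF that(1)]] kind_iff(4)[of t] that by blast
  have no_exchange: "\<not> terminal q s" if "start q" "NS q = {s}" for q s
  proof -
    have q: "q < n" using that D_less by (simp add: start_def)
    then have "kind q = 3" "\<alpha> 2 (2 * q) = s" using start_end[OF s1 q, of s] s1 that by (auto simp: st1_def)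
    moreover have "\<alpha> 3 (2 * q) = of_bool (terminal q (\<alpha> 2 (2 * q)))" using s2 q by (simp add: st2_def)
    ultimately show ?thesis using k3[OF q] by auto
  qed
  \<comment> \<open>The contents of array 7 serve as the choice function \<open>rep\<close>.\<close>
  interpret search_ram n v adj S u "\<alpha>1 7"
  proof
    show "adj v (\<alpha>1 7 s) \<and> adj s (\<alpha>1 7 s)" if "s \<in> S" "adj v x" "adj s x" for s x
      using s3 S_less[OF that(1)] that(2,3) unfolding st3_def by blast
  qed (use no_free no_exchange in blast)+
  show ?case
  proof (rule tr_Seq[OF nodes_spec[OF t(1) t2 s3 refl], where k' = "55 * n * n + 114 * n + 32"], goal_cases)
    case (1 \<rho>2 \<alpha>2)
    then have fr': "frame {8} \<rho>1 \<alpha>1 \<rho>2 \<alpha>2" and s4: "st4 \<alpha>2" by simp_all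
    have w: "st0 \<rho>2 \<alpha>2" "st1 \<alpha>2" using frame_st0[OF fr'] frame_st1[OF fr'] t by simp_all
    have e2: "\<alpha>2 2 i < n" for i using w(1) by (simp add: st0_def)
    have w3: "st3 \<alpha>2" using s3 fr' by (simp add: st3_def frame_def)
    interpret search_run n v adj S u "\<alpha>1 7" \<alpha>2
      by unfold_locales (fact w(2), fact w3, fact s4, fact e2)
    show ?case
    proof (rule tr_Seq[OF roots_spec, where k' = "53 * n * n + 101 * n + 29"], goal_cases)
      case (2 \<rho>3 \<alpha>3)
      then obtain Ou P B where r3: "\<forall>r<2. \<rho>3 r = \<rho>2 r" and inv: "sinv Ou P B {} \<alpha>3" by blast
      show ?case
      proof (rule tr_Seq[OF rounds_spec[OF inv], where k' = "6 * n * n + 20 * n + 12"], goal_cases)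
        case (1 \<rho>4 \<alpha>4)
        then obtain Ou P B dn where r4: "\<forall>r<2. \<rho>4 r = \<rho>3 r" and inv': "sinv Ou P B dn \<alpha>4" "\<forall>k. \<forall>t<n. \<not> applicable Ou dn k t" by blast
        have "\<rho>4 0 = 0" "\<And>y. \<alpha>2 0 y = of_bool (y \<in> S)" using r4 r3 w(1) by (auto simp: st0_def)
        then show ?case using final_spec[OF inv'] by (intro tr_weaken[OF final_spec[OF inv']]) auto
      qed (simp add: algebra_simps)
    qed (simp_all add: algebra_simps)
  qed (simp add: algebra_simps)
qed (simp add: algebra_simps)

lemma phase_spec:
  assumes "st0 \<rho> \<alpha>"
  shows "tr (100 * (n + 1)\<^sup>2) phase_prog \<rho> \<alpha> phase_post"
  unfolding phase_prog_def
proof (rule tr_Seq[OF kinds_spec[OF assms], where k' = "82 * n * n + 167 * n + 50"], goal_cases)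
  case (1 \<rho>1 \<alpha>1)
  then have s: "st0 \<rho>1 \<alpha>1" "st1 \<alpha>1" by simp_all
  show ?case
  proof (rule tr_Seq[OF flags_spec[OF s], where k' = "64 * n * n + 143 * n + 40"], goal_cases)
    case (1 \<rho>2 \<alpha>2)
    then have fr: "frame {3, 4} \<rho>1 \<alpha>1 \<rho>2 \<alpha>2" and s2: "st2 \<alpha>2" by simp_all
    have t: "st0 \<rho>2 \<alpha>2" "st1 \<alpha>2" using frame_st0[OF fr] frame_st1[OF fr] s by simp_all
    let ?B = "\<lambda>q. \<alpha>2 1 q = 4 \<or> \<alpha>2 1 q = 3 \<and> \<alpha>2 3 (2 * q) = 1"
    show ?case
    proof (rule tr_Seq[OF tr_Find[where B = ?B], where k' = "64 * n * n + 140 * n + 36"], goal_cases)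
      case (3 \<rho>3 \<alpha>3)
      then have a: "\<alpha>3 = \<alpha>2" and r: "\<forall>r. r \<notin> {2, 10} \<longrightarrow> \<rho>3 r = \<rho>2 r"
        and f: "\<rho>3 2 = 0 \<and> (\<forall>q<n. \<not> ?B q) \<or> (\<exists>q<n. \<rho>3 2 = Suc q \<and> ?B q)"
        using 3[THEN conjunct1] 3[THEN conjunct2, THEN conjunct1] 3[THEN conjunct2, THEN conjunct2] by simp_all
      have t0: "st0 \<rho>3 \<alpha>2" using t(1) r by (simp add: st0_def)
      show ?case
        unfolding a
      proof (rule tr_If[where k = "64 * n * n + 140 * n + 34"], goal_cases)
        case 2
        then have "\<rho>3 2 = 0" by simp
        then have "\<And>q. q < n \<Longrightarrow> \<not> ?B q" using f by auto
        then show ?case by (rule search_spec[OF t0 t(2) s2])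
      next
        case 3
        then have "\<rho>3 2 \<noteq> 0" by simp
        then obtain q where "q < n" "\<rho>3 2 = Suc q" "?B q" using f by metis
        then show ?case by (intro tr_weaken[OF exchange_spec[OF t0 t(2) s2]]) (simp_all add: algebra_simps)
      qed simp_all
    qed simp_all
  qed (simp add: algebra_simps)
qed (simp add: algebra_simps power2_eq_square)

end

section \<open>The loop over the neighbours of the given vertex\<close>

locale main_ram = ram n v adj + clawfree "{..<n}" adj v
  for n v :: nat and adj :: "nat \<Rightarrow> nat \<Rightarrow> bool"
begin

definition cover_exists :: bool where
  "cover_exists \<longleftrightarrow> (\<exists>T\<subseteq>D. indep T \<and> (\<forall>x. adj v x \<longrightarrow> covers T x))"

lemma main_spec: "tr (n * (100 * (n + 1)\<^sup>2 + 3 * n + 5) + 1) main_prog (\<lambda>_. 0) (\<lambda>_ _. 0) (\<lambda>\<rho> \<alpha>. \<rho> 0 = of_bool (\<not> cover_exists))"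
  unfolding main_prog_def
proof (rule tr_For'[where k = "100 * (n + 1)\<^sup>2 + 3 * n + 4" and J = "\<lambda>i \<rho> \<alpha>. (\<forall>j. \<alpha> 2 j < n) \<and>
    (\<rho> 0 = 0 \<and> (\<exists>S\<subseteq>D. indep S \<and> (\<forall>y. \<alpha> 0 y = of_bool (y \<in> S)) \<and> (\<forall>x<i. adj v x \<longrightarrow> covers S x)) \<or> \<rho> 0 = 1 \<and> \<not> cover_exists)"], goal_cases)
  case 1
  have "\<exists>S\<subseteq>D. indep S \<and> (\<forall>y. 0 = (of_bool (y \<in> S) :: nat)) \<and> (\<forall>x<0. adj v x \<longrightarrow> covers S x)"
    by (rule exI[of _ "{}"]) (simp add: indep_def)
  then show ?case using v_less by simp
next
  case (2 u \<rho> \<alpha>)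
  then have u: "u < n" and e: "\<forall>j. \<alpha> 2 j < n" and J: "\<rho> 0 = 0 \<and> (\<exists>S\<subseteq>D. indep S \<and> (\<forall>y. \<alpha> 0 y = of_bool (y \<in> S)) \<and> (\<forall>x<u. adj v x \<longrightarrow> covers S x)) \<or> \<rho> 0 = 1 \<and> \<not> cover_exists"
    by simp_all
  from J show ?case
  proof
    assume "\<rho> 0 = 1 \<and> \<not> cover_exists"
    then show ?thesis using e u v_less by (intro tr_straight) simp
  next
    assume "\<rho> 0 = 0 \<and> (\<exists>S\<subseteq>D. indep S \<and> (\<forall>y. \<alpha> 0 y = of_bool (y \<in> S)) \<and> (\<forall>x<u. adj v x \<longrightarrow> covers S x))"
    then obtain S where r0: "\<rho> 0 = 0" and S: "S \<subseteq> D" "indep S" "\<And>y. \<alpha> 0 y = of_bool (y \<in> S)" "\<And>x. x < u \<Longrightarrow> adj v x \<Longrightarrow> covers S x" by blast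
    have Sn: "y < n" if "y \<in> S" for y using S(1) that by (auto simp: D_def)
    let ?post = "\<lambda>\<rho> \<alpha>. (\<forall>j. \<alpha> 2 j < n) \<and> (\<rho> 0 = 0 \<and> (\<exists>S\<subseteq>D. indep S \<and> (\<forall>y. \<alpha> 0 y = of_bool (y \<in> S)) \<and> (\<forall>x<Suc u. adj v x \<longrightarrow> covers S x)) \<or> \<rho> 0 = 1 \<and> \<not> cover_exists)"
    have keep: "?post \<rho>' \<alpha>" if "\<rho>' 0 = 0" "adj v u \<longrightarrow> covers S u" for \<rho>'
      using that S e unfolding less_Suc_eq by blast
    show ?thesis
    proof (rule tr_If[where k = "100 * (n + 1)\<^sup>2 + 3 * n + 3"], goal_cases)
      case 1
      show ?case using u v_less by simp
    next
      case 3
      then have "\<not> adj v u" using r0 by (cases "adj v u") simp_all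
      then show ?case using keep[of "\<rho>(1 := u)"] r0 by (intro tr_straight) simp
    next
      case 2
      then have vu: "adj v u" by (cases "adj v u") simp_all
      let ?B = "\<lambda>y. y \<in> S \<and> adj u y"
      show ?case
      proof (rule tr_Seq[where k = "3 * n + 2" and k' = "100 * (n + 1)\<^sup>2 + 1" and M = "\<lambda>\<rho>' \<alpha>'. \<rho>' = \<rho>(1 := u, 2 := of_bool (\<exists>y<n. ?B y), 10 := n) \<and> \<alpha>' = \<alpha>"], goal_cases)
        case 1
        show ?case using u S(3) by (intro tr_Any[where B = ?B]) auto
      next
        case (2 \<rho>1 \<alpha>1)
        have r1: "\<rho>1 0 = 0" "\<rho>1 1 = u" using 2 r0 by simp_all
        show ?case
        proof (rule tr_If[where k = "100 * (n + 1)\<^sup>2"], goal_cases)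
          case 3
          then have "covers S u" using 2 by (auto simp: covers_def)
          then have "?post \<rho>1 \<alpha>1" using keep[of \<rho>1] r1 2 by blast
          then show ?case by (intro tr_straight) simp
        next
          case uncov: 2
          then have no: "\<not> adj u y" if "y \<in> S" for y using 2 that Sn[OF that] by auto
          interpret phase_ram n v adj S u by unfold_locales (use S no vu in auto)
          have "st0 \<rho>1 \<alpha>1" using 2 r1 S(3) e by (simp add: st0_def)
          then show ?case
          proof (rule tr_weaken[OF phase_spec], goal_cases)
            case (2 \<rho>2 \<alpha>2)
            then have e2: "\<forall>j. \<alpha>2 2 j < n" and c: "\<rho>2 0 = 0 \<and> (\<exists>T. improves T \<and> (\<forall>y. \<alpha>2 0 y = of_bool (y \<in> T))) \<or> \<rho>2 0 = 1 \<and> \<not> cover_exists"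
              unfolding phase_post_def cover_exists_def by blast+
            have "T \<subseteq> D \<and> indep T \<and> (\<forall>x<Suc u. adj v x \<longrightarrow> covers T x)" if "improves T" for T
              using that S(4) unfolding improves_def less_Suc_eq by blast
            then show ?case using e2 c by blast
          qed simp
        qed simp_all
      qed simp
    qed simp
  qed
next
  case (3 \<rho> \<alpha>)
  have "cover_exists" if "S \<subseteq> D" "indep S" "\<forall>x<n. adj v x \<longrightarrow> covers S x" for S
  proof -
    have "\<forall>x. adj v x \<longrightarrow> covers S x" using that(3) adj_V adj_sym by (metis lessThan_iff)
    then show ?thesis using that unfolding cover_exists_def by blast
  qed
  then show ?case using 3 by auto
qed (simp add: algebra_simps)

end

text \<open>All syntactic limits are checked by evaluation on the concrete program.\<close>

lemma (in ram) tame_main: "tame main_prog"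
  by (simp add: main_prog_def phase_prog_def search_prog_def exchange_prog_def final_prog_def add_prog_def Find_def Any_def
    kinds_prog_def count_prog_def count_step_def classify_prog_def flags_prog_def flag_prog_def has_prog_def has_step_def rep_prog_def
    nodes_prog_def node_prog_def roots_prog_def rounds_prog_def scan_prog_def scan_step_def act_prog_def merge_prog_def merge_step_def turn_prog_def grow_prog_def
    small_aexp_def cell_def)

section \<open>From digraphs to adjacency relations\<close>

lemma pair_graph_adj:
  assumes "pair_graph G"
  shows "x \<rightarrow>\<^bsub>with_proj G\<^esub> y \<Longrightarrow> x \<in> pverts G" "x \<rightarrow>\<^bsub>with_proj G\<^esub> y \<Longrightarrow> y \<rightarrow>\<^bsub>with_proj G\<^esub> x" "\<not> x \<rightarrow>\<^bsub>with_proj G\<^esub> x"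
proof -
  interpret pair_graph G by fact
  show "x \<rightarrow>\<^bsub>with_proj G\<^esub> y \<Longrightarrow> x \<in> pverts G" using in_arcsD1 by simp
  show "x \<rightarrow>\<^bsub>with_proj G\<^esub> y \<Longrightarrow> y \<rightarrow>\<^bsub>with_proj G\<^esub> x" using pair_sym_arcs by (simp add: symmetric_def sym_def)
  show "\<not> x \<rightarrow>\<^bsub>with_proj G\<^esub> x" using pair_no_loops[of "(x, x)"] by auto
qed

lemma claw_free_adj:
  assumes pg: "pair_graph G" and cf: "claw_free (with_proj G)"
    and adj: "c \<rightarrow>\<^bsub>with_proj G\<^esub> x" "c \<rightarrow>\<^bsub>with_proj G\<^esub> y" "c \<rightarrow>\<^bsub>with_proj G\<^esub> z" and ne: "x \<noteq> y" "x \<noteq> z" "y \<noteq> z"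
  shows "x \<rightarrow>\<^bsub>with_proj G\<^esub> y \<or> x \<rightarrow>\<^bsub>with_proj G\<^esub> z \<or> y \<rightarrow>\<^bsub>with_proj G\<^esub> z"
proof (rule ccontr)
  assume non: "\<not> ?thesis"
  note G = pair_graph_adj[OF pg]
  define H where "H = \<lparr>pverts = {c, x, y, z}, parcs = {c} \<times> {x, y, z} \<union> {x, y, z} \<times> {c}\<rparr>"
  have cne: "c \<noteq> x" "c \<noteq> y" "c \<noteq> z" using adj G(3) by blast+
  have K: "complete_bipartite_digraph 1 3 (with_proj H)"
    unfolding complete_bipartite_digraph_pair_def
  proof (intro conjI exI)
    show "pverts H = {c} \<union> {x, y, z}" "{c} \<inter> {x, y, z} = {}" "parcs H = {c} \<times> {x, y, z} \<union> {x, y, z} \<times> {c}"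
      using cne by (auto simp: H_def)
  qed (use ne in \<open>simp_all add: H_def\<close>)
  have arcs: "(a, b) \<in> parcs H \<longleftrightarrow> a \<rightarrow>\<^bsub>with_proj G\<^esub> b \<and> a \<in> pverts H \<and> b \<in> pverts H" for a b
  proof
    assume "(a, b) \<in> parcs H"
    then show "a \<rightarrow>\<^bsub>with_proj G\<^esub> b \<and> a \<in> pverts H \<and> b \<in> pverts H"
      using adj G(2)[OF adj(1)] G(2)[OF adj(2)] G(2)[OF adj(3)] unfolding H_def by auto
  next
    assume ab: "a \<rightarrow>\<^bsub>with_proj G\<^esub> b \<and> a \<in> pverts H \<and> b \<in> pverts H"
    have "\<not> y \<rightarrow>\<^bsub>with_proj G\<^esub> x" "\<not> z \<rightarrow>\<^bsub>with_proj G\<^esub> x" "\<not> z \<rightarrow>\<^bsub>with_proj G\<^esub> y" using non G(2) by blast+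
    then show "(a, b) \<in> parcs H" using ab non G(3)[of a] unfolding H_def by auto
  qed
  have "verts (with_proj H) \<subseteq> verts (with_proj G)" using G(1)[OF adj(1)] G(1)[OF G(2)[OF adj(1)]] G(1)[OF G(2)[OF adj(2)]] G(1)[OF G(2)[OF adj(3)]] by (simp add: H_def)
  moreover have "arcs (with_proj H) \<subseteq> arcs (with_proj G)" "arcs (with_proj H) = {e \<in> arcs (with_proj G). tail (with_proj G) e \<in> verts (with_proj H) \<and> head (with_proj G) e \<in> verts (with_proj H)}"
    using arcs by auto
  moreover have "wf_digraph (with_proj G)" "wf_digraph (with_proj H)"
    using G(1,2) arcs by (auto simp: wf_digraph_def)
  ultimately have "induced_subgraph (with_proj H) (with_proj G)"
    by (simp add: induced_subgraph_def subgraph_def compatible_def)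
  then show False using cf K by (auto simp: claw_free_def)
qed

lemma clawfree_of_claw_free:
  assumes "pair_graph G" "pverts G = V" "finite V" "claw_free (with_proj G)"
  shows "clawfree V (\<lambda>x y. x \<rightarrow>\<^bsub>with_proj G\<^esub> y)"
  by unfold_locales (use assms pair_graph_adj[OF assms(1)] claw_free_adj[OF assms(1,4)] in blast)+

text \<open>A neighbour \<open>x\<close> of \<open>v\<close> extends an independent set
  \<open>T\<close> outside the closed neighbourhood exactly when \<open>T\<close> does not cover
  \<open>x\<close>.\<close>

lemma shedding_iff:
  assumes "pair_graph G" "pverts G = V" "finite V" "claw_free (with_proj G)"
  defines "adj \<equiv> \<lambda>x y. x \<rightarrow>\<^bsub>with_proj G\<^esub> y"
  shows "shedding (with_proj G) v \<longleftrightarrow> \<not> (\<exists>T\<subseteq>clawfree.D V adj v. clawfree.indep adj T \<and> (\<forall>x. adj v x \<longrightarrow> clawfree.covers adj T x))"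
proof -
  interpret clawfree V adj v unfolding adj_def by (rule clawfree_of_claw_free[OF assms(1-4)])
  have nb: "nbhd (with_proj G) v = {x. adj v x}" using adj_V adj_sym assms(2) by (auto simp: nbhd_def adj_def)
  have D: "verts (with_proj G) - closed_nbhd (with_proj G) v = D" unfolding closed_nbhd_def nb using assms(2) by (auto simp: D_def)
  have a: "x \<rightarrow>\<^bsub>with_proj G\<^esub> y \<longleftrightarrow> adj x y" for x y by (simp add: adj_def)
  have b: "(x \<noteq> y \<longrightarrow> \<not> adj x y) \<longleftrightarrow> \<not> adj x y" for x y using adj_irrefl by (cases "x = y") simp_all
  have ind: "independent_set (with_proj G) T \<longleftrightarrow> T \<subseteq> V \<and> indep T" for T
    unfolding independent_set_def indep_def a b with_proj_simps(1) assms(2) ..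
  have ins: "independent_set (with_proj G) (insert x T) \<longleftrightarrow> \<not> covers T x" if "T \<subseteq> D" "indep T" "adj v x" for x T
  proof -
    have "x \<in> V" using adj_V[OF adj_sym[OF that(3)]] .
    then have "insert x T \<subseteq> V" using that(1) by (auto simp: D_def)
    moreover have "indep (insert x T) \<longleftrightarrow> (\<forall>y\<in>T. \<not> adj x y)"
      using that(2) adj_irrefl adj_sym unfolding indep_def by blast
    ultimately show ?thesis by (simp add: ind covers_def)
  qed
  have DV: "D \<subseteq> V" by (auto simp: D_def)
  have ind': "independent_set (with_proj G) T \<longleftrightarrow> indep T" if "T \<subseteq> D" for T
    using order_trans[OF that DV] ind by simp
  have ins': "(\<exists>x\<in>{x. adj v x}. independent_set (with_proj G) (insert x T)) \<longleftrightarrow> (\<exists>x. adj v x \<and> \<not> covers T x)" if "T \<subseteq> D" "indep T" for T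
    using ins[OF that] by simp
  have "shedding (with_proj G) v \<longleftrightarrow> (\<forall>T. T \<subseteq> D \<longrightarrow> indep T \<longrightarrow> (\<exists>x. adj v x \<and> \<not> covers T x))"
    unfolding shedding_def D nb by (intro arg_cong[where f = All] ext imp_cong ind' ins' refl)
  then show ?thesis by (simp only: not_ex de_Morgan_conj de_Morgan_disj not_all imp_conv_disj not_not)
qed

section \<open>Asymptotic bounds and the final program\<close>

lemma real_le_cube: "real n \<le> real n ^ 3" "real n ^ 2 \<le> real n ^ 3" if "1 \<le> n"
  using that power_increasing[of 1 3 "real n"] power_increasing[of 2 3 "real n"] by simp_all

text \<open>From 1 on every lower power is at most the cube, so any number above the sum of the
  coefficients will do.\<close>

lemma time_bound: "(\<lambda>n. real (400 * (n * (100 * (n + 1)\<^sup>2 + 3 * n + 5) + 1) + 2)) \<in> O(\<lambda>n. real n ^ 3)"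
proof (rule bigoI)
  show "\<forall>\<^sub>F n in sequentially. norm (real (400 * (n * (100 * (n + 1)\<^sup>2 + 3 * n + 5) + 1) + 2)) \<le> 1000000 * norm (real n ^ 3)"
    using eventually_ge_at_top[of 1]
  proof eventually_elim
    case (elim n)
    have "1 \<le> real n ^ 3" using elim by simp
    then show ?case using real_le_cube[OF elim] by (simp add: power2_eq_square power3_eq_cube algebra_simps)
  qed
qed

text \<open>The factor 30 is the limit on leaves in \<open>small_aexp\<close>: values of expressions
  stay below \<open>(4 * n + 20) ^ 30\<close>.\<close>

definition word_size :: "nat \<Rightarrow> nat" where
  "word_size n = 30 * nat \<lceil>log 2 (real (4 * n + 20))\<rceil>"

lemma word_size_sufficient: "(4 * n + 20) ^ 30 \<le> 2 ^ word_size n"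
proof -
  define k where "k = nat \<lceil>log 2 (real (4 * n + 20))\<rceil>"
  have k: "log 2 (real (4 * n + 20)) \<le> real k" unfolding k_def by (rule real_nat_ceiling_ge)
  have "real (4 * n + 20) = 2 powr log 2 (real (4 * n + 20))" by simp
  also have "\<dots> \<le> 2 powr real k" using k by (intro powr_mono) simp_all
  also have "\<dots> = real (2 ^ k)" by (simp add: powr_realpow)
  finally have "4 * n + 20 \<le> 2 ^ k" by linarith
  then have "(4 * n + 20) ^ 30 \<le> (2 ^ k) ^ 30" by (rule power_mono) simp
  then show ?thesis by (simp add: word_size_def k_def power_mult[symmetric] mult.commute)
qed

lemma word_size_bound: "(\<lambda>n. real (word_size n)) \<in> O(\<lambda>n. ln (real n))"
proof (rule bigoI)
  show "\<forall>\<^sub>F n in sequentially. norm (real (word_size n)) \<le> (60 / ln 2 + 30) * norm (ln (real n))"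
    \<comment> \<open>From 20 on, \<open>4 * n + 20\<close> is at most \<open>5 * n\<close>, hence
      at most \<open>n * n\<close>, and the logarithm of \<open>n\<close> is at least 1, which
      absorbs the rounding.\<close>
    using eventually_ge_at_top[of 20]
  proof eventually_elim
    case (elim n)
    define k where "k = nat \<lceil>log 2 (real (4 * n + 20))\<rceil>"
    have "real (4 * n + 20) \<le> 5 * real n" using elim by simp
    also have "\<dots> \<le> real n * real n" using elim by (intro mult_right_mono) auto
    finally have "ln (real (4 * n + 20)) \<le> ln (real n * real n)" using elim by (subst ln_le_cancel_iff) auto
    then have l: "ln (real (4 * n + 20)) \<le> 2 * ln (real n)" using elim by (simp add: ln_mult)
    have "exp 1 \<le> real n" using exp_le elim by linarith
    then have "ln (exp 1) \<le> ln (real n)" using elim by (subst ln_le_cancel_iff) auto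
    then have one: "1 \<le> ln (real n)" by simp
    have "0 \<le> log 2 (real (4 * n + 20))" by (subst zero_le_log_cancel_iff) auto
    then have "real k \<le> ln (real (4 * n + 20)) / ln 2 + 1"
      unfolding log_def k_def by linarith
    also have "\<dots> \<le> 2 * ln (real n) / ln 2 + ln (real n)"
      using l one by (intro add_mono divide_right_mono) auto
    finally have "30 * real k \<le> 30 * (2 * ln (real n) / ln 2 + ln (real n))" by simp
    also have "\<dots> = (60 / ln 2 + 30) * ln (real n)" by (simp add: algebra_simps)
    finally have "30 * real k \<le> (60 / ln 2 + 30) * ln (real n)" .
    moreover have "real (word_size n) = 30 * real k" unfolding word_size_def k_def[symmetric] by simp
    ultimately show ?case using one by simp
  qed
qed

lemma (in main_ram) rel_input:
  assumes "\<And>a b. adj a b \<longleftrightarrow> a \<rightarrow>\<^bsub>G\<^esub> b"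
  shows "rel (\<lambda>_. 0) (\<lambda>_ _. 0) (graph_vertex_input G n v)"
proof -
  have "a * n + b < n * n" if "a < n" "b < n" for a b
  proof -
    have "a * n + b < Suc a * n" using that by simp
    also have "\<dots> \<le> n * n" using that by (intro mult_le_mono1) simp
    finally show ?thesis .
  qed
  then show ?thesis using assms by (simp add: rel_def graph_vertex_input_def)
qed

theorem theorem4p1:
  "\<exists>(prog :: com) (T :: nat \<Rightarrow> nat) (w :: nat \<Rightarrow> nat).
    (\<lambda>n. real (T n)) \<in> O(\<lambda>n. real n ^ 3) \<and>
    (\<lambda>n. real (w n)) \<in> O(\<lambda>n. ln (real n)) \<and>
    (\<forall>(G :: nat pair_pre_digraph) n v.
      pair_graph G \<longrightarrow> pverts G = {..<n} \<longrightarrow> claw_free (with_proj G) \<longrightarrow> v \<in> pverts G \<longrightarrow>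
      answers (w n) prog (graph_vertex_input (with_proj G) n v) (T n) (shedding (with_proj G) v))"
proof (intro exI conjI allI impI)
  show "(\<lambda>n. real (400 * (n * (100 * (n + 1)\<^sup>2 + 3 * n + 5) + 1) + 2)) \<in> O(\<lambda>n. real n ^ 3)" by (rule time_bound)
  show "(\<lambda>n. real (word_size n)) \<in> O(\<lambda>n. ln (real n))" by (rule word_size_bound)
  fix G :: "nat pair_pre_digraph" and n v
  assume G: "pair_graph G" "pverts G = {..<n}" "claw_free (with_proj G)" and v: "v \<in> pverts G"
  define adj where "adj = (\<lambda>x y. x \<rightarrow>\<^bsub>with_proj G\<^esub> y)"
  have cf: "clawfree {..<n} adj" unfolding adj_def by (rule clawfree_of_claw_free[OF G(1,2) _ G(3)]) simp
  have sh: "shedding (with_proj G) v \<longleftrightarrow> \<not> (\<exists>T\<subseteq>clawfree.D {..<n} adj v. clawfree.indep adj T \<and> (\<forall>x. adj v x \<longrightarrow> clawfree.covers adj T x))"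
    unfolding adj_def by (rule shedding_iff[OF G(1,2) finite_lessThan G(3)])
  have vn: "v < n" using v G(2) by simp
  interpret main_ram n v adj by (intro main_ram.intro ram.intro cf vn)
  let ?\<sigma> = "graph_vertex_input (with_proj G) n v" and ?w = "word_size n"
  have rl: "rel (\<lambda>_. 0) (\<lambda>_ _. 0) ?\<sigma>" by (rule rel_input) (simp add: adj_def)
  have w: "lim ^ 30 \<le> 2 ^ ?w" by (rule word_size_sufficient)
  let ?k = "n * (100 * (n + 1)\<^sup>2 + 3 * n + 5) + 1"
  have "wp main_prog (\<lambda>\<rho> \<alpha> c. \<rho> 0 = of_bool (\<not> cover_exists) \<and> c \<le> 0 + ?k) (\<lambda>_. 0) (\<lambda>_ _. 0) 0"
    using main_spec unfolding tr_def by blast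
  from wp_sound[OF w tame_main rl this] obtain t \<sigma>' \<rho>' \<alpha>' c' where
    ex: "exec ?w (cp main_prog) ?\<sigma> t \<sigma>'" and r': "rel \<rho>' \<alpha>' \<sigma>'" and ans: "\<rho>' 0 = of_bool (\<not> cover_exists)"
    and c': "c' \<le> ?k" "t \<le> 400 * c'" by auto
  \<comment> \<open>The answer is in variable 0, that is, in register 2; one more assignment, of
    cost 2, moves it to register 0.\<close>
  have "small_aexp (Reg 2)" by (simp add: small_aexp_def)
  then have "exec ?w (Assign 0 (Reg 2)) \<sigma>' (acost (Reg 2) + 1) (\<sigma>'\<lparr>reg := (reg \<sigma>')(0 := aval (Reg 2) \<sigma>')\<rparr>)"
    by (intro exec.Assign rel_afits[OF w r'])
  from exec.Seq[OF ex this] have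
    "exec ?w (Seq (cp ram.main_prog) (Assign 0 (Reg 2))) ?\<sigma> (t + 2) (\<sigma>'\<lparr>reg := (reg \<sigma>')(0 := reg \<sigma>' 2)\<rparr>)" by (simp add: eval_nat_numeral)
  moreover have "t + 2 \<le> 400 * ?k + 2"
    by (intro add_mono order_trans[OF c'(2)] mult_le_mono2 c'(1) order_refl)
  moreover have "reg \<sigma>' (0 + 2) = \<rho>' 0" using r' unfolding rel_def by blast
  then have "reg \<sigma>' 2 = \<rho>' 0" by (simp add: numeral_2_eq_2)
  moreover have "shedding (with_proj G) v \<longleftrightarrow> \<not> cover_exists"
    unfolding cover_exists_def by (rule sh)
  ultimately have "reg (\<sigma>'\<lparr>reg := (reg \<sigma>')(0 := reg \<sigma>' 2)\<rparr>) 0 = of_bool (shedding (with_proj G) v)"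
    "exec ?w (Seq (cp ram.main_prog) (Assign 0 (Reg 2))) ?\<sigma> (t + 2) (\<sigma>'\<lparr>reg := (reg \<sigma>')(0 := reg \<sigma>' 2)\<rparr>)" "t + 2 \<le> 400 * ?k + 2"
    using ans by simp_all
  then show "answers ?w (Seq (cp ram.main_prog) (Assign 0 (Reg 2))) ?\<sigma> (400 * ?k + 2) (shedding (with_proj G) v)"
    unfolding answers_def by blast
qed

end
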